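(* Let $p\ge3$ be a prime, $K$ a quadratic number field, $r>1$ an integer, and $P\in Y_0(p^r)(\mathcal{O}_K)$. Then $\mathrm{h}(P)\le 110\,p\log p$.
   Context: $X_0(N)$ is the modular curve of level $\Gamma_0(N)$, $Y_0(N)$ is $X_0(N)$ minus its cusps, and $Y_0(N)(\mathcal{O}_K)$ is the set of $P\in Y_0(N)(K)$ with $j(P)\in\mathcal{O}_K$ ($j$ the modular invariant, $\mathcal{O}_K$ the ring of integers of $K$). $\mathrm{h}(P)=\mathrm{h}(j(P))$, where $\mathrm{h}$ is the absolute logarithmic Weil height. *)

theory Defs
  imports
    "HOL-Analysis.Analysis"
    "HOL-Computational_Algebra.Computational_Algebra"
    "HOL-Algebra.Embedded_Algebras"
    "HOL-Algebra.Ideal_Product"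
    "HOL-Algebra.Algebraic_Closure_Type"
begin

hide_const (open) Divisibility.prime

section \<open>Number fields\<close>

text \<open>
  Number fields are subfields of the complex numbers; up to isomorphism this is no restriction.
\<close>

abbreviation complex_ring :: "complex ring" where
  "complex_ring \<equiv> ring_of_type_algebra"

definition number_field :: "complex set \<Rightarrow> bool" where
  "number_field K \<longleftrightarrow>
     subfield K complex_ring \<and> ring.finite_dimension complex_ring \<rat> K"

definition field_degree :: "complex set \<Rightarrow> nat" where
  "field_degree K = ring.dim complex_ring \<rat> K"

definition quadratic_field :: "complex set \<Rightarrow> bool" where
  "quadratic_field K \<longleftrightarrow> number_field K \<and> field_degree K = 2"

definition integers_of :: "complex set \<Rightarrow> complex set" where
  "integers_of K = {x \<in> K. algebraic_int x}"

definition integer_ring :: "complex set \<Rightarrow> complex ring" where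
  "integer_ring K = complex_ring\<lparr>carrier := integers_of K\<rparr>"

section \<open>The absolute logarithmic Weil height\<close>

text \<open>
  The height is the sum over all places \<open>v\<close> of \<open>K\<close> of \<open>log max(1, |x|\<^sub>v)\<close> with weight
  \<open>[K\<^sub>v : Q\<^sub>v] / [K : Q]\<close>. The weighted finite absolute value is
  \<open>|x|\<^sub>v ^ [K\<^sub>v : Q\<^sub>v] = N(\<pp>)^(- ord x)\<close> for the prime ideal \<open>\<pp>\<close> of \<open>v\<close>, and
  the sum over the embeddings of \<open>K\<close> counts each Archimedean place with its local degree
  (1 if real, 2 if complex).
\<close>

definition embeddings :: "complex set \<Rightarrow> (complex \<Rightarrow> complex) set" where
  "embeddings K = ring_hom (complex_ring\<lparr>carrier := K\<rparr>) complex_ring \<inter> extensional K"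

definition finite_places :: "complex set \<Rightarrow> complex set set" where
  "finite_places K = {\<pp>. primeideal \<pp> (integer_ring K) \<and> \<pp> \<noteq> {0}}"

definition ideal_norm :: "complex set \<Rightarrow> complex set \<Rightarrow> nat" where
  "ideal_norm K \<pp> = card (carrier (integer_ring K Quot \<pp>))"

definition ord_integer :: "complex set \<Rightarrow> complex set \<Rightarrow> complex \<Rightarrow> nat" where
  "ord_integer K \<pp> a = (GREATEST n. a \<in> \<pp> [^]\<^bsub>ideals_set (integer_ring K)\<^esub> n)"

definition ord_at :: "complex set \<Rightarrow> complex set \<Rightarrow> complex \<Rightarrow> int" where
  "ord_at K \<pp> x =
     (THE k. \<exists>a\<in>integers_of K - {0}. \<exists>b\<in>integers_of K - {0}.
        x = a / b \<and> k = int (ord_integer K \<pp> a) - int (ord_integer K \<pp> b))"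

definition finite_norm :: "complex set \<Rightarrow> complex set \<Rightarrow> complex \<Rightarrow> real" where
  "finite_norm K \<pp> x = (if x = 0 then 0 else real (ideal_norm K \<pp>) powi (- ord_at K \<pp> x))"

text \<open>For \<open>x \<in> K\<close> only finitely many terms of the infinite sum are nonzero.\<close>

definition weil_height :: "complex set \<Rightarrow> complex \<Rightarrow> real" where
  "weil_height K x =
     ((\<Sum>\<sigma>\<in>embeddings K. ln (max 1 (norm (\<sigma> x)))) +
      (\<Sum>\<^sub>\<infinity>\<pp>\<in>finite_places K. ln (max 1 (finite_norm K \<pp> x)))) / real (field_degree K)"

section \<open>The modular invariant\<close>

definition upper_half_plane :: "complex set" where
  "upper_half_plane = {z. Im z > 0}"

definition eisenstein_G :: "nat \<Rightarrow> complex \<Rightarrow> complex" where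
  "eisenstein_G k z =
     (\<Sum>\<^sub>\<infinity>(m, n)\<in>UNIV - {(0, 0)}. 1 / (of_int m + of_int n * z) ^ k)"

definition klein_j :: "complex \<Rightarrow> complex" where
  "klein_j z =
     (let g2 = 60 * eisenstein_G 4 z; g3 = 140 * eisenstein_G 6 z
      in 1728 * g2 ^ 3 / (g2 ^ 3 - 27 * g3 ^ 2))"

section \<open>The modular curve of level \<open>\<Gamma>\<^sub>0(N)\<close>\<close>

text \<open>
  The complex points of \<open>Y\<^sub>0(N)\<close> are the orbits of \<open>\<Gamma>\<^sub>0(N)\<close> on the upper half plane.
\<close>

definition Gamma0_orbit :: "nat \<Rightarrow> complex \<Rightarrow> complex set" where
  "Gamma0_orbit N z =
     {(of_int a * z + of_int b) / (of_int c * z + of_int d) | a b c d :: int.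
        a * d - b * c = 1 \<and> int N dvd c}"

definition eval2 :: "rat poly poly \<Rightarrow> complex \<Rightarrow> complex \<Rightarrow> complex" where
  "eval2 F x y = poly (map_poly (\<lambda>c. poly (map_poly of_rat c) x) F) y"

text \<open>
  \<open>X\<^sub>0(N)\<close> over \<open>Q\<close> is the smooth projective curve with function field
  \<open>Q(j(z), j(N z))\<close>. Its elements are represented as quotients of functions on the upper half
  plane. The value at a zero of the denominator carries no meaning (the HOL quotient is 0 there),
  so values have to be taken as limits.
\<close>

definition X0_function_field :: "nat \<Rightarrow> (complex \<Rightarrow> complex) set" where
  "X0_function_field N =
     {f. \<exists>A B. (\<exists>z\<in>upper_half_plane. eval2 B (klein_j z) (klein_j (of_nat N * z)) \<noteq> 0) \<and>
          f = (\<lambda>z. eval2 A (klein_j z) (klein_j (of_nat N * z)) /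
                   eval2 B (klein_j z) (klein_j (of_nat N * z)))}"

text \<open>
  The residue field at the point of \<open>X\<^sub>0(N)\<close> below \<open>\<tau>\<close>, embedded in the complex numbers by
  evaluation: the values at \<open>\<tau>\<close> of the functions that are regular there. A function on the
  curve is regular at the point iff it has a finite limit at \<open>\<tau>\<close>, also if the point is elliptic.
\<close>

definition residue_field_at :: "nat \<Rightarrow> complex \<Rightarrow> complex set" where
  "residue_field_at N \<tau> = {v. \<exists>f\<in>X0_function_field N. (f \<longlongrightarrow> v) (at \<tau>)}"

text \<open>
  A \<open>K\<close>-rational point of the curve over \<open>Q\<close> is a closed point with an embedding of its residue
  field into \<open>K\<close>; inside the complex points these are the points whose residue field lies in
  \<open>K\<close>. In general this is stronger than the rationality of \<open>j(\<tau>)\<close> and \<open>j(N \<tau>)\<close>, since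
  the plane curve given by the modular equation is singular.
\<close>

definition Y0_points :: "nat \<Rightarrow> complex set \<Rightarrow> complex set set" where
  "Y0_points N K = {Gamma0_orbit N \<tau> | \<tau>. \<tau> \<in> upper_half_plane \<and> residue_field_at N \<tau> \<subseteq> K}"

definition j_invariant :: "complex set \<Rightarrow> complex" where
  "j_invariant P = the_elem (klein_j ` P)"

definition Y0_integral_points :: "nat \<Rightarrow> complex set \<Rightarrow> complex set set" where
  "Y0_integral_points N K = {P \<in> Y0_points N K. j_invariant P \<in> integers_of K}"

definition point_height :: "complex set \<Rightarrow> complex set \<Rightarrow> real" where
  "point_height K P = weil_height K (j_invariant P)"

end

theory Submission
  imports Defs "HOL-Complex_Analysis.Complex_Analysis" "Jordan_Normal_Form.Char_Poly"
begin

text \<open>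
  Runge's method. Put \<open>a(z) = \<Delta>(z) / \<Delta>(pz)\<close> and \<open>b(z) = a(pz)\<close>. Both are modular units on
  \<open>X\<^sub>0(p\<^sup>r)\<close> over \<open>\<rat>\<close> for \<open>r \<ge> 2\<close>, so their values at the given point lie in \<open>K\<close>, and
  \<open>a\<close>, \<open>p\<^bsup>12\<^esup>/a\<close>, \<open>b\<close>, \<open>p\<^bsup>12\<^esup>/b\<close> are integral over \<open>\<int>[j]\<close>. The norms from \<open>K\<close> to \<open>\<rat>\<close> of these
  four values are therefore at least 1 in absolute value. As the conjugate values are the values of
  \<open>a\<close> and \<open>b\<close> at a second point with conjugate \<open>j\<close>, the sum over both points of
  \<open>- log (|\<Delta>| Im\<^sup>6)\<close> changes by at most \<open>12 log p\<close> on passing from \<open>z\<close> to \<open>pz\<close> and from \<open>pz\<close> to \<open>p\<^sup>2z\<close>.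
  This is impossible if one of the points is closer to a cusp than \<open>Im \<ge> 16 p log p\<close>.
\<close>

section \<open>Algebraic integers\<close>

hide_const (open) Polynomials.degree Polynomials.lead_coeff UnivPoly.up_ring.coeff
  UnivPoly.up_ring.monom Coset.order Indexed_Polynomials.ring.indexed_const

text \<open>The assumption r > 1 buys a walk of two steps. A single comparison is compatible with
  one point sliding from height T to T / p while its conjugate climbs by the same amount. A third
  vertex breaks this balance: a vertex high in the cusp has only one neighbour above it, so a path
  without backtracking that has started to fall keeps falling. The other obstacle is that the values
  lie in K. The residue field is given by quotients of rational polynomials in j(z) and j(Nz), so a
  function with rational q-expansion that is fixed by the stabiliser of j(Nz) must be written
  explicitly as such a quotient. Lagrange interpolation over the conjugates does this over the
  complex numbers. A Q-linear map from C to Q, applied to the coefficients of the resulting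
  relation, then makes it rational, because the q-expansions that it relates are rational. The same
  projection yields a rational orbit polynomial, and from it the conjugate values, without Galois
  theory of function fields.\<close>

interpretation zmod: Modules.module "\<lambda>(n::int) (x::complex). of_int n * x"
  by standard (simp_all add: algebra_simps)

text \<open>Multiplication by x acts on the generators through an integer matrix. The vector of
  generators is an eigenvector, nonzero because of \<open>g0\<close>, so x is a root of the monic
  integral characteristic polynomial.\<close>

lemma algebraic_int_if_stable_span:
  fixes x :: complex
  assumes "finite G" "g0 \<in> G" "g0 \<noteq> 0" "\<And>g. g \<in> G \<Longrightarrow> x * g \<in> zmod.span G"
  shows "algebraic_int x"
proof -
  have "\<forall>g\<in>G. \<exists>u. x * g = (\<Sum>h\<in>G. of_int (u h) * h)"
    using assms(4) by (auto simp: zmod.span_finite[OF assms(1)])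
  then obtain M where M: "\<And>g. g \<in> G \<Longrightarrow> x * g = (\<Sum>h\<in>G. of_int (M g h) * h)"
    by metis
  obtain f where f: "bij_betw f {0..<card G} G" using assms(1) ex_bij_betw_nat_finite by blast
  define n where "n = card G"
  define A where "A = mat n n (\<lambda>(i,j). M (f i) (f j))"
  define B :: "complex mat" where "B = map_mat of_int A"
  define v where "v = vec n f"
  have A: "A \<in> carrier_mat n n" by (simp add: A_def)
  have B: "B \<in> carrier_mat n n" by (simp add: A_def B_def)
  have "B *\<^sub>v v = x \<cdot>\<^sub>v v"
  proof (rule eq_vecI)
    show "dim_vec (B *\<^sub>v v) = dim_vec (x \<cdot>\<^sub>v v)" using B by (simp add: v_def)
    fix i assume "i < dim_vec (x \<cdot>\<^sub>v v)"
    then have i: "i < n" by (simp add: v_def)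
    then have fi: "f i \<in> G" using f by (auto simp: bij_betw_def n_def)
    have "vec_index (B *\<^sub>v v) i = (\<Sum>j=0..<n. of_int (M (f i) (f j)) * f j)"
      using i by (simp add: B_def A_def v_def mult_mat_vec_def scalar_prod_def)
    also have "\<dots> = (\<Sum>h\<in>G. of_int (M (f i) h) * h)"
      unfolding n_def by (rule sum.reindex_bij_betw[OF f, of "\<lambda>h. of_int (M (f i) h) * h"])
    also have "\<dots> = x * f i" using M[OF fi] by simp
    finally show "vec_index (B *\<^sub>v v) i = vec_index (x \<cdot>\<^sub>v v) i" using i by (simp add: v_def)
  qed
  moreover have "v \<noteq> 0\<^sub>v n"
  proof
    assume "v = 0\<^sub>v n"
    obtain i where "i < n" "f i = g0" using f assms(2) by (force simp: bij_betw_def n_def image_iff)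
    with \<open>v = 0\<^sub>v n\<close> show False using assms(3)
      by (metis index_vec index_zero_vec(1) v_def)
  qed
  ultimately have "eigenvector B v x" using B by (auto simp: eigenvector_def v_def)
  then have "eigenvalue B x" by (auto simp: eigenvalue_def)
  then have "poly (char_poly B) x = 0" using eigenvalue_root_char_poly[OF B] by simp
  moreover have "char_poly B = map_poly of_int (char_poly A)"
    unfolding B_def by (rule of_int_hom.char_poly_hom[OF A])
  moreover have "Polynomial.lead_coeff (char_poly A) = 1"
    using degree_monic_char_poly[OF A] by simp
  ultimately show ?thesis unfolding algebraic_int_altdef_ipoly by metis
qed

lemma zspan_mult:
  assumes "\<And>g. g \<in> G \<Longrightarrow> x * g \<in> zmod.span H" "w \<in> zmod.span G"
  shows "x * w \<in> zmod.span H"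
  using assms(2)
proof (induction rule: zmod.span_induct_alt)
  case base
  then show ?case using zmod.span_zero by simp
next
  case (step c g y)
  have "x * (of_int c * g + y) = of_int c * (x * g) + x * y" by (simp add: algebra_simps)
  then show ?case using step assms(1) by (simp add: zmod.span_add zmod.span_scale)
qed

lemma algebraic_int_power_span:
  fixes x :: complex
  assumes "algebraic_int x"
  shows "\<exists>n>0. x ^ n \<in> zmod.span {x ^ i |i. i < n}"
proof -
  obtain p where p: "poly (map_poly of_int p) x = 0" "Polynomial.lead_coeff p = 1"
    using assms by (auto simp: algebraic_int_altdef_ipoly)
  define n where "n = Polynomial.degree p"
  have "n > 0"
  proof (rule ccontr)
    assume "\<not> n > 0"
    then obtain c where "p = [:c:]" using degree_eq_zeroE n_def by auto
    with p show False by simp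
  qed
  have "0 = (\<Sum>i\<le>n. of_int (poly.coeff p i) * x ^ i)"
    using p(1) by (simp add: poly_altdef n_def)
  also have "\<dots> = (\<Sum>i<n. of_int (poly.coeff p i) * x ^ i) + x ^ n"
    using p(2) by (simp add: n_def lessThan_Suc_atMost[symmetric])
  finally have "x ^ n = - (\<Sum>i<n. of_int (poly.coeff p i) * x ^ i)"
    by (simp add: eq_neg_iff_add_eq_0 add.commute)
  moreover have "(\<Sum>i<n. of_int (poly.coeff p i) * x ^ i) \<in> zmod.span {x ^ i |i. i < n}"
    by (intro zmod.span_sum zmod.span_scale zmod.span_base) auto
  ultimately have "x ^ n \<in> zmod.span {x ^ i |i. i < n}" by (simp add: zmod.span_neg)
  then show ?thesis using \<open>n > 0\<close> by blast
qed

text \<open>Multiplying by x leaves the products \<open>h * x ^ i\<close> only at the top exponent,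
  where \<open>xn\<close> leads back. The last conjunct keeps every multiplier that was stable
  before, so that elements can be adjoined one after another.\<close>

lemma stable_span_extend:
  fixes x :: complex
  assumes "n > 0" "finite G" "1 \<in> G" 
    and xn: "\<And>g. g \<in> G \<Longrightarrow> x ^ n * g \<in> zmod.span {h * x ^ i |h i. h \<in> G \<and> i < n}"
  defines "G' \<equiv> {h * x ^ i |h i. h \<in> G \<and> i < n}"
  shows "finite G' \<and> 1 \<in> G' \<and> (\<forall>g\<in>G'. x * g \<in> zmod.span G') \<and>
     (\<forall>y. (\<forall>g\<in>G. y * g \<in> zmod.span G) \<longrightarrow> (\<forall>g\<in>G'. y * g \<in> zmod.span G'))"
proof (intro conjI allI impI ballI)
  have "G' = (\<lambda>(h,i). h * x ^ i) ` (G \<times> {..<n})" by (auto simp: G'_def)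
  then show "finite G'" using assms(2) by simp
  show "1 \<in> G'" unfolding G'_def using assms(1,3) by (intro CollectI exI[of _ 1] exI[of _ 0]) auto
next
  fix g assume "g \<in> G'"
  then obtain h i where hi: "h \<in> G" "i < n" "g = h * x ^ i" by (auto simp: G'_def)
  show "x * g \<in> zmod.span G'"
  proof (cases "Suc i < n")
    case True
    then have "x * g \<in> G'" unfolding G'_def using hi
      by (intro CollectI exI[of _ h] exI[of _ "Suc i"]) auto
    then show ?thesis by (rule zmod.span_base)
  next
    case False
    then have "Suc i = n" using hi by simp
    then have "x * g = x ^ n * h" using hi by auto
    then show ?thesis using xn[OF hi(1)] by (simp add: G'_def)
  qed
next
  fix y g assume y: "\<forall>g\<in>G. y * g \<in> zmod.span G" and "g \<in> G'"
  then obtain h i where hi: "h \<in> G" "i < n" "g = h * x ^ i" by (auto simp: G'_def)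
  have "x ^ i * (y * h) \<in> zmod.span G'"
  proof (rule zspan_mult[of G])
    show "x ^ i * ga \<in> zmod.span G'" if "ga \<in> G" for ga
      by (rule zmod.span_base) (use that hi in \<open>auto simp: G'_def mult.commute\<close>)
  qed (use y hi in blast)
  then show "y * g \<in> zmod.span G'" by (simp add: hi(3) algebra_simps)
qed

lemma stable_span_adjoin:
  fixes x :: complex
  assumes "algebraic_int x" "finite G" "1 \<in> G"
  shows "\<exists>G'. finite G' \<and> 1 \<in> G' \<and> (\<forall>g\<in>G'. x * g \<in> zmod.span G') \<and>
     (\<forall>y. (\<forall>g\<in>G. y * g \<in> zmod.span G) \<longrightarrow> (\<forall>g\<in>G'. y * g \<in> zmod.span G'))"
proof -
  obtain n where n: "n > 0" "x ^ n \<in> zmod.span {x ^ i |i. i < n}"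
    using algebraic_int_power_span[OF assms(1)] by auto
  have "x ^ n * g \<in> zmod.span {h * x ^ i |h i. h \<in> G \<and> i < n}" if "g \<in> G" for g
  proof -
    have "g * x ^ n \<in> zmod.span {h * x ^ i |h i. h \<in> G \<and> i < n}"
      by (rule zspan_mult[OF _ n(2)]) (use that in \<open>auto intro!: zmod.span_base\<close>)
    then show ?thesis by (simp add: mult.commute)
  qed
  from stable_span_extend[OF n(1) assms(2,3) this] show ?thesis by blast
qed

text \<open>One module serves all elements of S simultaneously. Sums and products of these elements
  stabilise it as well, which is how algebraic integers become a ring below.\<close>

lemma stable_span_list:
  fixes S :: "complex set"
  assumes "finite S" "\<And>x. x \<in> S \<Longrightarrow> algebraic_int x"
  shows "\<exists>G. finite G \<and> 1 \<in> G \<and> (\<forall>x\<in>S. \<forall>g\<in>G. x * g \<in> zmod.span G)"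
  using assms
proof (induction S rule: finite_induct)
  case empty
  then show ?case by (intro exI[of _ "{1}"]) auto
next
  case (insert x S)
  then obtain G where G: "finite G" "1 \<in> G" "\<forall>x\<in>S. \<forall>g\<in>G. x * g \<in> zmod.span G" by auto
  from stable_span_adjoin[OF _ G(1,2), of x] insert.prems obtain G' where
    "finite G'" "1 \<in> G'" "\<forall>g\<in>G'. x * g \<in> zmod.span G'"
    "\<forall>y. (\<forall>g\<in>G. y * g \<in> zmod.span G) \<longrightarrow> (\<forall>g\<in>G'. y * g \<in> zmod.span G')" by auto
  then show ?case using G by (intro exI[of _ G']) auto
qed

lemma algebraic_int_add:
  fixes x y :: complex
  assumes "algebraic_int x" "algebraic_int y" shows "algebraic_int (x + y)"
proof -
  obtain G where G: "finite G" "1 \<in> G" "\<forall>z\<in>{x,y}. \<forall>g\<in>G. z * g \<in> zmod.span G"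
    using stable_span_list[of "{x,y}"] assms by auto
  show ?thesis
    by (rule algebraic_int_if_stable_span[OF G(1,2)])
       (use G(3) in \<open>auto simp: ring_distribs intro!: zmod.span_add\<close>)
qed

lemma algebraic_int_mult:
  fixes x y :: complex
  assumes "algebraic_int x" "algebraic_int y" shows "algebraic_int (x * y)"
proof -
  obtain G where G: "finite G" "1 \<in> G" "\<forall>z\<in>{x,y}. \<forall>g\<in>G. z * g \<in> zmod.span G"
    using stable_span_list[of "{x,y}"] assms by auto
  show ?thesis
  proof (rule algebraic_int_if_stable_span[OF G(1,2)])
    fix g assume "g \<in> G"
    then have "x * (y * g) \<in> zmod.span G" using zspan_mult[of G x G "y * g"] G(3) by simp
    then show "x * y * g \<in> zmod.span G" by (simp add: mult.assoc)
  qed auto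
qed

lemma algebraic_int_diff:
  fixes x y :: complex
  assumes "algebraic_int x" "algebraic_int y" shows "algebraic_int (x - y)"
  using algebraic_int_add[OF assms(1), of "-y"] assms(2) by simp

lemma algebraic_int_pow:
  fixes x :: complex
  assumes "algebraic_int x" shows "algebraic_int (x ^ n)"
  by (induction n) (auto intro: algebraic_int_mult assms)

lemma algebraic_int_sum:
  fixes f :: "'a \<Rightarrow> complex"
  assumes "\<And>i. i \<in> A \<Longrightarrow> algebraic_int (f i)" shows "algebraic_int (sum f A)"
  using assms by (induction A rule: infinite_finite_induct) (auto intro: algebraic_int_add)

text \<open>Transitivity of integrality: start from a module stable under all coefficients and
  adjoin the powers of z below the degree.\<close>

lemma algebraic_int_monic_root:
  fixes z :: complex
  assumes "poly P z = 0" "Polynomial.lead_coeff P = 1" "\<And>i. algebraic_int (poly.coeff P i)"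
  shows "algebraic_int z"
proof -
  define n where "n = Polynomial.degree P"
  have "n > 0"
  proof (rule ccontr)
    assume "\<not> n > 0"
    then obtain c where "P = [:c:]" using degree_eq_zeroE n_def by auto
    with assms show False by simp
  qed
  obtain G where G: "finite G" "1 \<in> G" "\<forall>x\<in>poly.coeff P ` {..n}. \<forall>g\<in>G. x * g \<in> zmod.span G"
    using stable_span_list[of "poly.coeff P ` {..n}"] assms(3) by auto
  have zn: "z ^ n = (\<Sum>i<n. - (poly.coeff P i * z ^ i))"
  proof -
    have "0 = (\<Sum>i\<le>n. poly.coeff P i * z ^ i)" using assms(1) by (simp add: poly_altdef n_def)
    also have "\<dots> = (\<Sum>i<n. poly.coeff P i * z ^ i) + z ^ n"
      using assms(2) by (simp add: n_def lessThan_Suc_atMost[symmetric])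
    finally show ?thesis by (simp add: sum_negf eq_neg_iff_add_eq_0 add.commute)
  qed
  let ?G = "{h * z ^ i |h i. h \<in> G \<and> i < n}"
  have "z ^ n * g \<in> zmod.span ?G" if g: "g \<in> G" for g
  proof -
    have "z ^ i * (poly.coeff P i * g) \<in> zmod.span ?G" if "i < n" for i
    proof (rule zspan_mult[of G])
      show "z ^ i * ga \<in> zmod.span ?G" if "ga \<in> G" for ga
        by (rule zmod.span_base) (use that \<open>i < n\<close> in \<open>auto simp: mult.commute\<close>)
      show "poly.coeff P i * g \<in> zmod.span G" using G(3) g \<open>i < n\<close> by simp
    qed
    then have "(\<Sum>i<n. - (z ^ i * (poly.coeff P i * g))) \<in> zmod.span ?G"
      by (intro zmod.span_sum zmod.span_neg) auto
    moreover have "z ^ n * g = (\<Sum>i<n. - (z ^ i * (poly.coeff P i * g)))"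
      unfolding zn sum_distrib_right by (intro sum.cong refl) (simp add: algebra_simps)
    ultimately show ?thesis by simp
  qed
  from stable_span_extend[OF \<open>n > 0\<close> G(1,2) this]
  have "finite ?G" "1 \<in> ?G" "\<forall>g\<in>?G. z * g \<in> zmod.span ?G" by blast+
  then show ?thesis using algebraic_int_if_stable_span[of ?G 1 z] by auto
qed

section \<open>Quadratic fields\<close>

lemma complex_ring_simps [simp]:
  "carrier complex_ring = UNIV" "mult complex_ring = (*)" "one complex_ring = 1"
  "ring.zero complex_ring = 0" "ring.add complex_ring = (+)"
  by (simp_all add: ring_of_type_algebra_def)

lemma field_complex_ring: "field complex_ring"
  by (rule field_from_type_algebra)

lemma cring_complex_ring: "cring complex_ring"
  by (rule domain.axioms(1)[OF field.axioms(1)[OF field_complex_ring]])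

interpretation cring_complex: ring complex_ring
  by (rule cring.axioms(1)[OF cring_complex_ring])

lemma minus_complex_ring: "x \<ominus>\<^bsub>complex_ring\<^esub> y = x - y"
  and a_inv_complex_ring: "\<ominus>\<^bsub>complex_ring\<^esub> y = - y"
proof -
  show *: "\<ominus>\<^bsub>complex_ring\<^esub> y = - y" for y
    by (rule cring_complex.minus_equality) simp_all
  show "x \<ominus>\<^bsub>complex_ring\<^esub> y = x - y"
    unfolding a_minus_def by (simp add: *)
qed

lemma m_inv_complex_ring: "x \<noteq> 0 \<Longrightarrow> inv\<^bsub>complex_ring\<^esub> x = inverse x"
  by (rule comm_monoid.comm_inv_char[OF cring.axioms(2)[OF cring_complex_ring]]) auto

lemma subfield_complex_closed:
  assumes "subfield K complex_ring"
  shows "0 \<in> K" "1 \<in> K" "x \<in> K \<Longrightarrow> y \<in> K \<Longrightarrow> x + y \<in> K" "x \<in> K \<Longrightarrow> y \<in> K \<Longrightarrow> x * y \<in> K"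
    "x \<in> K \<Longrightarrow> - x \<in> K" "x \<in> K \<Longrightarrow> inverse x \<in> K" "x \<in> K \<Longrightarrow> y \<in> K \<Longrightarrow> x - y \<in> K"
    "x \<in> K \<Longrightarrow> y \<in> K \<Longrightarrow> x / y \<in> K"
proof -
  note S = subringE[OF subfieldE(1)[OF assms]]
  show c: "0 \<in> K" "1 \<in> K" "\<And>x y. x \<in> K \<Longrightarrow> y \<in> K \<Longrightarrow> x + y \<in> K"
    "\<And>x y. x \<in> K \<Longrightarrow> y \<in> K \<Longrightarrow> x * y \<in> K"  "\<And>x. x \<in> K \<Longrightarrow> - x \<in> K"
    using S by (auto simp: a_inv_complex_ring)
  show i: "inverse x \<in> K" if "x \<in> K" for x
  proof (cases "x = 0")
    case False
    then show ?thesis using cring_complex.subfield_m_inv(1)[OF assms, of x] that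
      by (simp add: m_inv_complex_ring)
  qed (use c in simp)
  show "x \<in> K \<Longrightarrow> y \<in> K \<Longrightarrow> x - y \<in> K" using c(3)[of x "- y"] c(5) by simp
  show "x \<in> K \<Longrightarrow> y \<in> K \<Longrightarrow> x / y \<in> K" using c(4)[of x "inverse y"] i by (simp add: field_simps)
qed

lemma subfield_Rats: "subfield \<rat> complex_ring"
proof (rule field.subfieldI'[OF field_complex_ring])
  show "subring \<rat> complex_ring"
    by (rule cring_complex.subringI) (auto simp: a_inv_complex_ring)
  show "inv\<^bsub>complex_ring\<^esub> k \<in> \<rat>" if "k \<in> \<rat> - {\<zero>\<^bsub>complex_ring\<^esub>}" for k
    using that by (auto simp: m_inv_complex_ring)
qed

lemma line_extension_complex:
  "ring.line_extension complex_ring K v E = {k * v + e |k e. k \<in> K \<and> e \<in> E}"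
  by (auto simp: cring_complex.line_extension_def set_add_def' r_coset_def)

text \<open>The normal form Q(w) with a rational square of w turns the nontrivial automorphism into
  a change of sign.\<close>

locale quad_field =
  fixes K :: "complex set" and w :: complex and d :: rat
  assumes K_eq: "K = {of_rat x + of_rat y * w |x y. True}"
    and w_sq: "w * w = of_rat d" and w_irrat: "w \<notin> \<rat>"

lemma of_rat_in_subfield:
  assumes "subfield K complex_ring"
  shows "(of_rat x :: complex) \<in> K"
proof -
  note S = subfield_complex_closed[OF assms]
  have n: "of_nat n \<in> K" for n by (induction n) (auto intro: S)
  have z: "of_int z \<in> K" for z
    using n[of "nat \<bar>z\<bar>"] S(5)[OF n[of "nat \<bar>z\<bar>"]] by (cases "z \<ge> 0") auto
  obtain a b where "quotient_of x = (a, b)" by fastforce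
  then have "(of_rat x :: complex) = of_int a / of_int b"
    by (metis Rat.quotient_of_div of_rat_divide of_rat_of_int_eq)
  then show ?thesis using S(8) z by simp
qed

text \<open>A two-dimensional Q-space of numbers contains an irrational v, and 1, v form a basis.
  Completing the square in the quadratic equation of v produces the square root w.\<close>

lemma quadratic_field_imp_quad_field:
  assumes "quadratic_field K"
  shows "\<exists>w d. quad_field K w d"
proof -
  have sf: "subfield K complex_ring" and fd: "ring.finite_dimension complex_ring \<rat> K"
    and d2: "ring.dim complex_ring \<rat> K = 2"
    using assms by (auto simp: quadratic_field_def number_field_def field_degree_def)
  note S = subfield_complex_closed[OF sf]
  have "ring.dimension complex_ring 2 \<rat> K"
  proof -
    obtain n where n: "ring.dimension complex_ring n \<rat> K"
      using fd by (auto simp: cring_complex.finite_dimension_def)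
    then show ?thesis using cring_complex.dimI[OF subfield_Rats n] d2 by (simp add: over_def)
  qed
  then obtain v1 v2 where v: "K = {k * v1 + e |k e. k \<in> \<rat> \<and> (\<exists>l\<in>\<rat>. e = l * v2)}" "v2 \<noteq> 0"
      "v1 \<notin> {k * v2 |k. k \<in> \<rat>}"
  proof -
    assume a: "\<And>v1 v2. K = {k * v1 + e |k e. k \<in> \<rat> \<and> (\<exists>l\<in>\<rat>. e = l * v2)} \<Longrightarrow> v2 \<noteq> 0 \<Longrightarrow>
      v1 \<notin> {k * v2 |k. k \<in> \<rat>} \<Longrightarrow> thesis"
    from \<open>ring.dimension complex_ring 2 \<rat> K\<close> obtain v1 E where
      1: "v1 \<notin> E" "ring.dimension complex_ring 1 \<rat> E" "K = ring.line_extension complex_ring \<rat> v1 E"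
      by (cases rule: cring_complex.dimension.cases) auto
    from 1(2) obtain v2 F where
      2: "v2 \<notin> F" "ring.dimension complex_ring 0 \<rat> F" "E = ring.line_extension complex_ring \<rat> v2 F"
      by (cases rule: cring_complex.dimension.cases) auto
    from 2(2) have F: "F = {0}" by (cases rule: cring_complex.dimension.cases) auto
    have E: "E = {l * v2 |l. l \<in> \<rat>}" unfolding 2(3) F line_extension_complex by auto
    show thesis
    proof (rule a[of v1 v2])
      show "K = {k * v1 + e |k e. k \<in> \<rat> \<and> (\<exists>l\<in>\<rat>. e = l * v2)}"
        unfolding 1(3) line_extension_complex E by blast
      show "v2 \<noteq> 0" using 2(1) F by simp
      show "v1 \<notin> {k * v2 |k. k \<in> \<rat>}" using 1(1) E by simp
    qed
  qed
  have mem: "k * v1 + l * v2 \<in> K" if "k \<in> \<rat>" "l \<in> \<rat>" for k l using that v(1) by auto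
  have v1K: "v1 \<in> K" and v2K: "v2 \<in> K" using mem[of 1 0] mem[of 0 1] by auto
  have v1n: "v1 \<noteq> 0" using v(3) Rats_0 by (metis (mono_tags, lifting) mem_Collect_eq mult_zero_left)
  have indep: "k = 0 \<and> l = 0" if "k \<in> \<rat>" "l \<in> \<rat>" "k * v1 + l * v2 = 0" for k l
  proof (cases "k = 0")
    case False
    have "k * v1 = - (l * v2)" using that(3) by (simp only: eq_neg_iff_add_eq_0)
    then have "k * v1 / k = (- l / k) * v2" by simp
    then have "v1 = (- l / k) * v2" using False by simp
    moreover have "- l / k \<in> \<rat>" using that by simp
    ultimately show ?thesis using v(3) by blast
  next
    case True then show ?thesis using that v(2) by simp
  qed
  obtain v where vK: "v \<in> K" "v \<notin> \<rat>"
  proof (cases "v1 / v2 \<in> \<rat>")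
    case True
    have "(1::complex) * v1 + (- (v1/v2)) * v2 = 0" using v(2) by simp
    then have "(1::complex) = 0" using indep[of 1 "- (v1/v2)"] True Rats_1 Rats_minus_iff by blast
    then show ?thesis by simp
  next
    case False
    then show ?thesis using that[of "v1/v2"] S(8)[OF v1K v2K] by simp
  qed
  obtain a b where 1: "a \<in> \<rat>" "b \<in> \<rat>" "1 = a * v1 + b * v2" using S(2) v(1) by blast
  obtain a' b' where 2: "a' \<in> \<rat>" "b' \<in> \<rat>" "v = a' * v1 + b' * v2" using vK(1) v(1) by blast
  \<comment> \<open>The determinant of the change from the basis \<open>v1\<close>,
    \<open>v2\<close> to 1, v; Cramer's rule below divides by it.\<close>
  define D where "D = a * b' - b * a'"
  have Dn: "D \<noteq> 0"
  proof
    assume D0: "D = 0"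
    have "(b' - b * v) * 1 = (b' - b * v) * (a * v1 + b * v2)" using 1(3) by simp
    have e: "b' * 1 - b * v = D * v1" "a * v - a' * 1 = D * v2" unfolding 1(3) 2(3) D_def by (simp_all add: algebra_simps)
    show False
    proof (cases "b = 0")
      case False
      then have "v = b' / b" using e(1) D0 by (simp add: field_simps)
      then show False using vK(2) 1 2 by simp
    next
      case True
      then have "a \<noteq> 0" using 1(3) by auto
      then have "v = a' / a" using e(2) D0 by (simp add: field_simps)
      then show False using vK(2) 1 2 by simp
    qed
  qed
  have DQ: "D \<in> \<rat>" using 1 2 by (simp add: D_def)
  have Kv: "\<exists>x y. z = of_rat x + of_rat y * v" if zK: "z \<in> K" for z
  proof -
    obtain k l where kl: "k \<in> \<rat>" "l \<in> \<rat>" "z = k * v1 + l * v2" using zK v(1) by blast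
    have e: "b' * 1 - b * v = D * v1" "a * v - a' * 1 = D * v2" unfolding 1(3) 2(3) D_def by (simp_all add: algebra_simps)
    have "v1 = (b' - b * v) / D" "v2 = (a * v - a') / D" using e Dn by (auto simp: field_simps)
    then have "z = k * ((b' - b * v) / D) + l * ((a * v - a') / D)" unfolding kl(3) by simp
    then have "z = (k * b' - l * a') / D + ((l * a - k * b) / D) * v"
      using Dn by (simp add: divide_simps) (simp add: algebra_simps)
    moreover have "(k * b' - l * a') / D \<in> \<rat>" "(l * a - k * b) / D \<in> \<rat>" using kl 1 2 DQ by auto
    ultimately show ?thesis by (metis Rats_cases)
  qed
  obtain \<alpha> \<beta> where ab: "v * v = of_rat \<alpha> + of_rat \<beta> * v" using Kv[OF S(4)[OF vK(1) vK(1)]] by blast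
  define w where "w = v - of_rat (\<beta> / 2)"
  define d where "d = \<alpha> + \<beta> * \<beta> / 4"
  have "quad_field K w d"
  proof
    show "w * w = of_rat d" 
    proof -
      have "w * w = v * v - of_rat \<beta> * v + of_rat (\<beta> * \<beta> / 4)"
        by (simp add: w_def of_rat_mult of_rat_divide algebra_simps)
      then show ?thesis by (simp add: ab d_def of_rat_add)
    qed
    show "w \<notin> \<rat>"
    proof
      assume "w \<in> \<rat>"
      then have "w + of_rat (\<beta>/2) \<in> \<rat>" by (intro Rats_add) auto
      then show False using vK by (simp add: w_def)
    qed
    show "K = {of_rat x + of_rat y * w |x y. True}"
    proof (intro equalityI subsetI)
      fix z assume "z \<in> K"
      then obtain x y where "z = of_rat x + of_rat y * v" using Kv by blast
      then have "z = of_rat (x + y * \<beta> / 2) + of_rat y * w"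
        by (simp add: w_def of_rat_add of_rat_mult of_rat_divide algebra_simps)
      then show "z \<in> {of_rat x + of_rat y * w |x y. True}" by blast
    next
      fix z assume "z \<in> {of_rat x + of_rat y * w |x y. True}"
      then show "z \<in> K" unfolding w_def
        by (auto intro!: S of_rat_in_subfield[OF sf] vK)
    qed
  qed
  then show ?thesis by blast
qed

section \<open>Conjugation, trace and norm in a quadratic field\<close>

context quad_field
begin

lemma rep_unique:
  assumes "of_rat x + of_rat y * w = of_rat x' + of_rat y' * w"
  shows "x = x' \<and> y = y'"
proof -
  have e: "of_rat (y - y') * w = of_rat (x' - x)" using assms by (simp add: of_rat_diff algebra_simps)
  have "y = y'"
  proof (rule ccontr)
    assume "y \<noteq> y'"
    then have "w = of_rat ((x' - x) / (y - y'))" using e by (simp add: of_rat_divide field_simps)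
    then show False using w_irrat by simp
  qed
  then show ?thesis using assms by simp
qed

text \<open>The nontrivial automorphism of K. Off K the description has no witness, so the value
  there is unspecified.\<close>

definition cj :: "complex \<Rightarrow> complex" where
  "cj z = (THE c. \<exists>x y. z = of_rat x + of_rat y * w \<and> c = of_rat x - of_rat y * w)"

lemma cj_rep: "cj (of_rat x + of_rat y * w) = of_rat x - of_rat y * w"
  unfolding cj_def by (rule the_equality) (use rep_unique in blast)+

lemma K_cases:
  assumes "z \<in> K" obtains x y where "z = of_rat x + of_rat y * w" using assms K_eq by blast

lemma rep_in_K [simp]: "of_rat x + of_rat y * w \<in> K" using K_eq by blast

lemma of_rat_in_K [simp]: "of_rat x \<in> K" using rep_in_K[of x 0] by simp

lemma Rats_in_K: "x \<in> \<rat> \<Longrightarrow> x \<in> K" by (metis Rats_cases of_rat_in_K)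

lemma of_int_in_K [simp]: "of_int x \<in> K" by (rule Rats_in_K) auto

lemma cj_of_rat [simp]: "cj (of_rat x) = of_rat x" using cj_rep[of x 0] by simp

lemma cj_Rats: "x \<in> \<rat> \<Longrightarrow> cj x = x" by (metis Rats_cases cj_of_rat)

lemma cj_of_int [simp]: "cj (of_int x) = of_int x" by (rule cj_Rats) auto

lemma K_add [simp]: "x \<in> K \<Longrightarrow> y \<in> K \<Longrightarrow> x + y \<in> K"
  and cj_add: "x \<in> K \<Longrightarrow> y \<in> K \<Longrightarrow> cj (x + y) = cj x + cj y"
proof -
  assume "x \<in> K" "y \<in> K"
  then obtain a b a' b' where e: "x = of_rat a + of_rat b * w" "y = of_rat a' + of_rat b' * w"
    by (meson K_cases)
  have s: "x + y = of_rat (a + a') + of_rat (b + b') * w" by (simp add: e of_rat_add algebra_simps)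
  show "x + y \<in> K" unfolding s by simp
  show "cj (x + y) = cj x + cj y" unfolding s cj_rep unfolding e cj_rep by (simp add: of_rat_add algebra_simps)
qed

lemma mult_rep: "(of_rat a + of_rat b * w) * (of_rat a' + of_rat b' * w) =
   of_rat (a * a' + b * b' * d) + of_rat (a * b' + a' * b) * w"
proof -
  have "(of_rat a + of_rat b * w) * (of_rat a' + of_rat b' * w) =
    of_rat a * of_rat a' + of_rat b * of_rat b' * (w * w) + (of_rat a * of_rat b' + of_rat a' * of_rat b) * w"
    by (simp add: algebra_simps)
  then show ?thesis by (simp add: w_sq of_rat_add of_rat_mult)
qed

lemma K_mult [simp]: "x \<in> K \<Longrightarrow> y \<in> K \<Longrightarrow> x * y \<in> K"
  and cj_mult: "x \<in> K \<Longrightarrow> y \<in> K \<Longrightarrow> cj (x * y) = cj x * cj y"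
proof -
  assume "x \<in> K" "y \<in> K"
  then obtain a b a' b' where e: "x = of_rat a + of_rat b * w" "y = of_rat a' + of_rat b' * w"
    by (meson K_cases)
  show "x * y \<in> K" unfolding e mult_rep by simp
  show "cj (x * y) = cj x * cj y" unfolding e mult_rep cj_rep
    using mult_rep[of a "- b" a' "- b'"]
    by (simp add: of_rat_minus of_rat_add of_rat_mult of_rat_diff ring_distribs w_sq)
qed

lemma cj_in_K [simp]: "x \<in> K \<Longrightarrow> cj x \<in> K"
  by (metis K_cases cj_rep diff_minus_eq_add mult_minus_left of_rat_minus rep_in_K uminus_add_conv_diff
      add.commute)

lemma cj_cj: "x \<in> K \<Longrightarrow> cj (cj x) = x"
proof -
  assume "x \<in> K"
  then obtain a b where e: "x = of_rat a + of_rat b * w" by (meson K_cases)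
  then show "cj (cj x) = x" using cj_rep[of a "- b"] by (simp add: cj_rep of_rat_minus)
qed

lemma K_minus [simp]: "x \<in> K \<Longrightarrow> - x \<in> K" and cj_minus: "x \<in> K \<Longrightarrow> cj (- x) = - cj x"
  using K_mult[of "-1" x] cj_mult[of "-1" x] Rats_in_K[of "-1"] cj_Rats[of "-1"] by auto

lemma K_diff [simp]: "x \<in> K \<Longrightarrow> y \<in> K \<Longrightarrow> x - y \<in> K"
  and cj_diff: "x \<in> K \<Longrightarrow> y \<in> K \<Longrightarrow> cj (x - y) = cj x - cj y"
  using K_add[of x "- y"] cj_add[of x "- y"] by (auto simp: cj_minus)

lemma K_0 [simp]: "0 \<in> K" and K_1 [simp]: "1 \<in> K" by (auto intro: Rats_in_K)

lemma cj_0 [simp]: "cj 0 = 0" and cj_1 [simp]: "cj 1 = 1" by (auto intro: cj_Rats)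

lemma cj_eq_0: "x \<in> K \<Longrightarrow> cj x = 0 \<longleftrightarrow> x = 0" using cj_cj cj_0 by metis

lemma K_power [simp]: "x \<in> K \<Longrightarrow> x ^ n \<in> K" and cj_power: "x \<in> K \<Longrightarrow> cj (x ^ n) = cj x ^ n"
  by (induction n) (auto simp: cj_mult)

lemma trace_rat: "x \<in> K \<Longrightarrow> x + cj x \<in> \<rat>" and norm_rat: "x \<in> K \<Longrightarrow> x * cj x \<in> \<rat>"
proof -
  assume "x \<in> K"
  then obtain a b where e: "x = of_rat a + of_rat b * w" by (meson K_cases)
  have "x + cj x = of_rat (2 * a)" by (simp add: e cj_rep of_rat_mult)
  then show "x + cj x \<in> \<rat>" by simp
  have "x * cj x = of_rat (a * a + b * (- b) * d) + of_rat (a * (-b) + a * b) * w"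
    unfolding mult_rep[symmetric] by (simp add: e cj_rep of_rat_minus)
  then show "x * cj x \<in> \<rat>" by simp
qed

lemma K_inverse [simp]: "x \<in> K \<Longrightarrow> inverse x \<in> K"
proof (cases "x = 0")
  case False
  assume x: "x \<in> K"
  have "inverse x = cj x * inverse (x * cj x)" using False cj_eq_0[OF x] by (simp add: field_simps)
  also have "\<dots> \<in> K" using Rats_in_K[OF Rats_inverse[OF norm_rat[OF x]]] x by (intro K_mult cj_in_K)
  finally show ?thesis .
qed auto

lemma K_divide [simp]: "x \<in> K \<Longrightarrow> y \<in> K \<Longrightarrow> x / y \<in> K"
  by (simp add: divide_inverse)

lemma cj_inverse: "x \<in> K \<Longrightarrow> cj (inverse x) = inverse (cj x)"
  by (metis K_inverse cj_1 cj_mult inverse_unique inverse_zero right_inverse cj_0)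

lemma cj_divide: "x \<in> K \<Longrightarrow> y \<in> K \<Longrightarrow> cj (x / y) = cj x / cj y"
  by (simp add: divide_inverse cj_mult cj_inverse)

lemma poly_in_K: "z \<in> K \<Longrightarrow> poly (map_poly of_rat p) z \<in> K"
  by (induction p) (auto simp: map_poly_pCons)

lemma cj_poly: "z \<in> K \<Longrightarrow> cj (poly (map_poly of_rat p) z) = poly (map_poly of_rat p) (cj z)"
  by (induction p) (auto simp: map_poly_pCons cj_add cj_mult poly_in_K)

lemma algebraic_int_cj:
  assumes "x \<in> K" "algebraic_int x" shows "algebraic_int (cj x)"
proof -
  obtain p where p: "poly (map_poly of_int p) x = 0" "Polynomial.lead_coeff p = 1"
    using assms by (auto simp: algebraic_int_altdef_ipoly)
  have e: "map_poly of_rat (map_poly of_int p) = (map_poly of_int p :: complex poly)"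
    by (subst map_poly_map_poly) (auto simp: o_def)
  have "poly (map_poly of_int p) (cj x) = 0"
    using cj_poly[OF assms(1), of "map_poly of_int p"] p(1) by (simp add: e)
  then show ?thesis using p(2) by (auto simp: algebraic_int_altdef_ipoly)
qed

lemma trace_Ints: "x \<in> K \<Longrightarrow> algebraic_int x \<Longrightarrow> x + cj x \<in> \<int>"
  by (intro rational_algebraic_int_is_int algebraic_int_add algebraic_int_cj trace_rat)

lemma norm_Ints: "x \<in> K \<Longrightarrow> algebraic_int x \<Longrightarrow> x * cj x \<in> \<int>"
  by (intro rational_algebraic_int_is_int algebraic_int_mult algebraic_int_cj norm_rat)

text \<open>The norm of a nonzero integer is a nonzero rational integer. This is the whole
  arithmetic input of the method: two absolute values cannot be small together.\<close>

lemma norm_ge_1: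
  assumes "x \<in> K" "algebraic_int x" "x \<noteq> 0" shows "norm x * norm (cj x) \<ge> 1"
proof -
  have "x * cj x \<noteq> 0" using assms cj_eq_0 by simp
  moreover obtain n where "x * cj x = of_int n" using norm_Ints[OF assms(1,2)] by (elim Ints_cases)
  ultimately have "norm (x * cj x) \<ge> 1" by simp
  then show ?thesis by (simp add: norm_mult)
qed

lemma algebraic_intI_trace_norm:
  assumes "x \<in> K" "x + cj x \<in> \<int>" "x * cj x \<in> \<int>"
  shows "algebraic_int x"
proof -
  obtain t n where tn: "x + cj x = of_int t" "x * cj x = of_int n" using assms by (auto elim!: Ints_cases)
  have "poly (map_poly of_int [:n, -t, 1:]) x = of_int n - x * of_int t + x * x"
    by (simp add: map_poly_pCons algebra_simps)
  also have "\<dots> = 0" unfolding tn[symmetric] by (simp add: algebra_simps)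
  finally show ?thesis unfolding algebraic_int_altdef_ipoly
    by (intro exI[of _ "[:n, -t, 1:]"]) auto
qed

lemma integers_of_eq: "x \<in> integers_of K \<longleftrightarrow> x \<in> K \<and> algebraic_int x"
  by (auto simp: integers_of_def)

text \<open>An embedding fixes 1, hence the rationals, and maps w to one of the two square roots of
  d.\<close>

lemma ring_hom_cases:
  assumes "\<sigma> \<in> embeddings K"
  shows "\<sigma> = restrict id K \<or> \<sigma> = restrict cj K"
proof -
  have ext: "\<sigma> \<in> extensional K" and h: "\<sigma> \<in> Ring.ring_hom (complex_ring\<lparr>carrier := K\<rparr>) complex_ring"
    using assms by (auto simp: embeddings_def)
  have add: "\<sigma> (x + y) = \<sigma> x + \<sigma> y" and mult: "\<sigma> (x * y) = \<sigma> x * \<sigma> y" if "x \<in> K" "y \<in> K" for x y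
    using ring_hom_add[OF h, of x y] ring_hom_mult[OF h, of x y] that by auto
  have one: "\<sigma> 1 = 1" using ring_hom_one[OF h] by simp
  have zero: "\<sigma> 0 = 0" using add[of 0 0] by simp
  have minus: "\<sigma> (- x) = - \<sigma> x" if "x \<in> K" for x
    using add[of x "- x"] that zero by (simp add: add_eq_0_iff)
  have nat: "\<sigma> (of_nat n) = of_nat n" for n
  proof (induction n)
    case (Suc n)
    then show ?case using add[of 1 "of_nat n"] one Rats_in_K[of "of_nat n"] by simp
  qed (simp add: zero)
  have int: "\<sigma> (of_int n) = of_int n" for n
  proof (cases "n \<ge> 0")
    case True then show ?thesis using nat[of "nat n"] by simp
  next
    case False
    then have "(of_int n :: complex) = - of_nat (nat (- n))" by simp
    then show ?thesis using minus[of "of_nat (nat (- n))"] nat Rats_in_K[of "of_nat (nat (- n))"] by simp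
  qed
  have rat: "\<sigma> (of_rat x) = of_rat x" for x
  proof -
    obtain a b where q: "quotient_of x = (a, b)" by fastforce
    have b: "b \<noteq> 0" using quotient_of_denom_pos[OF q] by simp
    have e: "(of_rat x :: complex) * of_int b = of_int a"
      using Rat.quotient_of_div[OF q] b by (simp add: of_rat_divide)
    have "\<sigma> (of_rat x) * of_int b = \<sigma> (of_rat x * of_int b)"
      by (simp only: mult[OF of_rat_in_K of_int_in_K] int)
    also have "\<dots> = of_rat x * of_int b" unfolding e int ..
    finally have "\<sigma> (of_rat x) * of_int b = of_rat x * of_int b" .
    moreover have "(of_int b :: complex) \<noteq> 0" using b by simp
    ultimately show ?thesis by (metis mult_right_cancel)
  qed
  have wK: "w \<in> K" using rep_in_K[of 0 1] by simp
  have "\<sigma> w * \<sigma> w = w * w" using mult[OF wK wK] rat[of d] by (simp add: w_sq)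
  then have "(\<sigma> w - w) * (\<sigma> w + w) = 0" by (simp add: algebra_simps)
  then consider "\<sigma> w = w" | "\<sigma> w = - w" by (auto simp: eq_neg_iff_add_eq_0)
  then show ?thesis
  proof cases
    case 1
    have "\<sigma> z = restrict id K z" for z
    proof (cases "z \<in> K")
      case True
      then obtain x y where e: "z = of_rat x + of_rat y * w" by (meson K_cases)
      have "\<sigma> z = \<sigma> (of_rat x) + \<sigma> (of_rat y) * \<sigma> w"
        unfolding e using add[of "of_rat x" "of_rat y * w"] mult[of "of_rat y" w] wK by simp
      also have "\<dots> = id z" unfolding rat 1 e by (simp)
      finally show ?thesis using True by simp
    next
      case False
      then show ?thesis using ext by (simp add: extensional_def)
    qed
    then show ?thesis by (simp add: fun_eq_iff del: restrict_apply)
  next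
    case 2
    have "\<sigma> z = restrict cj K z" for z
    proof (cases "z \<in> K")
      case True
      then obtain x y where e: "z = of_rat x + of_rat y * w" by (meson K_cases)
      have "\<sigma> z = \<sigma> (of_rat x) + \<sigma> (of_rat y) * \<sigma> w"
        unfolding e using add[of "of_rat x" "of_rat y * w"] mult[of "of_rat y" w] wK by simp
      also have "\<dots> = cj z" unfolding rat 2 e by (simp add: cj_rep)
      finally show ?thesis using True by simp
    next
      case False
      then show ?thesis using ext by (simp add: extensional_def)
    qed
    then show ?thesis by (simp add: fun_eq_iff del: restrict_apply)
  qed
qed

end

section \<open>Heights of quadratic integers\<close>

lemma prime_power_not_all_dvd:
  fixes L M :: int
  assumes "L > 1" "\<And>n. L ^ n dvd M" shows "M = 0"
proof (rule ccontr)
  assume "M \<noteq> 0"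
  define n where "n = nat \<bar>M\<bar>"
  have "L ^ n \<le> \<bar>M\<bar>" using assms(2)[of n] \<open>M \<noteq> 0\<close> dvd_imp_le_int[of M "L ^ n"] by simp
  moreover have "int n < 2 ^ n" using of_nat_less_two_power[of n] by simp
  moreover have "(2::int) ^ n \<le> L ^ n" using assms(1) by (intro power_mono) auto
  ultimately show False by (simp add: n_def)
qed

lemma Ints_divide_imp_dvd:
  fixes a b :: int
  assumes "(of_int a :: complex) / of_int b \<in> \<int>" "b \<noteq> 0" shows "b dvd a"
proof -
  obtain c where "(of_int a :: complex) / of_int b = of_int c" using assms(1) by (elim Ints_cases)
  then have "(of_int a :: complex) = of_int (c * b)" using assms(2) by (simp add: divide_eq_eq)
  then have "a = c * b" by (simp only: of_int_eq_iff)
  then show ?thesis by simp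
qed

lemma dvd_imp_Ints_divide: "b dvd a \<Longrightarrow> (of_int a :: complex) / of_int b \<in> \<int>"
  by (metis Ints_of_int of_int_divide_in_Ints)

context quad_field
begin

lemma O_memI: "x \<in> K \<Longrightarrow> algebraic_int x \<Longrightarrow> x \<in> integers_of K"
  by (simp add: integers_of_eq)

lemma O_in_K [simp]: "x \<in> integers_of K \<Longrightarrow> x \<in> K"
  by (simp add: integers_of_eq)

lemma O_closed [simp]:
  "x \<in> integers_of K \<Longrightarrow> y \<in> integers_of K \<Longrightarrow> x + y \<in> integers_of K"
  "x \<in> integers_of K \<Longrightarrow> y \<in> integers_of K \<Longrightarrow> x * y \<in> integers_of K"
  "x \<in> integers_of K \<Longrightarrow> y \<in> integers_of K \<Longrightarrow> x - y \<in> integers_of K"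
  "x \<in> integers_of K \<Longrightarrow> - x \<in> integers_of K"
  "x \<in> integers_of K \<Longrightarrow> cj x \<in> integers_of K"
  "x \<in> integers_of K \<Longrightarrow> x ^ n \<in> integers_of K"
  "of_int m \<in> integers_of K" "0 \<in> integers_of K" "1 \<in> integers_of K"
  by (auto simp: integers_of_eq intro: algebraic_int_add algebraic_int_mult algebraic_int_diff
       algebraic_int_cj algebraic_int_pow)

lemma O_trace: "x \<in> integers_of K \<Longrightarrow> \<exists>t. x + cj x = of_int t"
  and O_norm: "x \<in> integers_of K \<Longrightarrow> \<exists>t. x * cj x = of_int t"
  using trace_Ints[of x] norm_Ints[of x] by (auto simp: integers_of_eq elim!: Ints_cases)

end

text \<open>A finite place in elementwise form. The aim is that \<open>ord_at\<close>, a description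
  over all ways of writing a fraction, has a value on integers. A local uniformiser takes the place
  of unique factorisation of ideals.\<close>

locale quad_prime = quad_field +
  fixes P :: "complex set"
  assumes P_sub: "P \<subseteq> integers_of K"
    and P_add: "\<And>x y. x \<in> P \<Longrightarrow> y \<in> P \<Longrightarrow> x + y \<in> P"
    and P_mult: "\<And>x y. x \<in> integers_of K \<Longrightarrow> y \<in> P \<Longrightarrow> x * y \<in> P"
    and P_one: "1 \<notin> P"
    and P_prime: "\<And>x y. x \<in> integers_of K \<Longrightarrow> y \<in> integers_of K \<Longrightarrow> x * y \<in> P \<Longrightarrow> x \<in> P \<or> y \<in> P"
    and P_nz: "\<exists>x\<in>P. x \<noteq> 0"
begin

section \<open>The residue field and the order at a prime ideal\<close>

lemma P_O [simp]: "x \<in> P \<Longrightarrow> x \<in> integers_of K" using P_sub by blast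

lemma P_mult': "x \<in> integers_of K \<Longrightarrow> y \<in> P \<Longrightarrow> y * x \<in> P"
  using P_mult[of x y] by (simp add: mult.commute)

lemma P_minus: "x \<in> P \<Longrightarrow> - x \<in> P" using P_mult[of "of_int (-1)" x] by simp

lemma P_diff: "x \<in> P \<Longrightarrow> y \<in> P \<Longrightarrow> x - y \<in> P" using P_add[of x "- y"] P_minus by simp

text \<open>The rational integers in P form a prime ideal of the integers. It is nonzero because it
  contains the norm of a nonzero element of P, and its least positive member generates it.\<close>

lemma residue_char_exists: "\<exists>L::int. prime L \<and> (\<forall>m. of_int m \<in> P \<longleftrightarrow> L dvd m)"
proof -
  obtain x where x: "x \<in> P" "x \<noteq> 0" using P_nz by blast
  obtain t where t: "x * cj x = of_int t" using O_norm[OF P_O[OF x(1)]] by blast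
  have tP: "of_int t \<in> P" using P_mult[of "cj x" x] x t by (simp add: mult.commute)
  have tn: "t \<noteq> 0"
  proof
    assume "t = 0" then have "x * cj x = 0" using t by simp
    then show False using x cj_eq_0[of x] by simp
  qed
  define A where "A = {n::nat. n > 0 \<and> (of_int (int n) :: complex) \<in> P}"
  have "nat \<bar>t\<bar> \<in> A" using tP tn P_minus[OF tP] unfolding A_def by (cases "t \<ge> 0") auto
  define l where "l = (LEAST n. n \<in> A)"
  have lA: "l \<in> A" unfolding l_def using \<open>nat \<bar>t\<bar> \<in> A\<close> by (rule LeastI)
  have lmin: "n \<in> A \<Longrightarrow> l \<le> n" for n unfolding l_def by (rule Least_le)
  define L where "L = int l"
  have LP: "of_int L \<in> P" and L0: "L > 0" using lA by (auto simp: A_def L_def)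
  have iff: "of_int m \<in> P \<longleftrightarrow> L dvd m" for m
  proof
    assume mP: "of_int m \<in> P"
    have "(of_int (m mod L) :: complex) = of_int m - of_int (m div L) * of_int L"
      by (simp add: minus_div_mult_eq_mod[symmetric])
    then have rP: "of_int (m mod L) \<in> P" using P_diff[OF mP P_mult[OF _ LP, of "of_int (m div L)"]] by simp
    show "L dvd m"
    proof (rule ccontr)
      assume "\<not> L dvd m"
      then have "m mod L \<noteq> 0" by (simp add: dvd_eq_mod_eq_0)
      then have "m mod L > 0" using pos_mod_sign[OF L0, of m] by linarith
      then have "nat (m mod L) \<in> A" using rP by (simp add: A_def)
      then have "l \<le> nat (m mod L)" by (rule lmin)
      then show False using pos_mod_bound[OF L0, of m] \<open>m mod L > 0\<close> by (simp add: L_def)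
    qed
  next
    assume "L dvd m"
    then obtain k where "m = L * k" by blast
    then show "of_int m \<in> P" using P_mult'[OF _ LP, of "of_int k"] by simp
  qed
  have "prime L"
  proof -
    have "prime_elem L"
    proof (rule prime_elemI)
      show "L \<noteq> 0" using L0 by simp
      show "\<not> is_unit L" using iff[of 1] P_one by simp
      show "L dvd a \<or> L dvd b" if "L dvd a * b" for a b
        using P_prime[of "of_int a" "of_int b"] iff[of "a * b"] iff[of a] iff[of b] that by simp
    qed
    then show ?thesis using L0 by (simp add: prime_def)
  qed
  then show ?thesis using iff by blast
qed

definition L :: int where "L = (SOME L. prime L \<and> (\<forall>m. of_int m \<in> P \<longleftrightarrow> L dvd m))"

lemma L_prime: "prime L" and L_iff: "of_int m \<in> P \<longleftrightarrow> L dvd m"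
  using someI_ex[OF residue_char_exists] unfolding L_def[symmetric] by blast+

lemma L_gt_1: "L > 1" using L_prime prime_gt_1_int by blast

lemma L_nz [simp]: "L \<noteq> 0" "(of_int L :: complex) \<noteq> 0" using L_gt_1 by auto

lemma L_in_P: "of_int L \<in> P" by (simp add: L_iff)

lemma norm_in_P: "x \<in> P \<Longrightarrow> x * cj x = of_int t \<Longrightarrow> L dvd t"
  using P_mult'[of "cj x" x] L_iff[of t] by simp

text \<open>The quotient by P is a field. If L does not divide the norm N of v, then
  \<open>cj v\<close> times an inverse of N modulo L works. Otherwise v (v - T) = - N lies in P, so
  v is congruent to its trace T, which must be invertible modulo L.\<close>

lemma unit_mod_P:
  assumes "v \<in> integers_of K" "v \<notin> P"
  shows "\<exists>v'\<in>integers_of K. 1 - v * v' \<in> P"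
proof -
  have inv: "\<exists>x y. m * x + L * y = 1" if "\<not> L dvd m" for m
  proof -
    have "coprime L m" using L_prime that by (simp add: prime_imp_coprime)
    then show ?thesis using bezout_int[of m L] by (metis coprime_iff_gcd_eq_1 gcd.commute mult.commute)
  qed
  obtain N where N: "v * cj v = of_int N" using O_norm assms by blast
  obtain T where T: "v + cj v = of_int T" using O_trace assms by blast
  show ?thesis
  proof (cases "L dvd N")
    case False
    then obtain x y where xy: "N * x + L * y = 1" using inv by blast
    have "1 - v * (cj v * of_int x) = of_int (1 - N * x)" using N by (simp add: mult.assoc[symmetric])
    also have "1 - N * x = L * y" using xy by simp
    finally have "1 - v * (cj v * of_int x) \<in> P" by (simp only: L_iff) simp
    then show ?thesis using assms by (intro bexI[of _ "cj v * of_int x"]) auto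
  next
    case True
    have "v * (v - of_int T) = - of_int N" using N T[symmetric] by (simp add: algebra_simps)
    also have "\<dots> \<in> P" using True P_minus L_iff by blast
    finally have vT: "v - of_int T \<in> P" using P_prime[of v "v - of_int T"] assms by auto
    have "\<not> L dvd T" using P_add[OF vT, of "of_int T"] L_iff[of T] assms by auto
    then obtain x y where xy: "T * x + L * y = 1" using inv by blast
    have "1 - v * of_int x = of_int (1 - T * x) - (v - of_int T) * of_int x" by (simp add: algebra_simps)
    also have "1 - T * x = L * y" using xy by simp
    finally have "1 - v * of_int x = of_int (L * y) - (v - of_int T) * of_int x" .
    also have "\<dots> \<in> P" by (intro P_diff P_mult'[OF _ vT]) (simp_all only: L_iff O_closed, simp)
    finally show ?thesis by (intro bexI[of _ "of_int x"]) auto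
  qed
qed

text \<open>An inverse uniformiser: it lies in the inverse ideal of P and has order exactly -1 at P.
  Then a is in the n-th power of P exactly when \<open>a * \<theta> ^ n\<close> is integral, and the
  last clause bounds n.\<close>

definition unif :: "complex \<Rightarrow> bool" where
  "unif \<theta> \<longleftrightarrow> \<theta> \<in> K \<and> (\<forall>x\<in>P. x * \<theta> \<in> integers_of K) \<and>
     (\<exists>u\<in>P. u * \<theta> \<in> integers_of K - P) \<and>
     (\<forall>a\<in>integers_of K - {0}. \<exists>n. a * \<theta> ^ n \<notin> integers_of K)"

text \<open>Here L generates P, and L has order one. If all quotients of a by powers of L were
  integral, every power of L would divide the norm of a.\<close>

lemma unif_inert:
  assumes "\<And>x. x \<in> P \<Longrightarrow> x / of_int L \<in> integers_of K"
  shows "unif (1 / of_int L)"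
  unfolding unif_def
proof (intro conjI ballI)
  show "1 / of_int L \<in> K" by simp
  show "\<And>x. x \<in> P \<Longrightarrow> x * (1 / complex_of_int L) \<in> integers_of K" using assms by simp
  show "\<exists>u\<in>P. u * (1 / complex_of_int L) \<in> integers_of K - P"
    using L_in_P P_one by (intro bexI[of _ "of_int L"]) auto
  fix a assume a: "a \<in> integers_of K - {0}"
  show "\<exists>n. a * (1 / of_int L) ^ n \<notin> integers_of K"
  proof (rule ccontr)
    assume "\<not> ?thesis"
    then have h: "a * (1 / of_int L) ^ n \<in> integers_of K" for n by blast
    obtain N where N: "a * cj a = of_int N" using a O_norm by blast
    have "L ^ n dvd N" for n
    proof (rule Ints_divide_imp_dvd)
      have "cj a * (a * (1 / of_int L) ^ n) \<in> integers_of K" using h a by simp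
      also have "cj a * (a * (1 / of_int L) ^ n) = of_int N / of_int (L ^ n)"
        using N by (simp add: power_divide mult.commute)
      finally show "(of_int N :: complex) / of_int (L ^ n) \<in> \<int>"
        by (auto simp: integers_of_eq intro!: rational_algebraic_int_is_int)
    qed simp
    then have "N = 0" using prime_power_not_all_dvd L_gt_1 by blast
    then show False using N a cj_eq_0[of a] by simp
  qed
qed

text \<open>The split and ramified cases. An element of P not divisible by L has norm divisible by
  L, so \<open>cj \<beta> / L\<close> carries P into the integers; integrality is tested on trace
  and norm.\<close>

lemma unif_other:
  assumes b: "\<beta> \<in> P" "\<beta> / of_int L \<notin> integers_of K"
  shows "unif (cj \<beta> / of_int L)"
proof -
  define \<theta> where "\<theta> = cj \<beta> / of_int L"
  obtain S where S: "\<beta> * cj \<beta> = of_int S" using O_norm[OF P_O[OF b(1)]] by blast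
  obtain T where T: "\<beta> + cj \<beta> = of_int T" using O_trace[OF P_O[OF b(1)]] by blast
  have LS: "L dvd S" using norm_in_P S b by blast
  have bK: "\<beta> \<in> K" using b by simp
  have tK: "\<theta> \<in> K" using b by (simp add: \<theta>_def)
  \<comment> \<open>Otherwise trace and norm of \<open>\<beta> / L\<close> would be
    integral.\<close>
  have Lb: "\<not> (L dvd T \<and> L * L dvd S)"
  proof
    assume a: "L dvd T \<and> L * L dvd S"
    have "\<beta> / of_int L \<in> integers_of K"
    proof (intro O_memI algebraic_intI_trace_norm)
      have "\<beta> / of_int L + cj (\<beta> / of_int L) = of_int T / of_int L"
        using T bK by (simp add: cj_divide add_divide_distrib[symmetric])
      then show "\<beta> / of_int L + cj (\<beta> / of_int L) \<in> \<int>" using a dvd_imp_Ints_divide by metis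
      have "\<beta> / of_int L * cj (\<beta> / of_int L) = of_int S / of_int (L * L)"
        using S bK by (simp add: cj_divide)
      then show "\<beta> / of_int L * cj (\<beta> / of_int L) \<in> \<int>" using a dvd_imp_Ints_divide by metis
    qed (use bK in auto)
    then show False using b by blast
  qed
  have 1: "x * \<theta> \<in> integers_of K" if x: "x \<in> P" for x
  proof (intro O_memI algebraic_intI_trace_norm)
    have xK: "x \<in> K" using x by simp
    show "x * \<theta> \<in> K" "x * \<theta> \<in> K" using tK xK by auto
    obtain N where N: "x * cj x = of_int N" using O_norm[OF P_O[OF x]] by blast
    have LN: "L dvd N" using norm_in_P N x by blast
    obtain t where t: "x * cj \<beta> + cj (x * cj \<beta>) = of_int t" using O_trace[of "x * cj \<beta>"] x b by auto
    \<comment> \<open>Each summand of this trace has a factor in P, so L divides the trace.\<close>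
    have "x * cj \<beta> + \<beta> * cj x \<in> P" by (intro P_add P_mult') (use x b in auto)
    then have Lt: "L dvd t" using t L_iff[of t] bK xK by (simp add: cj_mult cj_cj mult.commute)
    have "x * \<theta> + cj (x * \<theta>) = of_int t / of_int L"
      using t xK bK by (simp add: \<theta>_def cj_mult cj_divide cj_cj add_divide_distrib[symmetric])
    then show "x * \<theta> + cj (x * \<theta>) \<in> \<int>" using Lt dvd_imp_Ints_divide by metis
    have "x * \<theta> * cj (x * \<theta>) = (x * cj x) * (\<beta> * cj \<beta>) / of_int (L * L)"
      using xK bK by (simp add: \<theta>_def cj_mult cj_divide cj_cj)
    then have "x * \<theta> * cj (x * \<theta>) = of_int (N * S) / of_int (L * L)" by (simp add: N S)
    moreover have "L * L dvd N * S" using LN LS by (rule mult_dvd_mono)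
    ultimately show "x * \<theta> * cj (x * \<theta>) \<in> \<int>" using dvd_imp_Ints_divide by metis
  qed
  have 2: "\<exists>n. a * \<theta> ^ n \<notin> integers_of K" if a: "a \<in> integers_of K - {0}" for a
  proof (rule ccontr)
    assume "\<not> ?thesis"
    then have h: "a * \<theta> ^ n \<in> integers_of K" for n by blast
    obtain M where M: "a * cj a = of_int M" using a O_norm by blast
    have Mn: "M \<noteq> 0"
    proof
      assume "M = 0" then show False using M a cj_eq_0[of a] by simp
    qed
    have hM: "of_int M * \<theta> ^ n \<in> integers_of K" for n
    proof -
      have "cj a * (a * \<theta> ^ n) \<in> integers_of K" using h a by simp
      then show ?thesis using M by (simp add: mult.assoc[symmetric] mult.commute)
    qed
    obtain s where s: "S = L * s" using LS by blast
    have tn: "\<theta> * cj \<theta> = of_int s / of_int L"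
      using S bK s by (simp add: \<theta>_def cj_divide cj_cj mult.commute)
    \<comment> \<open>If L does not divide s, then \<open>\<theta>\<close> has norm s / L in lowest
      terms, and the norms of \<open>of_int M * \<theta> ^ n\<close> would have unbounded
      denominators.\<close>
    have "L dvd s"
    proof (rule ccontr)
      assume ns: "\<not> L dvd s"
      have "L ^ n dvd M * M" for n
      proof -
        obtain t where t: "of_int M * \<theta> ^ n * cj (of_int M * \<theta> ^ n) = of_int t" using O_norm[OF hM] by blast
        have "of_int M * \<theta> ^ n * cj (of_int M * \<theta> ^ n) = of_int (M * M) * (\<theta> * cj \<theta>) ^ n"
          using tK by (simp add: cj_mult cj_power power_mult_distrib)
        also have "\<dots> = of_int (M * M * s ^ n) / of_int (L ^ n)" by (simp add: tn power_divide)
        finally have "(of_int (M * M * s ^ n) :: complex) / of_int (L ^ n) \<in> \<int>"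
          unfolding t by (metis Ints_of_int)
        then have "L ^ n dvd M * M * s ^ n" by (rule Ints_divide_imp_dvd) simp
        moreover have "coprime (L ^ n) (s ^ n)" using L_prime ns
          by (simp add: prime_imp_coprime coprime_power_left_iff coprime_power_right_iff)
        ultimately show ?thesis by (simp add: coprime_dvd_mult_left_iff)
      qed
      then show False using prime_power_not_all_dvd[OF L_gt_1, of "M * M"] Mn by simp
    qed
    then have nT: "\<not> L dvd T" using Lb s by auto
    \<comment> \<open>Now L divides s, so by \<open>Lb\<close> it does not divide T. The power sums
      of \<open>\<beta>\<close> and its conjugate satisfy a two-term recurrence and are congruent to
      the powers of T modulo L, hence prime to L. Integral traces of
      \<open>of_int M * \<theta> ^ n\<close> then force every power of L to divide M.\<close>
    have V: "\<exists>v. \<beta> ^ n + cj \<beta> ^ n = of_int v \<and> L dvd v - T ^ n \<and>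
        (\<exists>v'. \<beta> ^ Suc n + cj \<beta> ^ Suc n = of_int v' \<and> L dvd v' - T ^ Suc n)" if "n \<ge> 1" for n
      using that
    proof (induction n rule: nat_induct_at_least)
      case base
      have "\<beta> ^ 2 + cj \<beta> ^ 2 = (\<beta> + cj \<beta>) * (\<beta> + cj \<beta>) - 2 * (\<beta> * cj \<beta>)"
        by (simp add: algebra_simps power2_eq_square)
      also have "\<dots> = of_int (T * T - 2 * S)" unfolding S T by simp
      finally show ?case using T LS by (intro exI[of _ T] conjI exI[of _ "T * T - 2 * S"])
         (auto simp: numeral_2_eq_2)
    next
      case (Suc n)
      then obtain v v' where v: "\<beta> ^ n + cj \<beta> ^ n = of_int v" "\<beta> ^ Suc n + cj \<beta> ^ Suc n = of_int v'"
        "L dvd v' - T ^ Suc n" by blast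
      have "\<beta> ^ Suc (Suc n) + cj \<beta> ^ Suc (Suc n) =
         (\<beta> + cj \<beta>) * (\<beta> ^ Suc n + cj \<beta> ^ Suc n) - (\<beta> * cj \<beta>) * (\<beta> ^ n + cj \<beta> ^ n)"
        by (simp add: algebra_simps)
      also have "\<dots> = of_int (T * v' - S * v)" unfolding S T v by simp
      finally have e: "\<beta> ^ Suc (Suc n) + cj \<beta> ^ Suc (Suc n) = of_int (T * v' - S * v)" .
      have "T * v' - S * v - T ^ Suc (Suc n) = T * (v' - T ^ Suc n) - S * v" by (simp add: algebra_simps)
      then have "L dvd T * v' - S * v - T ^ Suc (Suc n)"
        using dvd_diff[OF dvd_mult[OF v(3), of T] dvd_mult2[OF LS, of v]] by (simp only:)
      then show ?case using e v by blast
    qed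
    have "L ^ n dvd M" for n
    proof (cases "n \<ge> 1")
      case True
      then obtain v where v: "\<beta> ^ n + cj \<beta> ^ n = of_int v" "L dvd v - T ^ n" using V by blast
      have "\<not> L dvd v"
      proof
        assume "L dvd v"
        then have "L dvd T ^ n" using v(2) by (metis dvd_diff_commute dvd_diffD1 zdvd_zdiffD)
        then show False using nT L_prime prime_dvd_power by blast
      qed
      then have "coprime (L ^ n) v" using L_prime
          by (simp add: prime_imp_coprime coprime_power_left_iff)
      moreover have "L ^ n dvd M * v"
      proof (rule Ints_divide_imp_dvd)
        obtain t where t: "of_int M * \<theta> ^ n + cj (of_int M * \<theta> ^ n) = of_int t" using O_trace[OF hM] by blast
        have "of_int M * \<theta> ^ n + cj (of_int M * \<theta> ^ n) = of_int M * (\<beta> ^ n + cj \<beta> ^ n) / of_int (L ^ n)"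
          using bK tK by (simp add: cj_mult cj_power \<theta>_def cj_divide cj_cj power_divide
             add_divide_distrib[symmetric] ring_distribs add.commute)
        then have "(of_int (M * v) :: complex) / of_int (L ^ n) = of_int t" using t v(1) by simp
        then show "(of_int (M * v) :: complex) / of_int (L ^ n) \<in> \<int>" by simp
      qed simp
      ultimately show ?thesis by (simp add: coprime_dvd_mult_left_iff)
    next
      case False then show ?thesis by (cases n) auto
    qed
    then show False using prime_power_not_all_dvd[OF L_gt_1] Mn by blast
  qed
  have 3: "\<exists>u\<in>P. u * \<theta> \<in> integers_of K - P"
  proof (rule ccontr)
    assume "\<not> ?thesis"
    \<comment> \<open>If multiplication by \<open>\<theta>\<close> preserved P, then
      \<open>of_int L * \<theta> ^ n\<close> would be integral for all n, against fact 2.\<close>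
    then have h: "u \<in> P \<Longrightarrow> u * \<theta> \<in> P" for u using 1 by blast
    have "of_int L * \<theta> ^ n \<in> P" for n
    proof (induction n)
      case (Suc n) then show ?case using h[of "of_int L * \<theta> ^ n"] by (simp add: mult_ac)
    qed (simp add: L_in_P)
    then show False using 2[of "of_int L"] by auto
  qed
  show ?thesis unfolding unif_def \<theta>_def[symmetric] using tK 1 2 3 by blast
qed

lemma unif_exists: "\<exists>\<theta>. unif \<theta>"
  using unif_inert unif_other by blast

definition \<theta> where "\<theta> = (SOME t. unif t)"

lemma unif_theta: "unif \<theta>" unfolding \<theta>_def using unif_exists by (rule someI_ex)

lemma theta_K [simp]: "\<theta> \<in> K" and theta_P: "x \<in> P \<Longrightarrow> x * \<theta> \<in> integers_of K"
  using unif_theta by (auto simp: unif_def)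

text \<open>The element e = 1 - u \<open>\<theta>\<close> v' lies in P, so powers of e
  \<open>\<theta>\<close> are integral. Writing 1 as e^m + u \<open>\<theta>\<close> y splits a
  \<open>\<theta>\<close>^m into two integral parts, one using each hypothesis.\<close>

lemma theta_descend:
  assumes "a \<in> integers_of K" "a * \<theta> ^ Suc m \<in> integers_of K"
  shows "a * \<theta> ^ m \<in> integers_of K"
proof -
  obtain u where u: "u \<in> P" "u * \<theta> \<in> integers_of K" "u * \<theta> \<notin> P" using unif_theta by (auto simp: unif_def)
  obtain v' where v': "v' \<in> integers_of K" "1 - u * \<theta> * v' \<in> P" using unit_mod_P u by blast
  define e where "e = 1 - u * \<theta> * v'"
  have eO: "e \<in> P" using v' by (simp add: e_def)
  have pw: "e ^ k * \<theta> ^ k \<in> integers_of K" for k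
    using O_closed(6)[OF theta_P[OF eO], of k] by (simp add: power_mult_distrib)
  have "\<exists>y\<in>integers_of K. e ^ k = 1 - u * \<theta> * y" for k
  proof (induction k)
    case 0 then show ?case by (intro bexI[of _ 0]) auto
  next
    case (Suc k)
    then obtain y where y: "y \<in> integers_of K" "e ^ k = 1 - u * \<theta> * y" by blast
    have "e ^ Suc k = 1 - u * \<theta> * (v' + y - u * \<theta> * v' * y)"
      by (simp add: y(2)) (simp add: e_def algebra_simps)
    moreover have "v' + y - u * \<theta> * v' * y \<in> integers_of K"
      using O_closed(3)[OF O_closed(1)[OF v'(1) y(1)] O_closed(2)[OF O_closed(2)[OF u(2) v'(1)] y(1)]] .
    ultimately show ?case by blast
  qed
  then obtain y where y: "y \<in> integers_of K" "e ^ m = 1 - u * \<theta> * y" by blast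
  have "a * \<theta> ^ m = a * (e ^ m * \<theta> ^ m) + (a * \<theta> ^ Suc m) * (u * y)"
    unfolding y(2) by (simp add: algebra_simps)
  also have "\<dots> \<in> integers_of K"
    using O_closed(1)[OF O_closed(2)[OF assms(1) pw] O_closed(2)[OF assms(2) O_closed(2)[OF P_O[OF u(1)] y(1)]]] .
  finally show ?thesis .
qed

lemma theta_descend_le:
  assumes "a \<in> integers_of K" "a * \<theta> ^ n \<in> integers_of K" "m \<le> n"
  shows "a * \<theta> ^ m \<in> integers_of K"
  using assms(3,2) by (induction rule: inc_induct) (use theta_descend[OF assms(1)] in auto)

abbreviation R where "R \<equiv> integer_ring K"
abbreviation Pw where "Pw n \<equiv> P [^]\<^bsub>ideals_set R\<^esub> (n::nat)"

lemma Pw_0: "Pw 0 = integers_of K"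
  unfolding nat_pow_def by (simp add: ideals_set_def integer_ring_def)

lemma Pw_Suc: "Pw (Suc n) = ideal_prod R (Pw n) P"
  unfolding nat_pow_def by (simp add: ideals_set_def)

lemma R_simps [simp]: "mult R = (*)" "ring.add R = (+)"
  by (simp_all add: integer_ring_def)

lemma Pw_theta:
  "a \<in> Pw n \<Longrightarrow> a \<in> integers_of K \<and> a * \<theta> ^ n \<in> integers_of K"
proof (induction n arbitrary: a)
  case 0 then show ?case unfolding Pw_0 by simp
next
  case (Suc n)
  from Suc.prems[unfolded Pw_Suc] show ?case
  proof (induction rule: ideal_prod.induct)
    case (prod i j)
    have "i * j * \<theta> ^ Suc n = (i * \<theta> ^ n) * (j * \<theta>)" by simp
    then show ?case using Suc.IH[OF prod(1)] theta_P[OF prod(2)] prod(2) O_closed(2)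
      by (simp only: R_simps P_O)
  next
    case (sum s1 s2)
    then show ?case by (auto simp: ring_distribs)
  qed
qed

text \<open>Split 1 as u \<open>\<theta>\<close> v' plus an element of P. Then a is the sum of a
  \<open>\<theta>\<close> times u v' and a times that element, two products from P^n and P.\<close>

lemma theta_Pw:
  "a \<in> integers_of K \<Longrightarrow> a * \<theta> ^ n \<in> integers_of K \<Longrightarrow> a \<in> Pw n"
proof (induction n arbitrary: a)
  case 0 then show ?case unfolding Pw_0 by simp
next
  case (Suc n)
  obtain u where u: "u \<in> P" "u * \<theta> \<in> integers_of K" "u * \<theta> \<notin> P" using unif_theta by (auto simp: unif_def)
  obtain v' where v': "v' \<in> integers_of K" "1 - u * \<theta> * v' \<in> P" using unit_mod_P u by blast
  have 1: "a \<in> Pw n" using Suc.IH[OF Suc.prems(1) theta_descend[OF Suc.prems]] .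
  have "a * \<theta> \<in> integers_of K" using theta_descend_le[OF Suc.prems, of 1] by simp
  then have 2: "a * \<theta> \<in> Pw n" using Suc.IH[of "a * \<theta>"] Suc.prems(2) by (simp add: mult.assoc)
  have "a * \<theta> * (u * v') + a * (1 - u * \<theta> * v') \<in> Pw (Suc n)"
    unfolding Pw_Suc using ideal_prod.sum[OF ideal_prod.prod[OF 2, of "u * v'" P R]
        ideal_prod.prod[OF 1 v'(2), of R]] P_mult'[OF v'(1) u(1)] by simp
  also have "a * \<theta> * (u * v') + a * (1 - u * \<theta> * v') = a" by (simp add: algebra_simps)
  finally show ?case .
qed

lemma in_P_if_theta: assumes "x \<in> integers_of K" "x * \<theta> \<in> integers_of K" shows "x \<in> P"
proof -
  have "x \<in> ideal_prod R (integers_of K) P" using theta_Pw[of x "Suc 0"] assms unfolding Pw_Suc Pw_0 by simp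
  then show ?thesis
    by (induction rule: ideal_prod.induct) (auto intro: P_mult P_add)
qed

lemma ord_integerI:
  assumes "a \<in> integers_of K" "a * \<theta> ^ n \<in> integers_of K" "a * \<theta> ^ Suc n \<notin> integers_of K"
  shows "ord_integer K P a = n"
  unfolding ord_integer_def
proof (rule Greatest_equality)
  show "a \<in> Pw n" by (rule theta_Pw) (use assms in auto)
  fix m assume "a \<in> Pw m"
  then have "a * \<theta> ^ m \<in> integers_of K" using Pw_theta by blast
  then show "m \<le> n" using theta_descend_le[OF assms(1), of m "Suc n"] assms(3) by linarith
qed

lemma ord_exists:
  assumes "a \<in> integers_of K" "a \<noteq> 0"
  shows "\<exists>n. a * \<theta> ^ n \<in> integers_of K \<and> a * \<theta> ^ Suc n \<notin> integers_of K"
proof (rule ccontr)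
  assume *: "\<not> ?thesis"
  have "a * \<theta> ^ n \<in> integers_of K" for n by (induction n) (use assms * in auto)
  then show False using unif_theta assms by (auto simp: unif_def)
qed

lemma ord_integer_mult:
  assumes "a \<in> integers_of K" "a \<noteq> 0" "b \<in> integers_of K" "b \<noteq> 0"
  shows "ord_integer K P (a * b) = ord_integer K P a + ord_integer K P b"
proof -
  obtain m where m: "a * \<theta> ^ m \<in> integers_of K" "a * \<theta> ^ Suc m \<notin> integers_of K" using ord_exists assms by blast
  obtain n where n: "b * \<theta> ^ n \<in> integers_of K" "b * \<theta> ^ Suc n \<notin> integers_of K" using ord_exists assms by blast
  have e: "a * b * \<theta> ^ (m + n) = (a * \<theta> ^ m) * (b * \<theta> ^ n)" by (simp add: power_add)
  have "ord_integer K P (a * b) = m + n"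
  proof (rule ord_integerI)
    show "a * b * \<theta> ^ (m + n) \<in> integers_of K" unfolding e by (rule O_closed(2)[OF m(1) n(1)])
    show "a * b * \<theta> ^ Suc (m + n) \<notin> integers_of K"
    proof
      assume "a * b * \<theta> ^ Suc (m + n) \<in> integers_of K"
      moreover have "a * b * \<theta> ^ Suc (m + n) = (a * \<theta> ^ m) * (b * \<theta> ^ n) * \<theta>" by (simp add: power_add)
      ultimately have "(a * \<theta> ^ m) * (b * \<theta> ^ n) * \<theta> \<in> integers_of K" by (simp only:)
      then have "(a * \<theta> ^ m) * (b * \<theta> ^ n) \<in> P"
        by (rule in_P_if_theta[OF O_closed(2)[OF m(1) n(1)]])
      then have "a * \<theta> ^ m \<in> P \<or> b * \<theta> ^ n \<in> P" by (rule P_prime[OF m(1) n(1)])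
      then show False using theta_P[of "a * \<theta> ^ m"] theta_P[of "b * \<theta> ^ n"] m(2) n(2)
        by (auto simp only: power_Suc2 mult.assoc)
    qed
  qed (use assms in simp)
  then show ?thesis using ord_integerI[OF assms(1) m] ord_integerI[OF assms(3) n] by simp
qed

text \<open>Additivity of the order makes the difference independent of the fraction that represents
  x. It also gives order 0 to 1, so x / 1 is a witness.\<close>

lemma ord_at_integer:
  assumes "x \<in> integers_of K" "x \<noteq> 0"
  shows "ord_at K P x = int (ord_integer K P x)"
  unfolding ord_at_def
proof (rule the_equality)
  have "ord_integer K P (1 * 1) = ord_integer K P 1 + ord_integer K P 1" by (rule ord_integer_mult) auto
  then have "ord_integer K P 1 = 0" by simp
  then show "\<exists>a\<in>integers_of K - {0}. \<exists>b\<in>integers_of K - {0}. x = a / b \<and>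
      int (ord_integer K P x) = int (ord_integer K P a) - int (ord_integer K P b)"
    using assms by (intro bexI[of _ x] bexI[of _ 1]) auto
  fix k assume "\<exists>a\<in>integers_of K - {0}. \<exists>b\<in>integers_of K - {0}. x = a / b \<and>
      k = int (ord_integer K P a) - int (ord_integer K P b)"
  then obtain a b where ab: "a \<in> integers_of K" "a \<noteq> 0" "b \<in> integers_of K" "b \<noteq> 0" "x = a / b"
      "k = int (ord_integer K P a) - int (ord_integer K P b)" by blast
  have "a = x * b" using ab by simp
  then have "ord_integer K P a = ord_integer K P x + ord_integer K P b" using ord_integer_mult[OF assms ab(3,4)] by simp
  then show "k = int (ord_integer K P x)" using ab by simp
qed

lemma finite_norm_integer_le_1:
  assumes "x \<in> integers_of K" shows "finite_norm K P x \<le> 1"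
proof (cases "x = 0")
  case False
  define n where "n = ord_integer K P x"
  define N where "N = real (ideal_norm K P) ^ n"
  have "finite_norm K P x = inverse N"
    using False by (simp add: finite_norm_def ord_at_integer[OF assms False] n_def N_def power_int_minus)
  \<comment> \<open>An infinite residue ring would have cardinality 0 in HOL. The power is then 0,
    or 1 for exponent 0, and since the inverse of 0 is 0 the bound survives without finiteness of
    the residue ring.\<close>
  moreover have "N = 0 \<or> N \<ge> 1" unfolding N_def by (cases "ideal_norm K P = 0"; cases "n = 0") auto
  ultimately show ?thesis by (auto simp: inverse_le_1_iff)
qed (simp add: finite_norm_def)

end

section \<open>The height of an integer of a quadratic field\<close>

context quad_field
begin

lemma finite_place_quad_prime:
  assumes "P \<in> finite_places K" shows "quad_prime K w d P"
proof -
  interpret primeideal P "integer_ring K" using assms by (simp add: finite_places_def)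
  have c: "carrier (integer_ring K) = integers_of K" "mult (integer_ring K) = (*)"
    "ring.add (integer_ring K) = (+)" "ring.zero (integer_ring K) = 0" "one (integer_ring K) = 1"
    by (simp_all add: integer_ring_def)
  show ?thesis
  proof
    show "P \<subseteq> integers_of K" using a_subset by (simp add: c)
    show "\<And>x y. x \<in> P \<Longrightarrow> y \<in> P \<Longrightarrow> x + y \<in> P" using additive_subgroup.a_closed[OF is_additive_subgroup] by (simp add: c)
    show "\<And>x y. x \<in> integers_of K \<Longrightarrow> y \<in> P \<Longrightarrow> x * y \<in> P" using I_l_closed by (simp add: c)
    show "1 \<notin> P" using one_imp_carrier I_notcarr by (auto simp: c)
    show "\<And>x y. x \<in> integers_of K \<Longrightarrow> y \<in> integers_of K \<Longrightarrow> x * y \<in> P \<Longrightarrow> x \<in> P \<or> y \<in> P"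
      using I_prime by (simp add: c)
    have "0 \<in> P" using additive_subgroup.zero_closed[OF is_additive_subgroup] by (simp add: c)
    then show "\<exists>x\<in>P. x \<noteq> 0" using assms by (auto simp: finite_places_def)
  qed
qed

text \<open>Finite places contribute nothing for an integer. For an upper bound it is enough that
  every embedding is one of the two listed maps.\<close>

lemma weil_height_integer_le:
  assumes "quadratic_field K" "x \<in> integers_of K"
  shows "weil_height K x \<le> (ln (max 1 (norm x)) + ln (max 1 (norm (cj x)))) / 2"
proof -
  have "(\<Sum>\<^sub>\<infinity>\<pp>\<in>finite_places K. ln (max 1 (finite_norm K \<pp> x))) = (\<Sum>\<^sub>\<infinity>\<pp>\<in>finite_places K. 0)"
  proof (rule infsum_cong)
    fix P assume "P \<in> finite_places K"
    then interpret quad_prime K w d P by (rule finite_place_quad_prime)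
    show "ln (max 1 (finite_norm K P x)) = 0" using finite_norm_integer_le_1[OF assms(2)] by (simp add: max_def)
  qed
  then have fin: "(\<Sum>\<^sub>\<infinity>\<pp>\<in>finite_places K. ln (max 1 (finite_norm K \<pp> x))) = 0" by simp
  have xK: "x \<in> K" using assms(2) by simp
  let ?E = "{restrict id K, restrict cj K}"
  have "(\<Sum>\<sigma>\<in>embeddings K. ln (max 1 (norm (\<sigma> x)))) \<le> (\<Sum>\<sigma>\<in>?E. ln (max 1 (norm (\<sigma> x))))"
    by (rule sum_mono2) (use ring_hom_cases in auto)
  also have "\<dots> \<le> ln (max 1 (norm x)) + ln (max 1 (norm (cj x)))"
  proof (cases "restrict id K = restrict cj K")
    case True
    then have "?E = {restrict id K}" by simp
    then show ?thesis using xK by simp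
  next
    case False
    then show ?thesis using xK by (subst sum.insert) auto
  qed
  finally show ?thesis using assms(1) by (simp add: weil_height_def fin quadratic_field_def)
qed

end

section \<open>The modular group\<close>

definition mob :: "int \<Rightarrow> int \<Rightarrow> int \<Rightarrow> int \<Rightarrow> complex \<Rightarrow> complex" where
  "mob a b c d z = (of_int a * z + of_int b) / (of_int c * z + of_int d)"

abbreviation uhp :: "complex set" where "uhp \<equiv> upper_half_plane"

lemma uhp_iff: "z \<in> uhp \<longleftrightarrow> Im z > 0" by (simp add: upper_half_plane_def)

lemma open_uhp: "open uhp"
  unfolding upper_half_plane_def using open_halfspace_Im_gt[of 0] by simp

lemma convex_uhp: "convex uhp"
  unfolding upper_half_plane_def using convex_halfspace_Im_gt[of 0] by simp

lemma connected_uhp: "connected uhp" by (rule convex_connected[OF convex_uhp])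

lemma cocycle_nonzero:
  assumes "z \<in> uhp" "c \<noteq> 0 \<or> d \<noteq> 0" shows "of_int c * z + of_int d \<noteq> (0::complex)"
proof
  assume h: "of_int c * z + of_int d = 0"
  then have "Im (of_int c * z + of_int d) = 0" by simp
  then have "c = 0" using assms(1) by (simp add: uhp_iff)
  then show False using h assms(2) by simp
qed

lemma det_bottom_nonzero: "a * d - b * c \<noteq> (0::int) \<Longrightarrow> c \<noteq> 0 \<or> d \<noteq> 0" by auto

lemma Im_mob:
  assumes "z \<in> uhp" "a * d - b * c \<noteq> 0"
  shows "Im (mob a b c d z) = of_int (a * d - b * c) * Im z / (norm (of_int c * z + of_int d))\<^sup>2"
  unfolding mob_def Im_divide cmod_power2 by (simp add: algebra_simps)

lemma mob_uhp:
  assumes "z \<in> uhp" "a * d - b * c > 0" shows "mob a b c d z \<in> uhp"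
proof -
  have "norm (of_int c * z + of_int d) \<noteq> 0" using cocycle_nonzero assms det_bottom_nonzero[of a d b c] by auto
  then have "of_int (a * d - b * c) * Im z / (norm (of_int c * z + of_int d))\<^sup>2 > 0"
    using assms by (intro divide_pos_pos mult_pos_pos) (simp_all add: uhp_iff del: of_int_diff of_int_mult)
  then show ?thesis using Im_mob[of z a d b c] assms by (simp add: uhp_iff)
qed

lemma cocycle_mob:
  assumes "z \<in> uhp" "a' * d' - b' * c' \<noteq> 0"
  shows "(of_int c * mob a' b' c' d' z + of_int d) * (of_int c' * z + of_int d') =
     of_int (c * a' + d * c') * z + of_int (c * b' + d * d')"
proof -
  have n: "of_int c' * z + of_int d' \<noteq> 0" using cocycle_nonzero assms det_bottom_nonzero[of a' d' b' c'] by auto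
  have e: "mob a' b' c' d' z * (of_int c' * z + of_int d') = of_int a' * z + of_int b'"
    using n by (simp add: mob_def)
  have "(of_int c * mob a' b' c' d' z + of_int d) * (of_int c' * z + of_int d') =
    of_int c * (mob a' b' c' d' z * (of_int c' * z + of_int d')) + of_int d * (of_int c' * z + of_int d')"
    by (simp only: distrib_right mult.assoc)
  also have "\<dots> = of_int (c * a' + d * c') * z + of_int (c * b' + d * d')"
    unfolding e by (simp add: algebra_simps)
  finally show ?thesis .
qed

lemma mob_mob:
  assumes "z \<in> uhp" "a' * d' - b' * c' \<noteq> 0"
  shows "mob a b c d (mob a' b' c' d' z) =
     mob (a * a' + b * c') (a * b' + b * d') (c * a' + d * c') (c * b' + d * d') z"
proof -
  have n: "of_int c' * z + of_int d' \<noteq> 0" using cocycle_nonzero assms det_bottom_nonzero[of a' d' b' c'] by auto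
  have e: "mob a' b' c' d' z * (of_int c' * z + of_int d') = of_int a' * z + of_int b'"
    using n by (simp add: mob_def)
  have "mob a b c d (mob a' b' c' d' z) =
    ((of_int a * mob a' b' c' d' z + of_int b) * (of_int c' * z + of_int d')) /
    ((of_int c * mob a' b' c' d' z + of_int d) * (of_int c' * z + of_int d'))"
    unfolding mob_def[of a] using n by simp
  also have "(of_int a * mob a' b' c' d' z + of_int b) * (of_int c' * z + of_int d') =
    of_int a * (mob a' b' c' d' z * (of_int c' * z + of_int d')) + of_int b * (of_int c' * z + of_int d')"
    by (simp only: distrib_right mult.assoc)
  also have "\<dots> = of_int (a * a' + b * c') * z + of_int (a * b' + b * d')"
    unfolding e by (simp add: algebra_simps)
  finally show ?thesis unfolding cocycle_mob[OF assms] unfolding mob_def[of "a * a' + b * c'"] .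
qed

lemma mob_id [simp]: "mob 1 0 0 1 z = z" by (simp add: mob_def)
lemma mob_T: "mob 1 n 0 1 z = z + of_int n" by (simp add: mob_def)
lemma mob_S: "mob 0 (-1) 1 0 z = - 1 / z" by (simp add: mob_def)
lemma mob_p: "mob a 0 0 1 z = of_int a * z" by (simp add: mob_def)
lemma mob_neg: "mob (-a) (-b) (-c) (-d) z = mob a b c d z"
proof -
  have "mob (-a) (-b) (-c) (-d) z = (- (of_int a * z + of_int b)) / (- (of_int c * z + of_int d))"
    by (simp add: mob_def)
  then show ?thesis unfolding minus_divide_divide mob_def .
qed

lemma S_uhp: "z \<in> uhp \<Longrightarrow> - 1 / z \<in> uhp" using mob_uhp[of z 0 0 "-1" 1] by (simp add: mob_S)

lemma scale_uhp: "z \<in> uhp \<Longrightarrow> n > 0 \<Longrightarrow> of_nat n * z \<in> uhp" by (simp add: uhp_iff)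

definition SL2_inv :: "(complex \<Rightarrow> 'a) \<Rightarrow> bool" where
  "SL2_inv f \<longleftrightarrow> (\<forall>a b c d z. a * d - b * c = 1 \<longrightarrow> z \<in> uhp \<longrightarrow> f (mob a b c d z) = f z)"

text \<open>Translation and inversion generate the modular group. The induction is the Euclidean
  algorithm on the first column: translate by - q to replace a by its remainder modulo c, then
  invert to move the remainder into the lower left corner.\<close>

lemma SL2_invI:
  assumes T: "\<And>z. z \<in> uhp \<Longrightarrow> f (z + 1) = f z" and S: "\<And>z. z \<in> uhp \<Longrightarrow> f (- 1 / z) = f z"
  shows "SL2_inv f"
proof -
  have Tn: "f (z + of_nat n) = f z" if "z \<in> uhp" for z n
  proof (induction n)
    case (Suc n)
    have "z + of_nat n \<in> uhp" using that by (simp add: uhp_iff)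
    then show ?case using T[of "z + of_nat n"] Suc by (simp add: add_ac)
  qed simp
  have Ti: "f (z + of_int n) = f z" if "z \<in> uhp" for z n
  proof (cases "n \<ge> 0")
    case True then show ?thesis using Tn[OF that, of "nat n"] by simp
  next
    case False
    have "z + of_int n \<in> uhp" using that by (simp add: uhp_iff)
    then show ?thesis using Tn[of "z + of_int n" "nat (- n)"] False by simp
  qed
  have "f (mob a b c d z) = f z" if "a * d - b * c = 1" "z \<in> uhp" for a b c d z
    using that(1)
  proof (induction "nat \<bar>c\<bar>" arbitrary: a b c d rule: less_induct)
    case less
    show ?case
    proof (cases "c = 0")
      case True
      then have "a * d = 1" using less.prems by simp
      then consider "a = 1" "d = 1" | "a = - 1" "d = - 1" using zmult_eq_1_iff by auto
      then show ?thesis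
      proof cases
        case 1 then show ?thesis using True mob_T Ti[OF that(2)] by simp
      next
        case 2 then show ?thesis using True mob_neg[of 1 "-b" 0 1 z] mob_T[of "-b"] Ti[OF that(2), of "- b"] by simp
      qed
    next
      case False
      define q where "q = a div c"
      define r where "r = a - q * c"
      have r: "r = a mod c" by (simp add: r_def q_def minus_div_mult_eq_mod)
      have rc: "\<bar>r\<bar> < \<bar>c\<bar>" unfolding r using False by (rule abs_mod_less)
      have det: "(- c) * (b - q * d) - (- d) * r = 1" using less.prems by (simp add: r_def algebra_simps)
      have w: "mob a b c d z \<in> uhp" using mob_uhp that less.prems by simp
      have w': "mob a b c d z + of_int (- q) \<in> uhp" using w by (simp add: uhp_iff)
      have "mob a b c d z + of_int (- q) = mob 1 (-q) 0 1 (mob a b c d z)" by (simp add: mob_T)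
      also have "\<dots> = mob r (b - q * d) c d z"
        using less.prems by (subst mob_mob[OF that(2)]) (auto simp: r_def)
      finally have e1: "mob a b c d z + of_int (- q) = mob r (b - q * d) c d z" .
      have "- 1 / (mob a b c d z + of_int (- q)) = mob 0 (-1) 1 0 (mob r (b - q * d) c d z)"
        unfolding e1 mob_S ..
      also have "\<dots> = mob (- c) (- d) r (b - q * d) z"
        using det by (subst mob_mob[OF that(2)]) (auto simp: algebra_simps)
      finally have e2: "- 1 / (mob a b c d z + of_int (- q)) = mob (- c) (- d) r (b - q * d) z" .
      have "f (mob a b c d z) = f (mob a b c d z + of_int (- q))" using Ti[OF w, of "- q"] by simp
      also have "\<dots> = f (- 1 / (mob a b c d z + of_int (- q)))" using S[OF w'] by simp
      also have "\<dots> = f z" unfolding e2 by (rule less.hyps[OF _ det]) (use rc in simp)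
      finally show ?thesis .
    qed
  qed
  then show ?thesis by (auto simp: SL2_inv_def)
qed

lemma SL2_invD: "SL2_inv f \<Longrightarrow> a * d - b * c = 1 \<Longrightarrow> z \<in> uhp \<Longrightarrow> f (mob a b c d z) = f z"
  by (auto simp: SL2_inv_def)

text \<open>Choose the bottom row (c, d) with least |c z + d| among all coprime pairs. The top row
  is a coprime pair too, so its value is no smaller, which is the claim that the image has norm at
  least 1. Rounding the real part fixes the translation.\<close>

lemma fundamental_domain:
  assumes z: "z \<in> uhp"
  obtains a b c d where "a * d - b * c = 1" "norm (mob a b c d z) \<ge> 1" "\<bar>Re (mob a b c d z)\<bar> \<le> 1/2"
proof -
  have y: "Im z > 0" using z by (simp add: uhp_iff)
  \<comment> \<open>A and B enclose the pairs of value at most 1 in a box: the imaginary part bounds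
    c, then the triangle inequality bounds d.\<close>
  define A where "A = \<lceil>1 / Im z\<rceil>"
  define B where "B = \<lceil>1 + of_int A * norm z\<rceil>"
  define F where "F = {(c::int, d). coprime c d \<and> norm (of_int c * z + of_int d) \<le> 1}"
  have "F \<subseteq> {-A..A} \<times> {-B..B}"
  proof
    fix x assume "x \<in> F"
    then obtain c d where x: "x = (c, d)" "norm (of_int c * z + of_int d) \<le> 1" by (auto simp: F_def)
    have "\<bar>of_int c\<bar> * Im z \<le> 1"
      using abs_Im_le_cmod[of "of_int c * z + of_int d"] x(2) y by (simp add: abs_mult)
    then have "\<bar>of_int c\<bar> \<le> 1 / Im z" using y by (simp add: pos_le_divide_eq)
    then have c: "\<bar>c\<bar> \<le> A" unfolding A_def by linarith
    have "norm (of_int d :: complex) \<le> norm (of_int c * z + of_int d) + norm (of_int c * z)"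
      by (metis add_diff_cancel_left' norm_triangle_ineq4)
    also have "\<dots> \<le> 1 + of_int \<bar>c\<bar> * norm z" using x(2) by (simp add: norm_mult)
    also have "\<dots> \<le> 1 + of_int A * norm z" using c by (intro add_left_mono mult_right_mono) auto
    finally have "\<bar>d\<bar> \<le> B" unfolding B_def by simp linarith
    then show "x \<in> {-A..A} \<times> {-B..B}" using c x by (auto simp: abs_le_iff)
  qed
  then have fin: "finite F" by (rule finite_subset) simp
  have "(0, 1) \<in> F" by (simp add: F_def)
  then obtain cd where cd: "cd \<in> F" and
      mn: "\<And>x. x \<in> F \<Longrightarrow> norm (of_int (fst cd) * z + of_int (snd cd)) \<le> norm (of_int (fst x) * z + of_int (snd x))"
    using ex_is_arg_min_if_finite[OF fin, of "\<lambda>x. norm (of_int (fst x) * z + of_int (snd x))"]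
    unfolding is_arg_min_linorder by blast
  define c where "c = fst cd" define d where "d = snd cd"
  have cp: "coprime c d" and le1: "norm (of_int c * z + of_int d) \<le> 1" using cd by (auto simp: F_def c_def d_def)
  have mn': "norm (of_int c * z + of_int d) \<le> norm (of_int c' * z + of_int d')" if "coprime c' d'" for c' d'
  proof (cases "norm (of_int c' * z + of_int d') \<le> 1")
    case True then show ?thesis using mn[of "(c', d')"] that by (simp add: F_def c_def d_def)
  qed (use le1 in linarith)
  obtain u v where uv: "u * c + v * d = 1" using cp bezout_int[of c d] by auto
  define n where "n = round (Re (mob v (- u) c d z))"
  define a where "a = v - n * c" define b where "b = - u - n * d"
  have det0: "v * d - (- u) * c = 1" using uv by (simp add: algebra_simps)
  have det: "a * d - b * c = 1" using uv by (simp add: a_def b_def algebra_simps)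
  have "mob a b c d z = mob 1 (-n) 0 1 (mob v (-u) c d z)"
    using det0 by (subst mob_mob[OF z]) (auto simp: a_def b_def algebra_simps)
  then have w: "mob a b c d z = mob v (-u) c d z - of_int n" by (simp add: mob_T)
  have "\<bar>Re (mob a b c d z)\<bar> \<le> 1/2"
    unfolding w n_def using of_int_round_abs_le[of "Re (mob v (- u) c d z)"] by (simp add: abs_minus_commute)
  moreover have "norm (mob a b c d z) \<ge> 1"
  proof -
    have n0: "of_int c * z + of_int d \<noteq> 0" by (rule cocycle_nonzero[OF z]) (use det in auto)
    have "coprime a b"
    proof (rule coprimeI)
      fix e assume "e dvd a" "e dvd b"
      then have "e dvd a * d - b * c" by (intro dvd_diff dvd_mult2)
      then show "is_unit e" using det by simp
    qed
    then have "norm (of_int c * z + of_int d) \<le> norm (of_int a * z + of_int b)" by (rule mn')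
    then show ?thesis using n0 by (simp add: mob_def norm_divide)
  qed
  ultimately show ?thesis using that det by blast
qed

text \<open>86/100 is a rational number below sqrt 3 / 2; it serves as the lower bound for Im in all
  later estimates.\<close>

lemma fundamental_domain_Im:
  assumes "w \<in> uhp" "norm w \<ge> 1" "\<bar>Re w\<bar> \<le> 1/2" shows "Im w \<ge> 86/100"
proof (rule ccontr)
  assume a: "\<not> ?thesis"
  have i: "0 \<le> Im w" using assms by (simp add: uhp_iff)
  have "1 \<le> (norm w)\<^sup>2" using assms(2) by simp
  also have "\<dots> = (Re w)\<^sup>2 + (Im w)\<^sup>2" by (simp add: cmod_power2)
  also have "\<dots> \<le> (1/2)\<^sup>2 + (86/100)\<^sup>2" using a i assms(3) by (intro add_mono power_mono abs_le_square_iff[THEN iffD1]) auto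
  finally show False by (simp add: power2_eq_square)
qed

lemma reduce_uhp:
  assumes z: "z \<in> uhp"
  obtains a b c d where "a * d - b * c = 1" "mob a b c d z \<in> uhp" "Im (mob a b c d z) \<ge> 86/100"
    "\<bar>Re (mob a b c d z)\<bar> \<le> 1/2" "norm (mob a b c d z) \<ge> 1"
proof -
  obtain a b c d where *: "a * d - b * c = 1" "norm (mob a b c d z) \<ge> 1" "\<bar>Re (mob a b c d z)\<bar> \<le> 1/2"
    by (rule fundamental_domain[OF z])
  then have "mob a b c d z \<in> uhp" using mob_uhp[OF z] by simp
  then show ?thesis using that[OF *(1) _ fundamental_domain_Im[OF _ *(2,3)] *(3,2)] by simp
qed

section \<open>Eisenstein series and their q-expansions\<close>

lemma summable_on_int_powr:
  assumes "s > 1"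
  shows "(\<lambda>m::int. (1 + \<bar>real_of_int m\<bar>) powr (- s)) summable_on UNIV"
proof -
  have "summable (\<lambda>n. real (Suc n) powr (- s))"
    using assms by (subst summable_Suc_iff) (simp add: summable_real_powr_iff)
  then have n: "(\<lambda>n::nat. (1 + real n) powr (- s)) summable_on UNIV"
    by (intro norm_summable_imp_summable_on) (simp add: add_ac)
  have p: "(\<lambda>m::int. (1 + \<bar>real_of_int m\<bar>) powr (- s)) summable_on range int"
    using n by (subst summable_on_reindex) (auto simp: o_def)
  have q: "(\<lambda>m::int. (1 + \<bar>real_of_int m\<bar>) powr (- s)) summable_on range (\<lambda>n. - int n)"
    using n by (subst summable_on_reindex) (auto simp: o_def inj_on_def)
  have "UNIV = range int \<union> range (\<lambda>n. - int n)"
  proof -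
    have "x \<in> range int \<union> range (\<lambda>n. - int n)" for x
      by (cases "x \<ge> 0") (auto simp: image_iff intro: exI[of _ "nat x"] exI[of _ "nat (- x)"])
    then show ?thesis by blast
  qed
  then show ?thesis using summable_on_union[OF p q] by simp
qed

lemma summable_on_product_real:
  fixes f :: "'a \<Rightarrow> real" and g :: "'b \<Rightarrow> real"
  assumes "f summable_on A" "g summable_on B" "\<And>x. x \<in> A \<Longrightarrow> f x \<ge> 0" "\<And>x. x \<in> B \<Longrightarrow> g x \<ge> 0"
  shows "(\<lambda>(x, y). f x * g y) summable_on A \<times> B"
proof (rule summable_on_SigmaI)
  fix x assume "x \<in> A"
  show "((\<lambda>y. case (x, y) of (x, y) \<Rightarrow> f x * g y) has_sum f x * infsum g B) B"
    using has_sum_cmult_right[OF has_sum_infsum[OF assms(2)]] by simp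
next
  show "(\<lambda>x. f x * infsum g B) summable_on A" using assms(1) by (rule summable_on_cmult_left)
qed (use assms in auto)

text \<open>The imaginary part controls n and the triangle inequality then controls m. A nonzero
  pair of integers has an entry of size at least 1, which absorbs the two summands 1.\<close>

lemma lattice_lower_bound:
  assumes z: "z \<in> uhp"
  obtains C where "C > 0" "\<And>m n. (m, n) \<noteq> (0, 0) \<Longrightarrow>
     1 + \<bar>real_of_int m\<bar> \<le> C * norm (of_int m + of_int n * z) \<and> 1 + \<bar>real_of_int n\<bar> \<le> C * norm (of_int m + of_int n * z)"
proof -
  have y: "Im z > 0" using z by (simp add: uhp_iff)
  define a where "a = 1 / Im z"
  define b where "b = 1 + a * norm z"
  have a0: "a > 0" using y by (simp add: a_def)
  have b1: "b \<ge> 1" using a0 by (simp add: b_def)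
  have n: "\<bar>real_of_int n\<bar> \<le> a * norm (of_int m + of_int n * z)" for m n
  proof -
    have "\<bar>real_of_int n\<bar> * Im z \<le> norm (of_int m + of_int n * z)"
      using abs_Im_le_cmod[of "of_int m + of_int n * z"] y by (simp add: abs_mult)
    then show ?thesis using y by (simp add: a_def pos_le_divide_eq)
  qed
  have m: "\<bar>real_of_int m\<bar> \<le> b * norm (of_int m + of_int n * z)" for m n
  proof -
    have "norm (of_int m :: complex) \<le> norm (of_int m + of_int n * z) + norm (of_int n * z)"
      by (metis add_diff_cancel_right' norm_triangle_ineq4)
    also have "norm (of_int n * z) = \<bar>real_of_int n\<bar> * norm z" by (simp add: norm_mult)
    also have "\<dots> \<le> a * norm (of_int m + of_int n * z) * norm z" using n by (intro mult_right_mono) auto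
    finally show ?thesis by (simp add: b_def algebra_simps)
  qed
  show ?thesis
  proof (rule that[of "2 * (a + b)"])
    show "2 * (a + b) > 0" using a0 b1 by simp
    fix m n :: int assume mn: "(m, n) \<noteq> (0, 0)"
    let ?N = "norm (of_int m + of_int n * z)"
    have "1 \<le> \<bar>real_of_int m\<bar> \<or> 1 \<le> \<bar>real_of_int n\<bar>"
    proof (rule ccontr)
      assume "\<not> ?thesis"
      then have "\<bar>m\<bar> < 1" "\<bar>n\<bar> < 1" by linarith+
      then show False using mn by simp
    qed
    moreover have "0 \<le> a * ?N" "0 \<le> b * ?N" using a0 b1 by auto
    ultimately have "1 \<le> (a + b) * ?N" using m[of m n] n[of n m] by (auto simp: ring_distribs)
    then show "1 + \<bar>real_of_int m\<bar> \<le> 2 * (a + b) * ?N \<and> 1 + \<bar>real_of_int n\<bar> \<le> 2 * (a + b) * ?N"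
      using m[of m n] n[of n m] \<open>0 \<le> a * ?N\<close> \<open>0 \<le> b * ?N\<close> by (auto simp: ring_distribs)
  qed
qed

text \<open>A cube splits into two factors of exponent 3/2 > 1, so the double series is dominated by
  a product of two convergent ones. The last conclusion takes care of exponents above 3.\<close>

lemma lattice_bound_cube:
  assumes z: "z \<in> uhp"
  obtains C where "C > 0" "\<And>m n. (m, n) \<noteq> (0, 0) \<Longrightarrow>
     1 / norm (of_int m + of_int n * z) ^ 3 \<le> C * ((1 + \<bar>real_of_int m\<bar>) powr (- (3/2)) * (1 + \<bar>real_of_int n\<bar>) powr (- (3/2)))"
    "\<And>m n. (m, n) \<noteq> (0, 0) \<Longrightarrow> 1 / norm (of_int m + of_int n * z) \<le> C"
proof -
  obtain C where C: "C > 0" "\<And>m n. (m, n) \<noteq> (0, 0) \<Longrightarrow>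
     1 + \<bar>real_of_int m\<bar> \<le> C * norm (of_int m + of_int n * z) \<and> 1 + \<bar>real_of_int n\<bar> \<le> C * norm (of_int m + of_int n * z)"
    using lattice_lower_bound[OF z] by blast
  show ?thesis
  proof (rule that[of "C ^ 3 + C"])
    show "C ^ 3 + C > 0" using C(1) by (intro add_pos_pos) auto
    fix m n :: int assume mn: "(m, n) \<noteq> (0, 0)"
    let ?N = "norm (of_int m + of_int n * z)"
    let ?a = "1 + \<bar>real_of_int m\<bar>" let ?b = "1 + \<bar>real_of_int n\<bar>"
    have ab: "?a \<le> C * ?N" "?b \<le> C * ?N" using C(2)[OF mn] by auto
    have CN: "C * ?N \<ge> 1" using ab by linarith
    then have N0: "?N > 0" using C(1) by (metis mult_zero_right not_one_le_zero norm_ge_zero order_le_less)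
    have "?a powr (3/2) * ?b powr (3/2) \<le> (C * ?N) powr (3/2) * (C * ?N) powr (3/2)"
      using ab by (intro mult_mono powr_mono2) auto
    also have "\<dots> = (C * ?N) powr 3" by (simp add: powr_add[symmetric])
    also have "\<dots> = C ^ 3 * ?N ^ 3" using CN by (simp add: powr_numeral power_mult_distrib)
    finally have le: "?a powr (3/2) * ?b powr (3/2) \<le> C ^ 3 * ?N ^ 3" .
    have pos: "?a powr (3/2) * ?b powr (3/2) > 0" by simp
    have "1 / ?N ^ 3 = C ^ 3 / (C ^ 3 * ?N ^ 3)" using C(1) by simp
    also have "\<dots> \<le> C ^ 3 / (?a powr (3/2) * ?b powr (3/2))"
      using le pos C(1) N0 by (intro divide_left_mono mult_pos_pos) auto
    also have "\<dots> = C ^ 3 * (?a powr (- (3/2)) * ?b powr (- (3/2)))" by (simp only: powr_minus divide_inverse inverse_mult_distrib)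
    also have "\<dots> \<le> (C ^ 3 + C) * (?a powr (- (3/2)) * ?b powr (- (3/2)))"
      using C(1) by (intro mult_right_mono) auto
    finally show "1 / ?N ^ 3 \<le> (C ^ 3 + C) * (?a powr (- (3/2)) * ?b powr (- (3/2)))" .
    have "1 / ?N \<le> C" using CN N0 by (simp add: divide_le_eq)
    then show "1 / ?N \<le> C ^ 3 + C" using C(1) by (simp add: add_increasing)
  qed
qed

lemma lattice_cube_summable:
  "(\<lambda>(m::int, n::int). (1 + \<bar>real_of_int m\<bar>) powr (- (3/2)) * (1 + \<bar>real_of_int n\<bar>) powr (- (3/2))) summable_on A"
proof -
  have "(\<lambda>(m::int, n::int). (1 + \<bar>real_of_int m\<bar>) powr (- (3/2)) * (1 + \<bar>real_of_int n\<bar>) powr (- (3/2)))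
     summable_on UNIV \<times> UNIV"
    by (intro summable_on_product_real summable_on_int_powr) auto
  then show ?thesis by (rule summable_on_subset_banach) auto
qed

lemma eisenstein_summable:
  assumes z: "z \<in> uhp" and k: "k \<ge> 3"
  shows "(\<lambda>x. norm (case x of (m, n) \<Rightarrow> 1 / (of_int m + of_int n * z) ^ k)) summable_on (UNIV - {(0, 0)})"
proof -
  obtain C where C: "C > 0" "\<And>m n. (m, n) \<noteq> (0, 0) \<Longrightarrow>
     1 / norm (of_int m + of_int n * z) ^ 3 \<le> C * ((1 + \<bar>real_of_int m\<bar>) powr (- (3/2)) * (1 + \<bar>real_of_int n\<bar>) powr (- (3/2)))"
    "\<And>m n. (m, n) \<noteq> (0, 0) \<Longrightarrow> 1 / norm (of_int m + of_int n * z) \<le> C"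
    using lattice_bound_cube[OF z] by blast
  define g where "g = (\<lambda>(m::int, n::int). C ^ (k - 3) * C * ((1 + \<bar>real_of_int m\<bar>) powr (- (3/2)) * (1 + \<bar>real_of_int n\<bar>) powr (- (3/2))))"
  have g: "g summable_on (UNIV - {(0, 0)})"
    using summable_on_cmult_right[OF lattice_cube_summable, of "C ^ (k - 3) * C"] by (simp add: g_def case_prod_unfold)
  show ?thesis
  proof (rule summable_on_comparison_test[OF g])
    fix x :: "int \<times> int" assume x: "x \<in> UNIV - {(0, 0)}"
    obtain m n where mn: "x = (m, n)" by (cases x)
    let ?N = "norm (of_int m + of_int n * z)"
    have "1 / ?N ^ k = (1 / ?N) ^ (k - 3) * (1 / ?N ^ 3)"
      using k by (simp add: power_add[symmetric] power_one_over)
    also have "\<dots> \<le> C ^ (k - 3) * (C * ((1 + \<bar>real_of_int m\<bar>) powr (- (3/2)) * (1 + \<bar>real_of_int n\<bar>) powr (- (3/2))))"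
      using x mn C by (intro mult_mono power_mono) auto
    finally show "norm (case x of (m, n) \<Rightarrow> 1 / (of_int m + of_int n * z) ^ k) \<le> g x"
      by (simp add: mn g_def norm_divide norm_power mult.assoc)
  qed auto
qed

text \<open>The action is a change of basis of the lattice: \<open>?h\<close> multiplies pairs by
  the matrix, with the adjugate as inverse.\<close>

lemma eisenstein_mob:
  assumes z: "z \<in> uhp" and det: "a * d - b * c = 1"
  shows "eisenstein_G k (mob a b c d z) = (of_int c * z + of_int d) ^ k * eisenstein_G k z"
proof -
  have n0: "of_int c * z + of_int d \<noteq> 0" by (rule cocycle_nonzero[OF z]) (use det in auto)
  let ?h = "\<lambda>(m, n). (m * d + n * b, m * c + n * a)"
  have bij: "bij_betw ?h (UNIV - {(0, 0)}) (UNIV - {(0::int, 0::int)})"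
  proof (rule bij_betwI[where g = "\<lambda>(m, n). (m * a - n * b, n * d - m * c)"])
    have e: "x * (a * d - b * c) = x" for x using det by simp
    have *: "x = 0 \<and> y = 0" if "x * d + y * b = 0" "x * c + y * a = 0" for x y
    proof -
      have "x * (a * d - b * c) = (x * d + y * b) * a - (x * c + y * a) * b"
        "y * (a * d - b * c) = (x * c + y * a) * d - (x * d + y * b) * c"
        by (simp_all add: algebra_simps)
      then show ?thesis unfolding e that by simp
    qed
    show "?h \<in> UNIV - {(0, 0)} \<rightarrow> UNIV - {(0, 0)}" 
    proof
      fix x :: "int \<times> int" assume "x \<in> UNIV - {(0, 0)}"
      then show "?h x \<in> UNIV - {(0, 0)}" using *[of "fst x" "snd x"] by (cases x) auto
    qed
    have **: "x = 0 \<and> y = 0" if "x * a - y * b = 0" "y * d - x * c = 0" for x y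
    proof -
      have "x * (a * d - b * c) = (x * a - y * b) * d + (y * d - x * c) * b"
        "y * (a * d - b * c) = (x * a - y * b) * c + (y * d - x * c) * a"
        by (simp_all add: algebra_simps)
      then show ?thesis unfolding e that by simp
    qed
    show "(\<lambda>(m, n). (m * a - n * b, n * d - m * c)) \<in> UNIV - {(0, 0)} \<rightarrow> UNIV - {(0, 0)}" 
    proof
      fix x :: "int \<times> int" assume "x \<in> UNIV - {(0, 0)}"
      then show "(\<lambda>(m, n). (m * a - n * b, n * d - m * c)) x \<in> UNIV - {(0, 0)}"
        using **[of "fst x" "snd x"] by (cases x) auto
    qed
    show "(\<lambda>(m, n). (m * a - n * b, n * d - m * c)) (?h x) = x" for x
      by (cases x) (use e[of "fst x"] e[of "snd x"] in \<open>simp add: algebra_simps\<close>)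
    show "?h ((\<lambda>(m, n). (m * a - n * b, n * d - m * c)) x) = x" for x
      by (cases x) (use e[of "fst x"] e[of "snd x"] in \<open>simp add: algebra_simps\<close>)
  qed
  have "eisenstein_G k (mob a b c d z) =
    (\<Sum>\<^sub>\<infinity>(m, n)\<in>UNIV - {(0, 0)}. (of_int c * z + of_int d) ^ k * (1 / (of_int (m * d + n * b) + of_int (m * c + n * a) * z) ^ k))"
    unfolding eisenstein_G_def
  proof (intro infsum_cong)
    fix x :: "int \<times> int"
    obtain m n where mn: "x = (m, n)" by (cases x)
    have e: "mob a b c d z * (of_int c * z + of_int d) = of_int a * z + of_int b"
      using n0 by (simp add: mob_def)
    have "(of_int m + of_int n * mob a b c d z) * (of_int c * z + of_int d) =
       of_int m * (of_int c * z + of_int d) + of_int n * (mob a b c d z * (of_int c * z + of_int d))"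
      by (simp only: distrib_right mult.assoc)
    also have "\<dots> = of_int (m * d + n * b) + of_int (m * c + n * a) * z"
      unfolding e by (simp add: algebra_simps)
    finally have "of_int m + of_int n * mob a b c d z =
       (of_int (m * d + n * b) + of_int (m * c + n * a) * z) / (of_int c * z + of_int d)"
      using n0 by (metis nonzero_mult_div_cancel_right)
    then show "(case x of (m, n) \<Rightarrow> 1 / (of_int m + of_int n * mob a b c d z) ^ k) =
       (case x of (m, n) \<Rightarrow> (of_int c * z + of_int d) ^ k * (1 / (of_int (m * d + n * b) + of_int (m * c + n * a) * z) ^ k))"
      by (simp add: mn power_divide)
  qed
  also have "\<dots> = (of_int c * z + of_int d) ^ k *
     (\<Sum>\<^sub>\<infinity>x\<in>UNIV - {(0, 0)}. (case ?h x of (m, n) \<Rightarrow> 1 / (of_int m + of_int n * z) ^ k))"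
    by (subst infsum_cmult_right'[symmetric]) (simp add: case_prod_unfold)
  also have "(\<Sum>\<^sub>\<infinity>x\<in>UNIV - {(0, 0)}. (case ?h x of (m, n) \<Rightarrow> 1 / (of_int m + of_int n * z) ^ k)) = eisenstein_G k z"
    unfolding eisenstein_G_def by (rule infsum_reindex_bij_betw[OF bij])
  finally show ?thesis .
qed

abbreviation qe :: "complex \<Rightarrow> complex" where "qe z \<equiv> exp (2 * of_real pi * \<i> * z)"

lemma norm_qe: "norm (qe z) = exp (- 2 * pi * Im z)" by simp

lemma norm_qe_less_1: "z \<in> uhp \<Longrightarrow> norm (qe z) < 1" unfolding norm_qe by (simp add: uhp_iff)

lemma qe_of_nat: "qe (of_nat n * z) = qe z ^ n"
  by (simp add: exp_of_nat_mult[symmetric] mult_ac)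

section \<open>Rows of the lattice sum and the reflection formula for polygamma functions\<close>

definition row_sum :: "nat \<Rightarrow> complex \<Rightarrow> complex" where
  "row_sum k w = (\<Sum>\<^sub>\<infinity>m::int. 1 / (of_int m + w) ^ k)"

lemma row_summable:
  fixes w :: complex
  assumes "\<delta> > 0" "\<And>m. m \<in> A \<Longrightarrow> norm (of_int m + w) \<ge> \<delta>" "k \<ge> 2"
  shows "(\<lambda>m::int. norm (1 / (of_int m + w) ^ k)) summable_on A"
proof (rule summable_on_comparison_test)
  define C where "C = (1 + (1 + norm w) / \<delta>)"
  define B where "B = C ^ 2 * (1 / \<delta>) ^ (k - 2)"
  have "(\<lambda>m::int. (1 + \<bar>real_of_int m\<bar>) powr (- 2)) summable_on A"
    by (rule summable_on_subset_banach[OF summable_on_int_powr]) auto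
  then show "(\<lambda>m::int. B * (1 + \<bar>real_of_int m\<bar>) powr (- 2)) summable_on A"
    by (rule summable_on_cmult_right)
  fix m assume m: "m \<in> A"
  let ?N = "norm (of_int m + w)"
  have d: "?N \<ge> \<delta>" "?N > 0" by (rule assms(2)[OF m], rule order.strict_trans2[OF assms(1) assms(2)[OF m]])
  have "norm (of_int m :: complex) \<le> ?N + norm w" using norm_triangle_ineq4[of "of_int m + w" w] by simp
  then have "1 + \<bar>real_of_int m\<bar> \<le> ?N + (1 + norm w) * 1" by simp
  also have "\<dots> \<le> ?N + (1 + norm w) * (?N / \<delta>)" using d assms(1) by (intro add_left_mono mult_left_mono) auto
  also have "\<dots> = C * ?N" by (simp add: C_def ring_distribs)
  finally have le: "1 + \<bar>real_of_int m\<bar> \<le> C * ?N" .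
  have Cpos: "C > 0" unfolding C_def using assms(1) by (intro add_pos_nonneg divide_nonneg_pos) auto
  then have "1 / ?N ^ 2 = C ^ 2 / (C * ?N) ^ 2" by (simp add: power_mult_distrib)
  also have "\<dots> \<le> C ^ 2 / (1 + \<bar>real_of_int m\<bar>) ^ 2"
    using le Cpos d by (intro divide_left_mono power_mono mult_pos_pos zero_less_power) auto
  also have "\<dots> = C ^ 2 * (1 + \<bar>real_of_int m\<bar>) powr (- 2)" by (simp add: powr_minus powr_numeral divide_inverse)
  finally have 2: "1 / ?N ^ 2 \<le> C ^ 2 * (1 + \<bar>real_of_int m\<bar>) powr (- 2)" .
  obtain l where l: "k = 2 + l" using assms(3) le_Suc_ex by blast
  have "1 / ?N ^ k = (1 / ?N ^ 2) * (1 / ?N) ^ (k - 2)"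
    unfolding l power_add by (simp add: power_one_over)
  also have "\<dots> \<le> (C ^ 2 * (1 + \<bar>real_of_int m\<bar>) powr (- 2)) * (1 / \<delta>) ^ (k - 2)"
    using 2 d assms(1) by (intro mult_mono power_mono divide_left_mono) auto
  finally show "norm (1 / (of_int m + w) ^ k) \<le> B * (1 + \<bar>real_of_int m\<bar>) powr (- 2)"
    by (simp add: norm_divide norm_power B_def mult_ac)
qed auto

lemma UNIV_int_split: "(UNIV :: int set) = range int \<union> range (\<lambda>n. - 1 - int n)"
proof -
  have "x \<in> range int \<union> range (\<lambda>n. - 1 - int n)" for x
  proof (cases "x \<ge> 0")
    case True then show ?thesis using image_eqI[of x int "nat x" UNIV] by simp
  next
    case False then show ?thesis using image_eqI[of x "\<lambda>n. - 1 - int n" "nat (- 1 - x)" UNIV] by simp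
  qed
  then show ?thesis by blast
qed

lemma infsum_nat_suminf:
  fixes f :: "nat \<Rightarrow> complex"
  assumes "f summable_on UNIV" shows "infsum f UNIV = suminf f"
  using has_sum_imp_sums[OF has_sum_infsum[OF assms]] by (rule sums_unique)

text \<open>The terms with m >= 0 form a polygamma series at w. Those with m <= -1 form the same
  series at 1 - w, as k is even.\<close>

lemma row_sum_Polygamma:
  assumes "\<delta> > 0" "\<And>m::int. norm (of_int m + w) \<ge> \<delta>" "k \<ge> 2" "even k"
  shows "row_sum k w = (Polygamma (k - 1) w + Polygamma (k - 1) (1 - w)) / fact (k - 1)"
proof -
  let ?f = "\<lambda>m::int. 1 / (of_int m + w) ^ k"
  have sm: "?f summable_on A" for A
    by (rule abs_summable_summable[OF row_summable[OF assms(1) assms(2) assms(3)]])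
  have w0: "w \<noteq> 0" "1 - w \<noteq> 0" using assms(2)[of 0] assms(2)[of "-1"] assms(1) by auto
  have "row_sum k w = infsum ?f (range int) + infsum ?f (range (\<lambda>n. - 1 - int n))"
    unfolding row_sum_def by (subst UNIV_int_split, rule infsum_Un_disjoint) (auto intro: sm)
  also have "infsum ?f (range int) = (\<Sum>n. inverse ((w + of_nat n) ^ k))"
  proof -
    have "infsum ?f (range int) = infsum (?f \<circ> int) UNIV" by (rule infsum_reindex) simp
    also have "\<dots> = suminf (?f \<circ> int)"
      by (rule infsum_nat_suminf, subst summable_on_reindex[symmetric]) (auto intro: sm)
    finally show ?thesis by (simp add: o_def divide_inverse add.commute)
  qed
  also have "infsum ?f (range (\<lambda>n. - 1 - int n)) = (\<Sum>n. inverse ((1 - w + of_nat n) ^ k))"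
  proof -
    have inj: "inj (\<lambda>n. - 1 - int n)" by (simp add: inj_on_def)
    have "infsum ?f (range (\<lambda>n. - 1 - int n)) = infsum (?f \<circ> (\<lambda>n. - 1 - int n)) UNIV" by (rule infsum_reindex[OF inj])
    also have "\<dots> = suminf (?f \<circ> (\<lambda>n. - 1 - int n))"
      by (rule infsum_nat_suminf, subst summable_on_reindex[OF inj, symmetric]) (rule sm)
    also have "?f \<circ> (\<lambda>n. - 1 - int n) = (\<lambda>n. inverse ((1 - w + of_nat n) ^ k))"
    proof
      fix n
      have "of_int (- 1 - int n) + w = - (1 - w + of_nat n)" by simp
      then show "(?f \<circ> (\<lambda>n. - 1 - int n)) n = inverse ((1 - w + of_nat n) ^ k)"
        unfolding o_def using assms(4) by (simp only: power_minus_even divide_inverse mult_1)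
    qed
    finally show ?thesis .
  qed
  also have "(\<Sum>n. inverse ((w + of_nat n) ^ k)) = Polygamma (k - 1) w / fact (k - 1)"
    using sums_unique[OF Polygamma_LIMSEQ[OF w0(1), of "k - 1"]] assms(3,4) by simp
  also have "(\<Sum>n. inverse ((1 - w + of_nat n) ^ k)) = Polygamma (k - 1) (1 - w) / fact (k - 1)"
    using sums_unique[OF Polygamma_LIMSEQ[OF w0(2), of "k - 1"]] assms(3,4) by simp
  finally show ?thesis by (simp add: add_divide_distrib)
qed

text \<open>The combination to which the reflection formula applies: minus the k-th derivative of pi
  cot(pi w).\<close>

definition prefl :: "nat \<Rightarrow> complex \<Rightarrow> complex" where
  "prefl k w = Polygamma k w + (-1) ^ Suc k * Polygamma k (1 - w)"

lemma not_Ints_nonpos: "w \<notin> \<int> \<Longrightarrow> w \<notin> \<int>\<^sub>\<le>\<^sub>0 \<and> 1 - w \<notin> \<int>\<^sub>\<le>\<^sub>0"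
  using nonpos_Ints_Int[of w] nonpos_Ints_Int[of "1 - w"] Ints_diff[of 1 "1 - w"] by auto

lemma prefl_deriv:
  assumes "w \<notin> \<int>" shows "(prefl k has_field_derivative prefl (Suc k) w) (at w)"
proof -
  have n: "w \<notin> \<int>\<^sub>\<le>\<^sub>0" "1 - w \<notin> \<int>\<^sub>\<le>\<^sub>0" using not_Ints_nonpos[OF assms] by auto
  have "((\<lambda>w. Polygamma k w + (-1) ^ Suc k * Polygamma k (1 - w)) has_field_derivative
     Polygamma (Suc k) w + (-1) ^ Suc k * (Polygamma (Suc k) (1 - w) * (- 1))) (at w)"
  proof (intro DERIV_add DERIV_cmult)
    show "(Polygamma k has_field_derivative Polygamma (Suc k) w) (at w)"
      by (rule has_field_derivative_Polygamma[OF n(1)])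
    show "((\<lambda>w. Polygamma k (1 - w)) has_field_derivative Polygamma (Suc k) (1 - w) * - 1) (at w)"
      by (rule DERIV_chain2[where f = "Polygamma k" and g = "\<lambda>w. 1 - w", OF has_field_derivative_Polygamma[OF n(2)]]) (auto intro!: derivative_eq_intros)
  qed
  then show ?thesis by (simp add: prefl_def[abs_def])
qed

lemma prefl_step:
  assumes "open S" "S \<inter> \<int> = {}" "\<And>w. w \<in> S \<Longrightarrow> prefl k w = g w"
    "\<And>w. w \<in> S \<Longrightarrow> (g has_field_derivative g' w) (at w)" "w \<in> S"
  shows "prefl (Suc k) w = g' w"
proof -
  have "(g has_field_derivative prefl (Suc k) w) (at w)"
    by (rule has_field_derivative_transform_within_open[OF prefl_deriv assms(1,5)]) (use assms in auto)
  then show ?thesis using assms(4)[OF assms(5)] DERIV_unique by blast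
qed

lemma sin_pi_nonzero:
  assumes "w \<notin> \<int>" shows "sin (of_real pi * w) \<noteq> (0::complex)"
proof
  assume "sin (of_real pi * w) = 0"
  then obtain n where "of_real pi * w = of_real (of_int n * pi)" by (auto simp: Complex_Transcendental.sin_eq_0)
  then have "w = of_int n" by simp
  then show False using assms by simp
qed

text \<open>Differentiate the reflection formula Gamma(w) Gamma(1 - w) = pi / sin(pi w).\<close>

lemma prefl_0:
  assumes "w \<notin> \<int>"
  shows "prefl 0 w = - (of_real pi * cos (of_real pi * w) / sin (of_real pi * w))"
proof -
  have n: "w \<notin> \<int>\<^sub>\<le>\<^sub>0" "1 - w \<notin> \<int>\<^sub>\<le>\<^sub>0" using not_Ints_nonpos[OF assms] by auto
  let ?s = "sin (of_real pi * w)" let ?c = "cos (of_real pi * w)"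
  have s: "?s \<noteq> 0" by (rule sin_pi_nonzero[OF assms])
  have d1: "((\<lambda>w. Gamma w * Gamma (1 - w)) has_field_derivative
      (Gamma w * Digamma w) * Gamma (1 - w) + (Gamma (1 - w) * Digamma (1 - w) * (- 1)) * Gamma w) (at w)"
  proof (rule DERIV_mult)
    show "(Gamma has_field_derivative Gamma w * Digamma w) (at w)" by (rule has_field_derivative_Gamma[OF n(1)])
    show "((\<lambda>w. Gamma (1 - w)) has_field_derivative Gamma (1 - w) * Digamma (1 - w) * (- 1)) (at w)"
      by (rule DERIV_chain2[where f = Gamma and g = "\<lambda>w. 1 - w", OF has_field_derivative_Gamma[OF n(2)]]) (auto intro!: derivative_eq_intros)
  qed
  have d2: "((\<lambda>w. of_real pi / sin (of_real pi * w)) has_field_derivative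
      - (of_real pi * (?c * of_real pi)) / (?s * ?s)) (at w)"
    using s by (auto intro!: derivative_eq_intros)
  have "(Gamma w * Digamma w) * Gamma (1 - w) + (Gamma (1 - w) * Digamma (1 - w) * (- 1)) * Gamma w =
     - (of_real pi * (?c * of_real pi)) / (?s * ?s)"
    using DERIV_unique[OF d1[unfolded Gamma_reflection_complex] d2] .
  then have "(Gamma w * Gamma (1 - w)) * prefl 0 w = - (of_real pi * (?c * of_real pi)) / (?s * ?s)"
    by (simp add: prefl_def algebra_simps)
  then have "of_real pi / ?s * prefl 0 w = of_real pi / ?s * (- (of_real pi * ?c / ?s))"
    unfolding Gamma_reflection_complex by simp
  moreover have "of_real pi / ?s \<noteq> 0" using s by simp
  ultimately show ?thesis by (metis mult_left_cancel)
qed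

lemma open_not_Ints: "open (- \<int> :: complex set)"
  by (rule open_Compl) simp

text \<open>Five successive differentiations; the facts \<open>a1\<close> to \<open>a5'\<close>
  isolate their algebra, with the squared cosine replaced by 1 minus the squared sine. Orders 1, 3
  and 5 at w = 1/2 yield the zeta values at 2, 4 and 6.\<close>

lemma prefl_trig:
  assumes w: "w \<notin> \<int>"
  defines "s \<equiv> sin (of_real pi * w)" and "c \<equiv> cos (of_real pi * w)"
  shows "prefl 1 w = of_real pi ^ 2 / s ^ 2"
    and "prefl 3 w = of_real pi ^ 4 * (6 / s ^ 4 - 4 / s ^ 2)"
    and "prefl 5 w = of_real pi ^ 6 * (120 / s ^ 6 - 120 / s ^ 4 + 16 / s ^ 2)"
proof -
  let ?S = "- \<int> :: complex set"
  let ?s = "\<lambda>w. sin (of_real pi * w) :: complex" and ?c = "\<lambda>w. cos (of_real pi * w) :: complex"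
  note o = open_not_Ints
  have di: "?S \<inter> \<int> = {}" by auto
  have cs: "?c w * ?c w = 1 - ?s w * ?s w" for w
    using sin_cos_squared_add3[of "of_real pi * w"] by (simp add: algebra_simps)
  have s0: "?s w \<noteq> 0" if "w \<in> ?S" for w using sin_pi_nonzero that by auto
  have a1: "P * (- (P * s)) * s - P * c * (P * c) = - (P ^ 2) * (s * s + c * c)" for P s c :: complex
    by (simp add: algebra_simps power2_eq_square)
  have a2: "(0 * s ^ 2 - P ^ 2 * (of_nat 2 * (P * c * s ^ (2 - Suc 0)))) / (s ^ 2 * s ^ 2)
      = - 2 * P ^ 3 * c / s ^ 3" if "s \<noteq> 0" for P s c :: complex
    using that by (simp add: field_simps eval_nat_numeral)
  have a3: "- 2 * P ^ 3 * (- (P * s)) * s ^ 3 - - 2 * P ^ 3 * c * (of_nat 3 * (P * c * s ^ (3 - Suc 0)))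
       = P ^ 4 * s ^ 2 * (2 * (s * s) + 6 * (c * c))" for P s c :: complex
    by (simp add: algebra_simps eval_nat_numeral)
  have a3': "P ^ 4 * s ^ 2 * (2 * (s * s) + 6 * (1 - s * s)) / (s ^ 3 * s ^ 3) = P ^ 4 * (6 / s ^ 4 - 4 / s ^ 2)"
    if "s \<noteq> 0" for P s :: complex
    using that by (simp add: field_simps eval_nat_numeral)
  have a4: "P ^ 4 * ((0 * s ^ 4 - 6 * (of_nat 4 * (P * c * s ^ (4 - Suc 0)))) / (s ^ 4 * s ^ 4)
        - (0 * s ^ 2 - 4 * (of_nat 2 * (P * c * s ^ (2 - Suc 0)))) / (s ^ 2 * s ^ 2))
       = P ^ 5 * (c * (8 / s ^ 3 - 24 / s ^ 5))" if "s \<noteq> 0" for P s c :: complex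
    using that by (simp add: field_simps eval_nat_numeral)
  have a5: "P ^ 5 * (- (P * s) * (8 / s ^ 3 - 24 / s ^ 5) +
       ((0 * s ^ 3 - 8 * (of_nat 3 * (P * c * s ^ (3 - Suc 0)))) / (s ^ 3 * s ^ 3)
        - (0 * s ^ 5 - 24 * (of_nat 5 * (P * c * s ^ (5 - Suc 0)))) / (s ^ 5 * s ^ 5)) * c)
      = P ^ 6 * (24 / s ^ 4 - 8 / s ^ 2 + (c * c) * (120 / s ^ 6 - 24 / s ^ 4))" if "s \<noteq> 0" for P s c :: complex
    using that by (simp add: field_simps eval_nat_numeral)
  have a5': "P ^ 6 * (24 / s ^ 4 - 8 / s ^ 2 + (1 - s * s) * (120 / s ^ 6 - 24 / s ^ 4))
     = P ^ 6 * (120 / s ^ 6 - 120 / s ^ 4 + 16 / s ^ 2)" if "s \<noteq> 0" for P s :: complex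
    using that by (simp add: field_simps eval_nat_numeral)
  have ds: "(?s has_field_derivative of_real pi * ?c w) (at w)" for w by (auto intro!: derivative_eq_intros)
  have dc: "(?c has_field_derivative - (of_real pi * ?s w)) (at w)" for w by (auto intro!: derivative_eq_intros)
  have 1: "prefl (Suc 0) w = of_real pi ^ 2 / ?s w ^ 2" if "w \<in> ?S" for w
  proof (rule prefl_step[OF o di _ _ that, of 0 "\<lambda>w. - (of_real pi * ?c w / ?s w)"])
    fix w assume w: "w \<in> ?S"
    show "prefl 0 w = - (of_real pi * ?c w / ?s w)" using prefl_0 w by auto
    have "((\<lambda>w. - (of_real pi * ?c w / ?s w)) has_field_derivative
        - ((of_real pi * (- (of_real pi * ?s w)) * ?s w - of_real pi * ?c w * (of_real pi * ?c w)) / (?s w * ?s w))) (at w)"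
      by (intro DERIV_minus DERIV_divide DERIV_cmult ds dc s0 w)
    also have "of_real pi * (- (of_real pi * ?s w)) * ?s w - of_real pi * ?c w * (of_real pi * ?c w) =
       - (of_real pi ^ 2) * (?s w * ?s w + ?c w * ?c w)" by (rule a1)
    also have "?s w * ?s w + ?c w * ?c w = 1" by (simp add: cs)
    finally show "((\<lambda>w. - (of_real pi * ?c w / ?s w)) has_field_derivative of_real pi ^ 2 / ?s w ^ 2) (at w)"
      by (simp add: power2_eq_square)
  qed
  have 2: "prefl (Suc (Suc 0)) w = - 2 * of_real pi ^ 3 * ?c w / ?s w ^ 3" if "w \<in> ?S" for w
  proof (rule prefl_step[OF o di 1 _ that])
    fix w assume w: "w \<in> ?S"
    have "((\<lambda>w. of_real pi ^ 2 / ?s w ^ 2) has_field_derivative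
       (0 * ?s w ^ 2 - of_real pi ^ 2 * (of_nat 2 * (of_real pi * ?c w * ?s w ^ (2 - Suc 0)))) / (?s w ^ 2 * ?s w ^ 2)) (at w)"
      by (intro DERIV_divide DERIV_power ds DERIV_const) (use s0[OF w] in simp)
    also have "(0 * ?s w ^ 2 - of_real pi ^ 2 * (of_nat 2 * (of_real pi * ?c w * ?s w ^ (2 - Suc 0)))) / (?s w ^ 2 * ?s w ^ 2)
      = - 2 * of_real pi ^ 3 * ?c w / ?s w ^ 3"
      by (rule a2[OF s0[OF w]])
    finally show "((\<lambda>w. of_real pi ^ 2 / ?s w ^ 2) has_field_derivative - 2 * of_real pi ^ 3 * ?c w / ?s w ^ 3) (at w)" .
  qed
  have 3: "prefl (Suc (Suc (Suc 0))) w = of_real pi ^ 4 * (6 / ?s w ^ 4 - 4 / ?s w ^ 2)" if "w \<in> ?S" for w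
  proof (rule prefl_step[OF o di 2 _ that])
    fix w assume w: "w \<in> ?S"
    have "((\<lambda>w. - 2 * of_real pi ^ 3 * ?c w / ?s w ^ 3) has_field_derivative
       (- 2 * of_real pi ^ 3 * (- (of_real pi * ?s w)) * ?s w ^ 3 -
         - 2 * of_real pi ^ 3 * ?c w * (of_nat 3 * (of_real pi * ?c w * ?s w ^ (3 - Suc 0)))) / (?s w ^ 3 * ?s w ^ 3)) (at w)"
      by (intro DERIV_divide DERIV_power DERIV_cmult ds dc) (use s0[OF w] in simp)
    also have "- 2 * of_real pi ^ 3 * (- (of_real pi * ?s w)) * ?s w ^ 3 -
         - 2 * of_real pi ^ 3 * ?c w * (of_nat 3 * (of_real pi * ?c w * ?s w ^ (3 - Suc 0)))
       = of_real pi ^ 4 * ?s w ^ 2 * (2 * (?s w * ?s w) + 6 * (?c w * ?c w))"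
      by (rule a3)
    also have "\<dots> / (?s w ^ 3 * ?s w ^ 3) = of_real pi ^ 4 * (6 / ?s w ^ 4 - 4 / ?s w ^ 2)"
      unfolding cs by (rule a3'[OF s0[OF w]])
    finally show "((\<lambda>w. - 2 * of_real pi ^ 3 * ?c w / ?s w ^ 3) has_field_derivative
       of_real pi ^ 4 * (6 / ?s w ^ 4 - 4 / ?s w ^ 2)) (at w)" .
  qed
  have 4: "prefl (Suc (Suc (Suc (Suc 0)))) w = of_real pi ^ 5 * (?c w * (8 / ?s w ^ 3 - 24 / ?s w ^ 5))" if "w \<in> ?S" for w
  proof (rule prefl_step[OF o di 3 _ that])
    fix w assume w: "w \<in> ?S"
    have "((\<lambda>w. of_real pi ^ 4 * (6 / ?s w ^ 4 - 4 / ?s w ^ 2)) has_field_derivative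
       of_real pi ^ 4 * ((0 * ?s w ^ 4 - 6 * (of_nat 4 * (of_real pi * ?c w * ?s w ^ (4 - Suc 0)))) / (?s w ^ 4 * ?s w ^ 4)
        - (0 * ?s w ^ 2 - 4 * (of_nat 2 * (of_real pi * ?c w * ?s w ^ (2 - Suc 0)))) / (?s w ^ 2 * ?s w ^ 2))) (at w)"
      by (intro DERIV_cmult DERIV_diff DERIV_divide DERIV_power ds DERIV_const) (use s0[OF w] in simp_all)
    also have "of_real pi ^ 4 * ((0 * ?s w ^ 4 - 6 * (of_nat 4 * (of_real pi * ?c w * ?s w ^ (4 - Suc 0)))) / (?s w ^ 4 * ?s w ^ 4)
        - (0 * ?s w ^ 2 - 4 * (of_nat 2 * (of_real pi * ?c w * ?s w ^ (2 - Suc 0)))) / (?s w ^ 2 * ?s w ^ 2))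
       = of_real pi ^ 5 * (?c w * (8 / ?s w ^ 3 - 24 / ?s w ^ 5))"
      by (rule a4[OF s0[OF w]])
    finally show "((\<lambda>w. of_real pi ^ 4 * (6 / ?s w ^ 4 - 4 / ?s w ^ 2)) has_field_derivative
       of_real pi ^ 5 * (?c w * (8 / ?s w ^ 3 - 24 / ?s w ^ 5))) (at w)" .
  qed
  have 5: "prefl (Suc (Suc (Suc (Suc (Suc 0))))) w = of_real pi ^ 6 * (120 / ?s w ^ 6 - 120 / ?s w ^ 4 + 16 / ?s w ^ 2)" if "w \<in> ?S" for w
  proof (rule prefl_step[OF o di 4 _ that])
    fix w assume w: "w \<in> ?S"
    have "((\<lambda>w. of_real pi ^ 5 * (?c w * (8 / ?s w ^ 3 - 24 / ?s w ^ 5))) has_field_derivative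
       of_real pi ^ 5 * (- (of_real pi * ?s w) * (8 / ?s w ^ 3 - 24 / ?s w ^ 5) +
       ((0 * ?s w ^ 3 - 8 * (of_nat 3 * (of_real pi * ?c w * ?s w ^ (3 - Suc 0)))) / (?s w ^ 3 * ?s w ^ 3)
        - (0 * ?s w ^ 5 - 24 * (of_nat 5 * (of_real pi * ?c w * ?s w ^ (5 - Suc 0)))) / (?s w ^ 5 * ?s w ^ 5)) * ?c w)) (at w)"
      by (intro DERIV_cmult DERIV_mult DERIV_diff DERIV_divide DERIV_power ds dc DERIV_const) (use s0[OF w] in simp_all)
    also have "of_real pi ^ 5 * (- (of_real pi * ?s w) * (8 / ?s w ^ 3 - 24 / ?s w ^ 5) +
       ((0 * ?s w ^ 3 - 8 * (of_nat 3 * (of_real pi * ?c w * ?s w ^ (3 - Suc 0)))) / (?s w ^ 3 * ?s w ^ 3)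
        - (0 * ?s w ^ 5 - 24 * (of_nat 5 * (of_real pi * ?c w * ?s w ^ (5 - Suc 0)))) / (?s w ^ 5 * ?s w ^ 5)) * ?c w)
      = of_real pi ^ 6 * (24 / ?s w ^ 4 - 8 / ?s w ^ 2 + (?c w * ?c w) * (120 / ?s w ^ 6 - 24 / ?s w ^ 4))"
      by (rule a5[OF s0[OF w]])
    also have "\<dots> = of_real pi ^ 6 * (120 / ?s w ^ 6 - 120 / ?s w ^ 4 + 16 / ?s w ^ 2)"
      unfolding cs by (rule a5'[OF s0[OF w]])
    finally show "((\<lambda>w. of_real pi ^ 5 * (?c w * (8 / ?s w ^ 3 - 24 / ?s w ^ 5))) has_field_derivative
       of_real pi ^ 6 * (120 / ?s w ^ 6 - 120 / ?s w ^ 4 + 16 / ?s w ^ 2)) (at w)" .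
  qed
  show "prefl 1 w = of_real pi ^ 2 / s ^ 2" using 1[of w] w by (simp add: s_def)
  show "prefl 3 w = of_real pi ^ 4 * (6 / s ^ 4 - 4 / s ^ 2)" using 3[of w] w by (simp add: s_def numeral_3_eq_3)
  show "prefl 5 w = of_real pi ^ 6 * (120 / s ^ 6 - 120 / s ^ 4 + 16 / s ^ 2)"
  proof -
    have "(5::nat) = Suc (Suc (Suc (Suc (Suc 0))))" by simp
    then show ?thesis using 5[of w] w by (simp only: s_def Compl_iff not_False_eq_True simp_thms)
  qed
qed

section \<open>Polylogarithms and the Lipschitz formula\<close>

lemma power_series_summable:
  fixes x :: "'a :: {real_normed_field, banach}"
  assumes "norm x < 1" shows "summable (\<lambda>n. of_nat n ^ j * x ^ n)"
  using assms
proof (induction j arbitrary: x)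
  case 0 then show ?case by (simp add: summable_geometric)
next
  case (Suc j)
  have "summable (\<lambda>n. diffs (\<lambda>n. of_nat n ^ j) n * x ^ n)"
    by (rule termdiff_converges[of _ 1]) (use Suc in auto)
  then have "summable (\<lambda>n. x * (diffs (\<lambda>n. of_nat n ^ j) n * x ^ n))" by (rule summable_mult)
  then have "summable (\<lambda>n. of_nat (Suc n) ^ Suc j * x ^ Suc n)"
    by (simp add: diffs_def mult_ac del: of_nat_Suc)
  then show ?case by (subst summable_Suc_iff[symmetric])
qed

lemma power_series_norm_summable:
  fixes x :: complex
  assumes "norm x < 1" shows "summable (\<lambda>n. norm (of_nat n ^ j * x ^ n))"
  using power_series_summable[of "norm x" j] assms by (simp add: norm_mult norm_power)

definition pser :: "nat \<Rightarrow> complex \<Rightarrow> complex" where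
  "pser j x = (\<Sum>n. of_nat n ^ j * x ^ n)"

text \<open>The operator x d/dx raises j by one. The factor x stays on the left, so that x = 0 is no
  exception.\<close>

lemma pser_deriv:
  assumes "norm x < 1"
  shows "\<exists>d. (pser j has_field_derivative d) (at x) \<and> x * d = pser (Suc j) x"
proof (intro exI conjI)
  show "(pser j has_field_derivative (\<Sum>n. diffs (\<lambda>n. of_nat n ^ j) n * x ^ n)) (at x)"
    unfolding pser_def[abs_def]
    by (rule termdiffs_strong'[of 1]) (use assms power_series_summable in auto)
  have sm: "summable (\<lambda>n. diffs (\<lambda>n. of_nat n ^ j) n * x ^ n)"
    by (rule termdiff_converges[of _ 1]) (use assms power_series_summable in auto)
  have "x * (\<Sum>n. diffs (\<lambda>n. of_nat n ^ j) n * x ^ n) = (\<Sum>n. x * (diffs (\<lambda>n. of_nat n ^ j) n * x ^ n))"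
    by (rule suminf_mult[OF sm, symmetric])
  also have "\<dots> = (\<Sum>n. of_nat (Suc n) ^ Suc j * x ^ Suc n)"
    by (simp add: diffs_def mult_ac del: of_nat_Suc)
  also have "\<dots> = pser (Suc j) x"
    using suminf_split_head[OF power_series_summable[OF assms, of "Suc j"]] unfolding pser_def by simp
  finally show "x * (\<Sum>n. diffs (\<lambda>n. of_nat n ^ j) n * x ^ n) = pser (Suc j) x" .
qed

lemma qe_deriv: "(qe has_field_derivative 2 * of_real pi * \<i> * qe z) (at z)"
  by (auto intro!: derivative_eq_intros)

lemma pser_qe_deriv:
  assumes "z \<in> uhp"
  shows "((\<lambda>z. pser j (qe z)) has_field_derivative 2 * of_real pi * \<i> * pser (Suc j) (qe z)) (at z)"
proof -
  obtain d where d: "(pser j has_field_derivative d) (at (qe z))" "qe z * d = pser (Suc j) (qe z)"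
    using pser_deriv[OF norm_qe_less_1[OF assms]] by blast
  have "((\<lambda>z. pser j (qe z)) has_field_derivative d * (2 * of_real pi * \<i> * qe z)) (at z)"
    by (rule DERIV_chain2[where f = "pser j" and g = qe, OF d(1) qe_deriv])
  then show ?thesis unfolding d(2)[symmetric] by (simp only: mult_ac)
qed

lemma uhp_not_Ints: "uhp \<inter> \<int> = {}"
  by (auto simp: uhp_iff elim!: Ints_cases)

lemma pser_1:
  assumes "norm x < 1" shows "pser 1 x = x / (1 - x) ^ 2"
proof -
  have "(\<lambda>n. x * (of_nat (Suc n) * x ^ n)) sums (x * (1 / (1 - x)\<^sup>2))"
    by (rule sums_mult[OF geometric_deriv_sums[OF assms]])
  then have "(\<lambda>n. of_nat (Suc n) ^ 1 * x ^ Suc n) sums (x / (1 - x) ^ 2)"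
    by (simp add: mult_ac del: of_nat_Suc)
  then have "(\<lambda>n. of_nat n ^ 1 * x ^ n) sums (x / (1 - x) ^ 2)"
    by (subst (asm) sums_Suc_iff) simp
  then show ?thesis unfolding pser_def by (rule sums_unique[symmetric])
qed

text \<open>In the base case the inverse square of the sine, written in q = u^2, is a multiple of q
  / (1 - q)^2. Every further derivative in w contributes 2 pi i and the operator q d/dq.\<close>

lemma prefl_qser:
  assumes "w \<in> uhp"
  shows "prefl (Suc n) w = (2 * of_real pi * \<i>) ^ (n + 2) * pser (Suc n) (qe w)"
  using assms
proof (induction n arbitrary: w)
  case 0
  have wi: "w \<notin> \<int>" using uhp_not_Ints 0 by blast
  define u where "u = exp (\<i> * (of_real pi * w))"
  have u0: "u \<noteq> 0" by (simp add: u_def)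
  have uu: "u * u = qe w" unfolding u_def exp_add[symmetric] by (simp add: mult_ac)
  have q1: "qe w \<noteq> 1" using norm_qe_less_1[OF 0] by (metis norm_one less_irrefl)
  have s: "sin (of_real pi * w) = (u - inverse u) / (2 * \<i>)"
    unfolding u_def by (simp add: sin_exp_eq exp_minus)
  have "(u - inverse u) ^ 2 = (u * u - 1) ^ 2 / (u * u)" using u0 by (simp add: field_simps power2_eq_square)
  then have "sin (of_real pi * w) ^ 2 = - ((qe w - 1) ^ 2 / qe w) / 4"
    unfolding s power_divide uu by (simp add: power_mult_distrib)
  then have "of_real pi ^ 2 / sin (of_real pi * w) ^ 2 = of_real pi ^ 2 / (- ((qe w - 1) ^ 2 / qe w) / 4)" by simp
  also have "\<dots> = (2 * of_real pi * \<i>) ^ 2 * (qe w / (1 - qe w) ^ 2)"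
  proof -
    have "P / (- ((x - 1) ^ 2 / x) / 4) = - 4 * P * (x / (1 - x) ^ 2)" if "x \<noteq> 0" "x \<noteq> 1" for P x :: complex
    proof -
      have "(x - 1) ^ 2 = (1 - x) ^ 2" by (rule power2_commute)
      then show ?thesis by simp
    qed
    from this[OF _ q1] show ?thesis by (simp add: power_mult_distrib)
  qed
  also have "qe w / (1 - qe w) ^ 2 = pser (Suc 0) (qe w)" using pser_1[OF norm_qe_less_1[OF 0]] by simp
  finally show ?case using prefl_trig(1)[OF wi] by (simp only: One_nat_def add_0)
next
  case (Suc n)
  show ?case
  proof (rule prefl_step[OF open_uhp uhp_not_Ints Suc.IH _ Suc.prems])
    fix w assume w: "w \<in> uhp"
    have "((\<lambda>w. (2 * of_real pi * \<i>) ^ (n + 2) * pser (Suc n) (qe w)) has_field_derivative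
      (2 * of_real pi * \<i>) ^ (n + 2) * (2 * of_real pi * \<i> * pser (Suc (Suc n)) (qe w))) (at w)"
      by (rule DERIV_cmult[OF pser_qe_deriv[OF w]])
    then show "((\<lambda>w. (2 * of_real pi * \<i>) ^ (n + 2) * pser (Suc n) (qe w)) has_field_derivative
      (2 * of_real pi * \<i>) ^ (Suc n + 2) * pser (Suc (Suc n)) (qe w)) (at w)"
      by (simp only: add_Suc power_Suc2 mult.assoc)
  qed
qed

lemma norm_row_ge: "norm (of_int m + w) \<ge> \<bar>Im w\<bar>"
  using abs_Im_le_cmod[of "of_int m + w"] by simp

lemma row_sum_qser:
  assumes "w \<in> uhp" "k \<ge> 2" "even k"
  shows "row_sum k w = (2 * of_real pi * \<i>) ^ k / fact (k - 1) * pser (k - 1) (qe w)"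
proof -
  have "row_sum k w = (Polygamma (k - 1) w + Polygamma (k - 1) (1 - w)) / fact (k - 1)"
    by (rule row_sum_Polygamma[of "Im w"]) (use assms norm_row_ge[of w] in \<open>auto simp: uhp_iff\<close>)
  moreover obtain n where n: "k = Suc (Suc n)" using le_Suc_ex[OF assms(2)] by auto
  ultimately have "row_sum k w = prefl (Suc n) w / fact (k - 1)" using assms(3) by (simp add: prefl_def)
  then show ?thesis unfolding prefl_qser[OF assms(1)] by (simp add: n)
qed

lemma row_sum_uminus: "even k \<Longrightarrow> row_sum k (- w) = row_sum k w"
proof -
  assume k: "even k"
  have "row_sum k w = (\<Sum>\<^sub>\<infinity>m::int. 1 / (of_int (- m) + w) ^ k)"
    unfolding row_sum_def
    by (rule infsum_reindex_bij_betw[symmetric]) (rule bij_uminus[where 'a = int, unfolded bij_betw_def[symmetric]])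
  also have "\<dots> = row_sum k (- w)"
    unfolding row_sum_def
  proof (rule infsum_cong)
    fix m :: int
    have "of_int (- m) + w = - (of_int m + - w)" by simp
    then show "1 / (of_int (- m) + w) ^ k = 1 / (of_int m + - w) ^ k" using k by (simp only: power_minus_even)
  qed
  finally show ?thesis by simp
qed

section \<open>The zeta values at 2, 4 and 6, with both signs of the summation index\<close>

definition zl :: "nat \<Rightarrow> complex" where "zl k = (\<Sum>\<^sub>\<infinity>m\<in>UNIV - {0::int}. 1 / of_int m ^ k)"

text \<open>Split the nonzero integers by parity. The even ones reproduce the series with a factor
  2^-k, the odd ones give a row sum at 1/2, where the reflection formula is explicit.\<close>

lemma zl_half:
  assumes "k \<ge> 2" shows "zl k * (2 ^ k - 1) = row_sum k (1/2)"
proof -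
  let ?f = "\<lambda>m::int. 1 / (of_int m :: complex) ^ k"
  let ?E = "(\<lambda>m. 2 * m) ` (UNIV - {0::int})" and ?O = "range (\<lambda>m::int. 2 * m + 1)"
  have sm: "?f summable_on A" if "0 \<notin> A" for A
  proof (rule abs_summable_summable)
    have "(\<lambda>m::int. norm (1 / (of_int m + (0::complex)) ^ k)) summable_on A"
    proof (rule row_summable[of 1])
      fix m assume "m \<in> A"
      then have "m \<noteq> 0" using that by blast
      then have "\<bar>m\<bar> \<ge> 1" by linarith
      then show "1 \<le> norm (of_int m + (0::complex))" by simp
    qed (use assms in auto)
    then show "(\<lambda>x. norm (1 / complex_of_int x ^ k)) summable_on A" by simp
  qed
  have un: "UNIV - {0::int} = ?E \<union> ?O"
  proof (intro equalityI subsetI)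
    fix x :: int assume "x \<in> UNIV - {0}"
    show "x \<in> ?E \<union> ?O"
    proof (cases "even x")
      case True
      then obtain y where "x = 2 * y" by blast
      then show ?thesis using \<open>x \<in> UNIV - {0}\<close> by auto
    next
      case False
      then obtain y where "x = 2 * y + 1" by (rule oddE)
      then show ?thesis by blast
    qed
  next
    fix x :: int assume "x \<in> ?E \<union> ?O"
    moreover have "2 * m + 1 \<noteq> 0" for m :: int by presburger
    ultimately show "x \<in> UNIV - {0}" by auto
  qed
  have "zl k = infsum ?f ?E + infsum ?f ?O"
  proof -
    have odd: "2 * m + 1 \<noteq> 0" "2 * m + 1 \<noteq> 2 * n" for m n :: int by presburger+
    have d: "0 \<notin> ?E" "0 \<notin> ?O" using odd by auto
    have "?E \<inter> ?O = {}"
    proof (rule ccontr)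
      assume "?E \<inter> ?O \<noteq> {}"
      then obtain x where x: "x \<in> ?E" "x \<in> ?O" by blast
      from x(1) obtain m where m: "x = 2 * m" by auto
      from x(2) obtain n where n: "x = 2 * n + 1" by auto
      show False using odd(2)[of n m] m n by simp
    qed
    from infsum_Un_disjoint[OF sm[OF d(1)] sm[OF d(2)] this] show ?thesis
      unfolding zl_def arg_cong[OF un, of "infsum ?f"] .
  qed
  also have "infsum ?f ?E = 1 / 2 ^ k * zl k"
  proof -
    have "infsum ?f ?E = infsum (?f \<circ> (\<lambda>m. 2 * m)) (UNIV - {0})" by (rule infsum_reindex) (simp add: inj_on_def)
    also have "\<dots> = infsum (\<lambda>m. 1 / 2 ^ k * ?f m) (UNIV - {0})"
      by (rule infsum_cong) (simp add: power_mult_distrib)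
    also have "\<dots> = 1 / 2 ^ k * zl k" unfolding zl_def by (rule infsum_cmult_right')
    finally show ?thesis .
  qed
  also have "infsum ?f ?O = 1 / 2 ^ k * row_sum k (1/2)"
  proof -
    have "infsum ?f ?O = infsum (?f \<circ> (\<lambda>m. 2 * m + 1)) UNIV" by (rule infsum_reindex) (simp add: inj_on_def)
    also have "\<dots> = infsum (\<lambda>m. 1 / 2 ^ k * (1 / (of_int m + 1/2) ^ k)) UNIV"
    proof (rule infsum_cong)
      fix m :: int
      have "(of_int (2 * m + 1) :: complex) = 2 * (of_int m + 1/2)" by simp
      then show "(?f \<circ> (\<lambda>m. 2 * m + 1)) m = 1 / 2 ^ k * (1 / (of_int m + 1/2) ^ k)"
        unfolding o_def by (simp only: power_mult_distrib) simp
    qed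
    also have "\<dots> = 1 / 2 ^ k * row_sum k (1/2)" unfolding row_sum_def by (rule infsum_cmult_right')
    finally show ?thesis .
  qed
  finally have "2 ^ k * zl k = 2 ^ k * (1 / 2 ^ k * zl k + 1 / 2 ^ k * row_sum k (1/2))" by simp
  also have "\<dots> = zl k + row_sum k (1/2)" by (simp add: ring_distribs)
  finally show ?thesis by (simp add: algebra_simps)
qed

lemma half_not_Ints: "(1/2 :: complex) \<notin> \<int>"
proof
  assume "(1/2 :: complex) \<in> \<int>"
  then obtain n where "(1/2 :: complex) = of_int n" by (elim Ints_cases)
  then have "(2 :: complex) * (1 / 2) = 2 * of_int n" by (simp only:)
  then have "(1 :: complex) = of_int (2 * n)" by simp
  then have "1 = 2 * n" by (metis of_int_1 of_int_eq_iff)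
  then show False by presburger
qed

lemma row_sum_half:
  assumes "k \<ge> 2" "even k" shows "row_sum k (1/2) = prefl (k - 1) (1/2) / fact (k - 1)"
proof -
  have "row_sum k (1/2) = (Polygamma (k - 1) (1/2) + Polygamma (k - 1) (1 - 1/2)) / fact (k - 1)"
  proof (rule row_sum_Polygamma[of "1/2"])
    fix m :: int
    have "\<bar>2 * m + 1\<bar> \<ge> 1" by presburger
    then have "\<bar>2 * real_of_int m + 1\<bar> \<ge> 1" by linarith
    then have "\<bar>real_of_int m + 1/2\<bar> \<ge> 1/2" by linarith
    moreover have "norm (of_int m + 1/2 :: complex) = \<bar>real_of_int m + 1/2\<bar>"
      using norm_of_real[of "real_of_int m + 1/2", where 'a = complex] by simp
    ultimately show "norm (of_int m + 1/2 :: complex) \<ge> 1/2" by simp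
  qed (use assms in auto)
  moreover obtain n where n: "k = Suc (Suc n)" using le_Suc_ex[OF assms(1)] by auto
  ultimately show ?thesis using assms(2) by (simp add: prefl_def)
qed

lemma zl_values: "zl 2 = of_real pi ^ 2 / 3" "zl 4 = of_real pi ^ 4 / 45" "zl 6 = 2 * of_real pi ^ 6 / 945"
proof -
  have s: "sin (of_real pi * (1/2 :: complex)) = 1"
    using sin_of_real[of "pi / 2", where 'a = complex] by (simp del: sin_of_real)
  have p: "prefl 1 (1/2) = of_real pi ^ 2" "prefl 3 (1/2) = 2 * of_real pi ^ 4" "prefl 5 (1/2) = 16 * of_real pi ^ 6"
    using prefl_trig[OF half_not_Ints] unfolding s by simp_all
  have r: "row_sum 2 (1/2) = of_real pi ^ 2" "row_sum 4 (1/2) = of_real pi ^ 4 / 3" "row_sum 6 (1/2) = 2 * of_real pi ^ 6 / 15"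
    using row_sum_half[of 2] row_sum_half[of 4] row_sum_half[of 6] p by (simp_all add: fact_numeral)
  show "zl 2 = of_real pi ^ 2 / 3" "zl 4 = of_real pi ^ 4 / 45" "zl 6 = 2 * of_real pi ^ 6 / 945"
    using zl_half[of 2] zl_half[of 4] zl_half[of 6] unfolding r by (simp_all add: field_simps)
qed

text \<open>Summing over the infinite set of divisors of 0 gives \<open>sig j 0 = 0\<close>.\<close>

definition sig :: "nat \<Rightarrow> nat \<Rightarrow> nat" where "sig j N = (\<Sum>d | d dvd N. d ^ j)"

lemma sig_0 [simp]: "sig j 0 = 0" by (simp add: sig_def)

section \<open>Divisor sums, Lambert series and the q-expansion of Eisenstein series\<close>

definition qsig :: "nat \<Rightarrow> complex \<Rightarrow> complex" where "qsig j q = (\<Sum>N. of_nat (sig j N) * q ^ N)"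

lemma sig_le: "sig j N \<le> N ^ Suc j"
proof (cases "N = 0")
  case False
  have "sig j N \<le> (\<Sum>d | d dvd N. N ^ j)" unfolding sig_def
    by (rule sum_mono, rule power_mono) (use False in \<open>auto intro: dvd_imp_le\<close>)
  also have "\<dots> = card {d. d dvd N} * N ^ j" by simp
  also have "card {d. d dvd N} \<le> card {1..N}"
    by (rule card_mono) (use False in \<open>auto dest: dvd_imp_le intro!: Suc_leI Nat.gr0I\<close>)
  finally show ?thesis by simp
qed simp

lemma qsig_norm_summable:
  fixes q :: complex
  assumes "norm q < 1" shows "summable (\<lambda>N. norm (of_nat (sig j N) * q ^ N))"
proof (rule summable_comparison_test)
  show "summable (\<lambda>n. norm (of_nat n ^ Suc j * q ^ n))" by (rule power_series_norm_summable[OF assms])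
  have "real (sig j n) \<le> real n ^ Suc j" for n using sig_le[of j n] by (metis of_nat_le_iff of_nat_power)
  then show "\<exists>N. \<forall>n\<ge>N. norm (norm (of_nat (sig j n) * q ^ n)) \<le> norm (of_nat n ^ Suc j * q ^ n)"
    by (intro exI[of _ 0]) (auto simp: norm_mult norm_power intro!: mult_right_mono simp del: power_Suc)
qed

text \<open>Expand each polylogarithm and regroup the pairs (n, d) by their product N = n d; the
  given d then runs over the divisors of N.\<close>

lemma lambert:
  fixes q :: complex
  assumes q: "norm q < 1" and j: "j \<ge> 1"
  shows "(\<Sum>\<^sub>\<infinity>n\<in>{1..}. pser j (q ^ n)) = qsig j q"
    and "(\<lambda>n. norm (pser j (q ^ n))) summable_on {1..}"
proof -
  let ?f = "\<lambda>(n, d). of_nat d ^ j * q ^ (n * d) :: complex"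
  let ?g = "\<lambda>(N, d). of_nat d ^ j * q ^ N :: complex"
  let ?A = "{1::nat..} \<times> {1::nat..}" and ?B = "Sigma {1::nat..} (\<lambda>N. {d. d dvd N})"
  define r where "r = norm q"
  have r: "0 \<le> r" "r < 1" using q by (auto simp: r_def)
  have nf: "(\<lambda>x. norm (?f x)) summable_on ?A"
  proof (rule summable_on_comparison_test)
    have "summable (\<lambda>n. norm (r ^ (n - 1)))"
      by (subst summable_Suc_iff[symmetric]) (use r in \<open>simp add: summable_geometric\<close>)
    then have a: "(\<lambda>n. r ^ (n - 1)) summable_on {1..}"
      by (intro summable_on_subset_banach[OF norm_summable_imp_summable_on]) auto
    have "summable (\<lambda>d. norm (real d ^ j * r ^ d))"
      using power_series_norm_summable[of "of_real r" j] r by (simp add: norm_mult norm_power)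
    then have b: "(\<lambda>d. real d ^ j * r ^ d) summable_on {1..}"
      by (intro summable_on_subset_banach[OF norm_summable_imp_summable_on]) auto
    show "(\<lambda>(n, d). r ^ (n - 1) * (real d ^ j * r ^ d)) summable_on ?A"
      by (rule summable_on_product_real[OF a b]) (use r in auto)
    fix x assume x: "x \<in> ?A"
    obtain n d where nd: "x = (n, d)" "n \<ge> 1" "d \<ge> 1" using x by (cases x) auto
    \<comment> \<open>This inequality bounds the double series by a product of two single
      ones.\<close>
    have "n - 1 + d \<le> n * d"
    proof -
      obtain a b where "n = Suc a" "d = Suc b" using nd(2,3) by (cases n; cases d) auto
      then show ?thesis by simp
    qed
    then have "r ^ (n * d) \<le> r ^ (n - 1 + d)" using r by (intro power_decreasing) auto
    then have "real d ^ j * r ^ (n * d) \<le> real d ^ j * r ^ (n - 1 + d)" by (intro mult_left_mono) auto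
    then show "norm (?f x) \<le> (\<lambda>(n, d). r ^ (n - 1) * (real d ^ j * r ^ d)) x"
      by (simp add: nd norm_mult norm_power r_def power_add mult_ac)
  qed auto
  then have f: "?f summable_on ?A" by (rule abs_summable_summable)
  have nf': "(\<lambda>(n, d). norm (?f (n, d))) summable_on ?A" using nf by (simp add: case_prod_unfold)
  have inner: "(\<Sum>\<^sub>\<infinity>d\<in>{1..}. ?f (n, d)) = pser j (q ^ n)" if "n \<in> {1..}" for n
  proof -
    have qn: "norm (q ^ n) < 1" using q that by (simp add: norm_power power_less_one_iff)
    \<comment> \<open>The additional term d = 0 vanishes because j >= 1.\<close>
    have "(\<Sum>\<^sub>\<infinity>d\<in>{1..}. ?f (n, d)) = (\<Sum>\<^sub>\<infinity>d\<in>UNIV. of_nat d ^ j * (q ^ n) ^ d)"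
      by (rule infsum_cong_neutral) (use j in \<open>auto simp: power_mult\<close>)
    also have "\<dots> = pser j (q ^ n)" unfolding pser_def
      by (rule infsum_nat_suminf[OF norm_summable_imp_summable_on[OF power_series_norm_summable[OF qn]]])
    finally show ?thesis .
  qed
  show "(\<lambda>n. norm (pser j (q ^ n))) summable_on {1..}"
  proof (rule summable_on_comparison_test)
    show "(\<lambda>n. \<Sum>\<^sub>\<infinity>d\<in>{1..}. norm (?f (n, d))) summable_on {1..}"
      by (rule summable_on_Sigma_banach[OF nf'])
    fix n :: nat assume n: "n \<in> {1..}"
    have "(\<lambda>d. norm (?f (n, d))) summable_on {1..}" by (rule summable_on_SigmaD1[OF nf' n])
    then show "norm (pser j (q ^ n)) \<le> (\<Sum>\<^sub>\<infinity>d\<in>{1..}. norm (?f (n, d)))"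
      unfolding inner[OF n, symmetric] by (rule norm_infsum_bound)
  qed auto
  have bij: "bij_betw (\<lambda>(n, d). (n * d, d)) ?A ?B"
  proof (rule bij_betwI[where g = "\<lambda>(N, d). (N div d, d)"])
    show "(\<lambda>(n, d). (n * d, d)) \<in> ?A \<rightarrow> ?B" by auto
    show "(\<lambda>(N, d). (N div d, d)) \<in> ?B \<rightarrow> ?A"
      by (auto simp: Suc_le_eq dvd_div_eq_0_iff intro!: Nat.gr0I)
    show "(\<lambda>(N, d). (N div d, d)) ((\<lambda>(n, d). (n * d, d)) x) = x" if "x \<in> ?A" for x using that by (cases x) auto
    show "(\<lambda>(n, d). (n * d, d)) ((\<lambda>(N, d). (N div d, d)) x) = x" if "x \<in> ?B" for x using that by (cases x) auto
  qed
  have fg: "?f x = ?g ((\<lambda>(n, d). (n * d, d)) x)" for x by (cases x) simp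
  have g: "?g summable_on ?B"
    using f unfolding fg[abs_def] by (subst (asm) summable_on_reindex_bij_betw[OF bij])
  have "(\<Sum>\<^sub>\<infinity>n\<in>{1..}. pser j (q ^ n)) = (\<Sum>\<^sub>\<infinity>n\<in>{1..}. \<Sum>\<^sub>\<infinity>d\<in>{1..}. ?f (n, d))"
    using inner by (intro infsum_cong) simp
  also have "\<dots> = infsum ?f ?A" by (rule infsum_Sigma_banach[OF f])
  also have "\<dots> = infsum ?g ?B" unfolding fg[abs_def] by (rule infsum_reindex_bij_betw[OF bij])
  also have "\<dots> = (\<Sum>\<^sub>\<infinity>N\<in>{1..}. \<Sum>\<^sub>\<infinity>d\<in>{d. d dvd N}. ?g (N, d))" by (rule infsum_Sigma_banach[OF g, symmetric])
  also have "\<dots> = (\<Sum>\<^sub>\<infinity>N\<in>UNIV. of_nat (sig j N) * q ^ N)"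
  proof (rule infsum_cong_neutral)
    show "of_nat (sig j N) * q ^ N = 0" if "N \<in> UNIV - {1..}" for N using that by (cases N) auto
    show "(\<Sum>\<^sub>\<infinity>d\<in>{d. d dvd N}. ?g (N, d)) = of_nat (sig j N) * q ^ N" if "N \<in> {1..} \<inter> UNIV" for N
      using that by (simp add: sig_def sum_distrib_right)
  qed simp
  also have "\<dots> = qsig j q" unfolding qsig_def
    by (rule infsum_nat_suminf[OF norm_summable_imp_summable_on[OF qsig_norm_summable[OF q]]])
  finally show "(\<Sum>\<^sub>\<infinity>n\<in>{1..}. pser j (q ^ n)) = qsig j q" .
qed

lemma infsum_nonzero_int:
  fixes f :: "int \<Rightarrow> complex"
  assumes "\<And>n. f (- n) = f n" "(\<lambda>n::nat. f (int n)) summable_on {1..}"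
  shows "(\<Sum>\<^sub>\<infinity>n\<in>UNIV - {0}. f n) = 2 * (\<Sum>\<^sub>\<infinity>n\<in>{1..}. f (int n))" and "f summable_on UNIV - {0}"
proof -
  have un: "UNIV - {0::int} = int ` {1..} \<union> (\<lambda>n. - int n) ` {1..}"
  proof (intro equalityI subsetI)
    fix x :: int assume "x \<in> UNIV - {0}"
    then show "x \<in> int ` {1..} \<union> (\<lambda>n. - int n) ` {1..}"
      using image_eqI[of x int "nat x" "{1..}"] image_eqI[of x "\<lambda>n. - int n" "nat (- x)" "{1..}"]
      by (cases "x > 0") auto
  qed auto
  have inj: "inj_on (\<lambda>n. - int n) {1..}" by (simp add: inj_on_def)
  have s1: "f summable_on int ` {1..}" using assms(2) by (subst summable_on_reindex) (auto simp: o_def)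
  have s2: "f summable_on (\<lambda>n. - int n) ` {1..}" using assms by (subst summable_on_reindex[OF inj]) (auto simp: o_def)
  have "infsum f (UNIV - {0}) = infsum f (int ` {1..}) + infsum f ((\<lambda>n. - int n) ` {1..})"
    unfolding un by (rule infsum_Un_disjoint[OF s1 s2]) auto
  also have "infsum f (int ` {1..}) = (\<Sum>\<^sub>\<infinity>n\<in>{1..}. f (int n))" by (subst infsum_reindex) (auto simp: o_def)
  also have "infsum f ((\<lambda>n. - int n) ` {1..}) = (\<Sum>\<^sub>\<infinity>n\<in>{1..}. f (int n))"
    by (subst infsum_reindex[OF inj]) (auto simp: o_def assms)
  finally show "(\<Sum>\<^sub>\<infinity>n\<in>UNIV - {0}. f n) = 2 * (\<Sum>\<^sub>\<infinity>n\<in>{1..}. f (int n))" by simp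
  show "f summable_on UNIV - {0}" unfolding un by (rule summable_on_Un_disjoint[OF s1 s2]) auto
qed

lemma row_sums_qser:
  assumes z: "z \<in> uhp" and k: "k \<ge> 2" "even k"
  shows "(\<Sum>\<^sub>\<infinity>n\<in>UNIV - {0}. row_sum k (of_int n * z)) =
      2 * ((2 * of_real pi * \<i>) ^ k / fact (k - 1)) * qsig (k - 1) (qe z)"
    and "(\<lambda>n. row_sum k (of_int n * z)) summable_on UNIV - {0}"
proof -
  let ?C = "(2 * of_real pi * \<i>) ^ k / fact (k - 1) :: complex"
  have q: "norm (qe z) < 1" by (rule norm_qe_less_1[OF z])
  have e: "row_sum k (of_int (int n) * z) = ?C * pser (k - 1) (qe z ^ n)" if "n \<in> {1..}" for n
    using row_sum_qser[OF scale_uhp[OF z, of n] k] that by (simp add: qe_of_nat)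
  have sm: "(\<lambda>n. ?C * pser (k - 1) (qe z ^ n)) summable_on {1..}"
    by (rule summable_on_cmult_right, rule abs_summable_summable, rule lambert(2)[OF q]) (use k in auto)
  have sm': "(\<lambda>n. row_sum k (of_int (int n) * z)) summable_on {1..}"
    using sm by (rule summable_on_cong[THEN iffD2, rotated]) (rule e)
  have ev: "row_sum k (of_int (- n) * z) = row_sum k (of_int n * z)" for n
    using row_sum_uminus[OF k(2), of "of_int n * z"] by simp
  have "(\<Sum>\<^sub>\<infinity>n\<in>UNIV - {0}. row_sum k (of_int n * z)) = 2 * (\<Sum>\<^sub>\<infinity>n\<in>{1..}. row_sum k (of_int (int n) * z))"
    by (rule infsum_nonzero_int(1)[OF ev sm'])
  also have "(\<Sum>\<^sub>\<infinity>n\<in>{1..}. row_sum k (of_int (int n) * z)) = (\<Sum>\<^sub>\<infinity>n\<in>{1..}. ?C * pser (k - 1) (qe z ^ n))"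
    by (rule infsum_cong) (rule e)
  also have "\<dots> = ?C * qsig (k - 1) (qe z)"
    unfolding infsum_cmult_right' using lambert(1)[OF q, of "k - 1"] k by simp
  finally show "(\<Sum>\<^sub>\<infinity>n\<in>UNIV - {0}. row_sum k (of_int n * z)) = 2 * ?C * qsig (k - 1) (qe z)" by simp
  show "(\<lambda>n. row_sum k (of_int n * z)) summable_on UNIV - {0}" by (rule infsum_nonzero_int(2)[OF ev sm'])
qed

text \<open>The row n = 0 is the zeta value, the remaining rows have closed form. Absolute
  convergence for k >= 3 allows summation row by row; weight 2 needs the separate treatment further
  below.\<close>

lemma eisenstein_qser:
  assumes z: "z \<in> uhp" and k: "k \<ge> 3" "even k"
  shows "eisenstein_G k z = zl k + 2 * ((2 * of_real pi * \<i>) ^ k / fact (k - 1)) * qsig (k - 1) (qe z)"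
proof -
  let ?f = "\<lambda>(m, n). 1 / (of_int m + of_int n * z) ^ k"
  let ?A = "(\<lambda>m. (m, 0::int)) ` (UNIV - {0::int})" and ?B = "(\<lambda>(n, m). (m, n)) ` ((UNIV - {0::int}) \<times> (UNIV :: int set))"
  have sm: "?f summable_on (UNIV - {(0, 0)})" by (rule abs_summable_summable[OF eisenstein_summable[OF z k(1)]])
  have un: "UNIV - {(0, 0)} = ?A \<union> ?B" by (auto simp: image_iff)
  have smA: "?f summable_on ?A" and smB: "?f summable_on ?B"
    by (rule summable_on_subset_banach[OF sm]; auto)+
  have inj: "inj_on (\<lambda>(n, m). (m, n)) ((UNIV - {0::int}) \<times> (UNIV :: int set))" by (auto simp: inj_on_def)
  have "eisenstein_G k z = infsum ?f ?A + infsum ?f ?B"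
    unfolding eisenstein_G_def un by (rule infsum_Un_disjoint[OF smA smB]) auto
  also have "infsum ?f ?A = zl k"
    unfolding zl_def by (subst infsum_reindex) (auto simp: inj_on_def o_def)
  also have "infsum ?f ?B = infsum (?f \<circ> (\<lambda>(n, m). (m, n))) ((UNIV - {0::int}) \<times> (UNIV :: int set))"
    by (rule infsum_reindex[OF inj])
  also have "?f \<circ> (\<lambda>(n, m). (m, n)) = (\<lambda>(n, m). 1 / (of_int m + of_int n * z) ^ k)" by (auto simp: o_def)
  also have "infsum (\<lambda>(n, m). 1 / (of_int m + of_int n * z) ^ k) ((UNIV - {0::int}) \<times> (UNIV :: int set)) =
     (\<Sum>\<^sub>\<infinity>n\<in>UNIV - {0}. \<Sum>\<^sub>\<infinity>m. case (n, m) of (n, m) \<Rightarrow> 1 / (of_int m + of_int n * z) ^ k)"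
    by (rule infsum_Sigma_banach[symmetric])
       (use smB in \<open>subst (asm) summable_on_reindex[OF inj], simp add: o_def case_prod_unfold\<close>)
  also have "\<dots> = (\<Sum>\<^sub>\<infinity>n\<in>UNIV - {0}. row_sum k (of_int n * z))" by (simp add: row_sum_def)
  also have "\<dots> = 2 * ((2 * of_real pi * \<i>) ^ k / fact (k - 1)) * qsig (k - 1) (qe z)"
    by (rule row_sums_qser(1)[OF z]) (use k in auto)
  finally show ?thesis .
qed

lemma eisenstein_4: "z \<in> uhp \<Longrightarrow> eisenstein_G 4 z = of_real pi ^ 4 / 45 * (1 + 240 * qsig 3 (qe z))"
  and eisenstein_6: "z \<in> uhp \<Longrightarrow> eisenstein_G 6 z = 2 * of_real pi ^ 6 / 945 * (1 - 504 * qsig 5 (qe z))"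
proof -
  have f: "(fact 3 :: complex) = 6" "(fact 5 :: complex) = 120" by (simp_all add: fact_numeral)
  have i: "\<i> ^ 4 = 1" "\<i> ^ 6 = - 1" by (simp_all add: eval_nat_numeral)
  assume z: "z \<in> uhp"
  show "eisenstein_G 4 z = of_real pi ^ 4 / 45 * (1 + 240 * qsig 3 (qe z))"
    using eisenstein_qser[OF z, of 4] by (simp add: zl_values power_mult_distrib f i algebra_simps)
  show "eisenstein_G 6 z = 2 * of_real pi ^ 6 / 945 * (1 - 504 * qsig 5 (qe z))"
    using eisenstein_qser[OF z, of 6] by (simp add: zl_values power_mult_distrib f i algebra_simps)
qed

section \<open>The discriminant\<close>

text \<open>Neighbourhoods of the cusp: half planes Im z >= Y, with no restriction on the real
  part.\<close>

abbreviation at_ioo :: "complex filter" where "at_ioo \<equiv> filtercomap Im at_top"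

lemma eventually_at_ioo: "eventually P at_ioo \<longleftrightarrow> (\<exists>Y. \<forall>z. Im z \<ge> Y \<longrightarrow> P z)"
  by (simp add: eventually_filtercomap eventually_at_top_linorder) blast

lemma qe_tendsto: "filterlim qe (at 0) at_ioo"
proof -
  have "filterlim (\<lambda>y::real. exp (- 2 * pi * y)) (nhds 0) at_top" by real_asymp
  then have "filterlim (\<lambda>z. exp (- 2 * pi * Im z)) (nhds 0) at_ioo"
    by (rule filterlim_compose) (rule filterlim_filtercomap)
  then have "((\<lambda>z. norm (qe z)) \<longlongrightarrow> 0) at_ioo" by (simp only: norm_qe)
  then have "(qe \<longlongrightarrow> 0) at_ioo" by (rule tendsto_norm_zero_cancel)
  then show ?thesis by (simp add: filterlim_at)
qed

lemma power_series_fps: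
  fixes c :: "nat \<Rightarrow> complex"
  assumes "\<And>x. norm x < 1 \<Longrightarrow> summable (\<lambda>n. norm (c n * x ^ n))"
  shows "fps_conv_radius (Abs_fps c) \<ge> 1" "(\<lambda>x. \<Sum>n. c n * x ^ n) has_fps_expansion Abs_fps c"
    "(\<lambda>x. \<Sum>n. c n * x ^ n) holomorphic_on ball 0 1"
proof -
  show cr: "fps_conv_radius (Abs_fps c) \<ge> 1"
    unfolding fps_conv_radius_def one_ereal_def
  proof (rule conv_radius_geI_ex)
    fix r :: real assume r: "0 < r" "ereal r < ereal 1"
    show "\<exists>z. norm z = r \<and> summable (\<lambda>n. fps_nth (Abs_fps c) n * z ^ n)"
      using r assms[of "of_real r"] by (intro exI[of _ "of_real r"]) (auto intro: summable_norm_cancel)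
  qed
  have e: "(\<lambda>x. \<Sum>n. c n * x ^ n) = eval_fps (Abs_fps c)" by (simp add: eval_fps_def[abs_def])
  show "(\<lambda>x. \<Sum>n. c n * x ^ n) has_fps_expansion Abs_fps c"
    unfolding e has_fps_expansion_def using cr by (auto intro: less_le_trans[of 0 1])
  show "(\<lambda>x. \<Sum>n. c n * x ^ n) holomorphic_on ball 0 1"
    unfolding e
    by (rule holomorphic_on_eval_fps)
      (use cr in \<open>auto simp: eball_def dist_norm intro: less_le_trans[of _ "ereal 1"] simp: one_ereal_def\<close>)
qed

definition sigfps :: "nat \<Rightarrow> complex fps" where "sigfps j = Abs_fps (\<lambda>N. of_nat (sig j N))"

lemma qsig_fps: "qsig j has_fps_expansion sigfps j" "qsig j holomorphic_on ball 0 1"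
  using power_series_fps(2,3)[OF qsig_norm_summable]
  by (simp_all add: sigfps_def qsig_def[abs_def])

lemma holomorphic_qe_compose:
  assumes "f holomorphic_on ball 0 1" shows "(\<lambda>z. f (qe z)) holomorphic_on uhp"
proof -
  have "(f \<circ> qe) holomorphic_on uhp"
    by (rule holomorphic_on_compose_gen[OF _ assms]) (auto intro!: holomorphic_intros simp: norm_qe_less_1 simp del: norm_exp_eq_Re)
  then show ?thesis by (simp add: o_def)
qed

definition logcoef :: "nat \<Rightarrow> complex" where "logcoef N = of_nat (sig 1 N) / of_nat N"

definition logser :: "complex \<Rightarrow> complex" where "logser x = (\<Sum>N. logcoef N * x ^ N)"

lemma logcoef_le: "norm (logcoef N) \<le> real N"
proof (cases "N = 0")
  case False
  have "real (sig 1 N) \<le> real N ^ 2" using sig_le[of 1 N]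
    by (metis Suc_1 of_nat_le_iff of_nat_power)
  then show ?thesis using False by (simp add: logcoef_def norm_divide divide_le_eq power2_eq_square)
qed (simp add: logcoef_def)

lemma logser_norm_summable:
  assumes "norm (x::complex) < 1" shows "summable (\<lambda>N. norm (logcoef N * x ^ N))"
proof (rule summable_comparison_test)
  show "summable (\<lambda>n. norm (of_nat n ^ 1 * x ^ n))" by (rule power_series_norm_summable[OF assms])
  show "\<exists>N. \<forall>n\<ge>N. norm (norm (logcoef n * x ^ n)) \<le> norm (of_nat n ^ 1 * x ^ n)"
    by (intro exI[of _ 0]) (auto simp: norm_mult norm_power intro!: mult_right_mono logcoef_le)
qed

lemma logser_fps: "logser has_fps_expansion Abs_fps logcoef" "logser holomorphic_on ball 0 1"
  using power_series_fps(2,3)[OF logser_norm_summable] by (simp_all add: logser_def[abs_def])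

lemma logser_deriv:
  assumes "norm x < 1"
  shows "\<exists>d. (logser has_field_derivative d) (at x) \<and> x * d = qsig 1 x"
proof (intro exI conjI)
  have S: "summable (\<lambda>n. logcoef n * z ^ n)" if "norm z < 1" for z
    using logser_norm_summable[OF that] by (rule summable_norm_cancel)
  show "(logser has_field_derivative (\<Sum>n. diffs logcoef n * x ^ n)) (at x)"
    unfolding logser_def[abs_def] by (rule termdiffs_strong'[of 1]) (use assms S in auto)
  have sm: "summable (\<lambda>n. diffs logcoef n * x ^ n)"
    by (rule termdiff_converges[of _ 1]) (use assms S in auto)
  have d: "diffs logcoef n = of_nat (sig 1 (Suc n))" for n
    by (simp add: diffs_def logcoef_def del: of_nat_Suc)
  have "x * (\<Sum>n. diffs logcoef n * x ^ n) = (\<Sum>n. x * (diffs logcoef n * x ^ n))"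
    by (rule suminf_mult[OF sm, symmetric])
  also have "\<dots> = (\<Sum>n. of_nat (sig 1 (Suc n)) * x ^ Suc n)" unfolding d by (simp add: mult_ac)
  also have "\<dots> = qsig 1 x"
    using suminf_split_head[OF summable_norm_cancel[OF qsig_norm_summable[OF assms, of 1]]]
    unfolding qsig_def by simp
  finally show "x * (\<Sum>n. diffs logcoef n * x ^ n) = qsig 1 x" .
qed

text \<open>\<open>Dfun\<close> is the normalised discriminant \<open>q \<Prod>(1 - q\<^sup>n)\<^sup>24\<close>, written as the exponential of its
  logarithm: \<open>log \<Prod>(1 - q\<^sup>n) = - \<Sum> (\<sigma>(N) / N) q\<^sup>N\<close>. In this form it visibly has no zeros.\<close>

definition dlog :: "complex \<Rightarrow> complex" where
  "dlog z = 2 * of_real pi * \<i> * z - 24 * logser (qe z)"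

definition Dfun :: "complex \<Rightarrow> complex" where "Dfun z = exp (dlog z)"

text \<open>The quasimodular Eisenstein series of weight 2, entering as the normalised logarithmic
  derivative of \<open>Dfun\<close>.\<close>

definition E2 :: "complex \<Rightarrow> complex" where "E2 z = 1 - 24 * qsig 1 (qe z)"

lemma Dfun_nonzero [simp]: "Dfun z \<noteq> 0" by (simp add: Dfun_def)

lemma Dfun_qe: "Dfun z = qe z * exp (- 24 * logser (qe z))"
  unfolding Dfun_def dlog_def exp_diff exp_minus minus_mult_left[symmetric] by (simp add: divide_inverse)

lemma dlog_deriv:
  assumes "z \<in> uhp" shows "(dlog has_field_derivative 2 * of_real pi * \<i> * E2 z) (at z)"
proof -
  obtain d where d: "(logser has_field_derivative d) (at (qe z))" "qe z * d = qsig 1 (qe z)"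
    using logser_deriv[OF norm_qe_less_1[OF assms]] by blast
  have "((\<lambda>z. logser (qe z)) has_field_derivative d * (2 * of_real pi * \<i> * qe z)) (at z)"
    by (rule DERIV_chain2[where f = logser and g = qe, OF d(1) qe_deriv])
  moreover have "((\<lambda>z. 2 * of_real pi * \<i> * z) has_field_derivative 2 * of_real pi * \<i>) (at z)"
    by (auto intro!: derivative_eq_intros)
  ultimately have "(dlog has_field_derivative 2 * of_real pi * \<i> - 24 * (d * (2 * of_real pi * \<i> * qe z))) (at z)"
    unfolding dlog_def[abs_def] by (intro DERIV_diff DERIV_cmult)
  also have "2 * of_real pi * \<i> - 24 * (d * (2 * of_real pi * \<i> * qe z)) = 2 * of_real pi * \<i> * E2 z"
    unfolding E2_def d(2)[symmetric] by (simp add: algebra_simps)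
  finally show ?thesis .
qed

lemma Dfun_deriv:
  assumes "z \<in> uhp" shows "(Dfun has_field_derivative Dfun z * (2 * of_real pi * \<i> * E2 z)) (at z)"
  unfolding Dfun_def[abs_def] by (rule DERIV_chain2[OF DERIV_exp dlog_deriv[OF assms]])

lemma holomorphic_Dfun: "Dfun holomorphic_on uhp"
  using Dfun_deriv holomorphic_on_open[OF open_uhp] by blast

lemma qe_T: "qe (z + 1) = qe z" by (simp add: ring_distribs exp_add)

lemma Dfun_T: "Dfun (z + 1) = Dfun z" unfolding Dfun_qe qe_T ..

text \<open>A summable family may be summed along any exhaustion. The lopsided window is the one on
  which differences g(n - 1) - g(n) telescope to the symmetric end values g(- N) - g(N).\<close>

lemma has_sum_int_symmetric:
  fixes f :: "int \<Rightarrow> complex"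
  assumes "f summable_on UNIV"
  shows "(\<lambda>N. \<Sum>n\<in>{- int N + 1..int N}. f n) \<longlonglongrightarrow> infsum f UNIV"
proof -
  have "(f has_sum infsum f UNIV) UNIV" by (rule has_sum_infsum[OF assms])
  then have l: "(sum f \<longlongrightarrow> infsum f UNIV) (finite_subsets_at_top UNIV)" by (simp add: has_sum_def)
  have "filterlim (\<lambda>N. {- int N + 1..int N}) (finite_subsets_at_top UNIV) sequentially"
    unfolding filterlim_finite_subsets_at_top
  proof (intro allI impI)
    fix XX :: "int set" assume XX: "finite XX \<and> XX \<subseteq> UNIV"
    define M where "M = Max (insert 0 ((\<lambda>x. nat \<bar>x\<bar>) ` XX))"
    have M: "nat \<bar>x\<bar> \<le> M" if "x \<in> XX" for x unfolding M_def using XX that by (intro Max_ge) auto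
    show "\<forall>\<^sub>F N in sequentially. finite {- int N + 1..int N} \<and> XX \<subseteq> {- int N + 1..int N} \<and> {- int N + 1..int N} \<subseteq> UNIV"
      using eventually_gt_at_top[of M]
    proof eventually_elim
      case (elim N)
      have "x \<in> {- int N + 1..int N}" if "x \<in> XX" for x using M[OF that] elim by auto
      then show ?case by auto
    qed
  qed
  from filterlim_compose[OF l this] show ?thesis .
qed

lemma telescope_int:
  fixes g :: "int \<Rightarrow> complex"
  shows "(\<Sum>n\<in>{- int N + 1..int N}. g (n - 1) - g n) = g (- int N) - g (int N)"
proof (induction N)
  case (Suc N)
  have "{- int (Suc N) + 1..int (Suc N)} = insert (- int N) (insert (int N + 1) {- int N + 1..int N})" by auto
  then show ?case using Suc by (simp add: algebra_simps minus_diff_commute)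
qed simp

text \<open>Subtract the digamma series at 1 - w from the one at w. A telescoping series then shifts
  one half by an index and makes the terms symmetric in w and - w.\<close>

lemma cot_partial_fractions:
  assumes w: "w \<notin> \<int>"
  shows "(\<lambda>n. 1 / (of_nat (Suc n) - w) - 1 / (of_nat (Suc n) + w)) sums (prefl 0 w + 1 / w)"
proof -
  have n0: "w \<noteq> 0" "1 - w \<noteq> 0" using w by (auto simp: Ints_1) 
  have d: "Digamma z + euler_mascheroni = (\<Sum>n. inverse (of_nat (Suc n)) - inverse (z + of_nat n))" for z :: complex
    by (simp add: Digamma_def)
  have s: "(\<lambda>n. inverse (of_nat (Suc n)) - inverse (z + of_nat n)) sums (Digamma z + euler_mascheroni)" if "z \<noteq> 0" for z :: complex
    unfolding d by (rule summable_sums[OF summable_Digamma[OF that]])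
  have "(\<lambda>n. (inverse (of_nat (Suc n)) - inverse (w + of_nat n)) - (inverse (of_nat (Suc n)) - inverse (1 - w + of_nat n)))
     sums ((Digamma w + euler_mascheroni) - (Digamma (1 - w) + euler_mascheroni))"
    by (rule sums_diff[OF s[OF n0(1)] s[OF n0(2)]])
  then have a: "(\<lambda>n. inverse (1 - w + of_nat n) - inverse (w + of_nat n)) sums prefl 0 w"
    by (simp add: prefl_def)
  have l: "(\<lambda>n. inverse (w + of_nat n)) \<longlonglongrightarrow> 0"
    by (rule filterlim_compose[OF tendsto_inverse_0])
      (rule tendsto_add_filterlim_at_infinity[OF tendsto_const tendsto_of_nat])
  have b: "(\<lambda>n. inverse (w + of_nat n) - inverse (w + of_nat (Suc n))) sums (inverse (w + of_nat 0) - 0)"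
    by (rule telescope_sums'[OF l])
  have "(\<lambda>n. (inverse (1 - w + of_nat n) - inverse (w + of_nat n)) + (inverse (w + of_nat n) - inverse (w + of_nat (Suc n))))
    sums (prefl 0 w + (inverse (w + of_nat 0) - 0))" by (rule sums_add[OF a b])
  then show ?thesis by (simp add: divide_inverse algebra_simps)
qed

text \<open>Along multiples of a point of the lower half plane the cotangent tends to i, since exp(-
  2 pi i N v) tends to 0.\<close>

lemma cot_limit:
  assumes y: "Im v < 0"
  shows "(\<lambda>N. prefl 0 (of_nat N * v)) \<longlonglongrightarrow> - (of_real pi * \<i>)"
proof -
  define x where "x = exp (- 2 * of_real pi * \<i> * v)"
  have nx: "norm x < 1" using y by (simp add: x_def mult_pos_neg)
  have e: "prefl 0 (of_nat N * v) = - (of_real pi * \<i>) * (1 + x ^ N) / (1 - x ^ N)" if "N > 0" for N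
  proof -
    have wi: "of_nat N * v \<notin> \<int>" using y that by (auto elim!: Ints_cases simp: complex_eq_iff)
    define u where "u = exp (\<i> * (of_real pi * (of_nat N * v)))"
    have u0: "u \<noteq> 0" by (simp add: u_def)
    have ux: "x ^ N * (u * u) = 1"
      unfolding u_def x_def exp_of_nat_mult[symmetric] exp_add[symmetric] by (simp add: mult_ac)
    have s: "sin (of_real pi * (of_nat N * v)) = (u - inverse u) / (2 * \<i>)"
      unfolding u_def by (simp add: sin_exp_eq exp_minus)
    have c: "cos (of_real pi * (of_nat N * v)) = (u + inverse u) / 2"
      unfolding u_def by (simp add: cos_exp_eq exp_minus)
    have xn: "x ^ N = inverse u * inverse u" using ux u0 by (simp add: field_simps)
    have "x ^ N \<noteq> 1" using nx that by (metis norm_one norm_power power_less_one_iff less_irrefl norm_ge_zero)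
    have alg: "- (P * ((u + inverse u) / 2) / ((u - inverse u) / (2 * \<i>))) =
        - (P * \<i>) * (1 + inverse u * inverse u) / (1 - inverse u * inverse u)" if "1 - inverse u * inverse u \<noteq> 0" for P
    proof -
      have "u - inverse u = u * (1 - inverse u * inverse u)" "u + inverse u = u * (1 + inverse u * inverse u)"
        using u0 by (simp_all add: algebra_simps)
      moreover have "- (P * ((u * A) / 2) / ((u * B) / (2 * \<i>))) = - (P * \<i>) * A / B" if "B \<noteq> 0" for A B
        using u0 that by (simp add: field_simps)
      ultimately show ?thesis using that by simp
    qed
    show ?thesis unfolding prefl_0[OF wi] s c xn
      by (rule alg) (use \<open>x ^ N \<noteq> 1\<close> xn in simp)
  qed
  have "(\<lambda>N. - (of_real pi * \<i>) * (1 + x ^ N) / (1 - x ^ N)) \<longlonglongrightarrow> - (of_real pi * \<i>) * (1 + 0) / (1 - 0)"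
    by (intro tendsto_intros LIMSEQ_power_zero nx) simp
  then have "(\<lambda>N. - (of_real pi * \<i>) * (1 + x ^ N) / (1 - x ^ N)) \<longlonglongrightarrow> - (of_real pi * \<i>)" by simp
  then show ?thesis
  proof (rule Lim_transform_eventually)
    show "\<forall>\<^sub>F N in sequentially. - (of_real pi * \<i>) * (1 + x ^ N) / (1 - x ^ N) = prefl 0 (of_nat N * v)"
      using eventually_gt_at_top[of 0] by eventually_elim (simp only: e)
  qed
qed

text \<open>Liouville's theorem for level one. By invariance all values occur on a compact set or
  near the cusp. If f differed from its limit somewhere, |f - c| would attain its maximum inside the
  half plane, and f would be a constant other than its limit.\<close>

lemma maximum_principle_SL2:
  assumes hol: "f holomorphic_on uhp" and inv: "SL2_inv f" and lim: "(f \<longlongrightarrow> c) at_ioo" and z: "z \<in> uhp"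
  shows "f z = c"
proof (rule ccontr)
  assume ne: "f z \<noteq> c"
  define u where "u = (\<lambda>z. f z - c)"
  have hu: "u holomorphic_on uhp" unfolding u_def by (intro holomorphic_intros hol)
  have iu: "u (mob a b c' d w) = u w" if "a * d - b * c' = 1" "w \<in> uhp" for a b c' d w
    using SL2_invD[OF inv that] by (simp add: u_def)
  have "eventually (\<lambda>w. dist (f w) c < norm (u z)) at_ioo" by (rule tendstoD[OF lim]) (use ne in \<open>simp add: u_def\<close>)
  then obtain Y where Y: "\<And>w. Im w \<ge> Y \<Longrightarrow> norm (u w) < norm (u z)"
    by (auto simp: eventually_at_ioo dist_norm u_def)
  define XX where "XX = {w. \<bar>Re w\<bar> \<le> 1/2 \<and> 86/100 \<le> Im w \<and> Im w \<le> max Y 1}"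
  have Xe: "XX = cbox (Complex (-1/2) (86/100)) (Complex (1/2) (max Y 1))"
    by (auto simp: XX_def in_cbox_complex_iff)
  have Xc: "compact XX" unfolding Xe by (rule compact_cbox)
  have Xu: "XX \<subseteq> uhp" by (auto simp: XX_def uhp_iff)
  have "\<i> \<in> XX" by (simp add: XX_def)
  then obtain w where w: "w \<in> XX" "\<And>v. v \<in> XX \<Longrightarrow> norm (u v) \<le> norm (u w)"
    using continuous_attains_sup[OF Xc, of "\<lambda>v. norm (u v)"] holomorphic_on_imp_continuous_on[OF holomorphic_on_subset[OF hu Xu]]
    by (auto intro: continuous_intros)
  have red: "norm (u v) \<le> norm (u w) \<or> norm (u v) < norm (u z)" if v: "v \<in> uhp" for v
  proof -
    obtain a b c' d where *: "a * d - b * c' = 1" "mob a b c' d v \<in> uhp" "Im (mob a b c' d v) \<ge> 86/100"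
      "\<bar>Re (mob a b c' d v)\<bar> \<le> 1/2" "norm (mob a b c' d v) \<ge> 1" by (rule reduce_uhp[OF v])
    show ?thesis
    proof (cases "Im (mob a b c' d v) \<ge> Y")
      case True then show ?thesis using Y iu[OF *(1) v] by metis
    next
      case False
      then have "mob a b c' d v \<in> XX" using * by (simp add: XX_def)
      then show ?thesis using w(2) iu[OF *(1) v] by metis
    qed
  qed
  have zw: "norm (u z) \<le> norm (u w)" using red[OF z] by auto
  have mx: "norm (u v) \<le> norm (u w)" if "v \<in> uhp" for v using red[OF that] zw by linarith
  have "u constant_on uhp"
    by (rule maximum_modulus_principle[OF hu open_uhp connected_uhp open_uhp])
       (use mx w(1) Xu in auto)
  then obtain d where d: "\<And>v. v \<in> uhp \<Longrightarrow> u v = d" by (auto simp: constant_on_def)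
  have "Complex 0 (max Y 1) \<in> uhp" by (simp add: uhp_iff)
  then have "norm (u (Complex 0 (max Y 1))) = norm (u z)" using d z by simp
  then show False using Y[of "Complex 0 (max Y 1)"] by simp
qed

lemma has_sum_diff:
  fixes f g :: "'a \<Rightarrow> complex"
  assumes "(f has_sum a) A" "(g has_sum b) A" shows "((\<lambda>x. f x - g x) has_sum (a - b)) A"
  using has_sum_add[OF assms(1) has_sum_cmult_right[OF assms(2), of "-1"]] by simp

lemma has_sum_finite_sum:
  fixes f :: "'i \<Rightarrow> 'a \<Rightarrow> complex"
  assumes "finite I" "\<And>i. i \<in> I \<Longrightarrow> (f i has_sum a i) A"
  shows "((\<lambda>x. \<Sum>i\<in>I. f i x) has_sum (\<Sum>i\<in>I. a i)) A"
  using assms by (induction I rule: finite_induct) (auto intro: has_sum_add)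

lemma summable_on_diff:
  fixes f g :: "'a \<Rightarrow> complex"
  assumes "f summable_on A" "g summable_on A" shows "(\<lambda>x. f x - g x) summable_on A"
  using has_sum_diff[OF has_sum_infsum[OF assms(1)] has_sum_infsum[OF assms(2)]] by (auto simp: summable_on_def)

lemma infsum_diff:
  fixes f g :: "'a \<Rightarrow> complex"
  assumes "f summable_on A" "g summable_on A"
  shows "infsum (\<lambda>x. f x - g x) A = infsum f A - infsum g A"
  using has_sum_diff[OF has_sum_infsum[OF assms(1)] has_sum_infsum[OF assms(2)]] by (rule infsumI)

text \<open>With Y = n + m z the corrected term equals - 1 / (Y^2 (Y - 1)). Its cubic decay gives
  absolute convergence of the double series, while the uncorrected terms converge absolutely only
  along a single row or column.\<close>

lemma lattice_differences_summable:
  assumes z: "z \<in> uhp"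
  defines "t \<equiv> \<lambda>m n. 1 / (of_int n + of_int m * z) ^ 2 - (1 / (of_int (n - 1) + of_int m * z) - 1 / (of_int n + of_int m * z))"
  shows "(\<lambda>(m, n). t m n) summable_on (UNIV - {0}) \<times> UNIV"
    and "m \<noteq> 0 \<Longrightarrow> (\<lambda>n. 1 / (of_int n + of_int m * z) ^ 2) summable_on UNIV"
    and "(\<lambda>m. 1 / (of_int n + of_int m * z) ^ 2) summable_on (UNIV - {0})"
proof -
  obtain C where C: "C > 0" "\<And>m n. (m, n) \<noteq> (0, 0) \<Longrightarrow>
     1 + \<bar>real_of_int m\<bar> \<le> C * norm (of_int m + of_int n * z) \<and> 1 + \<bar>real_of_int n\<bar> \<le> C * norm (of_int m + of_int n * z)"
    using lattice_lower_bound[OF z] by blast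
  obtain C' where C': "C' > 0" "\<And>m n. (m, n) \<noteq> (0, 0) \<Longrightarrow>
     1 / norm (of_int m + of_int n * z) ^ 3 \<le> C' * ((1 + \<bar>real_of_int m\<bar>) powr (- (3/2)) * (1 + \<bar>real_of_int n\<bar>) powr (- (3/2)))"
     "\<And>m n. (m, n) \<noteq> (0, 0) \<Longrightarrow> 1 / norm (of_int m + of_int n * z) \<le> C'"
    by (rule lattice_bound_cube[OF z]) (erule that, blast+)
  define g where "g = (\<lambda>(m::int, n::int). (1 + C) * C' * ((1 + \<bar>real_of_int m\<bar>) powr (- (3/2)) * (1 + \<bar>real_of_int n\<bar>) powr (- (3/2))))"
  have g: "g summable_on A" for A
    using summable_on_cmult_right[OF lattice_cube_summable, of "(1 + C) * C'" A] unfolding g_def case_prod_unfold .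
  have nz: "of_int n + of_int m * z \<noteq> 0" if "(n, m) \<noteq> (0, 0)" for m n
    using cocycle_nonzero[OF z, of m n] that by (auto simp: add.commute)
  have "(\<lambda>x. norm ((\<lambda>(m, n). t m n) x)) summable_on (UNIV - {0}) \<times> UNIV"
  proof (rule summable_on_comparison_test[OF g])
    fix x :: "int \<times> int" assume "x \<in> (UNIV - {0}) \<times> UNIV"
    then obtain m n where x: "x = (m, n)" "m \<noteq> 0" by (cases x) auto
    define Y where "Y = of_int n + of_int m * z"
    have Y1: "of_int (n - 1) + of_int m * z = Y - 1" by (simp add: Y_def)
    have "Y \<noteq> 0" using nz[of n m] x(2) by (simp add: Y_def)
    moreover have "Y - 1 \<noteq> 0" using nz[of "n - 1" m] x(2) unfolding Y1 by simp
    ultimately have Y0: "Y \<noteq> 0" "Y - 1 \<noteq> 0" by auto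
    have tmn: "t m n = 1 / Y ^ 2 - (1 / (Y - 1) - 1 / Y)" by (simp only: t_def Y1 Y_def[symmetric])
    have alg: "1 / Y ^ 2 - (1 / (Y - 1) - 1 / Y) = - (1 / (Y ^ 2 * (Y - 1)))"
      using Y0 by (simp add: field_simps power2_eq_square)
    have "1 + \<bar>real_of_int m\<bar> \<le> C * norm (Y - 1)" using C(2)[of "n - 1" m] x(2) unfolding Y1 by simp
    then have "1 \<le> C * norm (Y - 1)" by linarith
    moreover have "norm Y \<le> norm (Y - 1) + 1" using norm_triangle_ineq[of "Y - 1" 1] by simp
    ultimately have "norm Y \<le> (1 + C) * norm (Y - 1)" by (simp add: algebra_simps)
    then have "1 / norm (Y - 1) \<le> (1 + C) / norm Y" using Y0 by (simp add: field_simps)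
    then have "1 / norm Y ^ 2 * (1 / norm (Y - 1)) \<le> 1 / norm Y ^ 2 * ((1 + C) / norm Y)"
      by (intro mult_left_mono) auto
    also have "\<dots> = (1 + C) * (1 / norm Y ^ 3)" by (simp add: power2_eq_square power3_eq_cube)
    also have "\<dots> \<le> (1 + C) * (C' * ((1 + \<bar>real_of_int n\<bar>) powr (- (3/2)) * (1 + \<bar>real_of_int m\<bar>) powr (- (3/2))))"
      unfolding Y_def using C(1) C'(2)[of n m] x(2) by (intro mult_left_mono) auto
    also have "\<dots> = g x" by (simp add: g_def x mult_ac)
    finally show "norm ((\<lambda>(m, n). t m n) x) \<le> g x"
      unfolding x split tmn alg by (simp add: norm_divide norm_mult norm_power)
  qed auto
  then show "(\<lambda>(m, n). t m n) summable_on (UNIV - {0}) \<times> UNIV" by (rule abs_summable_summable)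
  have sq: "1 / norm (of_int n + of_int m * z) ^ 2 \<le> C ^ 2 * (1 + \<bar>real_of_int k\<bar>) powr (- 2)"
    if "(n, m) \<noteq> (0, 0)" "k = n \<or> k = m" for m n k
  proof -
    let ?N = "norm (of_int n + of_int m * z)"
    have le: "1 + \<bar>real_of_int k\<bar> \<le> C * ?N" using C(2)[of n m] that by auto
    have "1 / ?N ^ 2 = C ^ 2 / (C * ?N) ^ 2" using C(1) by (simp add: power_mult_distrib)
    also have "\<dots> \<le> C ^ 2 / (1 + \<bar>real_of_int k\<bar>) ^ 2"
      using le nz[OF that(1)] C(1) by (intro divide_left_mono power_mono mult_pos_pos zero_less_power) auto
    also have "\<dots> = C ^ 2 * (1 + \<bar>real_of_int k\<bar>) powr (- 2)" by (simp add: powr_minus powr_numeral divide_inverse)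
    finally show ?thesis .
  qed
  have gs: "(\<lambda>k::int. C ^ 2 * (1 + \<bar>real_of_int k\<bar>) powr (- 2)) summable_on A" for A
    by (rule summable_on_cmult_right, rule summable_on_subset_banach[OF summable_on_int_powr]) auto
  show "(\<lambda>n. 1 / (of_int n + of_int m * z) ^ 2) summable_on UNIV" if "m \<noteq> 0"
    by (rule abs_summable_summable, rule summable_on_comparison_test[OF gs])
      (use sq that in \<open>auto simp: norm_divide norm_power\<close>)
  show "(\<lambda>m. 1 / (of_int n + of_int m * z) ^ 2) summable_on (UNIV - {0})"
    by (rule abs_summable_summable, rule summable_on_comparison_test[OF gs])
      (use sq in \<open>auto simp: norm_divide norm_power\<close>)
qed

lemma infsum_insert_0:
  fixes f :: "int \<Rightarrow> complex"
  assumes "f summable_on UNIV - {0}"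
  shows "infsum f UNIV = f 0 + infsum f (UNIV - {0})" "f summable_on UNIV"
proof -
  have "insert 0 (UNIV - {0::int}) = UNIV" by auto
  then show "infsum f UNIV = f 0 + infsum f (UNIV - {0})" "f summable_on UNIV"
    using infsum_insert[OF assms, of 0] summable_on_insert_iff[of f 0 "UNIV - {0}"] assms by simp_all
qed

text \<open>The double series for \<open>G\<^sub>2\<close> converges only conditionally. Subtracting the telescoping terms
  makes it absolutely convergent, and exchanging the order of summation leaves the limit of
  \<open>\<pi> cot\<close> as the defect in the transformation law.\<close>

lemma E2_S:
  assumes z: "z \<in> uhp"
  shows "E2 (- 1 / z) / z ^ 2 - E2 z = 6 / (of_real pi * \<i> * z)"
proof -
  let ?A = "UNIV - {0::int}"
  have z0: "z \<noteq> 0" using z by (auto simp: uhp_iff)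
  define b where "b = (\<lambda>m n. 1 / (of_int (n - 1) + of_int m * z) - 1 / (of_int n + of_int m * z))"
  define s where "s = (\<lambda>m n. 1 / (of_int n + of_int m * z) ^ 2)"
  define t where "t = (\<lambda>m n. s m n - b m n)"
  have tsum: "(\<lambda>(m, n). t m n) summable_on ?A \<times> UNIV"
    using lattice_differences_summable(1)[OF z] by (simp add: t_def s_def b_def)
  have srow: "(\<lambda>n. s m n) summable_on UNIV" if "m \<noteq> 0" for m
    unfolding s_def by (rule lattice_differences_summable(2)[OF z that])
  have scol: "(\<lambda>m. s m n) summable_on ?A" for n
    unfolding s_def by (rule lattice_differences_summable(3)[OF z])
  have trow: "(\<lambda>n. t m n) summable_on UNIV" if "m \<noteq> 0" for m
    by (rule summable_on_SigmaD1[OF tsum]) (use that in simp)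
  have tsw: "(\<lambda>(n, m). t m n) summable_on UNIV \<times> ?A"
    using tsum by (subst summable_on_swap) (simp add: case_prod_unfold)
  have tcol: "(\<lambda>m. t m n) summable_on ?A" for n
    by (rule summable_on_SigmaD1[OF tsw]) simp
  have bt: "b m n = s m n - t m n" for m n by (simp add: t_def)
  have brow: "(\<lambda>n. b m n) summable_on UNIV" if "m \<noteq> 0" for m
    unfolding bt using srow[OF that] trow[OF that] by (rule summable_on_diff)
  have bcol: "(\<lambda>m. b m n) summable_on ?A" for n
    unfolding bt using scol tcol by (rule summable_on_diff)
  have inv0: "(\<lambda>N. 1 / (of_nat N + c)) \<longlonglongrightarrow> 0" for c :: complex
  proof -
    have "(\<lambda>N. inverse (c + of_nat N)) \<longlonglongrightarrow> 0"
      by (rule filterlim_compose[OF tendsto_inverse_0])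
        (rule tendsto_add_filterlim_at_infinity[OF tendsto_const tendsto_of_nat])
    then show ?thesis by (simp add: divide_inverse add.commute)
  qed
  have part: "(\<Sum>n\<in>{- int N + 1..int N}. b m n) = 1 / (- of_nat N + of_int m * z) - 1 / (of_nat N + of_int m * z)" for m N
    unfolding b_def using telescope_int[of "\<lambda>n. 1 / (of_int n + of_int m * z)" N] by simp
  \<comment> \<open>Along a row the telescoping terms sum to 0, so summing rows first gives the rows
    of the weight 2 series unchanged.\<close>
  have b0: "infsum (b m) UNIV = 0" if "m \<noteq> 0" for m
  proof -
    have "(\<lambda>N. - (1 / (of_nat N + (- (of_int m * z)))) - 1 / (of_nat N + of_int m * z)) \<longlonglongrightarrow> - 0 - 0"
      by (intro tendsto_diff tendsto_minus inv0)
    moreover have "- (1 / (of_nat N + (- (of_int m * z)))) = 1 / (- of_nat N + of_int m * z)" for N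
    proof -
      have "- of_nat N + of_int m * z = - (of_nat N + (- (of_int m * z)))" by simp
      then show ?thesis by (simp only: divide_minus_right)
    qed
    ultimately have "(\<lambda>N. \<Sum>n\<in>{- int N + 1..int N}. b m n) \<longlonglongrightarrow> 0" unfolding part by simp
    then show ?thesis using has_sum_int_symmetric[OF brow[OF that]] LIMSEQ_unique by blast
  qed
  have Tm: "infsum (t m) UNIV = row_sum 2 (of_int m * z)" if "m \<noteq> 0" for m
  proof -
    have "infsum (t m) UNIV = infsum (s m) UNIV - infsum (b m) UNIV"
      unfolding t_def by (rule infsum_diff[OF srow[OF that] brow[OF that]])
    then show ?thesis using b0[OF that] by (simp add: s_def row_sum_def)
  qed
  define B where "B = (\<lambda>z. \<Sum>\<^sub>\<infinity>n\<in>?A. row_sum 2 (of_int n * z))"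
  have S: "- 1 / z \<in> uhp" by (rule S_uhp[OF z])
  have Bq: "B v = - 8 * of_real pi ^ 2 * qsig 1 (qe v)" if "v \<in> uhp" for v
    unfolding B_def using row_sums_qser(1)[OF that, of 2] by (simp add: power_mult_distrib)
  have T1: "(\<Sum>\<^sub>\<infinity>m\<in>?A. infsum (t m) UNIV) = B z"
    unfolding B_def by (rule infsum_cong) (simp add: Tm)
  have T2: "(\<Sum>\<^sub>\<infinity>m\<in>?A. infsum (t m) UNIV) = (\<Sum>\<^sub>\<infinity>n\<in>UNIV. \<Sum>\<^sub>\<infinity>m\<in>?A. t m n)"
    by (rule infsum_swap_banach[OF tsum])
  have Tsm: "(\<lambda>n. \<Sum>\<^sub>\<infinity>m\<in>?A. t m n) summable_on UNIV" by (rule summable_on_Sigma_banach[OF tsw])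
  define U where "U = (\<lambda>n. \<Sum>\<^sub>\<infinity>m\<in>?A. s m n)"
  define e where "e = (\<lambda>n. \<Sum>\<^sub>\<infinity>m\<in>?A. b m n)"
  have Tn: "(\<Sum>\<^sub>\<infinity>m\<in>?A. t m n) = U n - e n" for n
    unfolding U_def e_def t_def by (rule infsum_diff[OF scol bcol])
  have sz: "s m n = 1 / z ^ 2 * (1 / (of_int m + of_int n / z) ^ 2)" for m n
  proof -
    have "z * (of_int n / z) = of_int n" using z0 by simp
    then have "of_int n + of_int m * z = z * (of_int m + of_int n / z)"
      by (simp only: distrib_left) (simp only: add.commute mult.commute)
    then show ?thesis by (simp add: s_def power_mult_distrib)
  qed
  have U0: "U 0 = 1 / z ^ 2 * zl 2"
    unfolding U_def sz infsum_cmult_right' by (simp add: zl_def)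
  \<comment> \<open>In the other order, pulling out z^2 turns a column into a row for - 1 / z. It
    lacks the term m = 0, which is subtracted.\<close>
  have Un: "U n = 1 / z ^ 2 * row_sum 2 (of_int n * (- 1 / z)) - 1 / of_int n ^ 2" if "n \<noteq> 0" for n
  proof -
    have "infsum (\<lambda>m. s m n) UNIV = s 0 n + U n" unfolding U_def by (rule infsum_insert_0(1)[OF scol])
    moreover have "infsum (\<lambda>m. s m n) UNIV = 1 / z ^ 2 * row_sum 2 (of_int n / z)"
      unfolding sz infsum_cmult_right' row_sum_def ..
    moreover have "row_sum 2 (of_int n / z) = row_sum 2 (of_int n * (- 1 / z))"
      using row_sum_uminus[of 2 "of_int n / z"] by simp
    ultimately have "s 0 n + U n = 1 / z ^ 2 * row_sum 2 (of_int n * (- 1 / z))" by (simp only:)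
    then have "U n = 1 / z ^ 2 * row_sum 2 (of_int n * (- 1 / z)) - s 0 n" by (metis add_diff_cancel_left')
    then show ?thesis by (simp add: s_def)
  qed
  have rs: "(\<lambda>n. 1 / z ^ 2 * row_sum 2 (of_int n * (- 1 / z))) summable_on ?A"
    by (rule summable_on_cmult_right[OF row_sums_qser(2)[OF S]]) auto
  have zs: "(\<lambda>n. 1 / of_int n ^ 2 :: complex) summable_on ?A"
  proof (rule abs_summable_summable)
    have "(\<lambda>m::int. norm (1 / (of_int m + (0::complex)) ^ 2)) summable_on ?A"
    proof (rule row_summable[of 1])
      fix m assume "m \<in> ?A"
      then have "\<bar>m\<bar> \<ge> 1" by auto
      then show "1 \<le> norm (of_int m + (0::complex))" by simp
    qed auto
    then show "(\<lambda>x. norm (1 / complex_of_int x ^ 2)) summable_on ?A" by simp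
  qed
  have UA: "U summable_on ?A" using summable_on_diff[OF rs zs] by (rule summable_on_cong[THEN iffD2, rotated]) (simp add: Un)
  have Usum: "infsum U UNIV = 1 / z ^ 2 * zl 2 + (1 / z ^ 2 * B (- 1 / z) - zl 2)"
  proof -
    have "infsum U UNIV = U 0 + infsum U ?A" by (rule infsum_insert_0(1)[OF UA])
    also have "infsum U ?A = (\<Sum>\<^sub>\<infinity>n\<in>?A. 1 / z ^ 2 * row_sum 2 (of_int n * (- 1 / z)) - 1 / of_int n ^ 2)"
      by (rule infsum_cong) (simp add: Un)
    also have "\<dots> = 1 / z ^ 2 * B (- 1 / z) - zl 2"
      unfolding infsum_diff[OF rs zs] infsum_cmult_right' B_def zl_def ..
    finally show ?thesis unfolding U0 .
  qed
  have US: "U summable_on UNIV" by (rule infsum_insert_0(2)[OF UA])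
  have eT: "e n = U n - (\<Sum>\<^sub>\<infinity>m\<in>?A. t m n)" for n unfolding Tn by simp
  have es: "e summable_on UNIV" unfolding eT using US Tsm by (rule summable_on_diff)
  have esum: "infsum e UNIV = infsum U UNIV - B z"
    unfolding eT infsum_diff[OF US Tsm] T2[symmetric] T1 ..
  define v where "v = 1 / z"
  have "- 1 / z = - v" by (simp add: v_def)
  then have v: "Im v < 0" using S unfolding uhp_iff by simp
  \<comment> \<open>A finite sum over n telescopes inside the sum over m. What remains is the
    partial fraction series of the cotangent at N / z, and its limit is the defect.\<close>
  have ep: "(\<Sum>n\<in>{- int N + 1..int N}. e n) = 2 / z * (prefl 0 (of_nat N * v) + 1 / (of_nat N * v))" if N: "N > 0" for N
  proof -
    let ?w = "of_nat N * v"
    have wi: "?w \<notin> \<int>" using v N by (auto elim!: Ints_cases simp: complex_eq_iff)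
    let ?h = "\<lambda>m::int. 1 / z * (1 / (of_int m - ?w) - 1 / (of_int m + ?w))"
    have fs: "((\<lambda>m. \<Sum>n\<in>{- int N + 1..int N}. b m n) has_sum (\<Sum>n\<in>{- int N + 1..int N}. e n)) ?A"
      unfolding e_def by (rule has_sum_finite_sum) (use bcol in \<open>auto intro: has_sum_infsum\<close>)
    have ph: "(\<Sum>n\<in>{- int N + 1..int N}. b m n) = ?h m" for m
    proof -
      have "- of_nat N + of_int m * z = z * (of_int m - ?w)" "of_nat N + of_int m * z = z * (of_int m + ?w)"
        using z0 by (simp_all add: v_def algebra_simps)
      then show ?thesis unfolding part by (simp add: right_diff_distrib)
    qed
    have hs: "(?h has_sum (\<Sum>n\<in>{- int N + 1..int N}. e n)) ?A" using fs unfolding ph .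
    have ev: "?h (- m) = ?h m" for m
    proof -
      have "of_int (- m) - ?w = - (of_int m + ?w)" "of_int (- m) + ?w = - (of_int m - ?w)" by simp_all
      then show ?thesis by (simp only: divide_minus_right) simp
    qed
    have "?h summable_on int ` {1..}"
      by (rule summable_on_subset_banach[of _ ?A]) (use hs in \<open>auto simp: summable_on_def\<close>)
    then have sn: "(\<lambda>n::nat. ?h (int n)) summable_on {1..}"
      by (subst (asm) summable_on_reindex) (auto simp: o_def)
    have "(\<Sum>n\<in>{- int N + 1..int N}. e n) = infsum ?h ?A" using hs by (simp add: infsumI)
    also have "\<dots> = 2 * (\<Sum>\<^sub>\<infinity>n\<in>{1..}. ?h (int n))" by (rule infsum_nonzero_int(1)[OF ev sn])
    also have "(\<Sum>\<^sub>\<infinity>n\<in>{1..}. ?h (int n)) = 1 / z * (prefl 0 ?w + 1 / ?w)"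
    proof -
      have r: "{1::nat..} = range Suc" by (auto simp: image_iff intro: Suc_le_D)
      have sm: "(\<lambda>n. ?h (int (Suc n))) summable_on UNIV"
        using sn unfolding r by (subst (asm) summable_on_reindex) (auto simp: o_def)
      have "(\<Sum>\<^sub>\<infinity>n\<in>{1..}. ?h (int n)) = infsum (\<lambda>n. ?h (int (Suc n))) UNIV"
        unfolding r by (subst infsum_reindex) (auto simp: o_def)
      also have "\<dots> = (\<Sum>n. ?h (int (Suc n)))" by (rule infsum_nat_suminf[OF sm])
      also have "\<dots> = 1 / z * (prefl 0 ?w + 1 / ?w)"
        using sums_unique[OF sums_mult[OF cot_partial_fractions[OF wi], of "1 / z"]] by simp
      finally show ?thesis .
    qed
    finally show ?thesis by simp
  qed
  have "(\<lambda>N. 2 / z * (prefl 0 (of_nat N * v) + (1 / (of_nat N + 0)) * (1 / v))) \<longlonglongrightarrow> 2 / z * (- (of_real pi * \<i>) + 0 * (1 / v))"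
    by (intro tendsto_mult tendsto_add tendsto_const cot_limit inv0 v)
  then have "(\<lambda>N. \<Sum>n\<in>{- int N + 1..int N}. e n) \<longlonglongrightarrow> 2 / z * (- (of_real pi * \<i>) + 0 * (1 / v))"
  proof (rule Lim_transform_eventually)
    show "\<forall>\<^sub>F N in sequentially. 2 / z * (prefl 0 (of_nat N * v) + (1 / (of_nat N + 0)) * (1 / v)) = (\<Sum>n\<in>{- int N + 1..int N}. e n)"
      using eventually_gt_at_top[of 0]
    proof eventually_elim
      case (elim N)
      show ?case using ep[OF elim] by simp
    qed
  qed
  then have "infsum e UNIV = 2 / z * (- (of_real pi * \<i>))"
    using has_sum_int_symmetric[OF es] LIMSEQ_unique by fastforce
  then have key: "1 / z ^ 2 * zl 2 + (1 / z ^ 2 * B (- 1 / z) - zl 2) - B z = 2 / z * (- (of_real pi * \<i>))"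
    using esum Usum by simp
  have E: "zl 2 + B u = of_real pi ^ 2 / 3 * E2 u" if "u \<in> uhp" for u
    unfolding Bq[OF that] zl_values E2_def by (simp add: algebra_simps)
  have "1 / z ^ 2 * (zl 2 + B (- 1 / z)) - (zl 2 + B z) = 2 / z * (- (of_real pi * \<i>))"
    using key by (simp add: algebra_simps)
  then have k2: "of_real pi ^ 2 / 3 * (E2 (- 1 / z) / z ^ 2 - E2 z) = 2 / z * (- (of_real pi * \<i>))"
    unfolding E[OF S] E[OF z] by (simp add: algebra_simps)
  have p0: "of_real pi ^ 2 / 3 \<noteq> (0::complex)" by simp
  have "of_real pi ^ 2 / 3 * (6 / (of_real pi * \<i> * z)) = 2 / z * (- (of_real pi * \<i>))"
    using z0 by (simp add: divide_simps power2_eq_square)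
  then show ?thesis using k2 p0 mult_left_cancel by metis
qed

text \<open>By \<open>E2_S\<close> the logarithmic derivative of Dfun(- 1 / z) / Dfun(z) is 12 / z,
  so after division by z^12 the quotient is constant. The constant is read off at the fixed point
  i.\<close>

lemma Dfun_S:
  assumes z: "z \<in> uhp" shows "Dfun (- 1 / z) = z ^ 12 * Dfun z"
proof -
  define g where "g = (\<lambda>z. dlog (- 1 / z) - dlog z)"
  define Q where "Q = (\<lambda>z. exp (g z) / z ^ 12)"
  have n0: "w \<noteq> 0" if "w \<in> uhp" for w using that by (auto simp: uhp_iff)
  have dg: "(g has_field_derivative 12 / w) (at w)" if w: "w \<in> uhp" for w
  proof -
    have w0: "w \<noteq> 0" by (rule n0[OF w])
    have "((\<lambda>w. - 1 / w) has_field_derivative 1 / w ^ 2) (at w)"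
      using w0 by (auto intro!: derivative_eq_intros simp: power2_eq_square)
    then have "((\<lambda>w. dlog (- 1 / w)) has_field_derivative (2 * of_real pi * \<i> * E2 (- 1 / w)) * (1 / w ^ 2)) (at w)"
      by (rule DERIV_chain2[where f = dlog and g = "\<lambda>w. - 1 / w", OF dlog_deriv[OF S_uhp[OF w]]])
    then have "(g has_field_derivative (2 * of_real pi * \<i> * E2 (- 1 / w)) * (1 / w ^ 2) - 2 * of_real pi * \<i> * E2 w) (at w)"
      unfolding g_def by (rule DERIV_diff[OF _ dlog_deriv[OF w]])
    also have "(2 * of_real pi * \<i> * E2 (- 1 / w)) * (1 / w ^ 2) - 2 * of_real pi * \<i> * E2 w
       = 2 * of_real pi * \<i> * (E2 (- 1 / w) / w ^ 2 - E2 w)" by (simp add: algebra_simps)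
    also have "\<dots> = 12 / w" unfolding E2_S[OF w] using w0 by simp
    finally show ?thesis .
  qed
  have "\<exists>c. \<forall>w\<in>uhp. Q w = c"
  proof (rule has_field_derivative_zero_constant[OF convex_uhp])
    fix w assume w: "w \<in> uhp"
    have w0: "w \<noteq> 0" by (rule n0[OF w])
    have "(Q has_field_derivative (exp (g w) * (12 / w) * w ^ 12 - exp (g w) * (of_nat 12 * (1 * w ^ (12 - Suc 0)))) / (w ^ 12 * w ^ 12)) (at w)"
      unfolding Q_def
      by (intro DERIV_divide DERIV_power DERIV_ident DERIV_chain2[where f = exp and g = g, OF DERIV_exp dg[OF w]]) (use w0 in simp)
    moreover have "exp (g w) * (12 / w) * w ^ 12 = exp (g w) * (of_nat 12 * (1 * w ^ (12 - Suc 0)))"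
    proof -
      have "w ^ 12 = w * w ^ 11" by (simp add: power_Suc[symmetric] del: power_Suc)
      then show ?thesis using w0 by simp
    qed
    ultimately have "(Q has_field_derivative 0) (at w)" by simp
    then show "(Q has_field_derivative 0) (at w within uhp)" by (rule has_field_derivative_at_within)
  qed
  then obtain c where c: "\<And>w. w \<in> uhp \<Longrightarrow> Q w = c" by blast
  have "Q \<i> = 1" by (simp add: Q_def g_def eval_nat_numeral)
  then have "Q z = 1" using c[OF z] c[of \<i>] by (simp add: uhp_iff)
  then have "exp (g z) = z ^ 12" using n0[OF z] by (simp add: Q_def)
  then show ?thesis unfolding g_def exp_diff Dfun_def by (simp add: divide_eq_eq)
qed

section \<open>Weights 4 and 6 and the discriminant identity\<close>

definition E4 :: "complex \<Rightarrow> complex" where "E4 z = 1 + 240 * qsig 3 (qe z)"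
definition E6 :: "complex \<Rightarrow> complex" where "E6 z = 1 - 504 * qsig 5 (qe z)"

lemma eisenstein_E4: "z \<in> uhp \<Longrightarrow> eisenstein_G 4 z = of_real pi ^ 4 / 45 * E4 z"
  and eisenstein_E6: "z \<in> uhp \<Longrightarrow> eisenstein_G 6 z = 2 * of_real pi ^ 6 / 945 * E6 z"
  by (simp_all add: E4_def E6_def eisenstein_4 eisenstein_6)

lemma E4_mob: "z \<in> uhp \<Longrightarrow> a * d - b * c = 1 \<Longrightarrow> E4 (mob a b c d z) = (of_int c * z + of_int d) ^ 4 * E4 z"
  and E6_mob: "z \<in> uhp \<Longrightarrow> a * d - b * c = 1 \<Longrightarrow> E6 (mob a b c d z) = (of_int c * z + of_int d) ^ 6 * E6 z"
proof -
  assume z: "z \<in> uhp" and det: "a * d - b * c = 1"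
  have m: "mob a b c d z \<in> uhp" using mob_uhp[OF z, of a d b c] det by simp
  have "of_real pi ^ 4 / 45 * E4 (mob a b c d z) = of_real pi ^ 4 / 45 * ((of_int c * z + of_int d) ^ 4 * E4 z)"
    using eisenstein_mob[OF z det, of 4] unfolding eisenstein_E4[OF z] eisenstein_E4[OF m] by (simp only: mult_ac)
  moreover have "of_real pi ^ 4 / 45 \<noteq> (0::complex)" by simp
  ultimately show "E4 (mob a b c d z) = (of_int c * z + of_int d) ^ 4 * E4 z" by (metis mult_left_cancel)
  have "2 * of_real pi ^ 6 / 945 * E6 (mob a b c d z) = 2 * of_real pi ^ 6 / 945 * ((of_int c * z + of_int d) ^ 6 * E6 z)"
    using eisenstein_mob[OF z det, of 6] unfolding eisenstein_E6[OF z] eisenstein_E6[OF m] by (simp only: mult_ac)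
  moreover have "2 * of_real pi ^ 6 / 945 \<noteq> (0::complex)" by simp
  ultimately show "E6 (mob a b c d z) = (of_int c * z + of_int d) ^ 6 * E6 z" by (metis mult_left_cancel)
qed

lemma holomorphic_E4: "E4 holomorphic_on uhp" and holomorphic_E6: "E6 holomorphic_on uhp"
  unfolding E4_def[abs_def] E6_def[abs_def] by (intro holomorphic_intros holomorphic_qe_compose qsig_fps)+

lemma E4_T: "E4 (z + 1) = E4 z" and E6_T: "E6 (z + 1) = E6 z"
  unfolding E4_def E6_def qe_T by simp_all

lemma E4_S: "z \<in> uhp \<Longrightarrow> E4 (- 1 / z) = z ^ 4 * E4 z" and E6_S: "z \<in> uhp \<Longrightarrow> E6 (- 1 / z) = z ^ 6 * E6 z"
  using E4_mob[of z 0 0 "-1" 1] E6_mob[of z 0 0 "-1" 1] by (simp_all add: mob_S)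

text \<open>The series \<open>qsig\<close> divided by its variable, which allows the quotient by
  \<open>Dfun\<close> to be evaluated at q = 0.\<close>

definition qsig1 :: "nat \<Rightarrow> complex \<Rightarrow> complex" where "qsig1 j x = (\<Sum>N. of_nat (sig j (Suc N)) * x ^ N)"

lemma qsig1_norm_summable:
  assumes "norm (x::complex) < 1" shows "summable (\<lambda>N. norm (of_nat (sig j (Suc N)) * x ^ N))"
proof (cases "x = 0")
  case True
  then show ?thesis by (intro summable_finite[of "{0}"]) auto
next
  case False
  have "summable (\<lambda>N. norm (of_nat (sig j (Suc N)) * x ^ Suc N))"
    using qsig_norm_summable[OF assms, of j] by (subst summable_Suc_iff)
  then have "summable (\<lambda>N. norm (of_nat (sig j (Suc N)) * x ^ Suc N) * inverse (norm x))" by (rule summable_mult2)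
  then show ?thesis using False by (simp add: norm_mult mult_ac)
qed

lemma qsig_qsig1: "norm x < 1 \<Longrightarrow> qsig j x = x * qsig1 j x"
proof -
  assume x: "norm x < 1"
  have "qsig j x = (\<Sum>N. of_nat (sig j (Suc N)) * x ^ Suc N)"
    using suminf_split_head[OF summable_norm_cancel[OF qsig_norm_summable[OF x, of j]]] by (simp add: qsig_def)
  also have "\<dots> = (\<Sum>N. x * (of_nat (sig j (Suc N)) * x ^ N))" by (simp add: mult_ac)
  also have "\<dots> = x * qsig1 j x"
    unfolding qsig1_def by (rule suminf_mult[OF summable_norm_cancel[OF qsig1_norm_summable[OF x]]])
  finally show ?thesis .
qed

lemma qsig1_fps: "qsig1 j has_fps_expansion Abs_fps (\<lambda>N. of_nat (sig j (Suc N)))"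
  using power_series_fps(2)[OF qsig1_norm_summable] by (simp add: qsig1_def[abs_def])

lemma qsig1_0: "qsig1 j 0 = 1"
proof -
  have "qsig1 j 0 = of_nat (sig j (Suc 0))" unfolding qsig1_def by (subst powser_zero) simp
  also have "{d. d dvd Suc 0} = {Suc 0}" by auto
  then have "sig j (Suc 0) = 1" by (simp add: sig_def)
  finally show ?thesis by simp
qed

lemma logser_0: "logser 0 = 0" unfolding logser_def by (subst powser_zero) (simp add: logcoef_def)

text \<open>The quotient by \<open>Dfun\<close> is holomorphic and invariant, and tends to 3 * 240 +
  2 * 504 = 1728 at the cusp, so the maximum principle makes it constant.\<close>

lemma discriminant_identity:
  assumes z: "z \<in> uhp" shows "E4 z ^ 3 - E6 z ^ 2 = 1728 * Dfun z"
proof -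
  let ?f = "\<lambda>z. (E4 z ^ 3 - E6 z ^ 2) / Dfun z"
  let ?P = "\<lambda>x. (720 * qsig1 3 x + 3 * 240 ^ 2 * x * qsig1 3 x ^ 2 + 240 ^ 3 * x ^ 2 * qsig1 3 x ^ 3
      + 1008 * qsig1 5 x - 504 ^ 2 * x * qsig1 5 x ^ 2) * exp (24 * logser x)"
  have hol: "?f holomorphic_on uhp"
    by (intro holomorphic_intros holomorphic_E4 holomorphic_E6 holomorphic_Dfun) auto
  have inv: "SL2_inv ?f"
  proof (rule SL2_invI)
    show "?f (w + 1) = ?f w" if "w \<in> uhp" for w unfolding E4_T E6_T Dfun_T ..
    show "?f (- 1 / w) = ?f w" if w: "w \<in> uhp" for w
    proof -
      have w0: "w \<noteq> 0" using w by (auto simp: uhp_iff)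
      have "(E4 (- 1 / w) ^ 3 - E6 (- 1 / w) ^ 2) = w ^ 12 * (E4 w ^ 3 - E6 w ^ 2)"
        unfolding E4_S[OF w] E6_S[OF w] power_mult_distrib power_mult[symmetric] by (simp add: algebra_simps)
      then show ?thesis unfolding Dfun_S[OF w] using w0 by simp
    qed
  qed
  have eq: "?f w = ?P (qe w)" if w: "w \<in> uhp" for w
  proof -
    have x: "qsig 3 (qe w) = qe w * qsig1 3 (qe w)" "qsig 5 (qe w) = qe w * qsig1 5 (qe w)"
      using qsig_qsig1[OF norm_qe_less_1[OF w]] by auto
    have alg: "((1 + 240 * (x * a)) ^ 3 - (1 - 504 * (x * b)) ^ 2) / (x * e) =
       (720 * a + 3 * 240 ^ 2 * x * a ^ 2 + 240 ^ 3 * x ^ 2 * a ^ 3 + 1008 * b - 504 ^ 2 * x * b ^ 2) * (1 / e)"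
      if "x \<noteq> 0" for x a b e :: complex
    proof -
      have "(1 + 240 * (x * a)) ^ 3 - (1 - 504 * (x * b)) ^ 2 = x *
         (720 * a + 3 * 240 ^ 2 * x * a ^ 2 + 240 ^ 3 * x ^ 2 * a ^ 3 + 1008 * b - 504 ^ 2 * x * b ^ 2)"
        by (simp add: algebra_simps power2_eq_square power3_eq_cube)
      then show ?thesis using that by simp
    qed
    have "1 / exp (- 24 * logser (qe w)) = exp (24 * logser (qe w))"
      by (simp add: exp_minus divide_inverse)
    then show ?thesis unfolding E4_def E6_def Dfun_qe x by (subst alg) (simp_all only: exp_not_eq_zero not_False_eq_True)
  qed
  have "(?P \<longlongrightarrow> ?P 0) (at 0)"
    by (intro tendsto_intros isContD has_fps_expansion_imp_continuous[OF qsig1_fps] has_fps_expansion_imp_continuous[OF logser_fps(1)])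
  then have l: "((\<lambda>w. ?P (qe w)) \<longlongrightarrow> ?P 0) at_ioo" by (rule filterlim_compose[OF _ qe_tendsto])
  have P0: "?P 0 = 1728" by (simp add: qsig1_0 logser_0)
  have ev: "eventually (\<lambda>w. ?P (qe w) = ?f w) at_ioo"
    unfolding eventually_at_ioo by (intro exI[of _ 1]) (auto simp: eq uhp_iff)
  have "(?f \<longlongrightarrow> 1728) at_ioo" by (rule Lim_transform_eventually[OF l[unfolded P0] ev])
  from maximum_principle_SL2[OF hol inv this z] show ?thesis by (simp add: divide_eq_eq)
qed

lemma klein_j_eq:
  assumes z: "z \<in> uhp" shows "klein_j z = E4 z ^ 3 / Dfun z"
proof -
  define g2 where "g2 = 60 * eisenstein_G 4 z"
  define g3 where "g3 = 140 * eisenstein_G 6 z"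
  have g2: "g2 ^ 3 = 64 * of_real pi ^ 12 / 27 * E4 z ^ 3"
    unfolding g2_def eisenstein_E4[OF z] by (simp add: power_mult_distrib power_divide power_mult[symmetric])
  have g3: "27 * g3 ^ 2 = 64 * of_real pi ^ 12 / 27 * E6 z ^ 2"
    unfolding g3_def eisenstein_E6[OF z] by (simp add: power_mult_distrib power_divide power_mult[symmetric])
  have "g2 ^ 3 - 27 * g3 ^ 2 = 64 * of_real pi ^ 12 / 27 * (E4 z ^ 3 - E6 z ^ 2)"
    unfolding g2 g3 by (simp add: algebra_simps)
  also have "\<dots> = 4096 * of_real pi ^ 12 * Dfun z" unfolding discriminant_identity[OF z] by simp
  finally have d: "g2 ^ 3 - 27 * g3 ^ 2 = 4096 * of_real pi ^ 12 * Dfun z" .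
  have "klein_j z = 1728 * g2 ^ 3 / (g2 ^ 3 - 27 * g3 ^ 2)" by (simp add: klein_j_def g2_def g3_def Let_def)
  also have "\<dots> = E4 z ^ 3 / Dfun z" unfolding d unfolding g2 by simp
  finally show ?thesis .
qed

text \<open>The law for a general matrix is inherited from E4 and E6 through the discriminant
  identity, instead of composing the laws for the generators.\<close>

lemma Dfun_mob:
  assumes z: "z \<in> uhp" and det: "a * d - b * c = 1"
  shows "Dfun (mob a b c d z) = (of_int c * z + of_int d) ^ 12 * Dfun z"
proof -
  have m: "mob a b c d z \<in> uhp" using mob_uhp[OF z, of a d b c] det by simp
  have "1728 * Dfun (mob a b c d z) = (of_int c * z + of_int d) ^ 12 * (E4 z ^ 3 - E6 z ^ 2)"
    unfolding discriminant_identity[OF m, symmetric] E4_mob[OF z det] E6_mob[OF z det] power_mult_distrib power_mult[symmetric]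
    by (simp add: algebra_simps)
  then show ?thesis unfolding discriminant_identity[OF z] by simp
qed

lemma klein_j_inv: "SL2_inv klein_j"
proof -
  have "klein_j (mob a b c d z) = klein_j z" if det: "a * d - b * c = 1" and z: "z \<in> uhp" for a b c d z
  proof -
    have m: "mob a b c d z \<in> uhp" using mob_uhp[OF z, of a d b c] det by simp
    have n0: "of_int c * z + of_int d \<noteq> 0" by (rule cocycle_nonzero[OF z]) (use det in auto)
    show ?thesis
      unfolding klein_j_eq[OF z] klein_j_eq[OF m] E4_mob[OF z det] Dfun_mob[OF z det] power_mult_distrib power_mult[symmetric]
      using n0 by simp
  qed
  then show ?thesis by (auto simp: SL2_inv_def)
qed

lemma holomorphic_klein_j: "klein_j holomorphic_on uhp"
proof -
  have "(\<lambda>z. E4 z ^ 3 / Dfun z) holomorphic_on uhp"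
    by (intro holomorphic_intros holomorphic_E4 holomorphic_Dfun) auto
  then show ?thesis by (rule holomorphic_transform) (simp add: klein_j_eq)
qed

section \<open>Functions with q-expansions over a subring\<close>

definition csubring :: "complex set \<Rightarrow> bool" where
  "csubring R \<longleftrightarrow> 0 \<in> R \<and> 1 \<in> R \<and> (\<forall>x\<in>R. \<forall>y\<in>R. x + y \<in> R \<and> x - y \<in> R \<and> x * y \<in> R)"

lemma csubringD:
  assumes "csubring R"
  shows "0 \<in> R" "1 \<in> R" "x \<in> R \<Longrightarrow> y \<in> R \<Longrightarrow> x + y \<in> R" "x \<in> R \<Longrightarrow> y \<in> R \<Longrightarrow> x - y \<in> R"
    "x \<in> R \<Longrightarrow> y \<in> R \<Longrightarrow> x * y \<in> R" "x \<in> R \<Longrightarrow> - x \<in> R"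
proof -
  show d: "0 \<in> R" "1 \<in> R" "x \<in> R \<Longrightarrow> y \<in> R \<Longrightarrow> x + y \<in> R" "\<And>x y. x \<in> R \<Longrightarrow> y \<in> R \<Longrightarrow> x - y \<in> R"
    "x \<in> R \<Longrightarrow> y \<in> R \<Longrightarrow> x * y \<in> R"
    using assms by (auto simp: csubring_def)
  show "x \<in> R \<Longrightarrow> - x \<in> R" using d(4)[OF d(1), of x] by simp
qed

lemma csubring_sum: "csubring R \<Longrightarrow> (\<And>i. i \<in> A \<Longrightarrow> f i \<in> R) \<Longrightarrow> sum f A \<in> R"
  by (induction A rule: infinite_finite_induct) (auto intro: csubringD)

lemma csubring_power: "csubring R \<Longrightarrow> x \<in> R \<Longrightarrow> x ^ n \<in> R"
  by (induction n) (auto intro: csubringD)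

lemma csubring_of_nat: "csubring R \<Longrightarrow> of_nat n \<in> R"
  by (induction n) (auto intro: csubringD)

lemma csubring_Ints: "csubring R \<Longrightarrow> x \<in> \<int> \<Longrightarrow> x \<in> R"
proof -
  assume R: "csubring R" and "x \<in> \<int>"
  then obtain n where "x = of_int n" by (elim Ints_cases)
  then show "x \<in> R"
    using csubring_of_nat[OF R, of "nat n"] csubringD(6)[OF R csubring_of_nat[OF R, of "nat (- n)"]]
    by (cases "n \<ge> 0") auto
qed

lemma csubring_UNIV: "csubring UNIV" by (simp add: csubring_def)
lemma csubring_IntsR: "csubring \<int>" by (simp add: csubring_def)
lemma csubring_Rats: "csubring \<rat>" by (simp add: csubring_def)
lemma csubring_algebraic_int: "csubring {x. algebraic_int x}"
  by (auto simp: csubring_def intro: algebraic_int_add algebraic_int_diff algebraic_int_mult)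

definition fpsR :: "complex set \<Rightarrow> complex fps \<Rightarrow> bool" where "fpsR R F \<longleftrightarrow> (\<forall>n. fps_nth F n \<in> R)"

lemma fpsR_mult: "csubring R \<Longrightarrow> fpsR R F \<Longrightarrow> fpsR R G \<Longrightarrow> fpsR R (F * G)"
  unfolding fpsR_def fps_mult_nth by (auto intro!: csubring_sum csubringD(5))

lemma fpsR_add: "csubring R \<Longrightarrow> fpsR R F \<Longrightarrow> fpsR R G \<Longrightarrow> fpsR R (F + G)"
  and fpsR_diff: "csubring R \<Longrightarrow> fpsR R F \<Longrightarrow> fpsR R G \<Longrightarrow> fpsR R (F - G)"
  unfolding fpsR_def by (auto intro!: csubringD)

lemma fpsR_const: "csubring R \<Longrightarrow> c \<in> R \<Longrightarrow> fpsR R (fps_const c)"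
  unfolding fpsR_def by (auto intro!: csubringD)

lemma fpsR_1: "csubring R \<Longrightarrow> fpsR R 1"
  using fpsR_const[of R 1] csubringD by (simp add: fps_const_1_eq_1)

lemma fpsR_power: "csubring R \<Longrightarrow> fpsR R F \<Longrightarrow> fpsR R (F ^ n)"
  by (induction n) (auto intro: fpsR_mult fpsR_1)

lemma fpsR_X_power: "csubring R \<Longrightarrow> fpsR R (fps_X ^ n)"
  unfolding fpsR_def by (auto simp: fps_X_power_nth intro: csubringD)

text \<open>With constant term 1 the recursion for the coefficients of the inverse involves no
  division.\<close>

lemma fpsR_inverse:
  assumes R: "csubring R" and F: "fpsR R F" and F0: "fps_nth F 0 = 1"
  shows "fpsR R (inverse F)"
  unfolding fpsR_def
proof
  fix n show "fps_nth (inverse F) n \<in> R"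
  proof (induction n rule: less_induct)
    case (less n)
    show ?case
    proof (cases n)
      case 0 then show ?thesis using F0 R csubringD(2) by simp
    next
      case (Suc m)
      have "fps_nth (F * inverse F) n = 0"
        using F0 Suc inverse_mult_eq_1'[of F] by simp
      moreover have "fps_nth (F * inverse F) n = fps_nth (inverse F) n + (\<Sum>i=1..n. fps_nth F i * fps_nth (inverse F) (n - i))"
        unfolding fps_mult_nth using F0 by (simp add: sum.atLeast_Suc_atMost)
      ultimately have "fps_nth (inverse F) n = - (\<Sum>i=1..n. fps_nth F i * fps_nth (inverse F) (n - i))"
        by (simp add: eq_neg_iff_add_eq_0)
      also have "\<dots> \<in> R" using less F Suc by (intro csubringD(6)[OF R] csubring_sum[OF R] csubringD(5)[OF R]) (auto simp: fpsR_def)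
      finally show ?thesis .
    qed
  qed
qed

text \<open>\<open>qx h f k F\<close>: in terms of \<open>x = q\<^bsup>1/h\<^esup>\<close>, the function \<open>f\<close> is \<open>x\<^bsup>-k\<^esup> F(x)\<close> near \<open>i\<infinity>\<close>.\<close>

definition qx :: "nat \<Rightarrow> (complex \<Rightarrow> complex) \<Rightarrow> nat \<Rightarrow> complex fps \<Rightarrow> bool" where
  "qx h f k F \<longleftrightarrow> (\<exists>u. u has_fps_expansion F \<and>
     (\<forall>\<^sub>F z in at_ioo. f z * qe (z / of_nat h) ^ k = u (qe (z / of_nat h))))"

lemma at_ioo_affine:
  assumes "a > 0" shows "filterlim (\<lambda>z. of_real a * z + c) at_ioo at_ioo"
proof -
  have "filterlim (\<lambda>y. a * y + Im c) at_top at_top" using assms by real_asymp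
  then have "filterlim (\<lambda>z. a * Im z + Im c) at_top at_ioo" by (rule filterlim_compose) (rule filterlim_filtercomap)
  then show ?thesis by (simp add: filterlim_filtercomap_iff o_def)
qed

lemma qe_scaled_tendsto:
  assumes "h > 0" shows "filterlim (\<lambda>z. qe (z / of_nat h)) (at 0) at_ioo"
proof -
  have "filterlim (\<lambda>z. qe (of_real (1 / real h) * z + 0)) (at 0) at_ioo"
    by (rule filterlim_compose[OF qe_tendsto at_ioo_affine]) (use assms in simp)
  then show ?thesis by simp
qed

text \<open>Every small nonzero x is q^(1/h) at some z high in the half plane, obtained from the
  complex logarithm. Identities near the cusp thus become identities of germs at 0.\<close>

lemma eventually_at_0_of_at_ioo:
  assumes "h > 0" "\<forall>\<^sub>F z in at_ioo. P (qe (z / of_nat h))"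
  shows "\<forall>\<^sub>F x in at 0. P x"
proof -
  obtain Y where Y: "\<And>z. Im z \<ge> Y \<Longrightarrow> P (qe (z / of_nat h))" using assms(2) by (auto simp: eventually_at_ioo)
  have "P x" if "x \<noteq> 0" "dist x 0 < exp (- (2 * pi * \<bar>Y\<bar> / real h))" for x
  proof -
    define z where "z = of_nat h * Ln x / (2 * of_real pi * \<i>)"
    have e: "qe (z / of_nat h) = x" using assms(1) that(1) by (simp add: z_def)
    have "ln (norm x) < - (2 * pi * \<bar>Y\<bar> / real h)" using that by (subst exp_less_cancel_iff[symmetric]) (simp add: exp_ln)
    then have "ln (norm x) * real h < - (2 * pi * \<bar>Y\<bar>)" using assms(1) by (simp add: field_simps)
    then have "2 * pi * Y \<le> - (real h * ln (norm x))" by (smt (verit) mult.commute mult_left_mono pi_ge_zero)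
    then have "Y \<le> - (real h * ln (norm x)) / (2 * pi)"
      by (subst pos_le_divide_eq) (simp_all add: mult.commute)
    also have "\<dots> = Im z" using that(1) by (simp add: z_def Im_divide Re_Ln power2_eq_square)
    finally show ?thesis using Y[of z] e by simp
  qed
  then show ?thesis unfolding eventually_at by (intro exI[of _ "exp (- (2 * pi * \<bar>Y\<bar> / real h))"]) auto
qed

lemma fps_expansion_unique_at_0:
  fixes u v :: "complex \<Rightarrow> complex"
  assumes "u has_fps_expansion F" "v has_fps_expansion G" "\<forall>\<^sub>F x in at 0. u x = v x"
  shows "F = G"
proof -
  have "u has_laurent_expansion fps_to_fls F" "v has_laurent_expansion fps_to_fls G"
    by (rule has_laurent_expansion_fps[OF assms(1)], rule has_laurent_expansion_fps[OF assms(2)])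
  moreover have "v has_laurent_expansion fps_to_fls F"
    using calculation(1) has_laurent_expansion_cong[OF assms(3) refl] by blast
  ultimately have "fps_to_fls F = fps_to_fls G" using has_laurent_expansion_unique by blast
  then show ?thesis by simp
qed

lemma qx_unique:
  assumes "h > 0" "qx h f k F" "qx h g k G" "\<forall>\<^sub>F z in at_ioo. f z = g z" shows "F = G"
proof -
  obtain u v where u: "u has_fps_expansion F" "\<forall>\<^sub>F z in at_ioo. f z * qe (z / of_nat h) ^ k = u (qe (z / of_nat h))"
    and v: "v has_fps_expansion G" "\<forall>\<^sub>F z in at_ioo. g z * qe (z / of_nat h) ^ k = v (qe (z / of_nat h))"
    using assms by (auto simp: qx_def)
  have "\<forall>\<^sub>F z in at_ioo. u (qe (z / of_nat h)) = v (qe (z / of_nat h))"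
    using u(2) v(2) assms(4) by eventually_elim metis
  from fps_expansion_unique_at_0[OF u(1) v(1) eventually_at_0_of_at_ioo[OF assms(1) this]] show ?thesis .
qed

lemma qx_const: "qx h (\<lambda>_. c) 0 (fps_const c)"
  unfolding qx_def by (intro exI[of _ "\<lambda>_. c"]) (auto intro: fps_expansion_intros)

lemma has_fps_expansion_X_power: "(\<lambda>x::complex. x ^ n) has_fps_expansion fps_X ^ n"
  by (intro fps_expansion_intros)

lemma qx_shift: assumes "qx h f k F" shows "qx h f (k + m) (F * fps_X ^ m)"
proof -
  obtain u where u: "u has_fps_expansion F" "\<forall>\<^sub>F z in at_ioo. f z * qe (z / of_nat h) ^ k = u (qe (z / of_nat h))"
    using assms by (auto simp: qx_def)
  have "(\<lambda>x. u x * x ^ m) has_fps_expansion F * fps_X ^ m"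
    by (rule has_fps_expansion_mult[OF u(1) has_fps_expansion_X_power])
  moreover have "\<forall>\<^sub>F z in at_ioo. f z * qe (z / of_nat h) ^ (k + m) = u (qe (z / of_nat h)) * qe (z / of_nat h) ^ m"
    using u(2) by eventually_elim (simp only: power_add mult.assoc[symmetric])
  ultimately show ?thesis unfolding qx_def by blast
qed

lemma qx_mult: assumes "qx h f k F" "qx h g l G" shows "qx h (\<lambda>z. f z * g z) (k + l) (F * G)"
proof -
  obtain u v where u: "u has_fps_expansion F" "\<forall>\<^sub>F z in at_ioo. f z * qe (z / of_nat h) ^ k = u (qe (z / of_nat h))"
    and v: "v has_fps_expansion G" "\<forall>\<^sub>F z in at_ioo. g z * qe (z / of_nat h) ^ l = v (qe (z / of_nat h))"
    using assms by (auto simp: qx_def)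
  have "\<forall>\<^sub>F z in at_ioo. f z * g z * qe (z / of_nat h) ^ (k + l) = u (qe (z / of_nat h)) * v (qe (z / of_nat h))"
    using u(2) v(2)
  proof eventually_elim
    case (elim z)
    show ?case unfolding elim[symmetric] by (simp only: power_add mult_ac)
  qed
  then show ?thesis unfolding qx_def using has_fps_expansion_mult[OF u(1) v(1)] by blast
qed

lemma qx_add_same: assumes "qx h f k F" "qx h g k G" shows "qx h (\<lambda>z. f z + g z) k (F + G)"
proof -
  obtain u v where u: "u has_fps_expansion F" "\<forall>\<^sub>F z in at_ioo. f z * qe (z / of_nat h) ^ k = u (qe (z / of_nat h))"
    and v: "v has_fps_expansion G" "\<forall>\<^sub>F z in at_ioo. g z * qe (z / of_nat h) ^ k = v (qe (z / of_nat h))"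
    using assms by (auto simp: qx_def)
  have "\<forall>\<^sub>F z in at_ioo. (f z + g z) * qe (z / of_nat h) ^ k = u (qe (z / of_nat h)) + v (qe (z / of_nat h))"
    using u(2) v(2) by eventually_elim (simp only: distrib_right)
  then show ?thesis unfolding qx_def using has_fps_expansion_add[OF u(1) v(1)] by blast
qed

lemma qx_add: assumes "qx h f k F" "qx h g l G"
  shows "qx h (\<lambda>z. f z + g z) (k + l) (F * fps_X ^ l + G * fps_X ^ k)"
  using qx_add_same[OF qx_shift[OF assms(1), of l] qx_shift[OF assms(2), of k, unfolded add.commute[of l k]]] .

lemma qx_cong: assumes "qx h f k F" "\<And>z. z \<in> uhp \<Longrightarrow> f z = g z" shows "qx h g k F"
proof -
  obtain u where u: "u has_fps_expansion F" "\<forall>\<^sub>F z in at_ioo. f z * qe (z / of_nat h) ^ k = u (qe (z / of_nat h))"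
    using assms by (auto simp: qx_def)
  have "\<forall>\<^sub>F z in at_ioo. z \<in> uhp" unfolding eventually_at_ioo by (intro exI[of _ 1]) (auto simp: uhp_iff)
  with u(2) have "\<forall>\<^sub>F z in at_ioo. g z * qe (z / of_nat h) ^ k = u (qe (z / of_nat h))"
    by eventually_elim (simp add: assms(2))
  then show ?thesis unfolding qx_def using u(1) by blast
qed

lemma fps_compose_scale_X:
  "csubring R \<Longrightarrow> fpsR R F \<Longrightarrow> c \<in> R \<Longrightarrow> fpsR R (F oo (fps_const c * fps_X))"
  unfolding fpsR_def fps_compose_linear by (auto intro: csubringD(5) csubring_power)

lemma fps_compose_X_power: "csubring R \<Longrightarrow> fpsR R F \<Longrightarrow> fpsR R (F oo fps_X ^ m)"
  unfolding fpsR_def fps_nth_compose_X_power by (auto intro: csubringD(1))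

text \<open>In terms of x = q^(1/h) with h = \<open>\<alpha> * \<delta>\<close>, the scaling raises
  x to the power \<open>\<alpha>\<close>^2, and the translation contributes the root of unity
  \<open>\<zeta>\<close>.\<close>

lemma qx_affine:
  fixes \<alpha> \<beta> \<delta> h k :: nat
  assumes f: "qx 1 f k F" and ad: "\<alpha> > 0" "\<delta> > 0" "h = \<alpha> * \<delta>"
  defines "\<zeta> \<equiv> qe (of_nat \<beta> / of_nat \<delta>)"
  shows "qx h (\<lambda>z. f ((of_nat \<alpha> * z + of_nat \<beta>) / of_nat \<delta>)) (\<alpha> ^ 2 * k)
     (fps_const (inverse \<zeta> ^ k) * ((F oo (fps_const \<zeta> * fps_X)) oo fps_X ^ (\<alpha> ^ 2)))"
proof -
  obtain u where u: "u has_fps_expansion F" "\<forall>\<^sub>F z in at_ioo. f z * qe z ^ k = u (qe z)"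
    using f by (auto simp: qx_def)
  have z0: "\<zeta> \<noteq> 0" by (simp add: \<zeta>_def)
  have "(u \<circ> (\<lambda>x. \<zeta> * x)) has_fps_expansion (F oo (fps_const \<zeta> * fps_X))"
    by (rule has_fps_expansion_compose[OF u(1)]) (auto intro: fps_expansion_intros)
  then have "((u \<circ> (\<lambda>x. \<zeta> * x)) \<circ> (\<lambda>x. x ^ (\<alpha> ^ 2))) has_fps_expansion ((F oo (fps_const \<zeta> * fps_X)) oo fps_X ^ (\<alpha> ^ 2))"
    by (rule has_fps_expansion_compose[OF _ has_fps_expansion_X_power]) (use ad in simp)
  then have v: "(\<lambda>x. inverse \<zeta> ^ k * ((u \<circ> (\<lambda>x. \<zeta> * x)) \<circ> (\<lambda>x. x ^ (\<alpha> ^ 2))) x) has_fps_expansion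
     (fps_const (inverse \<zeta> ^ k) * ((F oo (fps_const \<zeta> * fps_X)) oo fps_X ^ (\<alpha> ^ 2)))"
    by (rule has_fps_expansion_cmult_left)
  have "filterlim (\<lambda>z. of_real (real \<alpha> / real \<delta>) * z + of_nat \<beta> / of_nat \<delta>) at_ioo at_ioo"
    by (rule at_ioo_affine) (use ad in simp)
  then have "filterlim (\<lambda>z. (of_nat \<alpha> * z + of_nat \<beta>) / of_nat \<delta>) at_ioo at_ioo" by (simp add: add_divide_distrib)
  from eventually_compose_filterlim[OF u(2) this]
  have "\<forall>\<^sub>F z in at_ioo. f ((of_nat \<alpha> * z + of_nat \<beta>) / of_nat \<delta>) * qe (z / of_nat h) ^ (\<alpha> ^ 2 * k) =
     inverse \<zeta> ^ k * ((u \<circ> (\<lambda>x. \<zeta> * x)) \<circ> (\<lambda>x. x ^ (\<alpha> ^ 2))) (qe (z / of_nat h))"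
  proof eventually_elim
    case (elim z)
    let ?w = "(of_nat \<alpha> * z + of_nat \<beta>) / of_nat \<delta> :: complex" and ?x = "qe (z / of_nat h)"
    have "qe ?w = \<zeta> * ?x ^ (\<alpha> ^ 2)"
    proof -
      have "of_nat (\<alpha> ^ 2) * (z / of_nat h) = of_nat \<alpha> * z / of_nat \<delta>"
        using ad by (simp add: power2_eq_square)
      then have "?w = of_nat \<beta> / of_nat \<delta> + of_nat (\<alpha> ^ 2) * (z / of_nat h)" by (simp add: add_divide_distrib)
      then show ?thesis unfolding qe_of_nat[symmetric] \<zeta>_def exp_add[symmetric] by (simp add: distrib_left)
    qed
    then have "f ?w * (\<zeta> * ?x ^ (\<alpha> ^ 2)) ^ k = u (\<zeta> * ?x ^ (\<alpha> ^ 2))" using elim by simp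
    then have A: "inverse \<zeta> ^ k * (f ?w * (\<zeta> * ?x ^ (\<alpha> ^ 2)) ^ k) = inverse \<zeta> ^ k * u (\<zeta> * ?x ^ (\<alpha> ^ 2))"
      by (simp only:)
    have B: "inverse \<zeta> ^ k * (f ?w * (\<zeta> * ?x ^ (\<alpha> ^ 2)) ^ k) = f ?w * ?x ^ (\<alpha> ^ 2 * k)"
    proof -
      have "inverse \<zeta> ^ k * (f ?w * (\<zeta> * ?x ^ (\<alpha> ^ 2)) ^ k) = (inverse \<zeta> * \<zeta>) ^ k * (f ?w * (?x ^ (\<alpha> ^ 2)) ^ k)"
        by (simp only: power_mult_distrib mult_ac)
      then show ?thesis using z0 by (simp add: power_mult)
    qed
    show ?case unfolding o_def using B[symmetric] A by (rule trans)
  qed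
  then show ?thesis unfolding qx_def using v by blast
qed

text \<open>Meromorphic at the cusp with coefficients in R. Only the cusp at infinity is inspected
  here; the others come in through the conjugates of a function.\<close>

definition MG :: "nat \<Rightarrow> complex set \<Rightarrow> (complex \<Rightarrow> complex) \<Rightarrow> bool" where
  "MG h R f \<longleftrightarrow> f holomorphic_on uhp \<and> (\<exists>k F. fpsR R F \<and> qx h f k F)"

lemma MG_const: "csubring R \<Longrightarrow> c \<in> R \<Longrightarrow> MG h R (\<lambda>_. c)"
  unfolding MG_def by (intro conjI exI[of _ 0] exI[of _ "fps_const c"] qx_const fpsR_const holomorphic_intros)

lemma MG_mult: "csubring R \<Longrightarrow> MG h R f \<Longrightarrow> MG h R g \<Longrightarrow> MG h R (\<lambda>z. f z * g z)"
proof -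
  assume R: "csubring R" and "MG h R f" "MG h R g"
  then obtain k F l G where "f holomorphic_on uhp" "fpsR R F" "qx h f k F" "g holomorphic_on uhp" "fpsR R G" "qx h g l G"
    unfolding MG_def by blast
  then show ?thesis unfolding MG_def
    by (intro conjI exI[of _ "k + l"] exI[of _ "F * G"] holomorphic_on_mult fpsR_mult R qx_mult)
qed

lemma MG_add: "csubring R \<Longrightarrow> MG h R f \<Longrightarrow> MG h R g \<Longrightarrow> MG h R (\<lambda>z. f z + g z)"
proof -
  assume R: "csubring R" and "MG h R f" "MG h R g"
  then obtain k F l G where "f holomorphic_on uhp" "fpsR R F" "qx h f k F" "g holomorphic_on uhp" "fpsR R G" "qx h g l G"
    unfolding MG_def by blast
  then show ?thesis unfolding MG_def
    by (intro conjI exI[of _ "k + l"] exI[of _ "F * fps_X ^ l + G * fps_X ^ k"] holomorphic_on_add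
       fpsR_add fpsR_mult fpsR_X_power R qx_add)
qed

lemma MG_uminus: "csubring R \<Longrightarrow> MG h R f \<Longrightarrow> MG h R (\<lambda>z. - f z)"
  using MG_mult[OF _ MG_const[of R "-1" h], of f] csubringD(2,6) by simp

lemma MG_power: "csubring R \<Longrightarrow> MG h R f \<Longrightarrow> MG h R (\<lambda>z. f z ^ n)"
  by (induction n) (auto intro: MG_mult MG_const csubringD)

lemma MG_sum: "csubring R \<Longrightarrow> (\<And>i. i \<in> A \<Longrightarrow> MG h R (f i)) \<Longrightarrow> MG h R (\<lambda>z. \<Sum>i\<in>A. f i z)"
  by (induction A rule: infinite_finite_induct) (auto intro: MG_add MG_const csubringD)

lemma MG_cong: "MG h R f \<Longrightarrow> (\<And>z. z \<in> uhp \<Longrightarrow> f z = g z) \<Longrightarrow> MG h R g"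
proof -
  assume "MG h R f" and e: "\<And>z. z \<in> uhp \<Longrightarrow> f z = g z"
  then obtain k F where "f holomorphic_on uhp" "fpsR R F" "qx h f k F" unfolding MG_def by blast
  then have "g holomorphic_on uhp" "qx h g k F"
    using holomorphic_transform[of f uhp g] qx_cong[of h f k F g] e by auto
  then show "MG h R g" unfolding MG_def using \<open>fpsR R F\<close> by blast
qed

lemma MG_mono: "MG h R f \<Longrightarrow> R \<subseteq> S \<Longrightarrow> MG h S f"
  unfolding MG_def fpsR_def by blast

section \<open>Integrality of the q-expansions of Delta and j\<close>

definition E4fps :: "complex fps" where "E4fps = 1 + fps_const 240 * sigfps 3"
definition E6fps :: "complex fps" where "E6fps = 1 - fps_const 504 * sigfps 5"
definition Dfps :: "complex fps" where "Dfps = fps_const (1/1728) * (E4fps ^ 3 - E6fps ^ 2)"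

lemma sigfps_int: "fpsR \<int> (sigfps j)" by (simp add: fpsR_def sigfps_def)

lemma E4fps_int: "fpsR \<int> E4fps"
  unfolding E4fps_def by (intro fpsR_add fpsR_1 fpsR_mult fpsR_const sigfps_int csubring_IntsR) auto

text \<open>The part of (E4^3 - E6^2) / 1728 that is linear in the divisor sums is (5 sigma_3 + 7
  sigma_5) / 12. Its integrality is a check of residues modulo 12 for each divisor.\<close>

lemma sig_congruence: "12 dvd 5 * sig 3 N + 7 * sig 5 N"
proof -
  have d: "12 dvd 5 * d ^ 3 + 7 * d ^ 5" for d :: nat
  proof -
    have "(5 * d ^ 3 + 7 * d ^ 5) mod 12 = (5 * (d mod 12) ^ 3 + 7 * (d mod 12) ^ 5) mod 12"
      by (intro mod_add_cong mod_mult_cong refl) (simp_all only: power_mod)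
    also have "\<dots> = 0"
    proof -
      have r: "\<forall>r\<in>{..<12}. (5 * r ^ 3 + 7 * r ^ 5) mod 12 = (0::nat)"
        by (simp add: lessThan_nat_numeral)
      have "d mod 12 \<in> {..<12}" by simp
      with r show ?thesis by (rule bspec)
    qed
    finally show ?thesis by (simp add: dvd_eq_mod_eq_0)
  qed
  have "5 * sig 3 N + 7 * sig 5 N = (\<Sum>d | d dvd N. 5 * d ^ 3 + 7 * d ^ 5)"
    by (simp add: sig_def sum.distrib sum_distrib_left)
  then show ?thesis using d by (simp add: dvd_sum)
qed

lemma Dfps_int: "fpsR \<int> Dfps"
proof -
  define A :: "complex fps" where "A = fps_const (1/12) * (fps_const 5 * sigfps 3 + fps_const 7 * sigfps 5)"
  have A: "fpsR \<int> A"
    unfolding fpsR_def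
  proof
    fix n
    obtain k where k: "5 * sig 3 n + 7 * sig 5 n = 12 * k" using sig_congruence[of n] by blast
    have "fps_nth A n = of_nat (5 * sig 3 n + 7 * sig 5 n) / 12" by (simp add: A_def sigfps_def)
    also have "\<dots> = of_nat k" unfolding k by simp
    finally show "fps_nth A n \<in> \<int>" by simp
  qed
  \<comment> \<open>The quadratic and cubic coefficients are multiples of 1728, with quotients 100,
    8000 and 147; only the linear part retains a denominator. The names \<open>c240\<close> and
    \<open>c504\<close> keep the constants folded while powers are expanded.\<close>
  have "fps_const (1/1728) * ((1 + c240 * a) ^ 3 - (1 - c504 * b) ^ 2) =
      fps_const (1/12) * (fps_const 5 * a + fps_const 7 * b) + fps_const 100 * a ^ 2 + fps_const 8000 * a ^ 3 - fps_const 147 * b ^ 2"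
    if "c240 = fps_const 240" "c504 = fps_const 504" for a b c240 c504 :: "complex fps"
  proof -
    have "(1 + c240 * a) ^ 3 - (1 - c504 * b) ^ 2 =
      (3 * c240) * a + (3 * c240 ^ 2) * a ^ 2 + c240 ^ 3 * a ^ 3 + (2 * c504) * b - c504 ^ 2 * b ^ 2"
      by (simp add: algebra_simps power2_eq_square power3_eq_cube)
    moreover have "3 * c240 = fps_const 720" "3 * c240 ^ 2 = fps_const 172800" "c240 ^ 3 = fps_const 13824000"
       "2 * c504 = fps_const 1008" "c504 ^ 2 = fps_const 254016"
      unfolding that by (simp_all add: fps_const_power numeral_fps_const)
    ultimately have "fps_const (1/1728) * ((1 + c240 * a) ^ 3 - (1 - c504 * b) ^ 2) =
       fps_const (1/1728) * (fps_const 720 * a + fps_const 172800 * a ^ 2 + fps_const 13824000 * a ^ 3 + fps_const 1008 * b - fps_const 254016 * b ^ 2)"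
      by (simp only:)
    also have "\<dots> = fps_const (1/1728 * 720) * a + fps_const (1/1728 * 172800) * a ^ 2 + fps_const (1/1728 * 13824000) * a ^ 3
       + fps_const (1/1728 * 1008) * b - fps_const (1/1728 * 254016) * b ^ 2"
      by (simp only: fps_const_mult[symmetric] ring_distribs mult.assoc right_diff_distrib)
    also have "\<dots> = fps_const (1/12) * (fps_const 5 * a + fps_const 7 * b) + fps_const 100 * a ^ 2 + fps_const 8000 * a ^ 3 - fps_const 147 * b ^ 2"
      by (simp add: ring_distribs mult.assoc[symmetric])
    finally show ?thesis .
  qed
  from this[OF refl refl, of "sigfps 3" "sigfps 5"]
  have eq: "Dfps = A + fps_const 100 * sigfps 3 ^ 2 + fps_const 8000 * sigfps 3 ^ 3 - fps_const 147 * sigfps 5 ^ 2"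
    by (simp only: Dfps_def E4fps_def E6fps_def A_def)
  show ?thesis unfolding eq
    by (intro fpsR_add fpsR_diff fpsR_mult fpsR_const fpsR_power sigfps_int A csubring_IntsR) auto
qed

lemma qx_1I: "u has_fps_expansion F \<Longrightarrow> (\<And>z. z \<in> uhp \<Longrightarrow> f z * qe z ^ k = u (qe z)) \<Longrightarrow> qx 1 f k F"
  unfolding qx_def by (intro exI[of _ u]) (auto simp: eventually_at_ioo uhp_iff intro!: exI[of _ 1])

lemma qx_E4: "qx 1 E4 0 E4fps"
  by (rule qx_1I[of "\<lambda>x. 1 + 240 * qsig 3 x"])
    (auto simp: E4_def E4fps_def intro!: fps_expansion_intros qsig_fps)

text \<open>The series of Delta / q, with constant term 1. Its integrality will be read off from
  \<open>Dfps\<close>, because the logarithm in the exponent has denominators.\<close>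

definition Ufps :: "complex fps" where "Ufps = fps_expansion (\<lambda>x. exp (- 24 * logser x)) 0"

lemma Ufps: "(\<lambda>x. exp (- 24 * logser x)) has_fps_expansion Ufps"
proof -
  have "(\<lambda>x. exp (- 24 * logser x)) analytic_on {0}"
    by (intro analytic_intros holomorphic_on_imp_analytic_at[OF logser_fps(2)]) auto
  then show ?thesis unfolding Ufps_def by (rule analytic_at_imp_has_fps_expansion_0)
qed

lemma Dfps_Ufps: "Dfps = fps_X * Ufps"
proof (rule fps_expansion_unique_at_0)
  show "(\<lambda>x. x * exp (- 24 * logser x)) has_fps_expansion fps_X * Ufps"
    by (intro has_fps_expansion_mult Ufps fps_expansion_intros)
  show "(\<lambda>x. (1/1728) * ((1 + 240 * qsig 3 x) ^ 3 - (1 - 504 * qsig 5 x) ^ 2)) has_fps_expansion Dfps"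
    unfolding Dfps_def E4fps_def E6fps_def by (intro fps_expansion_intros qsig_fps)
  have "\<forall>\<^sub>F z in at_ioo. (1/1728) * ((1 + 240 * qsig 3 (qe (z / of_nat 1))) ^ 3 - (1 - 504 * qsig 5 (qe (z / of_nat 1))) ^ 2) =
      qe (z / of_nat 1) * exp (- 24 * logser (qe (z / of_nat 1)))"
    unfolding eventually_at_ioo
    using discriminant_identity unfolding E4_def E6_def Dfun_qe
    by (intro exI[of _ 1]) (simp add: uhp_iff)
  from eventually_at_0_of_at_ioo[OF _ this]
  show "\<forall>\<^sub>F x in at 0. (1/1728) * ((1 + 240 * qsig 3 x) ^ 3 - (1 - 504 * qsig 5 x) ^ 2) = x * exp (- 24 * logser x)" by simp
qed

lemma Ufps_int: "fpsR \<int> Ufps"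
proof -
  have "fps_nth Ufps n = fps_nth Dfps (Suc n)" for n unfolding Dfps_Ufps by simp
  then show ?thesis using Dfps_int by (simp add: fpsR_def)
qed

lemma Ufps_0: "fps_nth Ufps 0 = 1"
  using has_fps_expansion_imp_0_eq_fps_nth_0[OF Ufps] by (simp add: logser_0)

lemma qx_Dfun: "qx 1 Dfun 0 (fps_X * Ufps)"
  by (rule qx_1I[OF has_fps_expansion_mult[OF has_fps_expansion_fps_X Ufps]]) (simp add: Dfun_qe)

lemma qx_inverse_Dfun: "qx 1 (\<lambda>z. 1 / Dfun z) 1 (inverse Ufps)"
proof (rule qx_1I)
  show "(\<lambda>x. inverse (exp (- 24 * logser x))) has_fps_expansion inverse Ufps"
    by (rule has_fps_expansion_inverse[OF Ufps]) (simp add: Ufps_0)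
  show "1 / Dfun z * qe z ^ 1 = inverse (exp (- 24 * logser (qe z)))" for z
    unfolding Dfun_qe by (simp add: divide_inverse)
qed

definition Jfps :: "complex fps" where "Jfps = E4fps ^ 3 * inverse Ufps"

lemma Jfps_int: "fpsR \<int> Jfps"
  unfolding Jfps_def by (intro fpsR_mult fpsR_power fpsR_inverse E4fps_int Ufps_int Ufps_0 csubring_IntsR)

lemma Jfps_0: "fps_nth Jfps 0 = 1"
  by (simp add: Jfps_def E4fps_def Ufps_0 sigfps_def fps_nth_power_0)

lemma qx_j: "qx 1 klein_j 1 Jfps"
proof -
  have "qx 1 (\<lambda>z. E4 z * E4 z * E4 z * (1 / Dfun z)) (0 + 0 + 0 + 1) (E4fps * E4fps * E4fps * inverse Ufps)"
    by (intro qx_mult qx_E4 qx_inverse_Dfun)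
  then have "qx 1 (\<lambda>z. E4 z * E4 z * E4 z * (1 / Dfun z)) 1 Jfps" by (simp add: Jfps_def power3_eq_cube)
  then show ?thesis by (rule qx_cong) (simp add: klein_j_eq power3_eq_cube)
qed

section \<open>Level one functions as polynomials in j\<close>

lemma qx_zero:
  assumes h: "h > 0" and hol: "f holomorphic_on uhp" and q: "qx h f k 0" and z: "z \<in> uhp"
  shows "f z = 0"
proof -
  obtain u where u: "u has_fps_expansion 0" "\<forall>\<^sub>F z in at_ioo. f z * qe (z / of_nat h) ^ k = u (qe (z / of_nat h))"
    using q by (auto simp: qx_def)
  have "\<forall>\<^sub>F x in nhds 0. u x = 0" using u(1) by (simp add: has_fps_expansion_0_iff)
  then have "\<forall>\<^sub>F x in at 0. u x = 0" by (simp add: eventually_nhds_conv_at)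
  then have "\<forall>\<^sub>F z in at_ioo. u (qe (z / of_nat h)) = 0"
    by (rule eventually_compose_filterlim[OF _ qe_scaled_tendsto[OF h]])
  with u(2) have "\<forall>\<^sub>F z in at_ioo. f z = 0" by eventually_elim simp
  then obtain Y where Y: "\<And>z. Im z \<ge> Y \<Longrightarrow> f z = 0" by (auto simp: eventually_at_ioo)
  have o: "open {z. Im z > max Y 0}" by (rule open_halfspace_Im_gt)
  show ?thesis
  proof (rule analytic_continuation_open[OF o open_uhp _ connected_uhp _ hol _ _ z, of "\<lambda>_. 0"])
    have "max Y 0 < max Y 0 + 1" by linarith
    then have "Complex 0 (max Y 0 + 1) \<in> {z. Im z > max Y 0}" by (simp only: mem_Collect_eq complex.sel)
    then show "{z. Im z > max Y 0} \<noteq> {}" by blast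
  qed (auto simp: uhp_iff Y)
qed

text \<open>Translation by 1 multiplies q^(1/h) by a primitive h-th root of unity. Every exponent
  that occurs must therefore be an integral power of q after accounting for the shift by k.\<close>

lemma qx_periodic:
  assumes h: "h > 0" and q: "qx h f k F" and T: "\<And>z. z \<in> uhp \<Longrightarrow> f (z + 1) = f z" and n: "fps_nth F n \<noteq> 0"
  shows "int h dvd int n - int k"
proof -
  obtain u where u: "u has_fps_expansion F" "\<forall>\<^sub>F z in at_ioo. f z * qe (z / of_nat h) ^ k = u (qe (z / of_nat h))"
    using q by (auto simp: qx_def)
  define \<zeta> where "\<zeta> = qe (1 / of_nat h)"
  have v: "(\<lambda>x. u (\<zeta> * x)) has_fps_expansion (F oo (fps_const \<zeta> * fps_X))"
    using has_fps_expansion_compose[OF u(1), of "\<lambda>x. \<zeta> * x" "fps_const \<zeta> * fps_X"]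
    by (simp add: o_def has_fps_expansion_cmult_left has_fps_expansion_fps_X)
  have w: "(\<lambda>x. \<zeta> ^ k * u x) has_fps_expansion fps_const (\<zeta> ^ k) * F"
    by (rule has_fps_expansion_cmult_left[OF u(1)])
  have "filterlim (\<lambda>z. of_real 1 * z + 1) at_ioo at_ioo" by (rule at_ioo_affine) simp
  then have "filterlim (\<lambda>z. z + 1) at_ioo at_ioo" by simp
  from eventually_compose_filterlim[OF u(2) this]
  have e1: "\<forall>\<^sub>F z in at_ioo. f (z + 1) * qe ((z + 1) / of_nat h) ^ k = u (qe ((z + 1) / of_nat h))" .
  have e2: "\<forall>\<^sub>F z in at_ioo. z \<in> uhp" unfolding eventually_at_ioo by (intro exI[of _ 1]) (auto simp: uhp_iff)
  have "\<forall>\<^sub>F z in at_ioo. u (\<zeta> * qe (z / of_nat h)) = \<zeta> ^ k * u (qe (z / of_nat h))"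
    using e1 e2 u(2)
  proof eventually_elim
    case (elim z)
    have "qe ((z + 1) / of_nat h) = \<zeta> * qe (z / of_nat h)"
      unfolding \<zeta>_def exp_add[symmetric] by (simp add: add_divide_distrib distrib_left add.commute)
    then have "u (\<zeta> * qe (z / of_nat h)) = f z * (\<zeta> * qe (z / of_nat h)) ^ k" using elim T by metis
    also have "\<dots> = \<zeta> ^ k * (f z * qe (z / of_nat h) ^ k)" by (simp only: power_mult_distrib mult_ac)
    finally show ?case unfolding elim(3) .
  qed
  from fps_expansion_unique_at_0[OF v w eventually_at_0_of_at_ioo[OF h this]]
  have "fps_nth (F oo (fps_const \<zeta> * fps_X)) n = fps_nth (fps_const (\<zeta> ^ k) * F) n" by simp
  then have "\<zeta> ^ n = \<zeta> ^ k" using n by (simp add: fps_compose_linear)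
  then have "qe (of_nat n * (1 / of_nat h)) = qe (of_nat k * (1 / of_nat h))" unfolding qe_of_nat \<zeta>_def .
  then obtain m :: int where "2 * of_real pi * \<i> * (of_nat n * (1 / of_nat h)) = 2 * of_real pi * \<i> * (of_nat k * (1 / of_nat h)) + of_real (of_int (2 * m) * pi) * \<i>"
    unfolding exp_eq by (auto simp: mult_ac)
  then have "2 * of_real pi * \<i> * (of_nat n * (1 / of_nat h)) = 2 * of_real pi * \<i> * (of_nat k * (1 / of_nat h) + of_int m)"
    by (simp add: algebra_simps)
  moreover have "2 * of_real pi * \<i> \<noteq> 0" by simp
  ultimately have "(of_nat n * (1 / of_nat h) :: complex) = of_nat k * (1 / of_nat h) + of_int m"
    using mult_left_cancel by blast
  then have "(of_nat n / of_nat h :: complex) = of_nat k / of_nat h + of_int m" by simp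
  then have "(of_nat n / of_nat h) * of_nat h = (of_nat k / of_nat h + of_int m) * (of_nat h :: complex)" by (simp only:)
  then have "of_int (int n) = (of_int (int k + m * int h) :: complex)" using h by (simp add: distrib_right)
  then have "int n = int k + m * int h" by (simp only: of_int_eq_iff)
  then show ?thesis by simp
qed

lemma filterlim_at_ioo_qx:
  assumes h: "h > 0" and q: "qx h f k F"
  shows "((\<lambda>z. f z * qe (z / of_nat h) ^ k) \<longlongrightarrow> fps_nth F 0) at_ioo"
proof -
  obtain u where u: "u has_fps_expansion F" "\<forall>\<^sub>F z in at_ioo. f z * qe (z / of_nat h) ^ k = u (qe (z / of_nat h))"
    using q by (auto simp: qx_def)
  have "(u \<longlongrightarrow> u 0) (at 0)" by (rule isContD[OF has_fps_expansion_imp_continuous[OF u(1)]])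
  then have "(u \<longlongrightarrow> fps_nth F 0) (at 0)" using has_fps_expansion_imp_0_eq_fps_nth_0[OF u(1)] by simp
  from filterlim_compose[OF this qe_scaled_tendsto[OF h]]
  have "((\<lambda>z. u (qe (z / of_nat h))) \<longlongrightarrow> fps_nth F 0) at_ioo" .
  then show ?thesis by (rule Lim_transform_eventually) (use u(2) in \<open>auto elim: eventually_mono\<close>)
qed

lemma qx_j_level:
  assumes h: "h > 0" shows "\<exists>V. qx h klein_j h V \<and> fpsR \<int> V \<and> fps_nth V 0 = 1"
proof -
  define V where "V = Jfps oo fps_X ^ h"
  obtain u where u: "u has_fps_expansion Jfps" "\<forall>\<^sub>F z in at_ioo. klein_j z * qe z ^ 1 = u (qe z)"
    using qx_j by (auto simp: qx_def)
  have "(u \<circ> (\<lambda>x. x ^ h)) has_fps_expansion V" unfolding V_def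
    by (rule has_fps_expansion_compose[OF u(1) has_fps_expansion_X_power]) (use h in simp)
  moreover have "\<forall>\<^sub>F z in at_ioo. klein_j z * qe (z / of_nat h) ^ h = (u \<circ> (\<lambda>x. x ^ h)) (qe (z / of_nat h))"
    using u(2)
  proof eventually_elim
    case (elim z)
    have "of_nat h * (z / of_nat h) = z" using h by simp
    then have "qe (z / of_nat h) ^ h = qe z" unfolding qe_of_nat[symmetric] by (simp only:)
    then show ?case using elim by (simp only: o_def power_one_right)
  qed
  ultimately have "qx h klein_j h V" unfolding qx_def by blast
  moreover have "fpsR \<int> V" unfolding V_def by (rule fps_compose_X_power[OF csubring_IntsR Jfps_int])
  moreover have "fps_nth V 0 = 1" by (simp add: V_def Jfps_0)
  ultimately show ?thesis by blast
qed

lemma qx_power: "qx h f k F \<Longrightarrow> qx h (\<lambda>z. f z ^ n) (k * n) (F ^ n)"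
proof (induction n)
  case 0 then show ?case using qx_const[of h 1] by simp
next
  case (Suc n)
  then show ?case using qx_mult[of h f k F "\<lambda>z. f z ^ n" "k * n" "F ^ n"] by simp
qed

text \<open>Remove the pole at the cusp term by term with multiples of powers of j. The multipliers
  stay in R because j has an integral expansion with leading coefficient 1. Once no pole is left the
  function is constant; k stays fixed and the induction is on the distance of the subdegree from
  it.\<close>

theorem invariant_poly_in_j:
  assumes R: "csubring R" and h: "h > 0"
  shows "f holomorphic_on uhp \<Longrightarrow> SL2_inv f \<Longrightarrow> qx h f k F \<Longrightarrow> fpsR R F \<Longrightarrow>
    \<exists>P. (\<forall>i. poly.coeff P i \<in> R) \<and> (\<forall>z\<in>uhp. f z = poly P (klein_j z))"
proof (induction "if F = 0 then 0 else Suc k - subdegree F" arbitrary: f F rule: less_induct)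
  case less
  note hol = less.prems(1) and inv = less.prems(2) and q = less.prems(3) and FR = less.prems(4)
  obtain V where V: "qx h klein_j h V" "fpsR \<int> V" "fps_nth V 0 = 1" using qx_j_level[OF h] by blast
  show ?case
  proof (cases "F = 0")
    case True
    then have "f z = 0" if "z \<in> uhp" for z using qx_zero[OF h hol _ that] q by simp
    then show ?thesis using csubringD(1)[OF R] by (intro exI[of _ 0]) simp
  next
    case F0: False
    define s where "s = subdegree F"
    have Fs: "fps_nth F s \<noteq> 0" using F0 by (simp add: s_def)
    have Tinv: "f (z + 1) = f z" if "z \<in> uhp" for z
      using SL2_invD[OF inv, of 1 1 1 0 z] that by (simp add: mob_T[of 1, simplified])
    have dv: "int h dvd int s - int k" by (rule qx_periodic[OF h q Tinv Fs])
    show ?thesis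
    proof (cases "s \<ge> k")
      case True
      have F_eq: "F = fps_shift k F * fps_X ^ k" using True by (simp add: fps_shift_times_fps_X_power s_def)
      have lim: "(f \<longlongrightarrow> fps_nth F k) at_ioo"
      proof -
        obtain u where u: "u has_fps_expansion F" "\<forall>\<^sub>F z in at_ioo. f z * qe (z / of_nat h) ^ k = u (qe (z / of_nat h))"
          using q by (auto simp: qx_def)
        have "u has_laurent_expansion fps_to_fls F" by (rule has_laurent_expansion_fps[OF u(1)])
        then have "(\<lambda>x. u x / x ^ k) has_laurent_expansion fps_to_fls F / fps_to_fls (fps_X ^ k)"
          by (rule has_laurent_expansion_divide[OF _ has_laurent_expansion_fps[OF has_fps_expansion_X_power]])
        moreover have "fps_to_fls F / fps_to_fls (fps_X ^ k) = fps_to_fls (fps_shift k F)"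
          by (subst F_eq) (simp only: fls_times_fps_to_fls nonzero_mult_div_cancel_right fps_to_fls_eq_0_iff
              power_eq_0_iff fps_X_neq_zero simp_thms)
        ultimately have le: "(\<lambda>x. u x / x ^ k) has_laurent_expansion fps_to_fls (fps_shift k F)" by (simp only:)
        have "((\<lambda>x. u x / x ^ k) \<longlongrightarrow> fls_nth (fps_to_fls (fps_shift k F)) 0) (at 0)"
          by (rule has_laurent_expansion_imp_tendsto_0[OF le fls_subdegree_fls_to_fps_gt0])
        from filterlim_compose[OF this qe_scaled_tendsto[OF h]]
        have "((\<lambda>z. u (qe (z / of_nat h)) / qe (z / of_nat h) ^ k) \<longlongrightarrow> fps_nth F k) at_ioo" by simp
        moreover have "\<forall>\<^sub>F z in at_ioo. u (qe (z / of_nat h)) / qe (z / of_nat h) ^ k = f z"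
          using u(2)
        proof eventually_elim
          case (elim z)
          show ?case unfolding elim[symmetric] by simp
        qed
        ultimately show ?thesis by (rule Lim_transform_eventually)
      qed
      have "f z = fps_nth F k" if "z \<in> uhp" for z by (rule maximum_principle_SL2[OF hol inv lim that])
      then show ?thesis using FR csubringD(1)[OF R]
        by (intro exI[of _ "[:fps_nth F k:]"]) (auto simp: fpsR_def coeff_pCons split: nat.split)
    next
      case False
      \<comment> \<open>Periodicity makes the pole order in q^(1/h) a multiple of h, so that a power
        of j has the same leading exponent.\<close>
      obtain M where M: "k = s + h * M"
      proof -
        from dv obtain t where t: "int s - int k = int h * t" by blast
        have "t \<le> 0"
        proof (rule ccontr)
          assume "\<not> t \<le> 0"
          then have "int h * t > 0" using h by simp
          then show False using t False by simp
        qed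
        then have "int k = int (s + h * nat (- t))" using t by simp
        then show ?thesis using that[of "nat (- t)"] by (simp only: of_nat_eq_iff)
      qed
      define c where "c = fps_nth F s"
      have cR: "c \<in> R" using FR by (simp add: c_def fpsR_def)
      define F' where "F' = F + fps_const (- c) * (V ^ M * fps_X ^ s)"
      define g where "g = (\<lambda>z. f z + (- c) * klein_j z ^ M)"
      have "qx h (\<lambda>z. (- c) * klein_j z ^ M) (0 + (h * M + s)) (fps_const (- c) * (V ^ M * fps_X ^ s))"
        by (intro qx_mult[OF qx_const] qx_shift qx_power V)
      then have qg: "qx h g k F'" unfolding g_def F'_def
        by (intro qx_add_same[OF q]) (simp add: M add.commute)
      have VR: "fpsR R V" using V(2) csubring_Ints[OF R] by (auto simp: fpsR_def)
      have F'R: "fpsR R F'" unfolding F'_def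
        by (intro fpsR_add[OF R] fpsR_mult[OF R] fpsR_const[OF R] fpsR_power[OF R] fpsR_X_power[OF R] FR VR csubringD(6)[OF R] cR)
      have hg: "g holomorphic_on uhp" unfolding g_def by (intro holomorphic_intros hol holomorphic_klein_j)
      have ig: "SL2_inv g" unfolding g_def SL2_inv_def
        using SL2_invD[OF inv] SL2_invD[OF klein_j_inv] by simp
      have n0: "fps_nth F' i = 0" if "i \<le> s" for i
      proof (cases "i = s")
        case True
        then show ?thesis by (simp add: F'_def c_def fps_X_power_mult_right_nth fps_nth_power_0 V(3))
      next
        case False
        then have "i < s" using that by simp
        then have "fps_nth F i = 0" unfolding s_def by (rule nth_less_subdegree_zero)
        then show ?thesis using \<open>i < s\<close> by (simp add: F'_def fps_X_power_mult_right_nth)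
      qed
      have "(if F' = 0 then 0 else Suc k - subdegree F') < (if F = 0 then 0 else Suc k - subdegree F)"
      proof (cases "F' = 0")
        case True then show ?thesis using F0 False by (simp add: s_def)
      next
        case F'0: False
        have "subdegree F' > s" using n0 nth_subdegree_nonzero[OF F'0] by (meson not_le)
        then show ?thesis using F0 F'0 False by (simp add: s_def)
      qed
      from less.hyps[OF this hg ig qg F'R] obtain P where
        P: "\<And>i. poly.coeff P i \<in> R" "\<And>z. z \<in> uhp \<Longrightarrow> g z = poly P (klein_j z)" by blast
      have "f z = poly (P + Polynomial.monom c M) (klein_j z)" if "z \<in> uhp" for z
      proof -
        have "f z = g z + c * klein_j z ^ M" by (simp add: g_def)
        then show ?thesis unfolding P(2)[OF that] by (simp only: poly_add poly_monom)
      qed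
      moreover have "poly.coeff (P + Polynomial.monom c M) i \<in> R" for i
        using P(1) cR csubringD[OF R] by (auto simp: Polynomial.coeff_monom)
      ultimately show ?thesis by blast
    qed
  qed
qed

lemma norm_klein_j_large: "\<forall>\<^sub>F z in at_ioo. norm (klein_j z) > B"
proof -
  have "((\<lambda>z. klein_j z * qe (z / of_nat 1) ^ 1) \<longlongrightarrow> 1) at_ioo"
    using filterlim_at_ioo_qx[OF _ qx_j] Jfps_0 by simp
  then have l: "((\<lambda>z. norm (klein_j z * qe z)) \<longlongrightarrow> 1) at_ioo" using tendsto_norm by fastforce
  have e1: "\<forall>\<^sub>F z in at_ioo. norm (klein_j z * qe z) > 1 / 2" by (rule order_tendstoD(1)[OF l]) simp
  have "(qe \<longlongrightarrow> 0) at_ioo" using qe_tendsto by (simp add: filterlim_at)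
  then have "((\<lambda>z. norm (qe z)) \<longlongrightarrow> 0) at_ioo" by (rule tendsto_norm_zero)
  then have e2: "\<forall>\<^sub>F z in at_ioo. norm (qe z) < 1 / (2 * (\<bar>B\<bar> + 1))" by (rule order_tendstoD(2)) simp
  show ?thesis using e1 e2
  proof eventually_elim
    case (elim z)
    show ?case
    proof (rule ccontr)
      assume "\<not> B < norm (klein_j z)"
      then have "norm (klein_j z) \<le> \<bar>B\<bar> + 1" by linarith
      then have "norm (klein_j z * qe z) \<le> (\<bar>B\<bar> + 1) * (1 / (2 * (\<bar>B\<bar> + 1)))"
        unfolding norm_mult using elim(2) by (intro mult_mono) auto
      also have "\<dots> = 1 / 2" by simp
      finally show False using elim(1) by simp
    qed
  qed
qed

text \<open>The image is open by the open mapping theorem. It is closed because nearby values are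
  taken either on a compact part of the reduction domain or near the cusp, where |j| is
  large.\<close>

theorem klein_j_surj: "\<exists>z\<in>uhp. klein_j z = w"
proof -
  have nc: "\<not> klein_j constant_on uhp"
  proof
    assume "klein_j constant_on uhp"
    then obtain c where c: "\<And>z. z \<in> uhp \<Longrightarrow> klein_j z = c" by (auto simp: constant_on_def)
    obtain Y where Y: "\<And>z. Im z \<ge> Y \<Longrightarrow> norm (klein_j z) > norm c"
      using norm_klein_j_large[of "norm c"] by (auto simp: eventually_at_ioo)
    show False using Y[of "Complex 0 (max Y 1)"] c[of "Complex 0 (max Y 1)"] by (simp add: uhp_iff)
  qed
  have op: "open (klein_j ` uhp)"
    by (rule open_mapping_thm[OF holomorphic_klein_j open_uhp connected_uhp open_uhp subset_refl nc])
  have cl: "closed (klein_j ` uhp)"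
  proof -
    have "v \<in> klein_j ` uhp" if v: "v \<in> closure (klein_j ` uhp)" for v
    proof (rule ccontr)
      assume nv: "v \<notin> klein_j ` uhp"
      obtain Y where Y: "\<And>z. Im z \<ge> Y \<Longrightarrow> norm (klein_j z) > norm v + 1"
        using norm_klein_j_large[of "norm v + 1"] by (auto simp: eventually_at_ioo)
      define XX where "XX = cbox (Complex (-1/2) (86/100)) (Complex (1/2) (max Y 1))"
      have Xu: "XX \<subseteq> uhp" by (auto simp: XX_def in_cbox_complex_iff uhp_iff)
      have "compact (klein_j ` XX)" unfolding XX_def
        by (rule compact_continuous_image[OF holomorphic_on_imp_continuous_on compact_cbox])
           (use holomorphic_on_subset[OF holomorphic_klein_j Xu] in \<open>simp add: XX_def\<close>)
      then have cl: "closed (klein_j ` XX)" by (rule compact_imp_closed)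
      have nv': "v \<notin> klein_j ` XX" using nv Xu by blast
      obtain e where e: "e > 0" "\<And>y. y \<in> klein_j ` XX \<Longrightarrow> e \<le> dist v y"
        using separate_point_closed[OF cl nv'] by blast
      obtain y where y: "y \<in> klein_j ` uhp" "dist y v < min e 1"
        using v[unfolded closure_approachable, rule_format, of "min e 1"] e(1) by auto
      then obtain z where z: "z \<in> uhp" "y = klein_j z" by blast
      obtain a b c d where *: "a * d - b * c = 1" "mob a b c d z \<in> uhp" "Im (mob a b c d z) \<ge> 86/100"
        "\<bar>Re (mob a b c d z)\<bar> \<le> 1/2" "norm (mob a b c d z) \<ge> 1" by (rule reduce_uhp[OF z(1)])
      have yj: "y = klein_j (mob a b c d z)" using SL2_invD[OF klein_j_inv *(1) z(1)] z(2) by simp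
      show False
      proof (cases "Im (mob a b c d z) \<ge> Y")
        case True
        have "norm y \<le> norm v + dist y v" unfolding dist_norm using norm_triangle_sub[of y v] by simp
        then show False using Y[OF True] yj y(2) by simp
      next
        case False
        then have "mob a b c d z \<in> XX" using * by (auto simp: XX_def in_cbox_complex_iff)
        then show False using e(2)[of y] yj y(2) by (auto simp: dist_commute)
      qed
    qed
    then have "closure (klein_j ` uhp) \<subseteq> klein_j ` uhp" by blast
    then show ?thesis by (simp only: closure_subset_eq)
  qed
  have ne: "klein_j ` uhp \<noteq> {}"
  proof -
    have "\<i> \<in> uhp" by (simp add: uhp_iff)
    then show ?thesis by blast
  qed
  have "klein_j ` uhp = UNIV" using clopen[of "klein_j ` uhp"] op cl ne by simp
  then have "w \<in> klein_j ` uhp" by simp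
  then show ?thesis by blast
qed

section \<open>Hecke orbits\<close>

text \<open>The upper triangular representative of a left coset of the modular group:
  \<open>\<alpha>\<close> is the gcd of the first column, Bezout coefficients complete the
  unimodular factor, and a translation reduces \<open>\<beta>\<close> modulo
  \<open>\<delta>\<close>.\<close>

lemma hermite_normal_form:
  fixes a b c d :: int
  assumes n: "a * d - b * c = int n" "n > 0"
  obtains p q r s :: int and \<alpha> \<beta> \<delta> :: nat where
    "p * s - q * r = 1" "\<alpha> * \<delta> = n" "\<beta> < \<delta>"
    "a = p * int \<alpha>" "b = p * int \<beta> + q * int \<delta>" "c = r * int \<alpha>" "d = r * int \<beta> + s * int \<delta>"
proof -
  define g where "g = gcd a c"
  have "a \<noteq> 0 \<or> c \<noteq> 0" using n by auto
  then have g0: "g > 0" unfolding g_def by simp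
  obtain a' c' where ac: "a = a' * g" "c = c' * g" "coprime a' c'"
    unfolding g_def using gcd_coprime_exists[of a c] \<open>a \<noteq> 0 \<or> c \<noteq> 0\<close> by auto
  obtain u v where uv: "u * a' + v * c' = 1" using ac(3) bezout_int[of a' c'] by auto
  define D where "D = a' * d - b * c'"
  have gD: "g * D = int n" using n(1) unfolding ac D_def by (simp add: algebra_simps)
  have D0: "D > 0" using gD n(2) g0 by (metis of_nat_0_less_iff zero_less_mult_pos)
  define B where "B = u * b + v * d"
  define q0 where "q0 = B div D" define \<beta> where "\<beta> = B mod D"
  have B: "B = q0 * D + \<beta>" by (simp add: q0_def \<beta>_def)
  have \<beta>: "0 \<le> \<beta>" "\<beta> < D" using D0 by (auto simp: \<beta>_def)
  have b: "b = a' * B - v * D"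
  proof -
    have "a' * B - v * D = b * (u * a' + v * c')" by (simp add: B_def D_def algebra_simps)
    then show ?thesis using uv by simp
  qed
  have d: "d = c' * B + u * D"
  proof -
    have "c' * B + u * D = d * (u * a' + v * c')" by (simp add: B_def D_def algebra_simps)
    then show ?thesis using uv by simp
  qed
  show ?thesis
  proof (rule that[of a' "c' * q0 + u" "a' * q0 - v" c' "nat g" "nat D" "nat \<beta>"])
    show "a' * (c' * q0 + u) - (a' * q0 - v) * c' = 1" using uv by (simp add: algebra_simps)
    show "nat g * nat D = n" using gD g0 D0 by (simp add: nat_mult_distrib[symmetric])
    show "nat \<beta> < nat D" using \<beta> D0 by simp
    show "a = a' * int (nat g)" "c = c' * int (nat g)" using ac g0 by auto
    show "b = a' * int (nat \<beta>) + (a' * q0 - v) * int (nat D)"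
      using b B \<beta> D0 by (simp add: algebra_simps)
    show "d = c' * int (nat \<beta>) + (c' * q0 + u) * int (nat D)"
      using d B \<beta> D0 by (simp add: algebra_simps)
  qed
qed

text \<open>The slash of \<open>Dfun\<close> in weight 12 by an integral matrix, without the power
  of the determinant. It depends only on the left coset of the matrix.\<close>

definition DM :: "int \<Rightarrow> int \<Rightarrow> int \<Rightarrow> int \<Rightarrow> complex \<Rightarrow> complex" where
  "DM a b c d z = Dfun (mob a b c d z) / (of_int c * z + of_int d) ^ 12"

definition jM :: "int \<Rightarrow> int \<Rightarrow> int \<Rightarrow> int \<Rightarrow> complex \<Rightarrow> complex" where
  "jM a b c d z = klein_j (mob a b c d z)"

lemma DM_left:
  assumes z: "z \<in> uhp" and g: "p * s - q * r = 1" and m: "a * d - b * c > 0"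
  shows "DM (p * a + q * c) (p * b + q * d) (r * a + s * c) (r * b + s * d) z = DM a b c d z"
proof -
  have mu: "mob a b c d z \<in> uhp" by (rule mob_uhp[OF z m])
  have m0: "a * d - b * c \<noteq> 0" using m by simp
  have n0: "of_int r * mob a b c d z + of_int s \<noteq> 0" by (rule cocycle_nonzero[OF mu]) (use g in auto)
  show ?thesis
    unfolding DM_def mob_mob[OF z m0, symmetric] cocycle_mob[OF z m0, symmetric] Dfun_mob[OF mu g] power_mult_distrib
    using n0 by simp
qed

lemma jM_left:
  assumes z: "z \<in> uhp" and g: "p * s - q * r = 1" and m: "a * d - b * c > 0"
  shows "jM (p * a + q * c) (p * b + q * d) (r * a + s * c) (r * b + s * d) z = jM a b c d z"
proof -
  have m0: "a * d - b * c \<noteq> 0" using m by simp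
  show ?thesis unfolding jM_def mob_mob[OF z m0, symmetric]
    by (rule SL2_invD[OF klein_j_inv g mob_uhp[OF z m]])
qed

lemma DM_right:
  assumes z: "z \<in> uhp" and g: "p * s - q * r = 1"
  shows "DM a b c d (mob p q r s z) = (of_int r * z + of_int s) ^ 12 *
     DM (a * p + b * r) (a * q + b * s) (c * p + d * r) (c * q + d * s) z"
proof -
  have g0: "p * s - q * r \<noteq> 0" using g by simp
  have n0: "of_int r * z + of_int s \<noteq> 0" by (rule cocycle_nonzero[OF z]) (use g in auto)
  show ?thesis
    unfolding DM_def mob_mob[OF z g0] cocycle_mob[OF z g0, symmetric] power_mult_distrib
    using n0 by simp
qed

lemma jM_right:
  assumes z: "z \<in> uhp" and g: "p * s - q * r = 1"
  shows "jM a b c d (mob p q r s z) = jM (a * p + b * r) (a * q + b * s) (c * p + d * r) (c * q + d * s) z"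
  unfolding jM_def using mob_mob[OF z, of p s q r] g by simp

lemma DM_scale: "DM (int n) 0 0 1 z = Dfun (of_nat n * z)" and jM_scale: "jM (int n) 0 0 1 z = klein_j (of_nat n * z)"
  by (simp_all add: DM_def jM_def mob_p)

definition aff :: "nat \<Rightarrow> nat \<Rightarrow> nat \<Rightarrow> complex \<Rightarrow> complex" where
  "aff \<alpha> \<beta> \<delta> z = (of_nat \<alpha> * z + of_nat \<beta>) / of_nat \<delta>"

lemma aff_uhp: "\<alpha> > 0 \<Longrightarrow> \<delta> > 0 \<Longrightarrow> z \<in> uhp \<Longrightarrow> aff \<alpha> \<beta> \<delta> z \<in> uhp"
proof -
  assume "\<alpha> > 0" "\<delta> > 0" "z \<in> uhp"
  moreover have "Im (aff \<alpha> \<beta> \<delta> z) = real \<alpha> * Im z / real \<delta>"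
    unfolding aff_def using Im_divide_of_nat[of "of_nat \<alpha> * z + of_nat \<beta>" \<delta>] by simp
  ultimately show ?thesis by (simp add: uhp_iff)
qed

text \<open>Every function \<open>DM M\<close> or \<open>jM M\<close> with \<open>det M = n\<close> is one of the finitely many that come
  from Hermite normal forms.\<close>

definition hnfs :: "nat \<Rightarrow> (nat \<times> nat \<times> nat) set" where
  "hnfs n = {(\<alpha>, \<beta>, \<delta>). \<alpha> * \<delta> = n \<and> \<beta> < \<delta>}"

lemma finite_hnfs: "n > 0 \<Longrightarrow> finite (hnfs n)"
proof -
  assume n: "n > 0"
  have "hnfs n \<subseteq> {..n} \<times> {..n} \<times> {..n}"
  proof
    fix x assume "x \<in> hnfs n"
    then obtain \<alpha> \<beta> \<delta> where x: "x = (\<alpha>, \<beta>, \<delta>)" "\<alpha> * \<delta> = n" "\<beta> < \<delta>" by (auto simp: hnfs_def)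
    have "\<alpha> > 0" "\<delta> > 0" using x(2) n by (auto intro!: Nat.gr0I)
    then have "\<alpha> * 1 \<le> n" "1 * \<delta> \<le> n" unfolding x(2)[symmetric] by (intro mult_le_mono; simp)+
    then show "x \<in> {..n} \<times> {..n} \<times> {..n}" using x by simp
  qed
  then show ?thesis by (rule finite_subset) simp
qed

lemma matrix_hnf:
  assumes m: "a * d - b * c = int n" "n > 0"
  shows "\<exists>(\<alpha>, \<beta>, \<delta>) \<in> hnfs n. \<forall>z\<in>uhp. jM a b c d z = klein_j (aff \<alpha> \<beta> \<delta> z) \<and>
     DM a b c d z = Dfun (aff \<alpha> \<beta> \<delta> z) / of_nat \<delta> ^ 12"
proof -
  obtain p q r s :: int and \<alpha> \<beta> \<delta> :: nat where h:
    "p * s - q * r = 1" "\<alpha> * \<delta> = n" "\<beta> < \<delta>"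
    "a = p * int \<alpha>" "b = p * int \<beta> + q * int \<delta>" "c = r * int \<alpha>" "d = r * int \<beta> + s * int \<delta>"
    by (rule hermite_normal_form[OF m])
  have pos: "int \<alpha> * int \<delta> - int \<beta> * 0 > 0" using h(2) m(2) by (metis diff_zero mult_zero_right of_nat_0_less_iff of_nat_mult)
  have "jM a b c d z = klein_j (aff \<alpha> \<beta> \<delta> z) \<and> DM a b c d z = Dfun (aff \<alpha> \<beta> \<delta> z) / of_nat \<delta> ^ 12" if z: "z \<in> uhp" for z
    using jM_left[OF z h(1) pos] DM_left[OF z h(1) pos] unfolding h(4-7)
    by (simp add: jM_def DM_def mob_def aff_def)
  then show ?thesis using h(2,3) by (intro bexI[of _ "(\<alpha>, \<beta>, \<delta>)"]) (auto simp: hnfs_def)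
qed

section \<open>Expansions with algebraic integer coefficients for matrices of determinant n\<close>

abbreviation AI :: "complex set" where "AI \<equiv> {x. algebraic_int x}"

lemma algebraic_int_root_of_unity:
  fixes x :: complex
  assumes "x ^ n = 1" "n > 0" shows "algebraic_int x"
proof (rule algebraic_int_monic_root)
  let ?P = "Polynomial.monom 1 n - 1 :: complex poly"
  show "poly ?P x = 0" using assms by (simp add: poly_monom)
  have dg: "Polynomial.degree (1 :: complex poly) < Polynomial.degree (Polynomial.monom (1::complex) n)"
    using assms by (simp add: Polynomial.degree_monom_eq)
  have "Polynomial.degree ?P = n"
  proof -
    have "?P = Polynomial.monom 1 n + - 1" by simp
    then show ?thesis using dg degree_add_eq_left[of "-1" "Polynomial.monom (1::complex) n"] by (simp add: Polynomial.degree_monom_eq)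
  qed
  then show "Polynomial.lead_coeff ?P = 1" using assms by (simp add: Polynomial.coeff_1)
  show "algebraic_int (poly.coeff ?P i)" for i by (auto simp: Polynomial.coeff_1 intro: algebraic_int_diff)
qed

lemma root_of_unity_AI: "\<delta> > 0 \<Longrightarrow> qe (of_nat \<beta> / of_nat \<delta>) \<in> AI \<and> inverse (qe (of_nat \<beta> / of_nat \<delta>)) \<in> AI"
proof -
  assume d: "\<delta> > 0"
  have "qe (of_nat \<beta> / of_nat \<delta>) ^ \<delta> = qe (of_nat \<delta> * (of_nat \<beta> / of_nat \<delta>))" unfolding qe_of_nat ..
  also have "of_nat \<delta> * (of_nat \<beta> / of_nat \<delta>) = (of_nat \<beta> * 1 :: complex)" using d by simp
  also have "qe (of_nat \<beta> * 1) = qe 1 ^ \<beta>" by (rule qe_of_nat)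
  also have "qe 1 = 1" using exp_two_pi_i by (simp add: mult.commute)
  finally have e: "qe (of_nat \<beta> / of_nat \<delta>) ^ \<delta> = 1" by simp
  then have "inverse (qe (of_nat \<beta> / of_nat \<delta>)) ^ \<delta> = 1" by (simp only: power_inverse inverse_1)
  then show ?thesis using algebraic_int_root_of_unity[OF e d] algebraic_int_root_of_unity[OF _ d] by blast
qed

lemma MG_affine:
  assumes f: "qx 1 f k F" "fpsR AI F" "f holomorphic_on uhp" and h: "\<alpha> > 0" "\<delta> > 0" "h = \<alpha> * \<delta>"
  shows "MG h AI (\<lambda>z. f (aff \<alpha> \<beta> \<delta> z))"
proof -
  let ?z = "qe (of_nat \<beta> / of_nat \<delta>)"
  note R = csubring_algebraic_int
  have z: "?z \<in> AI" "inverse ?z \<in> AI" using root_of_unity_AI[OF h(2)] by blast+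
  have "(f \<circ> aff \<alpha> \<beta> \<delta>) holomorphic_on uhp"
  proof (rule holomorphic_on_compose_gen[OF _ f(3)])
    show "aff \<alpha> \<beta> \<delta> holomorphic_on uhp" unfolding aff_def[abs_def] by (intro holomorphic_intros) (use h in simp)
    show "aff \<alpha> \<beta> \<delta> ` uhp \<subseteq> uhp" using aff_uhp[OF h(1,2)] by blast
  qed
  then have hol: "(\<lambda>z. f (aff \<alpha> \<beta> \<delta> z)) holomorphic_on uhp" by (simp add: o_def)
  have "fpsR AI (fps_const (inverse ?z ^ k) * ((F oo (fps_const ?z * fps_X)) oo fps_X ^ (\<alpha> ^ 2)))"
    by (intro fpsR_mult[OF R] fpsR_const[OF R] csubring_power[OF R] z fps_compose_X_power[OF R] fps_compose_scale_X[OF R] f(2))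
  then show ?thesis unfolding MG_def aff_def
    using hol qx_affine[OF f(1) h, of \<beta>] unfolding aff_def by blast
qed

lemma Ints_AI: "fpsR \<int> F \<Longrightarrow> fpsR AI F"
  unfolding fpsR_def by (auto intro: int_imp_algebraic_int)

lemma fpsR_XU: "fpsR \<int> (fps_X * Ufps)"
  using fpsR_mult[OF csubring_IntsR fpsR_X_power[OF csubring_IntsR, of 1] Ufps_int] by simp

lemma of_nat_AI: "(of_nat n :: complex) \<in> AI" by (simp add: csubring_of_nat[OF csubring_algebraic_int, simplified])

lemma MG_jM:
  assumes m: "a * d - b * c = int n" "n > 0" shows "MG n AI (jM a b c d)"
proof -
  obtain \<alpha> \<beta> \<delta> where h: "(\<alpha>, \<beta>, \<delta>) \<in> hnfs n" "\<forall>z\<in>uhp. jM a b c d z = klein_j (aff \<alpha> \<beta> \<delta> z)"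
    using matrix_hnf[OF m] by auto
  have "MG n AI (\<lambda>z. klein_j (aff \<alpha> \<beta> \<delta> z))"
    by (rule MG_affine[OF qx_j Ints_AI[OF Jfps_int] holomorphic_klein_j]) (use h m(2) in \<open>auto simp: hnfs_def intro!: Nat.gr0I\<close>)
  then show ?thesis by (rule MG_cong) (use h in simp)
qed

lemma MG_inverse_DM:
  assumes m: "a * d - b * c = int n" "n > 0" shows "MG n AI (\<lambda>z. 1 / DM a b c d z)"
proof -
  obtain \<alpha> \<beta> \<delta> where h: "(\<alpha>, \<beta>, \<delta>) \<in> hnfs n" "\<forall>z\<in>uhp. DM a b c d z = Dfun (aff \<alpha> \<beta> \<delta> z) / of_nat \<delta> ^ 12"
    using matrix_hnf[OF m] by auto
  have "(\<lambda>z. 1 / Dfun z) holomorphic_on uhp" by (intro holomorphic_intros holomorphic_Dfun) simp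
  then have "MG n AI (\<lambda>z. 1 / Dfun (aff \<alpha> \<beta> \<delta> z))"
    using MG_affine[OF qx_inverse_Dfun Ints_AI[OF fpsR_inverse[OF csubring_IntsR Ufps_int Ufps_0]], of \<alpha> \<delta> n \<beta>] h m(2)
    by (auto simp: hnfs_def intro!: Nat.gr0I)
  from MG_mult[OF csubring_algebraic_int MG_const[OF csubring_algebraic_int csubring_power[OF csubring_algebraic_int of_nat_AI[of \<delta>], of 12]] this]
  show ?thesis by (rule MG_cong) (use h in simp)
qed

text \<open>The normal form introduces the denominator \<open>\<delta>\<close>^12, which n^12 clears
  with quotient \<open>\<alpha>\<close>^12. This is the origin of the numerator n^12 in the inverse
  of the unit.\<close>

lemma MG_DM:
  assumes m: "a * d - b * c = int n" "n > 0" shows "MG n AI (\<lambda>z. of_nat n ^ 12 * DM a b c d z)"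
proof -
  obtain \<alpha> \<beta> \<delta> where h: "(\<alpha>, \<beta>, \<delta>) \<in> hnfs n" "\<forall>z\<in>uhp. DM a b c d z = Dfun (aff \<alpha> \<beta> \<delta> z) / of_nat \<delta> ^ 12"
    using matrix_hnf[OF m] by auto
  have d: "\<delta> > 0" "n = \<alpha> * \<delta>" using h(1) m(2) by (auto simp: hnfs_def)
  have "MG n AI (\<lambda>z. Dfun (aff \<alpha> \<beta> \<delta> z))"
    by (rule MG_affine[OF qx_Dfun Ints_AI[OF fpsR_XU] holomorphic_Dfun]) (use h m(2) in \<open>auto simp: hnfs_def intro!: Nat.gr0I\<close>)
  from MG_mult[OF csubring_algebraic_int MG_const[OF csubring_algebraic_int csubring_power[OF csubring_algebraic_int of_nat_AI[of \<alpha>], of 12]] this]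
  show ?thesis by (rule MG_cong) (use h d in \<open>simp add: power_mult_distrib\<close>)
qed

lemma qx_raise:
  assumes q: "qx h f k F" and hm: "h > 0" "m > 0" shows "qx (h * m) f (m * k) (F oo fps_X ^ m)"
proof -
  obtain u where u: "u has_fps_expansion F" "\<forall>\<^sub>F z in at_ioo. f z * qe (z / of_nat h) ^ k = u (qe (z / of_nat h))"
    using q by (auto simp: qx_def)
  have "(u \<circ> (\<lambda>x. x ^ m)) has_fps_expansion (F oo fps_X ^ m)"
    by (rule has_fps_expansion_compose[OF u(1) has_fps_expansion_X_power]) (use hm in simp)
  moreover have "\<forall>\<^sub>F z in at_ioo. f z * qe (z / of_nat (h * m)) ^ (m * k) = (u \<circ> (\<lambda>x. x ^ m)) (qe (z / of_nat (h * m)))"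
    using u(2)
  proof eventually_elim
    case (elim z)
    have "of_nat m * (z / of_nat (h * m)) = z / of_nat h" using hm by simp
    then have "qe (z / of_nat (h * m)) ^ m = qe (z / of_nat h)" unfolding qe_of_nat[symmetric] by (simp only:)
    then show ?case using elim by (simp only: o_def power_mult)
  qed
  ultimately show ?thesis unfolding qx_def by blast
qed

lemma MG_raise:
  assumes "csubring R" "MG h R f" "h > 0" "m > 0" shows "MG (h * m) R f"
  using assms qx_raise fps_compose_X_power unfolding MG_def by meson

text \<open>Maps of the whole plane with total division; composition and inverses are correct on the
  upper half plane only, so they are stated pointwise there.\<close>

definition SL2_maps :: "(complex \<Rightarrow> complex) set" where
  "SL2_maps = {mob a b c d |a b c d. a * d - b * c = 1}"

lemma SL2_maps_uhp: "\<gamma> \<in> SL2_maps \<Longrightarrow> z \<in> uhp \<Longrightarrow> \<gamma> z \<in> uhp"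
  unfolding SL2_maps_def using mob_uhp by force

lemma SL2_maps_id: "(\<lambda>z. z) \<in> SL2_maps"
proof -
  have "(\<lambda>z. z) = mob 1 0 0 1" by (rule ext) simp
  then show ?thesis unfolding SL2_maps_def by (intro CollectI exI[of _ "1::int"] exI[of _ "0::int"]) auto
qed

lemma SL2_maps_comp:
  assumes "\<gamma> \<in> SL2_maps" "\<delta> \<in> SL2_maps"
  shows "\<exists>\<epsilon>\<in>SL2_maps. \<forall>z\<in>uhp. \<epsilon> z = \<gamma> (\<delta> z)"
proof -
  obtain a b c d where g: "\<gamma> = mob a b c d" "a * d - b * c = 1" using assms(1) by (auto simp: SL2_maps_def)
  obtain p q r s where h: "\<delta> = mob p q r s" "p * s - q * r = 1" using assms(2) by (auto simp: SL2_maps_def)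
  have "(a * p + b * r) * (c * q + d * s) - (a * q + b * s) * (c * p + d * r) = (a * d - b * c) * (p * s - q * r)"
    by (simp add: algebra_simps)
  then have 1: "(a * p + b * r) * (c * q + d * s) - (a * q + b * s) * (c * p + d * r) = 1" using g h by simp
  have "mob (a * p + b * r) (a * q + b * s) (c * p + d * r) (c * q + d * s) \<in> SL2_maps"
    unfolding SL2_maps_def using 1 by blast
  moreover have "\<forall>z\<in>uhp. mob (a * p + b * r) (a * q + b * s) (c * p + d * r) (c * q + d * s) z = \<gamma> (\<delta> z)"
    unfolding g(1) h(1) using mob_mob[of _ p s q r a b c d] h(2) by simp
  ultimately show ?thesis by blast
qed

lemma SL2_maps_inv:
  assumes "\<gamma> \<in> SL2_maps"
  shows "\<exists>\<delta>\<in>SL2_maps. \<forall>z\<in>uhp. \<gamma> (\<delta> z) = z \<and> \<delta> (\<gamma> z) = z"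
proof -
  obtain a b c d where g: "\<gamma> = mob a b c d" "a * d - b * c = 1" using assms(1) by (auto simp: SL2_maps_def)
  have g': "d * a - (- b) * (- c) = 1" using g(2) by (simp add: algebra_simps)
  have "mob d (-b) (-c) a \<in> SL2_maps" unfolding SL2_maps_def using g' by blast
  moreover have "\<gamma> (mob d (-b) (-c) a z) = z \<and> mob d (-b) (-c) a (\<gamma> z) = z" if z: "z \<in> uhp" for z
  proof
    have "\<gamma> (mob d (-b) (-c) a z) = mob 1 0 0 1 z"
      unfolding g(1) using mob_mob[OF z, of d a "-b" "-c" a b c d] g' g(2) by (simp add: algebra_simps)
    then show "\<gamma> (mob d (-b) (-c) a z) = z" by simp
    have "mob d (-b) (-c) a (\<gamma> z) = mob 1 0 0 1 z"
      unfolding g(1) using mob_mob[OF z, of a d b c d "-b" "-c" a] g' g(2) by (simp add: algebra_simps)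
    then show "mob d (-b) (-c) a (\<gamma> z) = z" by simp
  qed
  ultimately show ?thesis by blast
qed

lemma klein_j_SL2_maps: "\<gamma> \<in> SL2_maps \<Longrightarrow> z \<in> uhp \<Longrightarrow> klein_j (\<gamma> z) = klein_j z"
  unfolding SL2_maps_def using SL2_invD[OF klein_j_inv] by blast

text \<open>The value 0 off the half plane makes two conjugates equal as HOL functions as soon as
  they agree on it. Finiteness of an orbit and products over it depend on this.\<close>

definition act :: "(complex \<Rightarrow> 'a::zero) \<Rightarrow> (complex \<Rightarrow> complex) \<Rightarrow> complex \<Rightarrow> 'a" where
  "act F \<gamma> z = (if z \<in> uhp then F (\<gamma> z) else 0)"

definition orb :: "(complex \<Rightarrow> 'a::zero) \<Rightarrow> (complex \<Rightarrow> 'a) set" where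
  "orb F = act F ` SL2_maps"

lemma orb_self: "act F (\<lambda>z. z) \<in> orb F" unfolding orb_def using SL2_maps_id by blast

lemma orb_zero: "g \<in> orb F \<Longrightarrow> z \<notin> uhp \<Longrightarrow> g z = 0" by (auto simp: orb_def act_def)

lemma orb_ext: "g \<in> orb F \<Longrightarrow> g' \<in> orb F \<Longrightarrow> (\<And>z. z \<in> uhp \<Longrightarrow> g z = g' z) \<Longrightarrow> g = g'"
proof (rule ext)
  fix z assume g: "g \<in> orb F" "g' \<in> orb F" and e: "\<And>z. z \<in> uhp \<Longrightarrow> g z = g' z"
  show "g z = g' z" using e orb_zero[OF g(1)] orb_zero[OF g(2)] by (cases "z \<in> uhp") simp_all
qed

lemma bij_orb:
  assumes g: "\<gamma> \<in> SL2_maps" shows "bij_betw (\<lambda>g. act g \<gamma>) (orb F) (orb F)"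
proof -
  obtain \<gamma>' where g': "\<gamma>' \<in> SL2_maps" "\<And>z. z \<in> uhp \<Longrightarrow> \<gamma> (\<gamma>' z) = z" "\<And>z. z \<in> uhp \<Longrightarrow> \<gamma>' (\<gamma> z) = z"
    using SL2_maps_inv[OF g] by blast
  have cl: "act h \<delta> \<in> orb F" if d: "\<delta> \<in> SL2_maps" and h: "h \<in> orb F" for h \<delta>
  proof -
    obtain \<epsilon> where e: "\<epsilon> \<in> SL2_maps" "h = act F \<epsilon>" using h by (auto simp: orb_def)
    obtain \<eta> where n: "\<eta> \<in> SL2_maps" "\<forall>z\<in>uhp. \<eta> z = \<epsilon> (\<delta> z)" using SL2_maps_comp[OF e(1) d] by blast
    have "act h \<delta> = act F \<eta>"
      by (rule ext) (use n(2) SL2_maps_uhp[OF d] in \<open>simp add: act_def e(2)\<close>)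
    then show ?thesis using n(1) by (simp add: orb_def)
  qed
  have i1: "act (act h \<gamma>) \<gamma>' = h" if "h \<in> orb F" for h
    by (rule ext) (use orb_zero[OF that] g'(2) SL2_maps_uhp[OF g'(1)] in \<open>simp add: act_def\<close>)
  have i2: "act (act h \<gamma>') \<gamma> = h" if "h \<in> orb F" for h
    by (rule ext) (use orb_zero[OF that] g'(3) SL2_maps_uhp[OF g] in \<open>simp add: act_def\<close>)
  show ?thesis
    by (rule bij_betw_byWitness[of _ "\<lambda>g. act g \<gamma>'"]) (use i1 i2 cl g g' in auto)
qed

lemma finite_orb_comb:
  assumes "finite (orb F)" "finite (orb G)" "\<And>z. z \<in> uhp \<Longrightarrow> H z = \<phi> (F z) (G z)"
  shows "finite (orb H)"
proof (rule finite_subset)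
  show "orb H \<subseteq> (\<lambda>(f, g) z. if z \<in> uhp then \<phi> (f z) (g z) else 0) ` (orb F \<times> orb G)"
  proof
    fix h assume "h \<in> orb H"
    then obtain \<gamma> where g: "\<gamma> \<in> SL2_maps" "h = act H \<gamma>" by (auto simp: orb_def)
    have "h = (\<lambda>z. if z \<in> uhp then \<phi> (act F \<gamma> z) (act G \<gamma> z) else 0)"
      by (rule ext) (use assms(3) SL2_maps_uhp[OF g(1)] in \<open>simp add: act_def g(2)\<close>)
    then show "h \<in> (\<lambda>(f, g) z. if z \<in> uhp then \<phi> (f z) (g z) else 0) ` (orb F \<times> orb G)"
      using g(1) by (intro image_eqI[of _ _ "(act F \<gamma>, act G \<gamma>)"]) (auto simp: orb_def)
  qed
  show "finite ((\<lambda>(f, g) z. if z \<in> uhp then \<phi> (f z) (g z) else 0) ` (orb F \<times> orb G))"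
    using assms by simp
qed

section \<open>Orbit polynomials and integrality over j\<close>

definition pMG :: "nat \<Rightarrow> complex set \<Rightarrow> (complex \<Rightarrow> complex poly) \<Rightarrow> bool" where
  "pMG h R H \<longleftrightarrow> (\<forall>i. MG h R (\<lambda>z. poly.coeff (H z) i))"

lemma pMG_1: "csubring R \<Longrightarrow> pMG h R (\<lambda>_. 1)"
  unfolding pMG_def using csubringD(1,2) by (auto simp: Polynomial.coeff_1 intro!: MG_const)

lemma pMG_const: "csubring R \<Longrightarrow> MG h R f \<Longrightarrow> pMG h R (\<lambda>z. [:f z:])"
proof -
  assume R: "csubring R" "MG h R f"
  have "MG h R (\<lambda>z. poly.coeff [:f z:] i)" for i
    using R csubringD(1)[OF R(1)] by (cases i) (simp_all add: MG_const)
  then show ?thesis by (simp add: pMG_def)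
qed

lemma pMG_linear: "csubring R \<Longrightarrow> MG h R f \<Longrightarrow> pMG h R (\<lambda>z. [:- f z, 1:])"
proof -
  assume R: "csubring R" "MG h R f"
  have "MG h R (\<lambda>z. poly.coeff [:- f z, 1:] i)" for i
  proof (cases i)
    case (Suc k)
    then show ?thesis using R csubringD(1,2)[OF R(1)] by (cases k) (simp_all add: MG_const)
  qed (use R MG_uminus in simp)
  then show ?thesis by (simp add: pMG_def)
qed

lemma pMG_mult: "csubring R \<Longrightarrow> pMG h R G \<Longrightarrow> pMG h R H \<Longrightarrow> pMG h R (\<lambda>z. G z * H z)"
  unfolding pMG_def Polynomial.coeff_mult by (intro allI MG_sum MG_mult) auto

lemma pMG_sum: "csubring R \<Longrightarrow> (\<And>i. i \<in> A \<Longrightarrow> pMG h R (G i)) \<Longrightarrow> pMG h R (\<lambda>z. \<Sum>i\<in>A. G i z)"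
  unfolding pMG_def Polynomial.coeff_sum by (intro allI MG_sum) auto

lemma pMG_prod: "csubring R \<Longrightarrow> (\<And>i. i \<in> A \<Longrightarrow> pMG h R (G i)) \<Longrightarrow> pMG h R (\<lambda>z. \<Prod>i\<in>A. G i z)"
  by (induction A rule: infinite_finite_induct) (auto intro: pMG_mult pMG_1)

lemma pMG_invariant:
  assumes R: "csubring R" and h: "h > 0" and H: "pMG h R H"
    and inv: "\<And>\<gamma> z. \<gamma> \<in> SL2_maps \<Longrightarrow> z \<in> uhp \<Longrightarrow> H (\<gamma> z) = H z"
  shows "\<exists>Q. (\<forall>i k. poly.coeff (Q i) k \<in> R) \<and> (\<forall>z\<in>uhp. \<forall>i. poly.coeff (H z) i = poly (Q i) (klein_j z))"
proof -
  have "\<exists>P. (\<forall>k. poly.coeff P k \<in> R) \<and> (\<forall>z\<in>uhp. poly.coeff (H z) i = poly P (klein_j z))" for i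
  proof -
    obtain k F where F: "(\<lambda>z. poly.coeff (H z) i) holomorphic_on uhp" "fpsR R F" "qx h (\<lambda>z. poly.coeff (H z) i) k F"
      using H unfolding pMG_def MG_def by blast
    have s: "SL2_inv (\<lambda>z. poly.coeff (H z) i)"
      unfolding SL2_inv_def
    proof (intro allI impI)
      fix a b c d :: int and z :: complex assume "a * d - b * c = 1" "z \<in> uhp"
      then have "H (mob a b c d z) = H z" by (intro inv) (auto simp: SL2_maps_def)
      then show "poly.coeff (H (mob a b c d z)) i = poly.coeff (H z) i" by simp
    qed
    show ?thesis by (rule invariant_poly_in_j[OF R h F(1) s F(3,2)])
  qed
  then show ?thesis by metis
qed

lemma orb_prod_invariant:
  assumes g: "\<gamma> \<in> SL2_maps" "z \<in> uhp"
  shows "(\<Prod>g\<in>orb f. \<phi> (g (\<gamma> z))) = (\<Prod>g\<in>orb f. \<phi> (g z) :: 'a :: comm_monoid_mult)"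
proof -
  have "(\<Prod>g\<in>orb f. \<phi> (act g \<gamma> z)) = (\<Prod>g\<in>orb f. \<phi> (g z))"
    by (rule prod.reindex_bij_betw[OF bij_orb[OF g(1)]])
  then show ?thesis using g by (simp add: act_def)
qed

text \<open>The monic polynomial whose roots are the distinct conjugates of f. Its coefficients are
  invariant, hence polynomials in j.\<close>

definition orb_poly :: "(complex \<Rightarrow> complex) \<Rightarrow> complex \<Rightarrow> complex poly" where
  "orb_poly f z = (\<Prod>g\<in>orb f. [:- g z, 1:])"

lemma orb_poly_coeffs:
  assumes R: "csubring R" and h: "h > 0" and M: "\<And>g. g \<in> orb f \<Longrightarrow> MG h R g"
  shows "\<exists>Q. (\<forall>i k. poly.coeff (Q i) k \<in> R) \<and> (\<forall>z\<in>uhp. \<forall>i. poly.coeff (orb_poly f z) i = poly (Q i) (klein_j z))"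
proof (rule pMG_invariant[OF R h])
  show "pMG h R (orb_poly f)" unfolding orb_poly_def[abs_def] by (intro pMG_prod pMG_linear R M)
  show "orb_poly f (\<gamma> z) = orb_poly f z" if "\<gamma> \<in> SL2_maps" "z \<in> uhp" for \<gamma> z
    unfolding orb_poly_def by (rule orb_prod_invariant[OF that])
qed

lemma monic_prod_linear:
  "finite A \<Longrightarrow> Polynomial.degree (\<Prod>i\<in>A. [:- f i, 1:]) = card A \<and> Polynomial.lead_coeff (\<Prod>i\<in>A. [:- f i, 1 :: 'a :: idom:]) = 1"
proof -
  assume A: "finite A"
  have "Polynomial.lead_coeff (\<Prod>i\<in>A. [:- f i, 1:]) = (\<Prod>i\<in>A. Polynomial.lead_coeff [:- f i, 1:])" by (rule lead_coeff_prod)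
  moreover have "Polynomial.degree (\<Prod>i\<in>A. [:- f i, 1:]) = (\<Sum>i\<in>A. Polynomial.degree [:- f i, 1:])"
    by (rule Polynomial.degree_prod_eq_sum_degree) simp
  ultimately show ?thesis by simp
qed

lemma poly_orb_poly: "poly (orb_poly f z) x = (\<Prod>g\<in>orb f. x - g z)"
  unfolding orb_poly_def poly_prod by simp

lemma poly_orb_self: "finite (orb f) \<Longrightarrow> z \<in> uhp \<Longrightarrow> poly (orb_poly f z) (f z) = 0"
  unfolding poly_orb_poly using orb_self[of f] by (intro prod_zero bexI[of _ "act f (\<lambda>z. z)"]) (auto simp: act_def)

lemma AI_poly: "(\<And>k. algebraic_int (poly.coeff P k)) \<Longrightarrow> algebraic_int x \<Longrightarrow> algebraic_int (poly P (x :: complex))"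
  unfolding poly_altdef by (intro algebraic_int_sum algebraic_int_mult algebraic_int_pow) auto

text \<open>The value f z is a root of the orbit polynomial, which is monic with coefficients
  polynomial in j(z) over the algebraic integers.\<close>

lemma integral_over_j:
  assumes fin: "finite (orb f)" and h: "h > 0" and M: "\<And>g. g \<in> orb f \<Longrightarrow> MG h AI g"
    and z: "z \<in> uhp" and j: "algebraic_int (klein_j z)"
  shows "algebraic_int (f z)"
proof -
  obtain Q where Q: "\<And>i k. poly.coeff (Q i) k \<in> AI" "\<And>i. poly.coeff (orb_poly f z) i = poly (Q i) (klein_j z)"
    using orb_poly_coeffs[OF csubring_algebraic_int h M] z by blast
  show ?thesis
  proof (rule algebraic_int_monic_root[OF poly_orb_self[OF fin z]])
    show "Polynomial.lead_coeff (orb_poly f z) = 1" unfolding orb_poly_def by (rule conjunct2[OF monic_prod_linear[OF fin, of "\<lambda>g. g z"]])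
    show "algebraic_int (poly.coeff (orb_poly f z) i)" for i
      unfolding Q(2) by (rule AI_poly) (use Q(1) j in auto)
  qed
qed

section \<open>The conjugates of Delta(z) / Delta(nz) and of j(nz)\<close>

definition gf :: "nat \<Rightarrow> complex \<Rightarrow> complex" where "gf n z = Dfun z / Dfun (of_nat n * z)"

lemma gf_nonzero [simp]: "gf n z \<noteq> 0" by (simp add: gf_def)

lemma gf_mob:
  assumes z: "z \<in> uhp" and g: "a * d - b * c = 1"
  shows "gf n (mob a b c d z) = Dfun z / DM (int n * a) (int n * b) c d z"
proof -
  have n0: "of_int c * z + of_int d \<noteq> (0::complex)" by (rule cocycle_nonzero[OF z]) (use g in auto)
  have "Dfun (of_nat n * mob a b c d z) = (of_int c * z + of_int d) ^ 12 * DM (int n * a) (int n * b) c d z"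
    using DM_right[OF z g, of "int n" 0 0 1] unfolding DM_scale by simp
  then show ?thesis unfolding gf_def Dfun_mob[OF z g] using n0 by simp
qed

lemma jn_mob:
  assumes z: "z \<in> uhp" and g: "a * d - b * c = 1"
  shows "klein_j (of_nat n * mob a b c d z) = jM (int n * a) (int n * b) c d z"
  using jM_right[OF z g, of "int n" 0 0 1] unfolding jM_scale by simp

text \<open>The conjugate by a unimodular matrix depends only on the left coset of diag(n, 1) times
  it. There are no more conjugates than Hermite normal forms of determinant n.\<close>

lemma finite_orb_hnf:
  assumes n: "n > 0"
    and f: "\<And>a b c d z. z \<in> uhp \<Longrightarrow> a * d - b * c = 1 \<Longrightarrow>
      f (mob a b c d z) = \<phi> z (jM (int n * a) (int n * b) c d z) (DM (int n * a) (int n * b) c d z)"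
  shows "finite (orb f)"
proof (rule finite_subset)
  let ?\<psi> = "\<lambda>(\<alpha>, \<beta>, \<delta>) z. if z \<in> uhp then \<phi> z (klein_j (aff \<alpha> \<beta> \<delta> z)) (Dfun (aff \<alpha> \<beta> \<delta> z) / of_nat \<delta> ^ 12) else 0"
  show "orb f \<subseteq> ?\<psi> ` hnfs n"
  proof
    fix h assume "h \<in> orb f"
    then obtain a b c d where g: "a * d - b * c = 1" "h = act f (mob a b c d)" by (auto simp: orb_def SL2_maps_def)
    have "(int n * a) * d - (int n * b) * c = int n * (a * d - b * c)" by (simp add: algebra_simps)
    then have "(int n * a) * d - (int n * b) * c = int n" using g(1) by simp
    from matrix_hnf[OF this n] obtain \<alpha> \<beta> \<delta> where m: "(\<alpha>, \<beta>, \<delta>) \<in> hnfs n"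
      "\<forall>z\<in>uhp. jM (int n * a) (int n * b) c d z = klein_j (aff \<alpha> \<beta> \<delta> z) \<and>
        DM (int n * a) (int n * b) c d z = Dfun (aff \<alpha> \<beta> \<delta> z) / of_nat \<delta> ^ 12" by blast
    have "h = ?\<psi> (\<alpha>, \<beta>, \<delta>)" by (rule ext) (use f[OF _ g(1)] m(2) in \<open>simp add: act_def g(2)\<close>)
    then show "h \<in> ?\<psi> ` hnfs n" using m(1) by blast
  qed
  show "finite (?\<psi> ` hnfs n)" using finite_hnfs[OF n] by simp
qed

lemma finite_orb_gf: "n > 0 \<Longrightarrow> finite (orb (gf n))"
  by (rule finite_orb_hnf[where \<phi> = "\<lambda>z u v. Dfun z / v"]) (auto intro: gf_mob)

lemma finite_orb_gf_inverse: "n > 0 \<Longrightarrow> finite (orb (\<lambda>z. of_nat n ^ 12 / gf n z))"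
  by (rule finite_orb_hnf[where \<phi> = "\<lambda>z u v. of_nat n ^ 12 / (Dfun z / v)"]) (auto simp: gf_mob)

lemma finite_orb_jn: "n > 0 \<Longrightarrow> finite (orb (\<lambda>z. klein_j (of_nat n * z)))"
  by (rule finite_orb_hnf[where \<phi> = "\<lambda>z u v. u"]) (auto intro: jn_mob)

lemma MG_orb:
  assumes "n > 0" "g \<in> orb f" "\<And>a b c d. (int n * a) * d - (int n * b) * c = int n \<Longrightarrow> MG n R (h a b c d)"
    "\<And>a b c d z. z \<in> uhp \<Longrightarrow> a * d - b * c = 1 \<Longrightarrow> f (mob a b c d z) = h a b c d z"
  shows "MG n R g"
proof -
  obtain a b c d where g: "a * d - b * c = 1" "g = act f (mob a b c d)" using assms(2) by (auto simp: orb_def SL2_maps_def)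
  have "(int n * a) * d - (int n * b) * c = int n * (a * d - b * c)" by (simp add: algebra_simps)
  then have "MG n R (h a b c d)" using g(1) by (intro assms(3)) simp
  then show ?thesis by (rule MG_cong) (use assms(4)[OF _ g(1)] in \<open>simp add: g(2) act_def\<close>)
qed

lemma MG_Dfun: "n > 0 \<Longrightarrow> MG n AI Dfun" and MG_inverse_Dfun: "n > 0 \<Longrightarrow> MG n AI (\<lambda>z. 1 / Dfun z)"
proof -
  assume n: "n > 0"
  have "MG 1 AI Dfun" unfolding MG_def using holomorphic_Dfun qx_Dfun Ints_AI[OF fpsR_XU] by blast
  then show "MG n AI Dfun" using MG_raise[OF csubring_algebraic_int, of 1 Dfun n] n by simp
  have "MG 1 AI (\<lambda>z. 1 / Dfun z)"
    unfolding MG_def using qx_inverse_Dfun Ints_AI[OF fpsR_inverse[OF csubring_IntsR Ufps_int Ufps_0]]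
    by (intro conjI holomorphic_intros holomorphic_Dfun) auto
  then show "MG n AI (\<lambda>z. 1 / Dfun z)" using MG_raise[OF csubring_algebraic_int, of 1 "\<lambda>z. 1 / Dfun z" n] n by simp
qed

lemma MG_orb_gf: "n > 0 \<Longrightarrow> g \<in> orb (gf n) \<Longrightarrow> MG n AI g"
proof (rule MG_orb[where h = "\<lambda>a b c d z. Dfun z * (1 / DM (int n * a) (int n * b) c d z)"])
  assume n: "n > 0"
  show "MG n AI (\<lambda>z. Dfun z * (1 / DM (int n * a) (int n * b) c d z))"
    if "(int n * a) * d - (int n * b) * c = int n" for a b c d
    by (intro MG_mult csubring_algebraic_int MG_Dfun n MG_inverse_DM that)
qed (auto simp: gf_mob)

lemma MG_orb_gf_inverse: "n > 0 \<Longrightarrow> g \<in> orb (\<lambda>z. of_nat n ^ 12 / gf n z) \<Longrightarrow> MG n AI g"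
proof (rule MG_orb[where h = "\<lambda>a b c d z. (of_nat n ^ 12 * DM (int n * a) (int n * b) c d z) * (1 / Dfun z)"])
  assume n: "n > 0"
  show "MG n AI (\<lambda>z. (of_nat n ^ 12 * DM (int n * a) (int n * b) c d z) * (1 / Dfun z))"
    if "(int n * a) * d - (int n * b) * c = int n" for a b c d
    by (intro MG_mult csubring_algebraic_int MG_inverse_Dfun n MG_DM that)
qed (auto simp: gf_mob)

lemma MG_orb_jn: "n > 0 \<Longrightarrow> g \<in> orb (\<lambda>z. klein_j (of_nat n * z)) \<Longrightarrow> MG n AI g"
  by (rule MG_orb[where h = "\<lambda>a b c d. jM (int n * a) (int n * b) c d"]) (auto simp: jn_mob intro: MG_jM)

lemma algebraic_int_gf:
  assumes "n > 0" "z \<in> uhp" "algebraic_int (klein_j z)"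
  shows "algebraic_int (gf n z)" "algebraic_int (of_nat n ^ 12 / gf n z)" "algebraic_int (klein_j (of_nat n * z))"
  using integral_over_j[OF finite_orb_gf[OF assms(1)] assms(1) MG_orb_gf[OF assms(1)] assms(2,3)]
    integral_over_j[OF finite_orb_gf_inverse[OF assms(1)] assms(1) MG_orb_gf_inverse[OF assms(1)] assms(2,3)]
    integral_over_j[OF finite_orb_jn[OF assms(1)] assms(1) MG_orb_jn[OF assms(1)] assms(2,3)]
  by simp_all

section \<open>Rational q-expansions\<close>

text \<open>Applied coefficientwise, such a functional respects every linear relation among series
  with rational coefficients. It is the means of descent from C to Q.\<close>

definition rat_linear :: "(complex \<Rightarrow> rat) \<Rightarrow> bool" where
  "rat_linear l \<longleftrightarrow> (\<forall>x y. l (x + y) = l x + l y) \<and> (\<forall>r x. l (of_rat r * x) = r * l x)"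

lemma rat_linear_exists:
  assumes "s \<noteq> 0" shows "\<exists>l. rat_linear l \<and> l s = 1"
proof -
  interpret vector_space_pair "\<lambda>r (x::complex). of_rat r * x" "(*) :: rat \<Rightarrow> rat \<Rightarrow> rat"
    by unfold_locales (simp_all add: ring_distribs of_rat_add of_rat_mult)
  have "vs1.independent {s}" using assms by (simp add: vs1.dependent_single)
  from linear_independent_extend[OF this, of "\<lambda>_. 1"] obtain l where
    l: "Vector_Spaces.linear (\<lambda>r (x::complex). of_rat r * x) ((*) :: rat \<Rightarrow> rat \<Rightarrow> rat) l" "l s = 1" by auto
  have "rat_linear l" unfolding rat_linear_def using linear_add[OF l(1)] linear_scale[OF l(1)] by simp
  then show ?thesis using l(2) by blast
qed

lemma rat_linear_0: "rat_linear l \<Longrightarrow> l 0 = 0"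
proof -
  assume "rat_linear l"
  then have "l (0 + 0) = l 0 + l 0" unfolding rat_linear_def by blast
  then show ?thesis by simp
qed

lemma rat_linear_sum: "rat_linear l \<Longrightarrow> l (\<Sum>i\<in>I. of_rat (r i) * c i) = (\<Sum>i\<in>I. r i * l (c i))"
  by (induction I rule: infinite_finite_induct) (simp_all add: rat_linear_0, simp add: rat_linear_def)

lemma MG_family:
  assumes R: "csubring R" and I: "finite I" and m: "\<And>i. i \<in> I \<Longrightarrow> MG h R (m i)"
  shows "\<exists>k F. \<forall>i\<in>I. qx h (m i) k (F i) \<and> fpsR R (F i)"
proof -
  have "\<forall>i\<in>I. \<exists>k F. fpsR R F \<and> qx h (m i) k F" using m by (auto simp: MG_def)
  then obtain k F where kF: "\<And>i. i \<in> I \<Longrightarrow> fpsR R (F i) \<and> qx h (m i) (k i) (F i)" by metis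
  have le: "k i \<le> sum k I" if "i \<in> I" for i by (rule member_le_sum) (use I that in auto)
  have "qx h (m i) (sum k I) (F i * fps_X ^ (sum k I - k i))" if "i \<in> I" for i
      using qx_shift[of h "m i" "k i" "F i" "sum k I - k i"] kF[OF that] le[OF that] by simp
  moreover have "fpsR R (F i * fps_X ^ (sum k I - k i))" if "i \<in> I" for i
    using kF[OF that] by (intro fpsR_mult R fpsR_X_power) auto
  ultimately show ?thesis by (intro exI[of _ "sum k I"] exI[of _ "\<lambda>i. F i * fps_X ^ (sum k I - k i)"]) blast
qed

lemma qx_lincomb:
  "(\<And>i. i \<in> I \<Longrightarrow> qx h (m i) k (F i)) \<Longrightarrow> qx h (\<lambda>z. \<Sum>i\<in>I. c i * m i z) k (\<Sum>i\<in>I. fps_const (c i) * F i)"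
proof (induction I rule: infinite_finite_induct)
  case (insert x A)
  have "qx h (\<lambda>z. c x * m x z) k (fps_const (c x) * F x)" using qx_mult[OF qx_const insert.prems[of x], of "c x"] by simp
  from qx_add_same[OF this insert.IH] insert.prems insert.hyps show ?case by simp
qed (use qx_shift[OF qx_const[of h 0], of k] in simp_all)

lemma MG_holomorphic: "MG h R f \<Longrightarrow> f holomorphic_on uhp" by (simp add: MG_def)

lemma holomorphic_lincomb:
  "(\<And>i. i \<in> I \<Longrightarrow> MG h R (m i)) \<Longrightarrow> (\<lambda>z. \<Sum>i\<in>I. c i * m i z) holomorphic_on uhp"
  by (intro holomorphic_intros) (auto intro: MG_holomorphic)

lemma eventually_at_ioo_uhp: "(\<And>z. z \<in> uhp \<Longrightarrow> P z) \<Longrightarrow> \<forall>\<^sub>F z in at_ioo. P z"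
  unfolding eventually_at_ioo by (intro exI[of _ 1]) (auto simp: uhp_iff)

lemma qx_0: "h > 0 \<Longrightarrow> qx h f k F \<Longrightarrow> (\<And>z. z \<in> uhp \<Longrightarrow> f z = 0) \<Longrightarrow> F = 0"
  by (rule qx_unique[of h f k F "\<lambda>_. 0"])
    (use qx_shift[OF qx_const[of h 0], of k] in \<open>auto intro!: eventually_at_ioo_uhp\<close>)

lemma rat_linear_nth:
  assumes l: "rat_linear l" and F: "\<And>i. i \<in> I \<Longrightarrow> fpsR \<rat> (F i)"
  shows "fps_nth (\<Sum>i\<in>I. fps_const (of_rat (l (c i))) * F i) n = of_rat (l (fps_nth (\<Sum>i\<in>I. fps_const (c i) * F i) n))"
proof -
  have "\<exists>r. fps_nth (F i) n = of_rat r" if "i \<in> I" for i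
    using F[OF that] by (auto simp: fpsR_def elim!: Rats_cases)
  then obtain r where r: "\<And>i. i \<in> I \<Longrightarrow> fps_nth (F i) n = of_rat (r i)" by metis
  have "fps_nth (\<Sum>i\<in>I. fps_const (c i) * F i) n = (\<Sum>i\<in>I. of_rat (r i) * c i)"
    unfolding fps_sum_nth by (intro sum.cong refl) (simp add: r mult.commute)
  then have "l (fps_nth (\<Sum>i\<in>I. fps_const (c i) * F i) n) = (\<Sum>i\<in>I. r i * l (c i))" by (simp add: rat_linear_sum[OF l])
  moreover have "fps_nth (\<Sum>i\<in>I. fps_const (of_rat (l (c i))) * F i) n = (\<Sum>i\<in>I. of_rat (r i * l (c i)))"
    unfolding fps_sum_nth by (intro sum.cong refl) (simp add: r mult.commute of_rat_mult)
  ultimately show ?thesis by (simp add: of_rat_sum)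
qed

text \<open>With rational q-expansions the relation means one rational linear condition on the
  \<open>c i\<close> for each power of q, and \<open>l\<close> preserves all of them.\<close>

lemma rat_linear_relation:
  assumes l: "rat_linear l" and I: "finite I" and m: "\<And>i. i \<in> I \<Longrightarrow> MG 1 \<rat> (m i)"
    and rel: "\<And>z. z \<in> uhp \<Longrightarrow> (\<Sum>i\<in>I. c i * m i z) = 0" and z: "z \<in> uhp"
  shows "(\<Sum>i\<in>I. of_rat (l (c i)) * m i z) = 0"
proof -
  obtain k F where F: "\<And>i. i \<in> I \<Longrightarrow> qx 1 (m i) k (F i)" "\<And>i. i \<in> I \<Longrightarrow> fpsR \<rat> (F i)"
    using MG_family[of \<rat> I 1 m, OF csubring_Rats I m] by blast
  have "(\<Sum>i\<in>I. fps_const (c i) * F i) = 0" by (rule qx_0[OF _ qx_lincomb[of I 1 m k F c, OF F(1)] rel]) simp_all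
  then have "(\<Sum>i\<in>I. fps_const (of_rat (l (c i))) * F i) = 0"
    by (intro fps_ext) (simp only: rat_linear_nth[of l I F c, OF l F(2)] fps_zero_nth rat_linear_0[OF l] of_rat_0)
  then have "qx 1 (\<lambda>z. \<Sum>i\<in>I. of_rat (l (c i)) * m i z) k 0" using qx_lincomb[of I 1 m k F "\<lambda>i. of_rat (l (c i))", OF F(1)] by simp
  then show ?thesis by (rule qx_zero[rotated 2, OF _ z]) (use holomorphic_lincomb[of I 1 \<rat> m, OF m] in auto)
qed

text \<open>Choose \<open>l\<close> with value 1 on some nonzero coefficient of the combination;
  that coefficient keeps the projected combination from vanishing.\<close>

lemma rat_linear_nonzero:
  assumes I: "finite I" and m: "\<And>i. i \<in> I \<Longrightarrow> MG 1 \<rat> (m i)"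
    and z: "z \<in> uhp" and ne: "(\<Sum>i\<in>I. c i * m i z) \<noteq> 0"
  obtains l w where "rat_linear l" "w \<in> uhp" "(\<Sum>i\<in>I. of_rat (l (c i)) * m i w) \<noteq> 0"
proof -
  obtain k F where F: "\<And>i. i \<in> I \<Longrightarrow> qx 1 (m i) k (F i)" "\<And>i. i \<in> I \<Longrightarrow> fpsR \<rat> (F i)"
    using MG_family[of \<rat> I 1 m, OF csubring_Rats I m] by blast
  have "(\<Sum>i\<in>I. fps_const (c i) * F i) \<noteq> 0"
  proof
    assume 0: "(\<Sum>i\<in>I. fps_const (c i) * F i) = 0"
    have "qx 1 (\<lambda>z. \<Sum>i\<in>I. c i * m i z) k 0" using qx_lincomb[of I 1 m k F c, OF F(1)] unfolding 0 .
    then show False using ne qx_zero[OF _ holomorphic_lincomb[of I 1 \<rat> m c, OF m] _ z, of 1 k] by auto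
  qed
  then obtain n where n: "fps_nth (\<Sum>i\<in>I. fps_const (c i) * F i) n \<noteq> 0" by (auto simp: fps_eq_iff)
  obtain l where l: "rat_linear l" "l (fps_nth (\<Sum>i\<in>I. fps_const (c i) * F i) n) = 1" using rat_linear_exists[OF n] by blast
  have "\<exists>w\<in>uhp. (\<Sum>i\<in>I. of_rat (l (c i)) * m i w) \<noteq> 0"
  proof (rule ccontr)
    assume "\<not> ?thesis"
    then have a: "\<And>w. w \<in> uhp \<Longrightarrow> (\<Sum>i\<in>I. of_rat (l (c i)) * m i w) = 0" by blast
    have 0: "(\<Sum>i\<in>I. fps_const (of_rat (l (c i))) * F i) = 0" by (rule qx_0[OF _ qx_lincomb[of I 1 m k F "\<lambda>i. of_rat (l (c i))", OF F(1)] a]) simp_all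
    have "fps_nth (\<Sum>i\<in>I. fps_const (of_rat (l (c i))) * F i) n = 1" by (simp only: rat_linear_nth[of l I F c, OF l(1) F(2)] l(2) of_rat_1)
    then show False unfolding 0 by simp
  qed
  then show thesis using l(1) that by blast
qed

lemma eventually_nonzero:
  assumes "f holomorphic_on uhp" "w \<in> uhp" "f w \<noteq> 0" "z \<in> uhp"
  shows "\<forall>\<^sub>F x in at z. f x \<noteq> 0"
  using non_zero_neighbour_alt[OF assms(1) open_uhp connected_uhp assms(4,2,3)] by eventually_elim simp

lemma poly_sum_bound: "Polynomial.degree P \<le> n \<Longrightarrow> poly P (x :: 'a :: comm_semiring_1) = (\<Sum>i\<le>n. poly.coeff P i * x ^ i)"
  unfolding Polynomial.poly_altdef by (rule sum.mono_neutral_left) (auto simp: Polynomial.coeff_eq_0)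

lemma pMG_bivariate:
  assumes h: "h > 0" and H: "pMG h UNIV H" and dg: "\<And>z. z \<in> uhp \<Longrightarrow> Polynomial.degree (H z) \<le> n"
    and inv: "\<And>\<gamma> z. \<gamma> \<in> SL2_maps \<Longrightarrow> z \<in> uhp \<Longrightarrow> H (\<gamma> z) = H z"
  obtains m c where "\<And>z i. z \<in> uhp \<Longrightarrow> i \<le> n \<Longrightarrow> poly.coeff (H z) i = (\<Sum>k\<le>m. c (i, k) * klein_j z ^ k)"
    "\<And>z x. z \<in> uhp \<Longrightarrow> poly (H z) x = (\<Sum>p\<in>{..n}\<times>{..m}. c p * (klein_j z ^ snd p * x ^ fst p))"
proof -
  obtain Q where Q: "\<And>z i. z \<in> uhp \<Longrightarrow> poly.coeff (H z) i = poly (Q i) (klein_j z)"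
  proof -
    have "\<exists>Q. (\<forall>i k. poly.coeff (Q i) k \<in> UNIV) \<and> (\<forall>z\<in>uhp. \<forall>i. poly.coeff (H z) i = poly (Q i) (klein_j z))"
      by (rule pMG_invariant[OF csubring_UNIV h H]) (rule inv)
    then show ?thesis using that by blast
  qed
  define m where "m = (\<Sum>i\<le>n. Polynomial.degree (Q i))"
  define c where "c = (\<lambda>(i, k). poly.coeff (Q i) k)"
  have 1: "poly.coeff (H z) i = (\<Sum>k\<le>m. c (i, k) * klein_j z ^ k)" if "z \<in> uhp" "i \<le> n" for z i
  proof -
    have "Polynomial.degree (Q i) \<le> m" unfolding m_def using that by (intro member_le_sum) auto
    then show ?thesis unfolding Q[OF that(1)] c_def by (simp add: poly_sum_bound)
  qed
  have 2: "poly (H z) x = (\<Sum>p\<in>{..n}\<times>{..m}. c p * (klein_j z ^ snd p * x ^ fst p))" if "z \<in> uhp" for z x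
  proof -
    have "poly (H z) x = (\<Sum>i\<le>n. (\<Sum>k\<le>m. c (i, k) * klein_j z ^ k) * x ^ i)"
      unfolding poly_sum_bound[OF dg[OF that]] using 1[OF that] by simp
    also have "\<dots> = (\<Sum>i\<le>n. \<Sum>k\<le>m. c (i, k) * (klein_j z ^ k * x ^ i))" by (simp add: sum_distrib_right mult.assoc)
    also have "\<dots> = (\<Sum>p\<in>{..n}\<times>{..m}. c p * (klein_j z ^ snd p * x ^ fst p))"
      unfolding sum.cartesian_product by (intro sum.cong) auto
    finally show ?thesis .
  qed
  show thesis using that[OF 1 2] by blast
qed

lemma eval2_exists: "\<exists>A. \<forall>x y. eval2 A x y = (\<Sum>p\<in>{..n}\<times>{..m}. of_rat (r p) * (x ^ snd p * y ^ fst p))"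
proof -
  define B where "B i = (\<Sum>k\<le>m. Polynomial.monom (r (i, k)) k)" for i :: nat
  define A where "A = (\<Sum>i\<le>n. Polynomial.monom (B i) i)"
  have dB: "Polynomial.degree (B i) \<le> m" for i
    unfolding B_def by (intro degree_sum_le) (auto intro: order_trans[OF Polynomial.degree_monom_le])
  have dA: "Polynomial.degree A \<le> n"
    unfolding A_def by (intro degree_sum_le) (auto intro: order_trans[OF Polynomial.degree_monom_le])
  have cB: "poly.coeff (B i) k = r (i, k)" if "k \<le> m" for i k
    unfolding B_def Polynomial.coeff_sum Polynomial.coeff_monom using that by (simp add: sum.delta)
  have cA: "poly.coeff A i = B i" if "i \<le> n" for i
    unfolding A_def Polynomial.coeff_sum Polynomial.coeff_monom using that by (simp add: sum.delta)
  have ev: "poly (map_poly f F) y = (\<Sum>i\<le>N. f (poly.coeff F i) * y ^ i)"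
    if "f 0 = 0" "Polynomial.degree F \<le> N" for f :: "'a::zero \<Rightarrow> complex" and F y N
  proof -
    have "poly (map_poly f F) y = (\<Sum>i\<le>N. poly.coeff (map_poly f F) i * y ^ i)"
      by (rule poly_sum_bound) (use degree_map_poly_le[of f F] that in linarith)
    then show ?thesis by (simp add: coeff_map_poly that)
  qed
  have "eval2 A x y = (\<Sum>p\<in>{..n}\<times>{..m}. of_rat (r p) * (x ^ snd p * y ^ fst p))" for x y
  proof -
    have "eval2 A x y = (\<Sum>i\<le>n. (\<Sum>k\<le>m. of_rat (r (i, k)) * x ^ k) * y ^ i)"
      unfolding eval2_def using dA by (subst ev) (auto simp: cA ev[OF _ dB] cB)
    also have "\<dots> = (\<Sum>i\<le>n. \<Sum>k\<le>m. of_rat (r (i, k)) * (x ^ k * y ^ i))" by (simp add: sum_distrib_right mult.assoc)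
    also have "\<dots> = (\<Sum>p\<in>{..n}\<times>{..m}. of_rat (r p) * (x ^ snd p * y ^ fst p))"
      unfolding sum.cartesian_product by (intro sum.cong) auto
    finally show ?thesis .
  qed
  then show ?thesis by blast
qed

definition modular_fn :: "nat \<Rightarrow> (complex \<Rightarrow> complex) \<Rightarrow> bool" where
  "modular_fn h f \<longleftrightarrow> MG 1 \<rat> f \<and> finite (orb f) \<and> (\<forall>g\<in>orb f. MG h UNIV g)"

lemma modular_fn_mult: "modular_fn h f \<Longrightarrow> modular_fn h g \<Longrightarrow> modular_fn h (\<lambda>z. f z * g z)"
  and modular_fn_add: "modular_fn h f \<Longrightarrow> modular_fn h g \<Longrightarrow> modular_fn h (\<lambda>z. f z + g z)"
proof -
  assume f: "modular_fn h f" and g: "modular_fn h g"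
  have a: "act (\<lambda>z. f z * g z) \<gamma> = (\<lambda>z. act f \<gamma> z * act g \<gamma> z)" "act (\<lambda>z. f z + g z) \<gamma> = (\<lambda>z. act f \<gamma> z + act g \<gamma> z)" for \<gamma>
    by (auto simp: act_def fun_eq_iff)
  have m: "\<forall>\<gamma>\<in>SL2_maps. MG h UNIV (act f \<gamma>)" "\<forall>\<gamma>\<in>SL2_maps. MG h UNIV (act g \<gamma>)"
    using f g by (auto simp: modular_fn_def orb_def)
  have 1: "finite (orb (\<lambda>z. f z * g z))" "finite (orb (\<lambda>z. f z + g z))"
    using finite_orb_comb[of f g "\<lambda>z. f z * g z" "(*)"] finite_orb_comb[of f g "\<lambda>z. f z + g z" "(+)"] f g
    by (simp_all add: modular_fn_def)
  have 2: "MG 1 \<rat> (\<lambda>z. f z * g z)" "MG 1 \<rat> (\<lambda>z. f z + g z)"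
    using f g by (auto simp: modular_fn_def intro: MG_mult MG_add csubring_Rats)
  have 3: "MG h UNIV k" if k: "k \<in> orb (\<lambda>z. f z * g z)" for k
  proof -
    obtain \<gamma> where c: "\<gamma> \<in> SL2_maps" "k = act (\<lambda>z. f z * g z) \<gamma>" using k by (auto simp: orb_def)
    show ?thesis unfolding c(2) a by (intro MG_mult csubring_UNIV) (use m c in blast)+
  qed
  have 4: "MG h UNIV k" if k: "k \<in> orb (\<lambda>z. f z + g z)" for k
  proof -
    obtain \<gamma> where c: "\<gamma> \<in> SL2_maps" "k = act (\<lambda>z. f z + g z) \<gamma>" using k by (auto simp: orb_def)
    show ?thesis unfolding c(2) a by (intro MG_add csubring_UNIV) (use m c in blast)+
  qed
  show "modular_fn h (\<lambda>z. f z * g z)" "modular_fn h (\<lambda>z. f z + g z)"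
    unfolding modular_fn_def using 1 2 3 4 by blast+
qed

lemma modular_fn_const: "modular_fn h (\<lambda>_. of_rat r)"
proof -
  have "act (\<lambda>_. of_rat r) \<gamma> = (\<lambda>z. if z \<in> uhp then of_rat r else 0 :: complex)" for \<gamma> by (auto simp: act_def)
  then have s: "orb (\<lambda>_. of_rat r) \<subseteq> {\<lambda>z. if z \<in> uhp then of_rat r else 0 :: complex}" by (auto simp: orb_def)
  have "MG h UNIV (\<lambda>z. if z \<in> uhp then of_rat r else 0)"
    by (rule MG_cong[OF MG_const[OF csubring_UNIV, of "of_rat r"]]) auto
  then show ?thesis unfolding modular_fn_def using s MG_const[OF csubring_Rats, of "of_rat r" 1]
    by (auto intro: finite_subset[OF s])
qed

lemma qx_scale:
  assumes q: "qx 1 f k F" and n: "n > 0" shows "qx 1 (\<lambda>z. f (of_nat n * z)) (n * k) (F oo fps_X ^ n)"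
proof -
  obtain u where u: "u has_fps_expansion F" "\<forall>\<^sub>F z in at_ioo. f z * qe z ^ k = u (qe z)"
    using q by (auto simp: qx_def)
  have "(u \<circ> (\<lambda>x. x ^ n)) has_fps_expansion (F oo fps_X ^ n)"
    by (rule has_fps_expansion_compose[OF u(1) has_fps_expansion_X_power]) (use n in simp)
  moreover have "filterlim (\<lambda>z. of_real (real n) * z + 0) at_ioo at_ioo"
    by (rule at_ioo_affine) (use n in simp)
  then have "filterlim (\<lambda>z. of_nat n * z) at_ioo at_ioo" by simp
  from eventually_compose_filterlim[OF u(2) this]
  have "\<forall>\<^sub>F z in at_ioo. f (of_nat n * z) * qe (z / of_nat 1) ^ (n * k) = (u \<circ> (\<lambda>x. x ^ n)) (qe (z / of_nat 1))"
    by eventually_elim (simp only: qe_of_nat power_mult o_def of_nat_1 div_by_1)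
  ultimately show ?thesis unfolding qx_def by blast
qed

lemma MG_scale:
  assumes R: "csubring R" and f: "MG 1 R f" and n: "n > 0" shows "MG 1 R (\<lambda>z. f (of_nat n * z))"
proof -
  obtain k F where F: "f holomorphic_on uhp" "fpsR R F" "qx 1 f k F" using f by (auto simp: MG_def)
  have "(f \<circ> (\<lambda>z. of_nat n * z)) holomorphic_on uhp"
    by (rule holomorphic_on_compose_gen[OF _ F(1)]) (use n in \<open>auto intro!: holomorphic_intros simp: uhp_iff\<close>)
  then show ?thesis unfolding MG_def using qx_scale[OF F(3) n] fps_compose_X_power[OF R F(2)] by (auto simp: o_def)
qed

lemma fpsR_Ints_Rats: "fpsR \<int> F \<Longrightarrow> fpsR \<rat> F" unfolding fpsR_def using Ints_subset_Rats by blast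

lemma MG_klein_j: "MG 1 \<rat> klein_j"
  unfolding MG_def using holomorphic_klein_j qx_j fpsR_Ints_Rats[OF Jfps_int] by blast

lemma MG_gf: "n > 0 \<Longrightarrow> MG 1 \<rat> (gf n)" and MG_gf_inverse: "n > 0 \<Longrightarrow> MG 1 \<rat> (\<lambda>z. 1 / gf n z)"
proof -
  assume n: "n > 0"
  have D: "MG 1 \<rat> Dfun" unfolding MG_def using holomorphic_Dfun qx_Dfun fpsR_Ints_Rats[OF fpsR_XU] by blast
  have I: "MG 1 \<rat> (\<lambda>z. 1 / Dfun z)"
    unfolding MG_def using qx_inverse_Dfun fpsR_Ints_Rats[OF fpsR_inverse[OF csubring_IntsR Ufps_int Ufps_0]]
    by (intro conjI holomorphic_intros holomorphic_Dfun) auto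
  show "MG 1 \<rat> (gf n)"
    using MG_mult[OF csubring_Rats D MG_scale[OF csubring_Rats I n]] by (simp add: gf_def[abs_def])
  show "MG 1 \<rat> (\<lambda>z. 1 / gf n z)"
    using MG_mult[OF csubring_Rats I MG_scale[OF csubring_Rats D n]] by (simp add: gf_def[abs_def])
qed

lemma modular_fn_jn: "n > 0 \<Longrightarrow> n dvd h \<Longrightarrow> h > 0 \<Longrightarrow> modular_fn h (\<lambda>z. klein_j (of_nat n * z))"
  and modular_fn_gf: "n > 0 \<Longrightarrow> n dvd h \<Longrightarrow> h > 0 \<Longrightarrow> modular_fn h (gf n)"
  and modular_fn_gf_inverse: "n > 0 \<Longrightarrow> n dvd h \<Longrightarrow> h > 0 \<Longrightarrow> modular_fn h (\<lambda>z. 1 / gf n z)"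
proof -
  assume n: "n > 0" "n dvd h" "h > 0"
  have r: "MG n AI g \<Longrightarrow> MG h UNIV g" for g
    using MG_raise[OF csubring_algebraic_int, of n g "h div n"] n MG_mono[of h AI g UNIV] by auto
  show "modular_fn h (\<lambda>z. klein_j (of_nat n * z))" unfolding modular_fn_def
    using MG_scale[OF csubring_Rats MG_klein_j n(1)] finite_orb_jn[OF n(1)] MG_orb_jn[OF n(1)] r by blast
  show "modular_fn h (gf n)" unfolding modular_fn_def
    using MG_gf[OF n(1)] finite_orb_gf[OF n(1)] MG_orb_gf[OF n(1)] r by blast
  have "MG 1 \<rat> (\<lambda>z. of_rat (of_nat n ^ 12) * (1 / gf n z))"
    by (intro MG_mult MG_const csubring_Rats MG_gf_inverse n) simp
  then have "MG 1 \<rat> (\<lambda>z. of_nat n ^ 12 / gf n z)" by (simp add: of_rat_power)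
  then have "modular_fn h (\<lambda>z. of_nat n ^ 12 / gf n z)" unfolding modular_fn_def
    using finite_orb_gf_inverse[OF n(1)] MG_orb_gf_inverse[OF n(1)] r by blast
  from modular_fn_mult[OF modular_fn_const[of h "1 / of_nat n ^ 12"] this]
  show "modular_fn h (\<lambda>z. 1 / gf n z)" using n by (simp add: of_rat_divide of_rat_power)
qed

section \<open>Values in the residue field\<close>

lemma qx_order_unique:
  assumes h: "h > 0" and q: "qx h f k F" "qx h g l G" and n: "fps_nth F 0 \<noteq> 0" "fps_nth G 0 \<noteq> 0"
    and e: "\<And>z. z \<in> uhp \<Longrightarrow> f z = g z"
  shows "k \<le> l"
proof (rule ccontr)
  assume "\<not> k \<le> l"
  then have kl: "l + (k - l) = k" "k - l > 0" by auto
  have "F = G * fps_X ^ (k - l)"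
    by (rule qx_unique[OF h q(1) _ eventually_at_ioo_uhp[OF e]]) (use qx_shift[OF q(2), of "k - l"] kl in simp_all)
  then have "fps_nth F 0 = 0" using kl(2) by simp
  then show False using n by simp
qed

text \<open>Comparing the orders of the poles at \<open>i\<infinity>\<close> identifies the stabiliser of \<open>j(Nz)\<close>.\<close>

lemma jn_stabiliser:
  assumes N: "N > 0" and det: "a * d - b * c = 1"
    and e: "\<And>z. z \<in> uhp \<Longrightarrow> klein_j (of_nat N * mob a b c d z) = klein_j (of_nat N * z)"
  shows "int N dvd c"
proof -
  have "(int N * a) * d - (int N * b) * c = int N * (a * d - b * c)" by (simp add: algebra_simps)
  then have m: "(int N * a) * d - (int N * b) * c = int N" using det by simp
  obtain p q r s :: int and \<alpha> \<beta> \<delta> :: nat where h: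
    "p * s - q * r = 1" "\<alpha> * \<delta> = N" "\<beta> < \<delta>"
    "int N * a = p * int \<alpha>" "int N * b = p * int \<beta> + q * int \<delta>" "c = r * int \<alpha>" "d = r * int \<beta> + s * int \<delta>"
    by (rule hermite_normal_form[OF m N])
  have ad: "\<alpha> > 0" "\<delta> > 0" using h(2) N by (auto intro!: Nat.gr0I)
  have pos: "int \<alpha> * int \<delta> - int \<beta> * 0 > 0" using ad by simp
  have e2: "klein_j (of_nat N * z) = klein_j ((of_nat \<alpha> * z + of_nat \<beta>) / of_nat \<delta>)" if z: "z \<in> uhp" for z
  proof -
    have "klein_j (of_nat N * z) = jM (int N * a) (int N * b) c d z" using jn_mob[OF z det, of N] e[OF z] by simp
    also have "\<dots> = jM (int \<alpha>) (int \<beta>) 0 (int \<delta>) z" using jM_left[OF z h(1) pos] unfolding h(4-7) by simp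
    finally show ?thesis by (simp add: jM_def mob_def)
  qed
  have nz: "fps_nth (fps_const (inverse (qe (of_nat \<beta> / of_nat \<delta>)) ^ 1) *
     ((Jfps oo (fps_const (qe (of_nat \<beta> / of_nat \<delta>)) * fps_X)) oo fps_X ^ \<alpha>\<^sup>2)) 0 \<noteq> 0"
    by (simp add: fps_compose_nth_0 Jfps_0)
  \<comment> \<open>Measured in q^(1/N), the pole of j(Nz) has order N^2 and that of the conjugate
    has order \<open>\<alpha>\<close>^2. So \<open>\<alpha>\<close> = N, and N divides c = r
    \<open>\<alpha>\<close>.\<close>
  have "N ^ 2 * 1 \<le> \<alpha> ^ 2 * 1"
  proof (rule qx_order_unique[OF N _ qx_affine[OF qx_j ad h(2)[symmetric], of \<beta>] _ nz])
    show "qx N (\<lambda>z. klein_j ((of_nat N * z + of_nat 0) / of_nat 1)) (N ^ 2 * 1) (fps_const (inverse (qe (of_nat 0 / of_nat 1)) ^ 1) *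
     ((Jfps oo (fps_const (qe (of_nat 0 / of_nat 1)) * fps_X)) oo fps_X ^ N\<^sup>2))"
      by (rule qx_affine[OF qx_j N]) simp_all
  qed (use e2 in \<open>simp_all add: fps_compose_nth_0 Jfps_0\<close>)
  then have "N \<le> \<alpha>" by (simp add: power2_nat_le_eq_le)
  moreover have "\<alpha> * 1 \<le> \<alpha> * \<delta>" using ad by (intro mult_le_mono) simp_all
  ultimately have "\<alpha> = N" using h(2) by simp
  then show ?thesis using h(6) by simp
qed

text \<open>When n divides c, conjugating by diag(n, 1) gives a unimodular matrix again, and the
  left coset of diag(n, 1) is unchanged.\<close>

lemma gf_stable:
  assumes z: "z \<in> uhp" and n: "n > 0" and det: "a * d - b * c = 1" and dv: "int n dvd c"
  shows "gf n (mob a b c d z) = gf n z"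
proof -
  obtain c' where c': "c = int n * c'" using dv by (elim dvdE)
  have det': "a * d - (int n * b) * c' = 1" using det c' by (simp add: algebra_simps)
  have "DM (int n * a) (int n * b) c d z = DM (int n) 0 0 1 z"
    using DM_left[OF z det', of "int n" 1 0 0] n unfolding c' by (simp add: mult.commute)
  then show ?thesis using gf_mob[OF z det, of n] by (simp add: DM_scale gf_def[of n z])
qed

lemma orb_punctured_sum_invariant:
  assumes g: "\<gamma> \<in> SL2_maps" "z \<in> uhp"
  shows "(\<Sum>g\<in>orb f. \<phi> (g (\<gamma> z)) * (\<Prod>g'\<in>orb f - {g}. \<psi> (g' (\<gamma> z)))) =
     (\<Sum>g\<in>orb f. \<phi> (g z) * (\<Prod>g'\<in>orb f - {g}. \<psi> (g' z)) :: 'a :: comm_semiring_1)"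
proof -
  let ?b = "\<lambda>g. act g \<gamma>"
  have b: "bij_betw ?b (orb f) (orb f)" by (rule bij_orb[OF g(1)])
  have b1: "bij_betw ?b (orb f - {g}) (orb f - {?b g})" if "g \<in> orb f" for g
  proof -
    have "?b ` (orb f - {g}) = ?b ` orb f - ?b ` {g}"
      by (rule inj_on_image_set_diff[OF bij_betw_imp_inj_on[OF b]]) (use that in auto)
    then show ?thesis using b inj_on_subset[of ?b "orb f" "orb f - {g}"] unfolding bij_betw_def by auto
  qed
  have e: "g' (\<gamma> z) = ?b g' z" for g' using g by (simp add: act_def)
  have "(\<Sum>g\<in>orb f. \<phi> (g (\<gamma> z)) * (\<Prod>g'\<in>orb f - {g}. \<psi> (g' (\<gamma> z)))) =
    (\<Sum>g\<in>orb f. \<phi> (?b g z) * (\<Prod>g'\<in>orb f - {?b g}. \<psi> (g' z)))"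
  proof (intro sum.cong refl arg_cong2[where f = "(*)"])
    fix g assume "g \<in> orb f"
    show "(\<Prod>g'\<in>orb f - {g}. \<psi> (g' (\<gamma> z))) = (\<Prod>g'\<in>orb f - {?b g}. \<psi> (g' z))"
      unfolding e by (rule prod.reindex_bij_betw[OF b1[OF \<open>g \<in> orb f\<close>], where g = "\<lambda>h. \<psi> (h z)"])
  qed (simp add: e)
  also have "\<dots> = (\<Sum>g\<in>orb f. \<phi> (g z) * (\<Prod>g'\<in>orb f - {g}. \<psi> (g' z)))"
    by (rule sum.reindex_bij_betw[OF b, where g = "\<lambda>g. \<phi> (g z) * (\<Prod>g'\<in>orb f - {g}. \<psi> (g' z))"])
  finally show ?thesis .
qed

text \<open>Lagrange interpolation over the conjugates \<open>(j(N\<gamma>z), f(\<gamma>z))\<close>.\<close>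

definition interp :: "(complex \<Rightarrow> complex) \<Rightarrow> (complex \<Rightarrow> complex) \<Rightarrow> (complex \<times> complex \<Rightarrow> complex poly) \<Rightarrow> complex \<Rightarrow> complex poly" where
  "interp u f \<phi> z = (\<Sum>g\<in>orb (\<lambda>z. (u z, f z)). \<phi> (g z) * (\<Prod>g'\<in>orb (\<lambda>z. (u z, f z)) - {g}. [:- fst (g' z), 1:]))"

lemma orb_pair:
  assumes "g \<in> orb (\<lambda>z. (u z, f z))"
  obtains \<gamma> where "\<gamma> \<in> SL2_maps" "\<And>z. z \<in> uhp \<Longrightarrow> g z = (u (\<gamma> z), f (\<gamma> z))" "\<And>z. fst (g z) = act u \<gamma> z" "\<And>z. snd (g z) = act f \<gamma> z"
proof -
  obtain \<gamma> where g: "\<gamma> \<in> SL2_maps" "g = act (\<lambda>z. (u z, f z)) \<gamma>" using assms by (auto simp: orb_def)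
  show thesis by (rule that[OF g(1)]) (simp_all add: g(2) act_def zero_prod_def)
qed

lemma interp_bivariate:
  assumes h: "h > 0" and u: "modular_fn h u" and f: "modular_fn h f"
    and \<phi>: "\<And>g. g \<in> orb (\<lambda>z. (u z, f z)) \<Longrightarrow> pMG h UNIV (\<lambda>z. \<phi> (g z))" "\<And>x. Polynomial.degree (\<phi> x) = 0"
  obtains n m c where
    "\<And>z x. z \<in> uhp \<Longrightarrow> poly (interp u f \<phi> z) x = (\<Sum>p\<in>{..n}\<times>{..m}. c p * (klein_j z ^ snd p * x ^ fst p))"
proof -
  let ?O = "orb (\<lambda>z. (u z, f z))"
  have fin: "finite ?O" by (rule finite_orb_comb[of u f]) (use u f in \<open>auto simp: modular_fn_def\<close>)
  have "MG h UNIV (\<lambda>z. fst (g z))" if "g \<in> ?O" for g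
  proof -
    obtain \<gamma> where "\<gamma> \<in> SL2_maps" "\<And>z. fst (g z) = act u \<gamma> z" using orb_pair[OF \<open>g \<in> ?O\<close>] by metis
    then show ?thesis using u by (auto simp: modular_fn_def orb_def)
  qed
  then have p: "pMG h UNIV (interp u f \<phi>)"
    unfolding interp_def[abs_def] by (intro pMG_sum pMG_mult pMG_prod pMG_linear csubring_UNIV \<phi>) auto
  have d: "Polynomial.degree (interp u f \<phi> z) \<le> card ?O" for z
    unfolding interp_def
  proof (intro degree_sum_le fin)
    fix g assume "g \<in> ?O"
    have "Polynomial.degree (\<phi> (g z) * (\<Prod>g'\<in>?O - {g}. [:- fst (g' z), 1:])) \<le>
       Polynomial.degree (\<phi> (g z)) + Polynomial.degree (\<Prod>g'\<in>?O - {g}. [:- fst (g' z), 1:])" by (rule Polynomial.degree_mult_le)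
    also have "Polynomial.degree (\<Prod>g'\<in>?O - {g}. [:- fst (g' z), 1:]) = card (?O - {g})"
      using monic_prod_linear[of "?O - {g}" "\<lambda>g'. fst (g' z)"] fin by simp
    also have "\<dots> \<le> card ?O" by (rule card_mono) (use fin in auto)
    finally show "Polynomial.degree (\<phi> (g z) * (\<Prod>g'\<in>?O - {g}. [:- fst (g' z), 1:])) \<le> card ?O" using \<phi>(2) by simp
  qed
  have i: "interp u f \<phi> (\<gamma> z) = interp u f \<phi> z" if "\<gamma> \<in> SL2_maps" "z \<in> uhp" for \<gamma> z
    unfolding interp_def by (rule orb_punctured_sum_invariant[OF that])
  show thesis 
  proof (rule pMG_bivariate[OF h p, of "card ?O"])
    show "interp u f \<phi> (\<gamma> z) = interp u f \<phi> z" if "\<gamma> \<in> SL2_maps" "z \<in> uhp" for \<gamma> z by (rule i[OF that])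
  qed (use d that in auto)
qed

text \<open>At x = u z every other summand contains the factor of the identity conjugate, which is u
  z - u z. Only one term survives.\<close>

lemma interp_eval:
  assumes fin: "finite (orb (\<lambda>z. (u z, f z)))" and z: "z \<in> uhp"
  shows "poly (interp u f \<phi> z) (u z) = poly (\<phi> (u z, f z)) (u z) *
     (\<Prod>g'\<in>orb (\<lambda>z. (u z, f z)) - {act (\<lambda>z. (u z, f z)) (\<lambda>z. z)}. u z - fst (g' z))"
proof -
  let ?F = "\<lambda>z. (u z, f z)" let ?O = "orb ?F" let ?g = "act ?F (\<lambda>z. z)"
  have g: "?g \<in> ?O" by (rule orb_self)
  have gz: "?g z = (u z, f z)" using z by (simp add: act_def)
  have "poly (interp u f \<phi> z) (u z) = (\<Sum>g\<in>?O. poly (\<phi> (g z)) (u z) * (\<Prod>g'\<in>?O - {g}. u z - fst (g' z)))"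
    unfolding interp_def poly_sum poly_mult poly_prod by simp
  also have "\<dots> = poly (\<phi> (?g z)) (u z) * (\<Prod>g'\<in>?O - {?g}. u z - fst (g' z)) +
     (\<Sum>g\<in>?O - {?g}. poly (\<phi> (g z)) (u z) * (\<Prod>g'\<in>?O - {g}. u z - fst (g' z)))"
    by (rule sum.remove[OF fin g])
  also have "(\<Sum>g\<in>?O - {?g}. poly (\<phi> (g z)) (u z) * (\<Prod>g'\<in>?O - {g}. u z - fst (g' z))) = 0"
  proof (intro sum.neutral ballI)
    fix h assume h: "h \<in> ?O - {?g}"
    have "(\<Prod>g'\<in>?O - {h}. u z - fst (g' z)) = 0"
      by (rule prod_zero) (use fin g h gz in \<open>auto intro!: bexI[of _ ?g]\<close>)
    then show "poly (\<phi> (h z)) (u z) * (\<Prod>g'\<in>?O - {h}. u z - fst (g' z)) = 0" by simp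
  qed
  finally show ?thesis unfolding gz by simp
qed

lemma eventually_at_uhp: "z \<in> uhp \<Longrightarrow> \<forall>\<^sub>F x in at z. x \<in> uhp"
  using eventually_at_in_open'[OF open_uhp] by simp

text \<open>Interpolating the constant 1 gives \<open>PP\<close>, interpolating f gives f times
  \<open>PP\<close>; both are polynomials in j and j(Nz), so f is their quotient. The assumption
  \<open>st\<close> keeps the denominator from vanishing identically, and a projection to Q makes
  numerator and denominator rational.\<close>

theorem value_in_residue_field:
  assumes N: "N > 0" and h: "h > 0" and u: "modular_fn h (\<lambda>z. klein_j (of_nat N * z))" and f: "modular_fn h f"
    and st: "\<And>\<gamma>. \<gamma> \<in> SL2_maps \<Longrightarrow> (\<And>z. z \<in> uhp \<Longrightarrow> klein_j (of_nat N * \<gamma> z) = klein_j (of_nat N * z)) \<Longrightarrow>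
      (\<And>z. z \<in> uhp \<Longrightarrow> f (\<gamma> z) = f z)"
    and \<tau>: "\<tau> \<in> uhp"
  shows "f \<tau> \<in> residue_field_at N \<tau>"
proof -
  let ?u = "\<lambda>z. klein_j (of_nat N * z)"
  let ?F = "\<lambda>z. (?u z, f z)" let ?O = "orb ?F" let ?g = "act ?F (\<lambda>z. z)"
  define PP where "PP z = (\<Prod>g'\<in>?O - {?g}. ?u z - fst (g' z))" for z
  have fin: "finite ?O" by (rule finite_orb_comb[of ?u f]) (use u f in \<open>auto simp: modular_fn_def\<close>)
  obtain n1 m1 c1 where 1: "\<And>z x. z \<in> uhp \<Longrightarrow>
      poly (interp ?u f (\<lambda>_. 1) z) x = (\<Sum>p\<in>{..n1}\<times>{..m1}. c1 p * (klein_j z ^ snd p * x ^ fst p))"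
    by (rule interp_bivariate[OF h u f, of "\<lambda>_. 1"]) (auto intro: pMG_1 csubring_UNIV)
  have mf: "MG h UNIV (\<lambda>z. snd (g z))" and mu: "MG h UNIV (\<lambda>z. fst (g z))" if g: "g \<in> ?O" for g
  proof -
    obtain \<gamma> where a: "\<gamma> \<in> SL2_maps" "\<And>z. fst (g z) = act ?u \<gamma> z" "\<And>z. snd (g z) = act f \<gamma> z" using orb_pair[OF g] by metis
    then show "MG h UNIV (\<lambda>z. snd (g z))" "MG h UNIV (\<lambda>z. fst (g z))" using u f by (auto simp: modular_fn_def orb_def)
  qed
  obtain n2 m2 c2 where 2: "\<And>z x. z \<in> uhp \<Longrightarrow>
      poly (interp ?u f (\<lambda>p. [:snd p:]) z) x = (\<Sum>p\<in>{..n2}\<times>{..m2}. c2 p * (klein_j z ^ snd p * x ^ fst p))"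
    by (rule interp_bivariate[OF h u f, of "\<lambda>p. [:snd p:]"]) (auto intro!: pMG_const csubring_UNIV mf)
  define I1 I2 where "I1 = {..n1} \<times> {..m1}" and "I2 = {..n2} \<times> {..m2}"
  define M where "M p z = klein_j z ^ snd p * ?u z ^ fst p" for p :: "nat \<times> nat" and z
  have E1: "(\<Sum>p\<in>I1. c1 p * M p z) = PP z" if "z \<in> uhp" for z
    using interp_eval[OF fin that, of "\<lambda>_. 1"] unfolding 1[OF that] by (simp add: M_def I1_def PP_def)
  have E2: "(\<Sum>p\<in>I2. c2 p * M p z) = f z * PP z" if "z \<in> uhp" for z
    using interp_eval[OF fin that, of "\<lambda>p. [:snd p:]"] unfolding 2[OF that] by (simp add: M_def I2_def PP_def)
  have mu1: "MG 1 \<rat> ?u" and mf1: "MG 1 \<rat> f" using u f by (auto simp: modular_fn_def)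
  have MM: "MG 1 \<rat> (M p)" for p
    unfolding M_def[abs_def] by (intro MG_mult MG_power csubring_Rats MG_klein_j mu1)
  have finI: "finite I1" "finite I2" by (auto simp: I1_def I2_def)
  \<comment> \<open>By \<open>st\<close> a conjugate pair with the same first component as the base
    pair is the base pair. Each of the finitely many factors therefore has only isolated
    zeros.\<close>
  have "\<exists>z\<in>uhp. PP z \<noteq> 0"
  proof -
    have "\<forall>\<^sub>F x in at \<tau>. ?u x - fst (g x) \<noteq> 0" if g: "g \<in> ?O - {?g}" for g
    proof -
      have gO: "g \<in> ?O" using g by simp
      obtain \<gamma> where a: "\<gamma> \<in> SL2_maps" "\<And>z. z \<in> uhp \<Longrightarrow> g z = (?u (\<gamma> z), f (\<gamma> z))" using orb_pair[OF gO] by metis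
      have "\<exists>w\<in>uhp. ?u w - fst (g w) \<noteq> 0"
      proof (rule ccontr)
        assume "\<not> ?thesis"
        then have *: "\<And>z. z \<in> uhp \<Longrightarrow> ?u (\<gamma> z) = ?u z" using a(2) by auto
        have "g = ?g" by (rule orb_ext[OF gO orb_self]) (use a(2) * st[OF a(1) *] in \<open>simp add: act_def\<close>)
        then show False using g by simp
      qed
      then obtain w where w: "w \<in> uhp" "?u w - fst (g w) \<noteq> 0" by blast
      have "(\<lambda>x. ?u x - fst (g x)) holomorphic_on uhp"
        by (intro holomorphic_on_diff MG_holomorphic[OF mu1] MG_holomorphic[OF mu[OF gO]])
      from eventually_nonzero[OF this w \<tau>] show ?thesis .
    qed
    then have "\<forall>\<^sub>F x in at \<tau>. \<forall>g\<in>?O - {?g}. ?u x - fst (g x) \<noteq> 0"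
      by (intro eventually_ball_finite) (use fin in auto)
    with eventually_at_uhp[OF \<tau>] have "\<forall>\<^sub>F x in at \<tau>. x \<in> uhp \<and> PP x \<noteq> 0"
      by eventually_elim (use fin in \<open>simp add: PP_def\<close>)
    from eventually_happens'[OF _ this] show ?thesis by auto
  qed
  then obtain z0 where z0: "z0 \<in> uhp" "(\<Sum>p\<in>I1. c1 p * M p z0) \<noteq> 0" using E1 by auto
  obtain l w where l: "rat_linear l" "w \<in> uhp" "(\<Sum>p\<in>I1. of_rat (l (c1 p)) * M p w) \<noteq> 0"
    by (rule rat_linear_nonzero[OF finI(1) MM z0])
  \<comment> \<open>Numerator and denominator enter a single relation over a disjoint sum of index
    sets, so the same \<open>l\<close> projects both and f remains their quotient.\<close>
  define m where "m = case_sum (\<lambda>p z. f z * M p z) M"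
  define c where "c = case_sum c1 (\<lambda>p. - c2 p)"
  have S: "(\<Sum>i\<in>I1 <+> I2. b i * m i z) = f z * (\<Sum>p\<in>I1. b (Inl p) * M p z) + (\<Sum>p\<in>I2. b (Inr p) * M p z)" for b z
    by (simp add: sum.Plus finI m_def sum_distrib_left mult_ac)
  have rel: "(\<Sum>i\<in>I1 <+> I2. c i * m i z) = 0" if "z \<in> uhp" for z
    unfolding S using E1[OF that] E2[OF that] by (simp add: c_def sum_negf)
  have mm: "MG 1 \<rat> (m i)" if "i \<in> I1 <+> I2" for i
    using MM MG_mult[OF csubring_Rats mf1 MM] by (cases i) (auto simp: m_def)
  have rel2: "f z * (\<Sum>p\<in>I1. of_rat (l (c1 p)) * M p z) = (\<Sum>p\<in>I2. of_rat (- l (- c2 p)) * M p z)" if "z \<in> uhp" for z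
  proof -
    have "f z * (\<Sum>p\<in>I1. of_rat (l (c1 p)) * M p z) + (\<Sum>p\<in>I2. of_rat (l (- c2 p)) * M p z) = 0"
      using rat_linear_relation[OF l(1) _ mm rel that] finI unfolding S by (simp add: c_def)
    then show ?thesis by (simp add: sum_negf of_rat_minus eq_neg_iff_add_eq_0)
  qed
  obtain B where B: "\<And>x y. eval2 B x y = (\<Sum>p\<in>I1. of_rat (l (c1 p)) * (x ^ snd p * y ^ fst p))"
    using eval2_exists[where n = n1 and m = m1 and r = "\<lambda>p. l (c1 p)"] unfolding I1_def by blast
  obtain A where A: "\<And>x y. eval2 A x y = (\<Sum>p\<in>I2. of_rat (- l (- c2 p)) * (x ^ snd p * y ^ fst p))"
    using eval2_exists[where n = n2 and m = m2 and r = "\<lambda>p. - l (- c2 p)"] unfolding I2_def by blast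
  define G where "G = (\<lambda>z. eval2 A (klein_j z) (?u z) / eval2 B (klein_j z) (?u z))"
  have "G \<in> X0_function_field N"
    unfolding X0_function_field_def G_def using l(2,3) unfolding M_def B[symmetric] by blast
  moreover have "(G \<longlongrightarrow> f \<tau>) (at \<tau>)"
  \<comment> \<open>The denominator may vanish at \<open>\<tau>\<close> itself, so f agrees with the
    quotient only on a punctured neighbourhood and its value appears as a limit.\<close>
  proof (rule Lim_transform_eventually)
    have "isCont f \<tau>"
      using holomorphic_on_imp_continuous_on[OF MG_holomorphic[OF mf1]] continuous_on_eq_continuous_at[OF open_uhp] \<tau> by blast
    then show "(f \<longlongrightarrow> f \<tau>) (at \<tau>)" by (rule isContD)
    have "(\<lambda>z. \<Sum>p\<in>I1. of_rat (l (c1 p)) * M p z) holomorphic_on uhp" by (rule holomorphic_lincomb[OF MM])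
    from eventually_nonzero[OF this l(2,3) \<tau>] eventually_at_uhp[OF \<tau>]
    show "\<forall>\<^sub>F x in at \<tau>. f x = G x"
    proof eventually_elim
      case (elim x)
      show ?case unfolding G_def A B M_def[symmetric] rel2[OF elim(2), symmetric] using elim(1) by simp
    qed
  qed
  ultimately show ?thesis unfolding residue_field_at_def by blast
qed

section \<open>Galois conjugates of values\<close>

lemma monic_eq_prod:
  fixes Q :: "'a :: idom poly"
  assumes A: "finite A" and inj: "inj_on f A" and c: "poly.coeff Q (card A) = 1" and d: "Polynomial.degree Q \<le> card A"
    and r: "\<And>i. i \<in> A \<Longrightarrow> poly Q (f i) = 0"
  shows "Q = (\<Prod>i\<in>A. [:- f i, 1:])"
proof (rule poly_eqI_degree_lead_coeff[where A = "f ` A" and n = "card A"])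
  have m: "Polynomial.degree (\<Prod>i\<in>A. [:- f i, 1:]) = card A" by (rule conjunct1[OF monic_prod_linear[OF A]])
  have m1: "poly.coeff (\<Prod>i\<in>A. [:- f i, 1:]) (card A) = 1" by (rule conjunct2[OF monic_prod_linear[OF A, of f], unfolded m])
  show "poly.coeff Q (card A) = poly.coeff (\<Prod>i\<in>A. [:- f i, 1:]) (card A)" by (simp only: m1 c)
  show "card A \<le> card (f ` A)" using card_image[OF inj] by simp
  show "Polynomial.degree (\<Prod>i\<in>A. [:- f i, 1:]) \<le> card A" using m by simp
  show "poly Q z = poly (\<Prod>i\<in>A. [:- f i, 1:]) z" if zA: "z \<in> f ` A" for z
  proof -
    obtain i where i: "i \<in> A" "z = f i" using zA by blast
    have "poly (\<Prod>i\<in>A. [:- f i, 1:]) z = 0" unfolding poly_prod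
      by (rule prod_zero[OF A]) (use i in \<open>auto intro!: bexI[of _ i]\<close>)
    then show ?thesis using r[OF i(1)] i(2) by simp
  qed
qed (use d in simp)

text \<open>The conjugates of a modular function with rational \<open>q\<close>-expansion form the roots of a
  polynomial over \<open>\<rat>(j)\<close>: applying a \<open>\<rat>\<close>-linear projection \<open>\<complex> \<rightarrow> \<rat>\<close> to the coefficients of
  the relation over \<open>\<complex>(j)\<close> gives another monic relation of the same degree.\<close>

theorem rational_orbit_polynomial:
  assumes h: "h > 0" and f: "modular_fn h f"
  obtains n m r where "\<And>z x. z \<in> uhp \<Longrightarrow>
    (\<Prod>g\<in>orb f. x - g z) = (\<Sum>p\<in>{..n}\<times>{..m}. of_rat (r p) * (klein_j z ^ snd p * x ^ fst p))"
proof -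
  define n where "n = card (orb f)"
  have fin: "finite (orb f)" and M: "\<And>g. g \<in> orb f \<Longrightarrow> MG h UNIV g" and f1: "MG 1 \<rat> f"
    using f by (auto simp: modular_fn_def)
  have p: "pMG h UNIV (orb_poly f)" unfolding orb_poly_def[abs_def] by (intro pMG_prod pMG_linear csubring_UNIV M)
  have dg: "Polynomial.degree (orb_poly f z) = n" "poly.coeff (orb_poly f z) n = 1" for z
    using monic_prod_linear[OF fin, of "\<lambda>g. g z"] by (auto simp: orb_poly_def n_def)
  have i: "orb_poly f (\<gamma> z) = orb_poly f z" if "\<gamma> \<in> SL2_maps" "z \<in> uhp" for \<gamma> z
    unfolding orb_poly_def by (rule orb_prod_invariant[OF that])
  obtain m c where c: "\<And>z i. z \<in> uhp \<Longrightarrow> i \<le> n \<Longrightarrow> poly.coeff (orb_poly f z) i = (\<Sum>k\<le>m. c (i, k) * klein_j z ^ k)"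
    "\<And>z x. z \<in> uhp \<Longrightarrow> poly (orb_poly f z) x = (\<Sum>p\<in>{..n}\<times>{..m}. c p * (klein_j z ^ snd p * x ^ fst p))"
  proof (rule pMG_bivariate[OF h p, of n])
    show "orb_poly f (\<gamma> z) = orb_poly f z" if "\<gamma> \<in> SL2_maps" "z \<in> uhp" for \<gamma> z by (rule i[OF that])
  qed (use dg in auto)
  obtain l where l: "rat_linear l" "l 1 = 1" using rat_linear_exists[of 1] by auto
  define r where "r p = l (c p)" for p
  have rel: "(\<Sum>p\<in>{..n}\<times>{..m}. of_rat (r p) * (klein_j z ^ snd p * f z ^ fst p)) = 0" if z: "z \<in> uhp" for z
    unfolding r_def
  proof (rule rat_linear_relation[OF l(1) _ _ _ z])
    show "MG 1 \<rat> (\<lambda>z. klein_j z ^ snd p * f z ^ fst p)" for p by (intro MG_mult MG_power csubring_Rats MG_klein_j f1)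
    show "(\<Sum>p\<in>{..n}\<times>{..m}. c p * (klein_j z ^ snd p * f z ^ fst p)) = 0" if "z \<in> uhp" for z
      unfolding c(2)[OF that, symmetric] by (rule poly_orb_self[OF fin that])
  qed simp
  \<comment> \<open>That the leading coefficient is 1 is itself a relation among powers of j. The
    constant 1 is adjoined under the extra index \<open>Suc m\<close> with coefficient - 1, and
    \<open>l 1 = 1\<close> preserves the relation.\<close>
  have top: "(\<Sum>k\<le>m. of_rat (r (n, k)) * klein_j z ^ k) = 1" if z: "z \<in> uhp" for z
  proof -
    define b where "b k = (if k \<le> m then c (n, k) else - 1)" for k
    define e where "e k z = (if k \<le> m then klein_j z ^ k else 1)" for k z
    have s: "(\<Sum>k\<le>Suc m. a (b k) * e k z) = (\<Sum>k\<le>m. a (c (n, k)) * klein_j z ^ k) + a (- 1)" for a :: "complex \<Rightarrow> complex" and z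
      by (simp add: b_def e_def)
    have "(\<Sum>k\<le>Suc m. of_rat (l (b k)) * e k z) = 0"
    proof (rule rat_linear_relation[OF l(1) _ _ _ z])
      show "MG 1 \<rat> (e k)" for k
        using MG_power[OF csubring_Rats MG_klein_j, of k] MG_const[OF csubring_Rats, of 1 1] by (cases "k \<le> m") (simp_all add: e_def[abs_def])
      show "(\<Sum>k\<le>Suc m. b k * e k z) = 0" if "z \<in> uhp" for z
        using s[of "\<lambda>x. x"] c(1)[OF that, of n] dg by simp
    qed simp
    moreover have "l (- 1) = - 1"
    proof -
      have "l (of_rat (- 1) * 1) = - 1 * l 1" using l(1) unfolding rat_linear_def by blast
      then show ?thesis using l(2) by simp
    qed
    ultimately show ?thesis unfolding s[of "\<lambda>x. of_rat (l x)"] r_def by simp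
  qed
  define Q where "Q z = (\<Sum>i\<le>n. Polynomial.monom (\<Sum>k\<le>m. of_rat (r (i, k)) * klein_j z ^ k) i)" for z
  have pQ: "poly (Q z) x = (\<Sum>p\<in>{..n}\<times>{..m}. of_rat (r p) * (klein_j z ^ snd p * x ^ fst p))" for z x
  proof -
    have "poly (Q z) x = (\<Sum>i\<le>n. \<Sum>k\<le>m. of_rat (r (i, k)) * (klein_j z ^ k * x ^ i))"
      unfolding Q_def poly_sum poly_monom by (simp add: sum_distrib_right mult.assoc)
    also have "\<dots> = (\<Sum>p\<in>{..n}\<times>{..m}. of_rat (r p) * (klein_j z ^ snd p * x ^ fst p))"
      unfolding sum.cartesian_product by (intro sum.cong) auto
    finally show ?thesis .
  qed
  have dQ: "Polynomial.degree (Q z) \<le> n" for z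
    unfolding Q_def by (intro degree_sum_le) (auto intro: order_trans[OF Polynomial.degree_monom_le])
  have cQ: "poly.coeff (Q z) n = 1" if "z \<in> uhp" for z
    unfolding Q_def Polynomial.coeff_sum Polynomial.coeff_monom using top[OF that] by (simp add: sum.delta)
  have root: "poly (Q z) (g z) = 0" if g: "g \<in> orb f" and z: "z \<in> uhp" for g z
  proof -
    obtain \<gamma> where a: "\<gamma> \<in> SL2_maps" "g = act f \<gamma>" using g by (auto simp: orb_def)
    show ?thesis using rel[OF SL2_maps_uhp[OF a(1) z]] z
      unfolding pQ by (simp add: a(2) act_def klein_j_SL2_maps[OF a(1) z])
  qed
  \<comment> \<open>Where the conjugates take distinct values, n roots determine a monic polynomial
    of degree n. The remaining points are isolated and follow by continuity.\<close>
  have gen: "Q z = orb_poly f z" if z: "z \<in> uhp" and inj: "inj_on (\<lambda>g. g z) (orb f)" for z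
    unfolding orb_poly_def by (rule monic_eq_prod[OF fin inj]) (use cQ[OF z] dQ root[OF _ z] in \<open>auto simp: n_def\<close>)
  have "(\<Prod>g\<in>orb f. x - g z) = (\<Sum>p\<in>{..n}\<times>{..m}. of_rat (r p) * (klein_j z ^ snd p * x ^ fst p))" if z: "z \<in> uhp" for z x
  proof -
    define L R where "L z = (\<Prod>g\<in>orb f. x - g z)" and "R z = poly (Q z) x" for z
    have "L holomorphic_on uhp" unfolding L_def[abs_def]
      by (intro holomorphic_intros) (auto intro: MG_holomorphic[OF M])
    moreover have "R holomorphic_on uhp" unfolding R_def[abs_def] pQ by (intro holomorphic_intros holomorphic_klein_j)
    ultimately have "isCont L z" "isCont R z"
      using holomorphic_on_imp_continuous_on continuous_on_eq_continuous_at[OF open_uhp] z by blast+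
    then have lim: "(L \<longlongrightarrow> L z) (at z)" "(R \<longlongrightarrow> R z) (at z)" by (auto intro: isContD)
    have "\<forall>\<^sub>F w in at z. g w - g' w \<noteq> 0" if g: "g \<in> orb f" "g' \<in> orb f - {g}" for g g'
    proof -
      have g': "g' \<in> orb f" using g(2) by simp
      have "\<exists>w\<in>uhp. g w - g' w \<noteq> 0" using orb_ext[OF g(1) g'] g(2) by auto
      then obtain w where w: "w \<in> uhp" "g w - g' w \<noteq> 0" by blast
      have "(\<lambda>w. g w - g' w) holomorphic_on uhp" by (intro holomorphic_on_diff MG_holomorphic[OF M] g(1) g')
      from eventually_nonzero[OF this w z] show ?thesis .
    qed
    then have "\<forall>\<^sub>F w in at z. \<forall>g\<in>orb f. \<forall>g'\<in>orb f - {g}. g w - g' w \<noteq> 0"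
      using fin by (intro eventually_ball_finite ballI) auto
    with eventually_at_uhp[OF z] have "\<forall>\<^sub>F w in at z. L w = R w"
    proof eventually_elim
      case (elim w)
      have "inj_on (\<lambda>g. g w) (orb f)" using elim(2) unfolding inj_on_def by fastforce
      from gen[OF elim(1) this] show ?case unfolding L_def R_def poly_orb_poly[symmetric] by simp
    qed
    then have "(L \<longlongrightarrow> R z) (at z)" using Lim_transform_eventually[OF lim(2)] by (simp add: eq_commute)
    from tendsto_unique[OF _ lim(1) this] have "L z = R z" by simp
    then show ?thesis unfolding L_def R_def pQ .
  qed
  then show thesis using that by blast
qed

context quad_field begin

lemma K_sum_of_rat:
  "(\<And>p. p \<in> I \<Longrightarrow> m p \<in> K) \<Longrightarrow> (\<Sum>p\<in>I. of_rat (r p) * m p) \<in> K \<and>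
    cj (\<Sum>p\<in>I. of_rat (r p) * m p) = (\<Sum>p\<in>I. of_rat (r p) * cj (m p))"
proof (induction I rule: infinite_finite_induct)
  case (insert p I)
  have a: "of_rat (r p) * m p \<in> K" using insert.prems[of p] of_rat_in_K by simp
  have b: "cj (of_rat (r p) * m p) = of_rat (r p) * cj (m p)" using cj_mult[OF of_rat_in_K insert.prems[of p]] by simp
  have IH: "(\<Sum>p\<in>I. of_rat (r p) * m p) \<in> K" "cj (\<Sum>p\<in>I. of_rat (r p) * m p) = (\<Sum>p\<in>I. of_rat (r p) * cj (m p))"
    using insert by auto
  show ?case unfolding sum.insert[OF insert.hyps] cj_add[OF a IH(1)] b IH(2) using a IH(1) by simp
qed (use of_rat_in_K[of 0] in simp_all)

text \<open>Conjugating the rational orbit relation at \<open>\<tau>\<close> shows that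
  \<open>cj (f \<tau>)\<close> is a root of the orbit polynomial at a point with conjugate j, so it
  is the value of a conjugate of f there.\<close>

lemma conjugate_value:
  assumes h: "h > 0" and f: "modular_fn h f" and \<tau>: "\<tau> \<in> uhp" "f \<tau> \<in> K" "klein_j \<tau> \<in> K"
    and \<tau>': "\<tau>' \<in> uhp" "klein_j \<tau>' = cj (klein_j \<tau>)"
  shows "\<exists>\<gamma>\<in>SL2_maps. f (\<gamma> \<tau>') = cj (f \<tau>)"
proof -
  obtain n m r where r: "\<And>z x. z \<in> uhp \<Longrightarrow>
    (\<Prod>g\<in>orb f. x - g z) = (\<Sum>p\<in>{..n}\<times>{..m}. of_rat (r p) * (klein_j z ^ snd p * x ^ fst p))"
    by (rule rational_orbit_polynomial[OF h f]) blast
  have fin: "finite (orb f)" using f by (simp add: modular_fn_def)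
  have 0: "(\<Sum>p\<in>{..n}\<times>{..m}. of_rat (r p) * (klein_j \<tau> ^ snd p * f \<tau> ^ fst p)) = 0"
    unfolding r[OF \<tau>(1), symmetric] using poly_orb_self[OF fin \<tau>(1)] by (simp add: poly_orb_poly)
  have c: "cj (klein_j \<tau> ^ a * f \<tau> ^ b) = klein_j \<tau>' ^ a * cj (f \<tau>) ^ b" for a b
    using \<tau> \<tau>'(2) by (simp add: cj_mult cj_power)
  have "(\<Prod>g\<in>orb f. cj (f \<tau>) - g \<tau>') = cj (\<Sum>p\<in>{..n}\<times>{..m}. of_rat (r p) * (klein_j \<tau> ^ snd p * f \<tau> ^ fst p))"
    unfolding r[OF \<tau>'(1)] c[symmetric] by (rule conjunct2[OF K_sum_of_rat, symmetric]) (use \<tau> in simp)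
  then have "(\<Prod>g\<in>orb f. cj (f \<tau>) - g \<tau>') = 0" unfolding 0 by simp
  then obtain g where "g \<in> orb f" "cj (f \<tau>) - g \<tau>' = 0" using fin by (auto simp: prod_zero_iff)
  then show ?thesis using \<tau>'(1) by (auto simp: orb_def act_def)
qed

text \<open>Two functions must take their conjugate values at the same point. Treat f + t g for
  every natural t: only finitely many pairs of values are available, so two parameters share a pair,
  and two linear equations separate f from g.\<close>

theorem conjugate_point:
  assumes h: "h > 0" and f: "modular_fn h f" and g: "modular_fn h g"
    and \<tau>: "\<tau> \<in> uhp" "f \<tau> \<in> K" "g \<tau> \<in> K" "klein_j \<tau> \<in> K"
  obtains \<sigma> where "\<sigma> \<in> uhp" "klein_j \<sigma> = cj (klein_j \<tau>)" "f \<sigma> = cj (f \<tau>)" "g \<sigma> = cj (g \<tau>)"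
proof -
  obtain \<tau>' where \<tau>': "\<tau>' \<in> uhp" "klein_j \<tau>' = cj (klein_j \<tau>)" using klein_j_surj by blast
  have "\<exists>\<gamma>\<in>SL2_maps. f (\<gamma> \<tau>') + of_nat t * g (\<gamma> \<tau>') = cj (f \<tau>) + of_nat t * cj (g \<tau>)" for t :: nat
  proof -
    have m: "modular_fn h (\<lambda>z. f z + of_nat t * g z)"
      using modular_fn_add[OF f modular_fn_mult[OF modular_fn_const[of h "of_nat t"] g]] by simp
    have tK: "(of_nat t :: complex) \<in> K" "cj (of_nat t) = of_nat t"
      using of_rat_in_K[of "of_nat t"] cj_of_rat[of "of_nat t"] by simp_all
    have "cj (f \<tau> + of_nat t * g \<tau>) = cj (f \<tau>) + of_nat t * cj (g \<tau>)"
      using tK \<tau> by (simp add: cj_add cj_mult)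
    then show ?thesis using conjugate_value[OF h m \<tau>(1) _ \<tau>(4) \<tau>'] tK \<tau> by simp
  qed
  then obtain \<gamma> where \<gamma>: "\<And>t. \<gamma> t \<in> SL2_maps"
    "\<And>t. f (\<gamma> t \<tau>') + of_nat t * g (\<gamma> t \<tau>') = cj (f \<tau>) + of_nat t * cj (g \<tau>)" by metis
  define V where "V t = (f (\<gamma> t \<tau>'), g (\<gamma> t \<tau>'))" for t
  have "range V \<subseteq> (\<lambda>h. h \<tau>') ` orb f \<times> (\<lambda>h. h \<tau>') ` orb g"
  proof (rule image_subsetI)
    fix t
    have "f (\<gamma> t \<tau>') = act f (\<gamma> t) \<tau>'" "g (\<gamma> t \<tau>') = act g (\<gamma> t) \<tau>'" using \<tau>'(1) by (simp_all add: act_def)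
    then show "V t \<in> (\<lambda>h. h \<tau>') ` orb f \<times> (\<lambda>h. h \<tau>') ` orb g" unfolding V_def orb_def using \<gamma>(1) by blast
  qed
  then have "finite (range V)" by (rule finite_subset) (use f g in \<open>auto simp: modular_fn_def\<close>)
  then have "\<not> inj V" using finite_imageD by auto
  then obtain s t where st: "s \<noteq> t" "V s = V t" by (auto simp: inj_def)
  have e: "f (\<gamma> s \<tau>') = f (\<gamma> t \<tau>')" "g (\<gamma> s \<tau>') = g (\<gamma> t \<tau>')" using st(2) by (auto simp: V_def)
  have lin: "y = y'" if "x + a * y = x' + a * y'" "x + b * y = x' + b * y'" "a \<noteq> b" for x x' y y' a b :: complex
  proof -
    have "(a - b) * (y - y') = (x + a * y) - (x' + a * y') - ((x + b * y) - (x' + b * y'))" by (simp add: algebra_simps)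
    then show ?thesis using that by simp
  qed
  have "g (\<gamma> t \<tau>') = cj (g \<tau>)"
    by (rule lin[of "f (\<gamma> t \<tau>')" "of_nat s" _ "cj (f \<tau>)" _ "of_nat t"]) (use \<gamma>(2)[of s] \<gamma>(2)[of t] st(1) in \<open>simp_all add: e\<close>)
  moreover from this have "f (\<gamma> t \<tau>') = cj (f \<tau>)" using \<gamma>(2)[of t] by simp
  ultimately show thesis
    using that[of "\<gamma> t \<tau>'"] SL2_maps_uhp[OF \<gamma>(1) \<tau>'(1)] klein_j_SL2_maps[OF \<gamma>(1) \<tau>'(1)] \<tau>'(2) by simp
qed

end

section \<open>The height of the discriminant\<close>

text \<open>Up to normalisation, twelve times the Archimedean term of the Faltings height. On
  reduced points it is close to 2 pi Im z, so it measures the distance from the cusp.\<close>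

definition ht :: "complex \<Rightarrow> real" where "ht z = - ln (norm (Dfun z)) - 6 * ln (Im z)"

lemma ht_mob:
  assumes z: "z \<in> uhp" and det: "a * d - b * c = 1" shows "ht (mob a b c d z) = ht z"
proof -
  define n where "n = norm (of_int c * z + of_int d)"
  have "of_int c * z + of_int d \<noteq> (0 :: complex)" by (rule cocycle_nonzero[OF z]) (use det in auto)
  then have n: "n > 0" by (simp add: n_def)
  have y: "Im z > 0" using z by (simp add: uhp_iff)
  have 1: "norm (Dfun (mob a b c d z)) = n ^ 12 * norm (Dfun z)"
    unfolding Dfun_mob[OF z det] n_def by (simp add: norm_mult norm_power)
  have 2: "Im (mob a b c d z) = Im z / n ^ 2" using Im_mob[OF z, of a d b c] det by (simp add: n_def)
  show ?thesis unfolding ht_def 1 2 using n y by (simp add: ln_mult ln_div ln_realpow)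
qed

lemma ht_SL2_maps: "\<gamma> \<in> SL2_maps \<Longrightarrow> z \<in> uhp \<Longrightarrow> ht (\<gamma> z) = ht z"
  unfolding SL2_maps_def using ht_mob by auto

section \<open>Explicit estimates on the reduced domain\<close>

lemma norm_power_series_le:
  fixes a :: "nat \<Rightarrow> complex"
  assumes a0: "a 0 = 0" and a: "\<And>n. norm (a n) \<le> B ^ n" and x: "B * norm x < 1" and B: "B \<ge> 0"
  shows "norm (\<Sum>n. a n * x ^ n) \<le> B * norm x / (1 - B * norm x)"
proof -
  define t where "t = B * norm x"
  have t: "0 \<le> t" "t < 1" using x B by (auto simp: t_def)
  have le: "norm (a (Suc n) * x ^ Suc n) \<le> t * t ^ n" for n
  proof -
    have "norm (a (Suc n) * x ^ Suc n) \<le> B ^ Suc n * norm x ^ Suc n"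
      unfolding norm_mult norm_power by (intro mult_right_mono a) simp
    then show ?thesis by (simp add: t_def power_mult_distrib mult_ac)
  qed
  have g: "(\<lambda>n. t * t ^ n) sums (t * (1 / (1 - t)))" by (intro sums_mult geometric_sums) (use t in simp)
  have sn: "summable (\<lambda>n. norm (a (Suc n) * x ^ Suc n))"
    by (rule summable_comparison_test'[OF sums_summable[OF g]]) (use le in simp)
  have "summable (\<lambda>n. a n * x ^ n)" using summable_norm_cancel[OF sn] by (subst (asm) summable_Suc_iff)
  from suminf_split_initial_segment[OF this, of 1]
  have "(\<Sum>n. a n * x ^ n) = (\<Sum>n. a (Suc n) * x ^ Suc n)" using a0 by simp
  also have "norm \<dots> \<le> (\<Sum>n. norm (a (Suc n) * x ^ Suc n))" by (rule summable_norm[OF sn])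
  also have "\<dots> \<le> (\<Sum>n. t * t ^ n)" by (intro suminf_le le sn sums_summable[OF g])
  also have "\<dots> = t / (1 - t)" using sums_unique[OF g] by simp
  finally show ?thesis by (simp add: t_def)
qed

text \<open>2 pi * 0.86 exceeds 5, and exp 5 >= (1 + 5/100)^100 > 100.\<close>

lemma norm_qe_small: "Im z \<ge> 86/100 \<Longrightarrow> norm (qe z) \<le> 1/100"
proof -
  assume z: "Im z \<ge> 86/100"
  have "3.14 * (86/100) \<le> pi * Im z" using pi_approx z by (intro mult_mono) auto
  then have "exp 5 \<le> exp (2 * pi * Im z)" by simp
  moreover have "(100::real) \<le> exp 5"
  proof -
    have "(100::real) \<le> (1 + 5 / of_nat 100) ^ 100" by (simp add: power_divide)
    also have "\<dots> \<le> exp 5" by (rule exp_ge_one_plus_x_over_n_power_n) auto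
    finally show ?thesis .
  qed
  ultimately have "(100::real) \<le> exp (2 * pi * Im z)" by linarith
  then have "1 / exp (2 * pi * Im z) \<le> 1 / 100" by (intro divide_left_mono) auto
  then show ?thesis unfolding norm_qe by (simp add: exp_minus inverse_eq_divide)
qed

lemma frac_mono: "0 \<le> s \<Longrightarrow> s \<le> t \<Longrightarrow> t < 1 \<Longrightarrow> s / (1 - s) \<le> t / (1 - (t::real))"
  by (intro frac_le) auto

text \<open>The coefficients are at most 2^n, so the geometric majorant is at most 1/49, and 24/49 <
  1/2.\<close>

lemma logser_small: "Im z \<ge> 86/100 \<Longrightarrow> norm (24 * logser (qe z)) \<le> 1/2"
proof -
  assume z: "Im z \<ge> 86/100"
  note x = norm_qe_small[OF z]
  have "norm (logcoef n) \<le> 2 ^ n" for n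
  proof -
    have "real n \<le> real (2 ^ n)" using less_exp[of n] by (intro of_nat_mono) simp
    from order_trans[OF logcoef_le[of n] this] show ?thesis by simp
  qed
  moreover have "logcoef 0 = 0" by (simp add: logcoef_def)
  ultimately have "norm (logser (qe z)) \<le> 2 * norm (qe z) / (1 - 2 * norm (qe z))"
    unfolding logser_def by (intro norm_power_series_le) (use x in auto)
  also have "\<dots> \<le> (2/100) / (1 - 2/100)" by (rule frac_mono) (use x in auto)
  finally have "norm (logser (qe z)) \<le> 1/49" by simp
  then show ?thesis unfolding norm_mult by simp
qed

text \<open>sigma_3(n) <= n^4 <= 16^n, and 240 * 16 / 84 < 46.\<close>

lemma norm_E4_le: "Im z \<ge> 86/100 \<Longrightarrow> norm (E4 z) \<le> 47"
proof -
  assume z: "Im z \<ge> 86/100"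
  note x = norm_qe_small[OF z]
  have "real (sig 3 n) \<le> 16 ^ n" for n
  proof -
    have "sig 3 n \<le> n ^ 4" using sig_le[of 3 n] by simp
    also have "\<dots> \<le> (2 ^ n) ^ 4" using less_exp[of n] by (intro power_mono) auto
    also have "\<dots> = 16 ^ n" by (simp add: power_mult[symmetric] mult.commute[of n]) (simp add: power_mult)
    finally show ?thesis by (metis of_nat_le_iff of_nat_numeral of_nat_power)
  qed
  then have "norm (qsig 3 (qe z)) \<le> 16 * norm (qe z) / (1 - 16 * norm (qe z))"
    unfolding qsig_def by (intro norm_power_series_le) (use x in auto)
  also have "\<dots> \<le> (16/100) / (1 - 16/100)" by (rule frac_mono) (use x in auto)
  finally have "norm (240 * qsig 3 (qe z)) \<le> 46" unfolding norm_mult by simp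
  then show ?thesis unfolding E4_def using norm_triangle_ineq[of 1 "240 * qsig 3 (qe z)"] by simp
qed

lemma ln_norm_Dfun: "ln (norm (Dfun z)) = - 2 * pi * Im z - Re (24 * logser (qe z))"
proof -
  have "norm (Dfun z) = exp (- 2 * pi * Im z - Re (24 * logser (qe z)))"
    unfolding Dfun_qe norm_mult norm_qe norm_exp_eq_Re exp_add[symmetric] by simp
  then show ?thesis by (simp only: ln_exp)
qed

lemma ht_approx:
  assumes "Im z \<ge> 86/100" shows "\<bar>ht z - (2 * pi * Im z - 6 * ln (Im z))\<bar> \<le> 1/2"
proof -
  have "\<bar>Re (24 * logser (qe z))\<bar> \<le> 1/2" using abs_Re_le_cmod logser_small[OF assms] by (rule order_trans)
  then show ?thesis unfolding ht_def ln_norm_Dfun by simp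
qed

lemma ln_le_of_le_exp: "0 < x \<Longrightarrow> x \<le> exp y \<Longrightarrow> ln x \<le> (y::real)"
  using ln_le_cancel_iff[of x "exp y"] by simp

text \<open>The cube of E4 contributes 47^3 <= 2^19 <= exp 19 and the lower bound for |Delta|
  another exp 1, which makes the 20.\<close>

lemma ln_klein_j_le:
  assumes z: "Im z \<ge> 86/100" shows "ln (max 1 (norm (klein_j z))) \<le> 2 * pi * Im z + 20"
proof -
  have zu: "z \<in> uhp" using z by (simp add: uhp_iff)
  have Y: "2 * pi * Im z \<ge> 0" using z by simp
  have "\<bar>Re (24 * logser (qe z))\<bar> \<le> 1/2" using abs_Re_le_cmod logser_small[OF z] by (rule order_trans)
  then have "ln (norm (Dfun z)) \<ge> - (2 * pi * Im z + 1)" unfolding ln_norm_Dfun by simp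
  then have D: "norm (Dfun z) \<ge> exp (- (2 * pi * Im z + 1))" by (subst (asm) ln_ge_iff) auto
  have e19: "(47::real) ^ 3 \<le> exp 19"
  proof -
    have "(47::real) ^ 3 \<le> (1 + 19 / of_nat 19) ^ 19" by simp
    also have "\<dots> \<le> exp 19" by (rule exp_ge_one_plus_x_over_n_power_n) auto
    finally show ?thesis .
  qed
  have "norm (klein_j z) = norm (E4 z) ^ 3 / norm (Dfun z)" unfolding klein_j_eq[OF zu] by (simp add: norm_divide norm_power)
  also have "\<dots> \<le> exp 19 / exp (- (2 * pi * Im z + 1))"
    by (intro frac_le D order_trans[OF power_mono[OF norm_E4_le[OF z]] e19]) auto
  also have "\<dots> = exp (2 * pi * Im z + 20)" by (simp add: exp_diff[symmetric])
  finally have "max 1 (norm (klein_j z)) \<le> exp (2 * pi * Im z + 20)" using Y by simp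
  then show ?thesis by (rule ln_le_of_le_exp[rotated]) auto
qed

text \<open>Six times the tangent of the logarithm at 16: slope 6/16 and intercept 6 (ln 16 - 1) <=
  10.8. The bound ln 16 <= 2.8 comes from (507/500)^50 >= 2.\<close>

lemma ln_le_linear: "x > 0 \<Longrightarrow> 6 * ln x \<le> 3/8 * x + (11::real)"
proof -
  assume x: "x > 0"
  have "ln (x / 16) \<le> x / 16 - 1" using ln_le_minus_one[of "x / 16"] x by simp
  moreover have "ln (16::real) \<le> 2.8"
  proof -
    have "2 * (500::real) ^ 50 \<le> 507 ^ 50" by simp
    then have "2 \<le> (507 / 500 :: real) ^ 50" by (simp add: power_divide le_divide_eq)
    also have "\<dots> = (1 + (7/10) / of_nat 50) ^ 50" by simp
    also have "\<dots> \<le> exp (7/10)" by (rule exp_ge_one_plus_x_over_n_power_n) auto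
    finally have "2 ^ 4 \<le> exp (7/10 :: real) ^ 4" by (rule power_mono) simp
    also have "\<dots> = exp 2.8" using exp_of_nat_mult[of 4 "7/10::real"] by simp
    finally have "(16::real) \<le> exp 2.8" by simp
    then show ?thesis by (rule ln_le_of_le_exp[rotated]) simp
  qed
  ultimately show ?thesis using x by (simp add: ln_div)
qed

lemma neg_ln_le: "y \<ge> 86/100 \<Longrightarrow> - 6 * ln y \<le> (1::real)"
proof -
  assume y: "y \<ge> 86/100"
  have "ln (1 / y) \<le> 1 / y - 1" using ln_le_minus_one[of "1 / y"] y by simp
  also have "1 / y \<le> 1 / (86/100)" using y by (intro divide_left_mono) auto
  finally show ?thesis using y by (simp add: ln_div)
qed

text \<open>If c = 0 the imaginary part does not change; otherwise |c z + d| >= Im z gives the bound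
  1 / Im z.\<close>

lemma reduced:
  assumes z: "z \<in> uhp"
  obtains w \<gamma> where "w \<in> uhp" "\<gamma> \<in> SL2_maps" "z = \<gamma> w" "Im w \<ge> 86/100" "Im w \<le> max (Im z) (1 / Im z)"
proof -
  obtain a b c d where r: "a * d - b * c = 1" "mob a b c d z \<in> uhp" "Im (mob a b c d z) \<ge> 86/100"
    by (rule reduce_uhp[OF z])
  have m: "mob a b c d \<in> SL2_maps" using r(1) by (auto simp: SL2_maps_def)
  obtain \<gamma> where g: "\<gamma> \<in> SL2_maps" "\<And>z. z \<in> uhp \<Longrightarrow> \<gamma> (mob a b c d z) = z" using SL2_maps_inv[OF m] by blast
  have y: "Im z > 0" using z by (simp add: uhp_iff)
  define n where "n = norm (of_int c * z + of_int d)"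
  have im: "Im (mob a b c d z) = Im z / n ^ 2" using Im_mob[OF z, of a d b c] r(1) by (simp add: n_def)
  have "of_int c * z + of_int d \<noteq> (0 :: complex)" by (rule cocycle_nonzero[OF z]) (use r(1) in auto)
  then have n0: "n > 0" by (simp add: n_def)
  have "Im (mob a b c d z) \<le> max (Im z) (1 / Im z)"
  proof (cases "c = 0")
    case True
    then have "a * d = 1" using r(1) by simp
    then have "\<bar>d\<bar> = 1" by (metis abs_mult_self_eq abs_zmult_eq_1 mult.commute abs_1)
    then have "n = 1" unfolding n_def True by (simp add: norm_of_int)
    then show ?thesis unfolding im by simp
  next
    case False
    have "1 * Im z \<le> \<bar>of_int c\<bar> * Im z" using False y by (intro mult_right_mono) auto
    also have "\<dots> = \<bar>Im (of_int c * z + of_int d)\<bar>" using y by (simp add: abs_mult)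
    also have "\<dots> \<le> n" unfolding n_def by (rule abs_Im_le_cmod)
    finally have "Im z ^ 2 \<le> n ^ 2" using y by (intro power_mono) auto
    then have "Im z / n ^ 2 \<le> Im z / Im z ^ 2" using y n0 by (intro divide_left_mono) auto
    also have "\<dots> = 1 / Im z" using y by (simp add: power2_eq_square)
    finally show ?thesis unfolding im by simp
  qed
  then show thesis using that[OF r(2) g(1) _ r(3)] g(2)[OF z] by simp
qed

text \<open>With ln y <= y - 1 and pi > 3 the main term 2 pi y - 6 ln y is at least 6, well above
  the error 1/2. Positivity lets single terms be dropped from the sums compared later.\<close>

lemma ht_pos: assumes z: "z \<in> uhp" shows "ht z > 0"
proof -
  obtain w \<gamma> where w: "w \<in> uhp" "\<gamma> \<in> SL2_maps" "z = \<gamma> w" "Im w \<ge> 86/100" by (rule reduced[OF z])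
  have "ln (Im w) \<le> Im w - 1" using w(4) by (intro ln_le_minus_one) auto
  moreover have "3 * Im w \<le> pi * Im w" using pi_gt3 w(4) by (intro mult_right_mono) auto
  ultimately have "ht w > 0" using ht_approx[OF w(4)] by linarith
  then show ?thesis using ht_SL2_maps[OF w(2,1)] w(3) by simp
qed

lemma ht_le: assumes z: "z \<in> uhp" shows "ht z \<le> 2 * pi * max (Im z) (1 / Im z) + 2"
proof -
  obtain w \<gamma> where w: "w \<in> uhp" "\<gamma> \<in> SL2_maps" "z = \<gamma> w" "Im w \<ge> 86/100" "Im w \<le> max (Im z) (1 / Im z)"
    by (rule reduced[OF z])
  have "pi * Im w \<le> pi * max (Im z) (1 / Im z)" using w(5) by (intro mult_left_mono) auto
  then have "ht w \<le> 2 * pi * max (Im z) (1 / Im z) + 2" using ht_approx[OF w(4)] neg_ln_le[OF w(4)] by linarith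
  then show ?thesis using ht_SL2_maps[OF w(2,1)] w(3) by simp
qed

section \<open>Neighbours in the p-isogeny graph\<close>

definition SL2_eq :: "complex \<Rightarrow> complex \<Rightarrow> bool" where
  "SL2_eq x y \<longleftrightarrow> (\<exists>\<gamma>\<in>SL2_maps. x = \<gamma> y)"

lemma ht_SL2_eq: "SL2_eq x y \<Longrightarrow> y \<in> uhp \<Longrightarrow> ht x = ht y"
  unfolding SL2_eq_def using ht_SL2_maps by blast

text \<open>For prime determinant the normal form has \<open>\<alpha>\<close> = p or
  \<open>\<alpha>\<close> = 1. The former, the unique step towards the cusp, occurs exactly when p
  divides the first column.\<close>

lemma hecke_neighbour:
  assumes p: "Factorial_Ring.prime p" and u: "u \<in> uhp" and det: "a * d - b * c = int p"
  shows "(int p dvd a \<and> int p dvd c \<and> SL2_eq (mob a b c d u) (of_nat p * u)) \<or>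
    (\<not> (int p dvd a \<and> int p dvd c) \<and> (\<exists>k::nat. SL2_eq (mob a b c d u) ((u + of_nat k) / of_nat p)))"
proof -
  have p0: "p > 0" using p by (simp add: prime_gt_0_nat)
  obtain P q r s :: int and \<alpha> \<beta> \<delta> :: nat where h:
    "P * s - q * r = 1" "\<alpha> * \<delta> = p" "\<beta> < \<delta>"
    "a = P * int \<alpha>" "b = P * int \<beta> + q * int \<delta>" "c = r * int \<alpha>" "d = r * int \<beta> + s * int \<delta>"
    by (rule hermite_normal_form[OF det p0])
  have ad: "\<alpha> > 0" "\<delta> > 0" using h(2) p0 by (auto intro!: Nat.gr0I)
  have au: "aff \<alpha> \<beta> \<delta> u \<in> uhp" by (rule aff_uhp[OF ad u])
  have "mob a b c d u = mob P q r s (mob (int \<alpha>) (int \<beta>) 0 (int \<delta>) u)"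
    unfolding h(4-7) by (subst mob_mob[OF u]) (use ad in simp_all)
  also have "mob (int \<alpha>) (int \<beta>) 0 (int \<delta>) u = aff \<alpha> \<beta> \<delta> u" by (simp add: mob_def aff_def)
  finally have e: "SL2_eq (mob a b c d u) (aff \<alpha> \<beta> \<delta> u)" unfolding SL2_eq_def SL2_maps_def using h(1) by blast
  have "\<alpha> dvd p" using h(2) by (metis dvd_triv_left)
  then consider "\<alpha> = 1" | "\<alpha> = p" using p by (auto simp: prime_nat_iff)
  then show ?thesis
  proof cases
    case 1
    then have "\<not> (int p dvd a \<and> int p dvd c)"
    proof -
      have "int p dvd P * s - q * r" if "int p dvd P" "int p dvd r" using that by (intro dvd_diff dvd_mult2 dvd_mult) auto
      then show ?thesis using 1 h p by (auto simp: prime_nat_iff)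
    qed
    then show ?thesis using e 1 h(2) by (auto simp: aff_def)
  next
    case 2
    then have "\<delta> = 1" using h(2) p0 by simp
    then have "aff \<alpha> \<beta> \<delta> u = of_nat p * u" using 2 h(3) by (simp add: aff_def)
    then show ?thesis using e 2 h(4,6) by simp
  qed
qed

text \<open>The points before and after \<open>\<gamma> u\<close> on the walk are two neighbours of
  u. The one before goes up only if p divides a, the one after only if p divides c. Determinant 1
  excludes both, so the walk does not backtrack.\<close>

lemma hecke_dichotomy:
  assumes p: "Factorial_Ring.prime p" and u: "u \<in> uhp" and g: "\<gamma> \<in> SL2_maps"
  shows "(SL2_eq (\<gamma> u / of_nat p) (of_nat p * u) \<and> (\<exists>k::nat. SL2_eq (of_nat p * \<gamma> u) ((u + of_nat k) / of_nat p))) \<or>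
    ((\<exists>k::nat. SL2_eq (\<gamma> u / of_nat p) ((u + of_nat k) / of_nat p)) \<and>
      (SL2_eq (of_nat p * \<gamma> u) (of_nat p * u) \<or> (\<exists>k::nat. SL2_eq (of_nat p * \<gamma> u) ((u + of_nat k) / of_nat p))))"
proof -
  obtain a b c d where m: "\<gamma> = mob a b c d" "a * d - b * c = 1" using g by (auto simp: SL2_maps_def)
  have p0: "p > 0" using p by (simp add: prime_gt_0_nat)
  have 1: "a * (int p * d) - b * (int p * c) = int p" "(int p * a) * d - (int p * b) * c = int p"
  proof -
    have "a * (int p * d) - b * (int p * c) = int p * (a * d - b * c)" "(int p * a) * d - (int p * b) * c = int p * (a * d - b * c)"
      by (simp_all add: algebra_simps)
    then show "a * (int p * d) - b * (int p * c) = int p" "(int p * a) * d - (int p * b) * c = int p" using m(2) by simp_all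
  qed
  have det0: "a * d - b * c \<noteq> 0" using m(2) by simp
  have e1: "\<gamma> u / of_nat p = mob a b (int p * c) (int p * d) u"
    using mob_mob[OF u det0, of 1 0 0 "int p"] by (simp add: m(1) mob_def[of 1 0 0])
  have e2: "of_nat p * \<gamma> u = mob (int p * a) (int p * b) c d u"
    using mob_mob[OF u det0, of "int p" 0 0 1] by (simp add: m(1) mob_p)
  have nd: "\<not> (int p dvd a \<and> int p dvd c)"
  proof
    assume "int p dvd a \<and> int p dvd c"
    then have "int p dvd a * d - b * c" by (intro dvd_diff dvd_mult2 dvd_mult) auto
    then show False using m(2) p by (auto simp: prime_nat_iff)
  qed
  show ?thesis using hecke_neighbour[OF p u 1(1)] hecke_neighbour[OF p u 1(2)] nd unfolding e1 e2 by auto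
qed

lemma ln_norm_gf:
  assumes n: "n > 0" and z: "z \<in> uhp"
  shows "ln (norm (gf n z)) = 6 * ln (real n) + ht (of_nat n * z) - ht z"
proof -
  have y: "Im z > 0" using z by (simp add: uhp_iff)
  have "ln (norm (gf n z)) = ln (norm (Dfun z)) - ln (norm (Dfun (of_nat n * z)))"
    unfolding gf_def norm_divide by (simp add: ln_div)
  then show ?thesis unfolding ht_def using n y by (simp add: ln_mult)
qed

section \<open>The main inequality\<close>

lemma ht_reduced_lower: "Im w \<ge> 86/100 \<Longrightarrow> ht w \<ge> 2 * pi * Im w - 6 * ln (Im w) - 1/2"
  and ht_reduced_upper: "Im w \<ge> 86/100 \<Longrightarrow> ht w \<le> 2 * pi * Im w - 6 * ln (Im w) + 1/2"
  using ht_approx[of w] by linarith+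

lemma Im_div_of_nat: "Im (z / of_nat p) = Im z / real p"
  by (rule Im_divide_of_nat)

lemma max_inverse_le: "y > 0 \<Longrightarrow> y \<le> b \<Longrightarrow> 1 \<le> y * b \<Longrightarrow> max y (1 / y) \<le> (b::real)"
  by (auto simp: divide_le_eq mult.commute)

lemma ht_le_bound:
  assumes z: "z \<in> uhp" and b: "Im z \<le> b" "1 \<le> Im z * b" shows "ht z \<le> 2 * pi * b + 2"
proof -
  have "max (Im z) (1 / Im z) \<le> b" using z b by (intro max_inverse_le) (auto simp: uhp_iff)
  then have "pi * max (Im z) (1 / Im z) \<le> pi * b" by (intro mult_left_mono) auto
  then show ?thesis using ht_le[OF z] by linarith
qed

text \<open>The heights of \<open>z\<close>, \<open>pz\<close>, \<open>p\<^sup>2z\<close> sit on a walk of two steps in the \<open>p\<close>-isogeny graph. If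
  the highest of the two given conjugates lay high in the cusp, its first step would have to go
  down; the two comparison inequalities then push the other conjugate up, which is impossible.\<close>

lemma height_walk_bound:
  fixes p :: nat and z1 z2 :: complex
  defines "L \<equiv> ln (real p)"
  assumes p: "Factorial_Ring.prime p" "p \<ge> 3" and z: "z1 \<in> uhp" "z2 \<in> uhp"
    and c1: "\<bar>(ht z1 + ht z2) - (ht (of_nat p * z1) + ht (of_nat p * z2))\<bar> \<le> 12 * L"
    and c2: "\<bar>(ht (of_nat p * z1) + ht (of_nat p * z2)) - (ht (of_nat p * (of_nat p * z1)) + ht (of_nat p * (of_nat p * z2)))\<bar> \<le> 12 * L"
    and w1: "w1 \<in> uhp" "\<gamma>1 \<in> SL2_maps" "z1 = \<gamma>1 w1" "Im w1 \<ge> 86/100"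
    and w2: "w2 \<in> uhp" "\<gamma>2 \<in> SL2_maps" "z2 = \<gamma>2 w2" "Im w2 \<ge> 86/100" "Im w2 \<le> Im w1"
  shows "Im w1 < 16 * (real p * L)"
proof (rule ccontr)
  define T where "T = Im w1"
  assume "\<not> ?thesis"
  then have T: "T \<ge> 16 * (real p * L)" by (simp add: T_def)
  have p0: "p > 0" and p3: "real p \<ge> 3" using p by auto
  have L1: "L \<ge> 1"
  proof -
    have "exp 1 \<le> real p" using exp_le p3 by linarith
    then show ?thesis unfolding L_def using p0 by (subst ln_ge_iff) auto
  qed
  have pL: "real p \<le> real p * L" "3 * L \<le> real p * L"
    using L1 p3 mult_left_mono[of 1 L "real p"] mult_right_mono[of 3 "real p" L] by auto
  have Tp: "T \<ge> 16 * real p" and TL: "T \<ge> 48 * L" and T48: "T \<ge> 48" using T pL L1 p3 by linarith+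
  have pp: "pi > (31415/10000)" "pi < (31416/10000)" using pi_approx by auto
  have lnT: "6 * ln T \<le> 3/8 * T + 11" using T48 by (intro ln_le_linear) auto
  have piT: "(31415/10000) * T \<le> pi * T" "pi * T \<le> (31416/10000) * T" using pp T48 by (auto intro!: mult_right_mono)
  have u: "of_nat p * z1 \<in> uhp" "of_nat p * z2 \<in> uhp" "of_nat p * w1 \<in> uhp" using scale_uhp z w1(1) p0 by auto
  have pos: "ht z2 > 0" "ht (of_nat p * z2) > 0" "ht (of_nat p * (of_nat p * z1)) > 0" "ht (of_nat p * (of_nat p * z2)) > 0"
    using ht_pos z u scale_uhp[OF u(1) p0] scale_uhp[OF u(2) p0] by auto
  have H01: "ht z1 = ht w1" "ht z2 = ht w2" using ht_SL2_maps w1 w2 by auto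
  have H1u: "ht z1 \<le> 2 * pi * T + 2" and H1l: "ht z1 \<ge> 2 * pi * T - 6 * ln T - 1/2"
    using ht_reduced_upper[OF w1(4)] ht_reduced_lower[OF w1(4)] neg_ln_le[OF w1(4)] by (auto simp: H01 T_def)
  have c1': "ht z1 + ht z2 - (ht (of_nat p * z1) + ht (of_nat p * z2)) \<le> 12 * L"
    "ht (of_nat p * z1) + ht (of_nat p * z2) - (ht z1 + ht z2) \<le> 12 * L" using c1 by linarith+
  have c2': "ht (of_nat p * z1) + ht (of_nat p * z2) - (ht (of_nat p * (of_nat p * z1)) + ht (of_nat p * (of_nat p * z2))) \<le> 12 * L"
    "(ht (of_nat p * (of_nat p * z1)) + ht (of_nat p * (of_nat p * z2))) - (ht (of_nat p * z1) + ht (of_nat p * z2)) \<le> 12 * L"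
    using c2 by linarith+
  have H2u: "ht z2 \<le> 2 * pi * T + 2"
  proof -
    have "pi * Im w2 \<le> pi * T" using w2(5) by (intro mult_left_mono) (auto simp: T_def)
    then show ?thesis unfolding H01(2) using ht_reduced_upper[OF w2(4)] neg_ln_le[OF w2(4)] by linarith
  qed
  have lnp: "ln (real p * x) = L + ln x" if "x > 0" for x using that p0 by (simp add: L_def ln_mult)
  define Q where "Q x = pi * (real p * x)" for x
  have low: "ht (of_nat p * w) \<ge> 2 * Q (Im w) - 6 * L - 6 * ln (Im w) - 1/2" if "Im w \<ge> 1" for w
  proof -
    have "1 * 1 \<le> real p * Im w" using p3 that by (intro mult_mono) auto
    then have "Im (of_nat p * w) \<ge> 86/100" by simp
    from ht_reduced_lower[OF this] have "ht (of_nat p * w) \<ge> 2 * pi * (real p * Im w) - 6 * ln (real p * Im w) - 1/2" by simp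
    then show ?thesis using lnp[of "Im w"] that by (simp add: Q_def)
  qed
  have mid: "ht ((w + of_nat m) / of_nat p) \<le> 2 * pi * b + 2"
    if "w \<in> uhp" "Im w / real p \<le> b" "1 \<le> Im w / real p * b" for w m b
  proof -
    have im: "Im ((w + of_nat m) / of_nat p) = Im w / real p" unfolding Im_div_of_nat by simp
    have "(w + of_nat m) / of_nat p \<in> uhp" using that(1) p0 unfolding uhp_iff im by simp
    then show ?thesis using that(2,3) unfolding im[symmetric] by (rule ht_le_bound)
  qed
  \<comment> \<open>A step up would bring the first point to height about 2 pi p T >= 6 pi T. The
    old sum is at most 4 pi T + 4, and a gain of that size exceeds 12 L.\<close>
  have "\<exists>k::nat. SL2_eq (of_nat p * z1) ((w1 + of_nat k) / of_nat p)"
  proof (rule ccontr)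
    assume "\<not> ?thesis"
    then have "SL2_eq (of_nat p * z1) (of_nat p * w1)"
      using hecke_dichotomy[OF p(1) w1(1,2)] unfolding w1(3) by blast
    then have e: "ht (of_nat p * z1) = ht (of_nat p * w1)" using u(3) by (rule ht_SL2_eq)
    have T3: "3 * T \<le> real p * T" using p3 T48 by (intro mult_right_mono) auto
    have "ht (of_nat p * w1) \<ge> 2 * Q T - 6 * L - 6 * ln T - 1/2"
      using low[of w1] T48 by (simp add: T_def)
    moreover have "3 * (pi * T) \<le> Q T" using mult_left_mono[OF T3, of pi] by (simp add: Q_def)
    ultimately show False using c1' e H1u H2u pos(2) piT lnT TL T48 by linarith
  qed
  then obtain k :: nat where k: "SL2_eq (of_nat p * z1) ((w1 + of_nat k) / of_nat p)" by blast
  define v where "v = (w1 + of_nat k) / of_nat p"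
  have imv: "Im v = T / real p" unfolding v_def Im_div_of_nat by (simp add: T_def)
  have Tp16: "T / real p \<ge> 16" using Tp p0 by (simp add: le_divide_eq)
  have vu: "v \<in> uhp" using imv Tp16 by (simp add: uhp_iff)
  obtain \<delta> where \<delta>: "\<delta> \<in> SL2_maps" "of_nat p * z1 = \<delta> v" using k unfolding v_def[symmetric] SL2_eq_def by blast
  have Hv: "ht (of_nat p * z1) = ht v" unfolding \<delta>(2) by (rule ht_SL2_maps[OF \<delta>(1) vu])
  have Tp3: "T / real p \<le> T / 3" using p3 T48 by (intro divide_left_mono) auto
  have lnTp: "ln (T / real p) \<ge> 0" using Tp16 by (intro ln_ge_zero) auto
  have piTp: "pi * (T / real p) \<le> pi * (T / 3)" using Tp3 by (intro mult_left_mono) auto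
  have H11: "ht (of_nat p * z1) \<le> 2 * pi * (T / 3) + 1/2"
  proof -
    have "Im v \<ge> 86/100" unfolding imv using Tp16 by linarith
    from ht_reduced_upper[OF this] show ?thesis unfolding Hv imv using lnTp piTp by linarith
  qed
  have small: "ht ((v + of_nat m) / of_nat p) \<le> 2 * pi * (T / 9) + 2" for m :: nat
  proof (rule mid[OF vu])
    have "T / real p / real p \<le> T / 3 / 3" using Tp3 p3 T48 by (intro frac_le) auto
    then show "Im v / real p \<le> T / 9" unfolding imv by simp
    have "9 \<le> (T / real p) * (T / real p)" using mult_mono[of 16 "T / real p" 16 "T / real p"] Tp16 by simp
    then show "1 \<le> Im v / real p * (T / 9)" unfolding imv by simp
  qed
  have vm: "(v + of_nat m) / of_nat p \<in> uhp" for m :: nat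
    unfolding uhp_iff Im_div_of_nat using vu p0 by (simp add: uhp_iff)
  have zz: "of_nat p * z1 / of_nat p = z1" using p0 by simp
  \<comment> \<open>\<open>z1\<close> is too high to lie below v, so it is the upper neighbour of v,
    and the next step of the walk goes down again.\<close>
  have "\<not> (\<exists>m::nat. SL2_eq z1 ((v + of_nat m) / of_nat p))"
  proof
    assume "\<exists>m::nat. SL2_eq z1 ((v + of_nat m) / of_nat p)"
    then obtain m :: nat where "SL2_eq z1 ((v + of_nat m) / of_nat p)" by blast
    from ht_SL2_eq[OF this vm] show False using small[of m] H1l piT lnT T48 by linarith
  qed
  then obtain m :: nat where "SL2_eq (of_nat p * (of_nat p * z1)) ((v + of_nat m) / of_nat p)"
    using hecke_dichotomy[OF p(1) vu \<delta>(1)] unfolding \<delta>(2)[symmetric] zz by blast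
  from ht_SL2_eq[OF this vm] have H21: "ht (of_nat p * (of_nat p * z1)) \<le> 2 * pi * (T / 9) + 2" using small[of m] by simp
  obtain w \<epsilon> where w: "w \<in> uhp" "\<epsilon> \<in> SL2_maps" "of_nat p * z2 = \<epsilon> w" "Im w \<ge> 86/100" by (rule reduced[OF u(2)])
  define V where "V = Im w"
  have H12: "ht (of_nat p * z2) = ht w" unfolding w(3) by (rule ht_SL2_maps[OF w(2,1)])
  have H12u: "ht w \<le> 2 * pi * V - 6 * ln V + 1/2" and H12l: "ht w \<ge> 2 * pi * V - 6 * ln V - 1/2"
    using ht_reduced_upper[OF w(4)] ht_reduced_lower[OF w(4)] by (auto simp: V_def)
  have nlV: "- 6 * ln V \<le> 1" using neg_ln_le[OF w(4)] by (simp add: V_def)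
  have piV0: "pi * V \<le> (31416/10000) * V" "(31415/10000) * V \<le> pi * V" using pp w(4) by (auto intro!: mult_right_mono simp: V_def)
  \<comment> \<open>The first point loses about 4 pi T / 3 in the first step. After deducting 12 L
    <= T / 4, the logarithm and the constants, the second point must stand at 2 pi V with V at least
    0.52 T.\<close>
  have V: "V \<ge> 52/100 * T"
    using c1'(1) pos(1) H1l H11 H12u H12 nlV piV0 piT lnT TL T48 by linarith
  have lnV: "6 * ln V \<le> 3/8 * V + 11" using V T48 by (intro ln_le_linear) auto
  have V3: "3 * (pi * V) \<le> Q V"
  proof -
    have "3 * V \<le> real p * V" using p3 V T48 by (intro mult_right_mono) auto
    from mult_left_mono[OF this, of pi] show ?thesis by (simp add: Q_def)
  qed
  have Hpw: "ht (of_nat p * w) \<ge> 2 * Q V - 6 * L - 6 * ln V - 1/2"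
    using low[of w] V T48 by (simp add: V_def)
  have pw: "of_nat p * w \<in> uhp" using scale_uhp[OF w(1) p0] .
  have V2: "2 * (pi * V) \<le> Q V - pi * V" using V3 by linarith
  have smallw: "ht ((w + of_nat m) / of_nat p) \<le> 2 * pi * (V / 3) + 2" for m :: nat
  proof (rule mid[OF w(1)])
    show "Im w / real p \<le> V / 3" unfolding V_def[symmetric] using p3 V T48 by (intro divide_left_mono) auto
    have "8 * real p \<le> V" using V Tp by linarith
    moreover have "1 \<le> V" using V T48 by linarith
    ultimately have "8 * real p * 1 \<le> V * V" using p3 by (intro mult_mono) auto
    then have "3 * real p \<le> V * V" using p3 by linarith
    then show "1 \<le> Im w / real p * (V / 3)" unfolding V_def[symmetric] using p0 by (simp add: le_divide_eq)
  qed
  have wm: "(w + of_nat m) / of_nat p \<in> uhp" for m :: nat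
    unfolding uhp_iff Im_div_of_nat using w(1) p0 by (simp add: uhp_iff)
  have z2p: "of_nat p * z2 / of_nat p = z2" using p0 by simp
  \<comment> \<open>If \<open>z2\<close> lies above w, its height is about 6 pi V or more, beyond
    the maximum 2 pi T. If the next point lies above w, the second sum grows too much. If both lie
    below w, both walks fall in the second step and the sum drops too much.\<close>
  consider "SL2_eq z2 (of_nat p * w)" | "SL2_eq (of_nat p * (of_nat p * z2)) (of_nat p * w)"
    | k l :: nat where "SL2_eq z2 ((w + of_nat k) / of_nat p)" "SL2_eq (of_nat p * (of_nat p * z2)) ((w + of_nat l) / of_nat p)"
    using hecke_dichotomy[OF p(1) w(1,2)] unfolding w(3)[symmetric] z2p by blast
  then show False
  proof cases
    case 1
    have "ht z2 = ht (of_nat p * w)" using 1 pw by (rule ht_SL2_eq)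
    then show False using Hpw H2u V3 lnV V piT piV0 TL T48 by linarith
  next
    case 2
    have "ht (of_nat p * (of_nat p * z2)) = ht (of_nat p * w)" using 2 pw by (rule ht_SL2_eq)
    then show False using Hpw c2'(2) pos(3) H11 H12 H12u V2 V piT piV0 TL T48 by linarith
  next
    case 3
    have "ht (of_nat p * (of_nat p * z2)) = ht ((w + of_nat l) / of_nat p)" using 3(2) wm by (rule ht_SL2_eq)
    moreover have "ht (of_nat p * z1) > 0" by (rule ht_pos[OF u(1)])
    ultimately show False using smallw[of l] c2'(1) H21 H12 H12l lnV V piT piV0 TL T48 by linarith
  qed
qed

section \<open>From the rational point to the values of the two units\<close>

lemma Gamma0_orbit_mem: "\<tau> \<in> Gamma0_orbit N \<tau>"
  unfolding Gamma0_orbit_def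
  by (rule CollectI, rule exI[of _ 1], rule exI[of _ 0], rule exI[of _ 0], rule exI[of _ 1]) simp

lemma j_invariant_orbit:
  assumes \<tau>: "\<tau> \<in> uhp" shows "j_invariant (Gamma0_orbit N \<tau>) = klein_j \<tau>"
proof -
  have "klein_j z = klein_j \<tau>" if zo: "z \<in> Gamma0_orbit N \<tau>" for z
  proof -
    obtain a b c d :: int where "a * d - b * c = 1" "z = mob a b c d \<tau>"
      using zo unfolding Gamma0_orbit_def mob_def by auto
    then show ?thesis using SL2_invD[OF klein_j_inv _ \<tau>] by simp
  qed
  then have "klein_j ` Gamma0_orbit N \<tau> \<subseteq> {klein_j \<tau>}" by (intro image_subsetI) (simp only: singleton_iff)
  then have "klein_j ` Gamma0_orbit N \<tau> = {klein_j \<tau>}" using imageI[OF Gamma0_orbit_mem[of \<tau> N], of klein_j] by blast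
  then show ?thesis by (simp add: j_invariant_def)
qed

text \<open>Expresses the shifted unit through units of levels n^2 and n at the same point, so that
  finiteness of orbits and invariance carry over.\<close>

lemma gf_ratio: "n > 0 \<Longrightarrow> gf (n * n) z * (1 / gf n z) = gf n (of_nat n * z)"
  by (simp add: gf_def mult.assoc)

text \<open>Divisibility of N by n^2 is where r > 1 enters: the stabiliser of j(Nz) must also fix
  the unit of level n^2.\<close>

lemma gf_value_in_residue_field:
  assumes n: "n > 0" and N: "N > 0" and dv: "n * n dvd N" and \<tau>: "\<tau> \<in> uhp"
  shows "gf n \<tau> \<in> residue_field_at N \<tau>" "gf n (of_nat n * \<tau>) \<in> residue_field_at N \<tau>"
    "modular_fn N (gf n)" "modular_fn N (\<lambda>z. gf n (of_nat n * z))"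
proof -
  have d: "n dvd N" using dv by (rule dvd_mult_left)
  show m: "modular_fn N (gf n)" by (rule modular_fn_gf[OF n d N])
  have "modular_fn N (\<lambda>z. gf (n * n) z * (1 / gf n z))"
    by (intro modular_fn_mult modular_fn_gf modular_fn_gf_inverse) (use n N d dv in auto)
  then show m2: "modular_fn N (\<lambda>z. gf n (of_nat n * z))" unfolding gf_ratio[OF n] .
  have st: "gf k (\<gamma> z) = gf k z"
    if \<gamma>: "\<gamma> \<in> SL2_maps" and e: "\<And>z. z \<in> uhp \<Longrightarrow> klein_j (of_nat N * \<gamma> z) = klein_j (of_nat N * z)"
      and z: "z \<in> uhp" and k: "k > 0" "k dvd N" for \<gamma> z k
  proof -
    obtain a b c d where g: "\<gamma> = mob a b c d" "a * d - b * c = 1" using \<gamma> by (auto simp: SL2_maps_def)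
    have "int N dvd c" using jn_stabiliser[OF N g(2)] e unfolding g(1) by blast
    then have "int k dvd c" using k(2) by (meson dvd_trans of_nat_dvd_iff)
    then show ?thesis unfolding g(1) by (rule gf_stable[OF z k(1) g(2)])
  qed
  have j: "modular_fn N (\<lambda>z. klein_j (of_nat N * z))" by (rule modular_fn_jn[OF N _ N]) simp
  show "gf n \<tau> \<in> residue_field_at N \<tau>"
    by (rule value_in_residue_field[OF N N j m _ \<tau>]) (rule st[OF _ _ _ n d])
  show "gf n (of_nat n * \<tau>) \<in> residue_field_at N \<tau>"
  proof (rule value_in_residue_field[OF N N j m2 _ \<tau>])
    fix \<gamma> z assume h: "\<gamma> \<in> SL2_maps" "\<And>z. z \<in> uhp \<Longrightarrow> klein_j (of_nat N * \<gamma> z) = klein_j (of_nat N * z)" "z \<in> uhp"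
    have "gf (n * n) (\<gamma> z) = gf (n * n) z" by (rule st[OF h]) (use n dv in auto)
    moreover have "gf n (\<gamma> z) = gf n z" by (rule st[OF h n d])
    ultimately show "gf n (of_nat n * \<gamma> z) = gf n (of_nat n * z)" unfolding gf_ratio[OF n, symmetric] by simp
  qed
qed

text \<open>The norm of the unit being at least 1 gives one inequality, that of n^12 divided by it
  the other. The term 6 ln n in \<open>ln_norm_gf\<close>, counted at both points, makes each of
  them miss equality of the sums by 12 ln n.\<close>

lemma (in quad_field) gf_norm_bounds:
  assumes n: "n > 0" and z: "z \<in> uhp" and s: "s \<in> uhp" and K: "gf n z \<in> K" and j: "algebraic_int (klein_j z)"
    and c: "gf n s = cj (gf n z)"
  shows "\<bar>(ht z + ht s) - (ht (of_nat n * z) + ht (of_nat n * s))\<bar> \<le> 12 * ln (real n)"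
proof -
  have nK: "(of_nat n :: complex) \<in> K" "cj (of_nat n) = of_nat n"
    using of_rat_in_K[of "of_nat n"] cj_of_rat[of "of_nat n"] by simp_all
  have l: "ln (norm (gf n z)) + ln (norm (gf n s)) = 12 * ln (real n) + (ht (of_nat n * z) + ht (of_nat n * s)) - (ht z + ht s)"
    unfolding ln_norm_gf[OF n z] ln_norm_gf[OF n s] by simp
  have "norm (gf n z) * norm (cj (gf n z)) \<ge> 1" by (rule norm_ge_1[OF K algebraic_int_gf(1)[OF n z j]]) simp
  then have "0 \<le> ln (norm (gf n z) * norm (gf n s))" unfolding c[symmetric] by (rule ln_ge_zero)
  then have 1: "0 \<le> ln (norm (gf n z)) + ln (norm (gf n s))" by (simp add: ln_mult)
  have iK: "of_nat n ^ 12 / gf n z \<in> K" using nK(1) K by simp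
  have ic: "cj (of_nat n ^ 12 / gf n z) = of_nat n ^ 12 / gf n s"
    using nK K by (simp add: cj_divide cj_power c)
  have "norm (of_nat n ^ 12 / gf n z) * norm (of_nat n ^ 12 / gf n s) \<ge> 1"
    unfolding ic[symmetric] by (rule norm_ge_1[OF iK algebraic_int_gf(2)[OF n z j]]) (use n in simp)
  then have "0 \<le> ln (norm (of_nat n ^ 12 / gf n z) * norm (of_nat n ^ 12 / gf n s))" by (rule ln_ge_zero)
  also have "\<dots> = 24 * ln (real n) - (ln (norm (gf n z)) + ln (norm (gf n s)))"
    using n by (simp add: norm_divide norm_power ln_mult ln_div ln_realpow)
  finally show ?thesis using 1 l unfolding abs_le_iff by linarith
qed

theorem theorem7p3:
  fixes p r :: nat and K :: "complex set" and P :: "complex set"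
  assumes "prime p" and "p \<ge> 3"
    and "quadratic_field K"
    and "r > 1"
    and "P \<in> Y0_integral_points (p ^ r) K"
  shows "point_height K P \<le> 110 * real p * ln (real p)"
proof -
  obtain w d where "quad_field K w d" using quadratic_field_imp_quad_field[OF assms(3)] by blast
  then interpret quad_field K w d .
  define N where "N = p ^ r"
  have p0: "p > 0" and N0: "N > 0" using assms(2) by (auto simp: N_def)
  have dv: "p * p dvd N"
  proof -
    have "p ^ 2 dvd p ^ r" using assms(4) by (intro le_imp_power_dvd) simp
    then show ?thesis by (simp add: N_def power2_eq_square)
  qed
  obtain \<tau> where \<tau>: "P = Gamma0_orbit N \<tau>" "\<tau> \<in> uhp" "residue_field_at N \<tau> \<subseteq> K" "j_invariant P \<in> integers_of K"
    using assms(5) unfolding Y0_integral_points_def Y0_points_def N_def by blast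
  have jP: "j_invariant P = klein_j \<tau>" unfolding \<tau>(1) by (rule j_invariant_orbit[OF \<tau>(2)])
  have jO: "klein_j \<tau> \<in> integers_of K" using \<tau>(4) unfolding jP .
  then have jK: "klein_j \<tau> \<in> K" and jA: "algebraic_int (klein_j \<tau>)" unfolding integers_of_def by blast+
  note g = gf_value_in_residue_field[OF p0 N0 dv \<tau>(2)]
  have gK: "gf p \<tau> \<in> K" "gf p (of_nat p * \<tau>) \<in> K" using g(1,2) \<tau>(3) by blast+
  obtain \<sigma> where \<sigma>: "\<sigma> \<in> uhp" "klein_j \<sigma> = cj (klein_j \<tau>)" "gf p \<sigma> = cj (gf p \<tau>)"
      "gf p (of_nat p * \<sigma>) = cj (gf p (of_nat p * \<tau>))"
    by (rule conjugate_point[OF N0 g(3,4) \<tau>(2) gK jK])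
  have pu: "of_nat p * \<tau> \<in> uhp" "of_nat p * \<sigma> \<in> uhp" using scale_uhp p0 \<tau>(2) \<sigma>(1) by auto
  have c1: "\<bar>(ht \<tau> + ht \<sigma>) - (ht (of_nat p * \<tau>) + ht (of_nat p * \<sigma>))\<bar> \<le> 12 * ln (real p)"
    by (rule gf_norm_bounds[OF p0 \<tau>(2) \<sigma>(1) gK(1) jA \<sigma>(3)])
  \<comment> \<open>The same comparison started at \<open>of_nat p * \<tau>\<close>, where j is
    again an algebraic integer.\<close>
  have c2: "\<bar>(ht (of_nat p * \<tau>) + ht (of_nat p * \<sigma>)) -
      (ht (of_nat p * (of_nat p * \<tau>)) + ht (of_nat p * (of_nat p * \<sigma>)))\<bar> \<le> 12 * ln (real p)"
    by (rule gf_norm_bounds[OF p0 pu gK(2) algebraic_int_gf(3)[OF p0 \<tau>(2) jA] \<sigma>(4)])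
  obtain w1 \<gamma>1 where w1: "w1 \<in> uhp" "\<gamma>1 \<in> SL2_maps" "\<tau> = \<gamma>1 w1" "Im w1 \<ge> 86/100" by (rule reduced[OF \<tau>(2)])
  obtain w2 \<gamma>2 where w2: "w2 \<in> uhp" "\<gamma>2 \<in> SL2_maps" "\<sigma> = \<gamma>2 w2" "Im w2 \<ge> 86/100" by (rule reduced[OF \<sigma>(1)])
  define B where "B = real p * ln (real p)"
  \<comment> \<open>The walk bound expects the higher point first; both comparisons are symmetric in
    the two points.\<close>
  have M: "max (Im w1) (Im w2) < 16 * B"
  proof (cases "Im w2 \<le> Im w1")
    case True
    then show ?thesis
      using height_walk_bound[OF assms(1,2) \<tau>(2) \<sigma>(1) c1 c2 w1 w2] by (simp add: B_def)
  next
    case False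
    have c1': "\<bar>(ht \<sigma> + ht \<tau>) - (ht (of_nat p * \<sigma>) + ht (of_nat p * \<tau>))\<bar> \<le> 12 * ln (real p)"
      using c1 by (simp only: add.commute)
    have c2': "\<bar>(ht (of_nat p * \<sigma>) + ht (of_nat p * \<tau>)) -
      (ht (of_nat p * (of_nat p * \<sigma>)) + ht (of_nat p * (of_nat p * \<tau>)))\<bar> \<le> 12 * ln (real p)"
      using c2 by (simp only: add.commute)
    show ?thesis
      using height_walk_bound[OF assms(1,2) \<sigma>(1) \<tau>(2) c1' c2' w2 w1] False by (simp add: B_def)
  qed
  have B3: "B \<ge> 3"
  proof -
    have "exp 1 \<le> real p" using exp_le assms(2) by linarith
    then have "ln (real p) \<ge> 1" using p0 by (subst ln_ge_iff) auto
    then have "3 * 1 \<le> real p * ln (real p)" using assms(2) by (intro mult_mono) auto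
    then show ?thesis by (simp add: B_def)
  qed
  \<comment> \<open>2 pi * 16 < 101, and the remaining 9 B cover the constant 20 because B >=
    3.\<close>
  have fin: "2 * pi * y + 20 \<le> 110 * B" if "y < 16 * B" "y \<ge> 0" for y
  proof -
    have "pi * y \<le> (31416/10000) * y" using pi_approx that by (intro mult_right_mono) auto
    then show ?thesis using that B3 by linarith
  qed
  have 1: "ln (max 1 (norm (klein_j \<tau>))) \<le> 110 * B"
    using ln_klein_j_le[OF w1(4)] fin[of "Im w1"] M w1(4) klein_j_SL2_maps[OF w1(2,1)] unfolding w1(3) by simp
  have 2: "ln (max 1 (norm (cj (klein_j \<tau>)))) \<le> 110 * B"
    using ln_klein_j_le[OF w2(4)] fin[of "Im w2"] M w2(4) klein_j_SL2_maps[OF w2(2,1)] unfolding \<sigma>(2)[symmetric] w2(3) by simp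
  have "weil_height K (klein_j \<tau>) \<le> (ln (max 1 (norm (klein_j \<tau>))) + ln (max 1 (norm (cj (klein_j \<tau>))))) / 2"
    by (rule weil_height_integer_le[OF assms(3) jO])
  also have "\<dots> \<le> 110 * B" using 1 2 by simp
  finally show ?thesis unfolding point_height_def jP by (simp add: B_def mult.assoc)
qed

end
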